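(* Let $k$ be an algebraically closed field of characteristic $0$, let $(\mathfrak g,B)$ be a finite-dimensional quadratic Lie algebra over $k$ with a $\mathbb Z_2$-gradation $\mathfrak g=\mathfrak k\oplus\mathfrak p$ such that $\mathfrak k$ and $\mathfrak p$ are $B$-orthogonal, and suppose that $\mathfrak k$ and $\mathfrak g$ are reductive. Then $$\big(\eta(\nu(\Omega(\mathfrak k)))\big)_0=2\Big(B(\rho_{\mathfrak k},\rho_{\mathfrak k})-B(\rho_{\mathfrak g},\rho_{\mathfrak g})\Big),$$ where $\rho_{\mathfrak g}$ (resp. $\rho_{\mathfrak k}$) is the Weyl vector of $\mathfrak g$ (resp. $\mathfrak k$) with respect to a Cartan subalgebra $\mathfrak h_{\mathfrak g}$ of $\mathfrak g$ (resp. $\mathfrak h_{\mathfrak k}$ of $\mathfrak k$) and a choice of a full set of positive roots for the action of $\operatorname{ad}(\mathfrak h_{\mathfrak g})$ (resp. $\operatorname{ad}(\mathfrak h_{\mathfrak k})$).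
   Context: A quadratic Lie algebra $(\mathfrak g,B)$ is a Lie algebra with a nondegenerate invariant symmetric bilinear form $B$. $\mathbb Z_2$-gradation: $[\mathfrak k,\mathfrak k]\subset\mathfrak k$, $[\mathfrak k,\mathfrak p]\subset\mathfrak p$, $[\mathfrak p,\mathfrak p]\subset\mathfrak k$. The Weyl vector is half the sum of the positive roots, and $B(\rho,\rho)$ is computed with the form on the dual of the Cartan subalgebra induced by the restriction of $B$ (to $\mathfrak h_{\mathfrak g}$, resp. $\mathfrak h_{\mathfrak k}$). Casimir element: $\Omega(\mathfrak k)=\sum_k w_kw^k$ for a basis $\{w_k\}$ of $\mathfrak k$ with $B$-dual basis $\{w^k\}$ of $\mathfrak k$. $\omega$ is the symplectic form on $\mathfrak p\oplus\mathfrak p^*$ with $\mathfrak p,\mathfrak p^*$ isotropic and $\omega(\alpha,v)=\alpha(v)$ for $\alpha\in\mathfrak p^*$, $v\in\mathfrak p$. The Weyl algebra $\mathcal W=\mathcal W(\mathfrak p\oplus\mathfrak p^*,\omega)$ is the quotient of $T(\mathfrak p\oplus\mathfrak p^* )$ by the two-sided ideal generated by $v\otimes w-w\otimes v-\omega(v,w)1$. The Lie algebra morphism $\nu:\mathfrak k\to\mathcal W$ is $\nu(x)=\sum_i[x,z_i]z_i^*$, with $\{z_i\}$ a basis of $\mathfrak p$ and $\{z_i^*\}$ its dual basis in $\mathfrak p^*$; it is extended to an algebra morphism $U(\mathfrak k)\to\mathcal W$. $\eta:\mathcal W\to S(\mathfrak p\oplus\mathfrak p^* )$ is the linear isomorphism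 inverse to the symmetrization map $Q(v_1\cdots v_n)=\frac1{n!}\sum_{\sigma\in S_n}v_{\sigma(1)}\cdots v_{\sigma(n)}$, and $(\cdot)_d$ denotes the component in $S^d(\mathfrak p\oplus\mathfrak p^* )$. *)

theory Defs
  imports
    "HOL-Algebra.QuotRing"
    "HOL-Combinatorics.Permutations"
    "HOL-Computational_Algebra.Polynomial"
    "HOL-Library.FuncSet"
    "HOL-Library.Function_Algebras"
    "HOL-Library.Poly_Mapping"
    "HOL-Library.Product_Plus"
begin

section \<open>Lie algebras\<close>

text \<open>
  A Lie algebra lives on a whole type; its subalgebras and ideals are sets, and every notion
  that is needed for a subalgebra takes the carrier set \<open>L\<close> as an argument.
\<close>

locale lie_algebra = vector_space scale
  for scale :: "'k::field \<Rightarrow> 'g::ab_group_add \<Rightarrow> 'g" (infixr \<open>*s\<close> 75) +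
  fixes bracket :: "'g \<Rightarrow> 'g \<Rightarrow> 'g"
  assumes bracket_linear_left: "\<And>y. Vector_Spaces.linear scale scale (\<lambda>x. bracket x y)"
    and bracket_linear_right: "\<And>x. Vector_Spaces.linear scale scale (\<lambda>y. bracket x y)"
    and bracket_self: "\<And>x. bracket x x = 0"
    and jacobi: "\<And>x y z. bracket x (bracket y z) + bracket y (bracket z x)
                          + bracket z (bracket x y) = 0"
begin

definition subalgebra :: "'g set \<Rightarrow> bool" where
  "subalgebra L \<longleftrightarrow> subspace L \<and> (\<forall>x\<in>L. \<forall>y\<in>L. bracket x y \<in> L)"

definition lie_ideal :: "'g set \<Rightarrow> 'g set \<Rightarrow> bool" where
  "lie_ideal I L \<longleftrightarrow> subspace I \<and> I \<subseteq> L \<and> (\<forall>x\<in>L. \<forall>y\<in>I. bracket x y \<in> I)"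

text \<open>Reductive means that the adjoint representation is completely reducible; its
  subrepresentations are the ideals.\<close>

definition reductive :: "'g set \<Rightarrow> bool" where
  "reductive L \<longleftrightarrow> subalgebra L \<and>
     (\<forall>I. lie_ideal I L \<longrightarrow>
        (\<exists>J. lie_ideal J L \<and> I \<inter> J = {0} \<and> {x + y | x y. x \<in> I \<and> y \<in> J} = L))"

fun lower_central :: "'g set \<Rightarrow> nat \<Rightarrow> 'g set" where
  "lower_central L 0 = L"
| "lower_central L (Suc n) = span {bracket x y | x y. x \<in> L \<and> y \<in> lower_central L n}"

definition nilpotent :: "'g set \<Rightarrow> bool" where
  "nilpotent L \<longleftrightarrow> (\<exists>n. lower_central L n = {0})"

definition normalizer :: "'g set \<Rightarrow> 'g set \<Rightarrow> 'g set" where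
  "normalizer H L = {x \<in> L. \<forall>h\<in>H. bracket x h \<in> H}"

definition cartan_subalgebra :: "'g set \<Rightarrow> 'g set \<Rightarrow> bool" where
  "cartan_subalgebra H L \<longleftrightarrow> subalgebra H \<and> H \<subseteq> L \<and> nilpotent H \<and> normalizer H L = H"

definition z2_gradation :: "'g set \<Rightarrow> 'g set \<Rightarrow> bool" where
  "z2_gradation \<kk> \<pp> \<longleftrightarrow> subspace \<kk> \<and> subspace \<pp> \<and>
     \<kk> \<inter> \<pp> = {0} \<and> {x + y | x y. x \<in> \<kk> \<and> y \<in> \<pp>} = UNIV \<and>
     (\<forall>x\<in>\<kk>. \<forall>y\<in>\<kk>. bracket x y \<in> \<kk>) \<and>
     (\<forall>x\<in>\<kk>. \<forall>y\<in>\<pp>. bracket x y \<in> \<pp>) \<and>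
     (\<forall>x\<in>\<pp>. \<forall>y\<in>\<pp>. bracket x y \<in> \<kk>)"

end

text \<open>A linear form on a subspace \<open>U\<close> is represented by its extension by zero outside \<open>U\<close>, so
  that equality of functions is equality of forms and the pointwise operations of
  \<^theory>\<open>HOL-Library.Function_Algebras\<close> are those of the dual space.\<close>

definition (in vector_space) dual_space :: "'b set \<Rightarrow> ('b \<Rightarrow> 'a) set" where
  "dual_space U = {\<alpha>. (\<forall>x\<in>U. \<forall>y\<in>U. \<alpha> (x + y) = \<alpha> x + \<alpha> y) \<and>
                     (\<forall>c. \<forall>x\<in>U. \<alpha> (scale c x) = c * \<alpha> x) \<and>
                     (\<forall>x. x \<notin> U \<longrightarrow> \<alpha> x = 0)}"

context lie_algebra
begin

definition root_space :: "'g set \<Rightarrow> 'g set \<Rightarrow> ('g \<Rightarrow> 'k) \<Rightarrow> 'g set" where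
  "root_space H L \<alpha> = {x \<in> L. \<forall>h\<in>H. bracket h x = \<alpha> h *s x}"

definition roots :: "'g set \<Rightarrow> 'g set \<Rightarrow> ('g \<Rightarrow> 'k) set" where
  "roots H L = {\<alpha> \<in> dual_space H. \<alpha> \<noteq> 0 \<and> root_space H L \<alpha> \<noteq> {0}}"

definition positive_system :: "'g set \<Rightarrow> 'g set \<Rightarrow> ('g \<Rightarrow> 'k) set \<Rightarrow> bool" where
  "positive_system H L P \<longleftrightarrow> P \<subseteq> roots H L \<and>
     (\<forall>\<alpha>\<in>roots H L. (\<alpha> \<in> P) \<noteq> (- \<alpha> \<in> P)) \<and>
     (\<forall>\<alpha>\<in>P. \<forall>\<beta>\<in>P. \<alpha> + \<beta> \<in> roots H L \<longrightarrow> \<alpha> + \<beta> \<in> P)"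

end

definition weyl_vector :: "('g \<Rightarrow> 'k::field) set \<Rightarrow> 'g \<Rightarrow> 'k" where
  "weyl_vector P = (\<lambda>x. (\<Sum>\<alpha>\<in>P. \<alpha> x) / 2)"

text \<open>\<open>B\<close> identifies \<open>H\<close> with its dual by sending \<open>t\<close> to \<open>B(t, -)\<close> restricted to \<open>H\<close>; the form on the
  dual is transported along this identification, which exists when \<open>B\<close> is nondegenerate on \<open>H\<close>.\<close>

definition form_representative ::
  "('g \<Rightarrow> 'g \<Rightarrow> 'k) \<Rightarrow> 'g set \<Rightarrow> ('g \<Rightarrow> 'k) \<Rightarrow> 'g" where
  "form_representative B H \<alpha> = (THE t. t \<in> H \<and> (\<forall>x\<in>H. B t x = \<alpha> x))"

definition dual_form ::
  "('g \<Rightarrow> 'g \<Rightarrow> 'k) \<Rightarrow> 'g set \<Rightarrow> ('g \<Rightarrow> 'k) \<Rightarrow> ('g \<Rightarrow> 'k) \<Rightarrow> 'k" where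
  "dual_form B H \<alpha> \<beta> = B (form_representative B H \<alpha>) (form_representative B H \<beta>)"

locale quadratic_lie_algebra = lie_algebra scale bracket
  for scale :: "'k::field \<Rightarrow> 'g::ab_group_add \<Rightarrow> 'g" (infixr \<open>*s\<close> 75)
    and bracket :: "'g \<Rightarrow> 'g \<Rightarrow> 'g" +
  fixes B :: "'g \<Rightarrow> 'g \<Rightarrow> 'k"
  assumes form_linear_left: "\<And>y. Vector_Spaces.linear scale (*) (\<lambda>x. B x y)"
    and form_symmetric: "\<And>x y. B x y = B y x"
    and form_invariant: "\<And>x y z. B (bracket x y) z = B x (bracket y z)"
    and form_nondegenerate: "\<And>x. (\<And>y. B x y = 0) \<Longrightarrow> x = 0"


section \<open>The tensor algebra and its quotients\<close>

text \<open>The free monoid on a type, written additively because multiplication of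
  \<^type>\<open>poly_mapping\<close> is convolution with respect to \<open>+\<close>.\<close>

datatype 'v free_monoid = Word (letters: "'v list")

instantiation free_monoid :: (type) monoid_add
begin

definition zero_free_monoid :: "'a free_monoid" where
  "0 = Word []"

definition plus_free_monoid :: "'a free_monoid \<Rightarrow> 'a free_monoid \<Rightarrow> 'a free_monoid" where
  "u + v = Word (letters u @ letters v)"

instance
  by standard (simp_all add: zero_free_monoid_def plus_free_monoid_def)

end

type_synonym ('k, 'v) free = "'v free_monoid \<Rightarrow>\<^sub>0 'k"
type_synonym ('k, 'v) tensor = "('k, 'v) free set"
type_synonym ('k, 'v) quot = "('k, 'v) tensor set"

definition free_algebra :: "'v set \<Rightarrow> ('k::comm_ring_1, 'v) free ring" where
  "free_algebra V = \<lparr>carrier = {f. \<forall>w\<in>Poly_Mapping.keys f. set (letters w) \<subseteq> V},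
     monoid.mult = (*), one = 1, zero = 0, add = (+)\<rparr>"

definition free_gen :: "'v \<Rightarrow> ('k::comm_ring_1, 'v) free" where
  "free_gen v = Poly_Mapping.single (Word [v]) 1"

definition free_scalar :: "'k::comm_ring_1 \<Rightarrow> ('k, 'v) free" where
  "free_scalar c = Poly_Mapping.single 0 c"

text \<open>The tensor algebra of a vector space \<open>V\<close> is the free algebra on the set \<open>V\<close> modulo the
  relations which make \<open>V\<close> embed linearly. Here \<open>V\<close> is a subspace of the type \<^typ>\<open>'v\<close> with
  scalar multiplication \<open>sc\<close>. The scalar multiple of \<open>a\<close> by \<open>c\<close> in an algebra is the product of
  \<open>a\<close> with the image of \<open>c\<close> under the structure map, such as \<open>tensor_scalar\<close>.\<close>

definition linear_relations ::
  "('k::comm_ring_1 \<Rightarrow> 'v::ab_group_add \<Rightarrow> 'v) \<Rightarrow> 'v set \<Rightarrow> ('k, 'v) free set" where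
  "linear_relations sc V =
     {free_gen (v + w) - free_gen v - free_gen w | v w. v \<in> V \<and> w \<in> V} \<union>
     {free_gen (sc c v) - free_scalar c * free_gen v | c v. v \<in> V}"

definition linear_ideal ::
  "('k::comm_ring_1 \<Rightarrow> 'v::ab_group_add \<Rightarrow> 'v) \<Rightarrow> 'v set \<Rightarrow> ('k, 'v) free set" where
  "linear_ideal sc V = Idl\<^bsub>free_algebra V\<^esub> (linear_relations sc V)"

definition tensor_algebra ::
  "('k::comm_ring_1 \<Rightarrow> 'v::ab_group_add \<Rightarrow> 'v) \<Rightarrow> 'v set \<Rightarrow> ('k, 'v) tensor ring" where
  "tensor_algebra sc V = free_algebra V Quot linear_ideal sc V"

definition tensor_gen ::
  "('k::comm_ring_1 \<Rightarrow> 'v::ab_group_add \<Rightarrow> 'v) \<Rightarrow> 'v set \<Rightarrow> 'v \<Rightarrow> ('k, 'v) tensor" where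
  "tensor_gen sc V v = linear_ideal sc V +>\<^bsub>free_algebra V\<^esub> free_gen v"

definition tensor_scalar ::
  "('k::comm_ring_1 \<Rightarrow> 'v::ab_group_add \<Rightarrow> 'v) \<Rightarrow> 'v set \<Rightarrow> 'k \<Rightarrow> ('k, 'v) tensor" where
  "tensor_scalar sc V c = linear_ideal sc V +>\<^bsub>free_algebra V\<^esub> free_scalar c"

text \<open>The quotient of the tensor algebra by the two-sided ideal generated by a set \<open>R\<close>.\<close>

definition quot_algebra ::
  "('k::comm_ring_1 \<Rightarrow> 'v::ab_group_add \<Rightarrow> 'v) \<Rightarrow> 'v set \<Rightarrow> ('k, 'v) tensor set
     \<Rightarrow> ('k, 'v) quot ring" where
  "quot_algebra sc V R = tensor_algebra sc V Quot (Idl\<^bsub>tensor_algebra sc V\<^esub> R)"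

definition quot_gen ::
  "('k::comm_ring_1 \<Rightarrow> 'v::ab_group_add \<Rightarrow> 'v) \<Rightarrow> 'v set \<Rightarrow> ('k, 'v) tensor set
     \<Rightarrow> 'v \<Rightarrow> ('k, 'v) quot" where
  "quot_gen sc V R v =
     (Idl\<^bsub>tensor_algebra sc V\<^esub> R) +>\<^bsub>tensor_algebra sc V\<^esub> tensor_gen sc V v"

definition quot_scalar ::
  "('k::comm_ring_1 \<Rightarrow> 'v::ab_group_add \<Rightarrow> 'v) \<Rightarrow> 'v set \<Rightarrow> ('k, 'v) tensor set
     \<Rightarrow> 'k \<Rightarrow> ('k, 'v) quot" where
  "quot_scalar sc V R c =
     (Idl\<^bsub>tensor_algebra sc V\<^esub> R) +>\<^bsub>tensor_algebra sc V\<^esub> tensor_scalar sc V c"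

definition quot_word ::
  "('k::comm_ring_1 \<Rightarrow> 'v::ab_group_add \<Rightarrow> 'v) \<Rightarrow> 'v set \<Rightarrow> ('k, 'v) tensor set
     \<Rightarrow> 'v list \<Rightarrow> ('k, 'v) quot" where
  "quot_word sc V R vs =
     foldr (\<lambda>v a. quot_gen sc V R v \<otimes>\<^bsub>quot_algebra sc V R\<^esub> a) vs \<one>\<^bsub>quot_algebra sc V R\<^esub>"

definition weyl_relations ::
  "('k::comm_ring_1 \<Rightarrow> 'v::ab_group_add \<Rightarrow> 'v) \<Rightarrow> 'v set \<Rightarrow> ('v \<Rightarrow> 'v \<Rightarrow> 'k)
     \<Rightarrow> ('k, 'v) tensor set" where
  "weyl_relations sc V \<omega> =
     (let T = tensor_algebra sc V; \<iota> = tensor_gen sc V in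
      {\<iota> v \<otimes>\<^bsub>T\<^esub> \<iota> w \<ominus>\<^bsub>T\<^esub> \<iota> w \<otimes>\<^bsub>T\<^esub> \<iota> v \<ominus>\<^bsub>T\<^esub> tensor_scalar sc V (\<omega> v w) | v w.
         v \<in> V \<and> w \<in> V})"

definition symmetric_relations ::
  "('k::comm_ring_1 \<Rightarrow> 'v::ab_group_add \<Rightarrow> 'v) \<Rightarrow> 'v set \<Rightarrow> ('k, 'v) tensor set" where
  "symmetric_relations sc V =
     (let T = tensor_algebra sc V; \<iota> = tensor_gen sc V in
      {\<iota> v \<otimes>\<^bsub>T\<^esub> \<iota> w \<ominus>\<^bsub>T\<^esub> \<iota> w \<otimes>\<^bsub>T\<^esub> \<iota> v | v w. v \<in> V \<and> w \<in> V})"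

definition (in lie_algebra) enveloping_relations :: "'g set \<Rightarrow> ('k, 'g) tensor set" where
  "enveloping_relations L =
     (let T = tensor_algebra scale L; \<iota> = tensor_gen scale L in
      {\<iota> x \<otimes>\<^bsub>T\<^esub> \<iota> y \<ominus>\<^bsub>T\<^esub> \<iota> y \<otimes>\<^bsub>T\<^esub> \<iota> x \<ominus>\<^bsub>T\<^esub> \<iota> (bracket x y) | x y. x \<in> L \<and> y \<in> L})"

abbreviation weyl_algebra ::
  "('k::comm_ring_1 \<Rightarrow> 'v::ab_group_add \<Rightarrow> 'v) \<Rightarrow> 'v set \<Rightarrow> ('v \<Rightarrow> 'v \<Rightarrow> 'k)
     \<Rightarrow> ('k, 'v) quot ring" where
  "weyl_algebra sc V \<omega> \<equiv> quot_algebra sc V (weyl_relations sc V \<omega>)"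

abbreviation symmetric_algebra ::
  "('k::comm_ring_1 \<Rightarrow> 'v::ab_group_add \<Rightarrow> 'v) \<Rightarrow> 'v set \<Rightarrow> ('k, 'v) quot ring" where
  "symmetric_algebra sc V \<equiv> quot_algebra sc V (symmetric_relations sc V)"

abbreviation (in lie_algebra) enveloping_algebra :: "'g set \<Rightarrow> ('k, 'g) quot ring" where
  "enveloping_algebra L \<equiv> quot_algebra scale L (enveloping_relations L)"


section \<open>Symmetrization and homogeneous components\<close>

text \<open>The linear map from the symmetric algebra to the Weyl algebra which is given on products of
  elements of \<open>V\<close> by the average over all orderings.\<close>

definition symmetrization ::
  "('k::field_char_0 \<Rightarrow> 'v::ab_group_add \<Rightarrow> 'v) \<Rightarrow> 'v set \<Rightarrow> ('v \<Rightarrow> 'v \<Rightarrow> 'k)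
     \<Rightarrow> ('k, 'v) quot \<Rightarrow> ('k, 'v) quot" where
  "symmetrization sc V \<omega> =
     (let S = symmetric_algebra sc V; RS = symmetric_relations sc V;
          W = weyl_algebra sc V \<omega>; RW = weyl_relations sc V \<omega> in
      THE Q. Q \<in> carrier S \<rightarrow>\<^sub>E carrier W \<and>
        (\<forall>a\<in>carrier S. \<forall>b\<in>carrier S. Q (a \<oplus>\<^bsub>S\<^esub> b) = Q a \<oplus>\<^bsub>W\<^esub> Q b) \<and>
        (\<forall>c. \<forall>a\<in>carrier S.
           Q (quot_scalar sc V RS c \<otimes>\<^bsub>S\<^esub> a) = quot_scalar sc V RW c \<otimes>\<^bsub>W\<^esub> Q a) \<and>
        (\<forall>vs. set vs \<subseteq> V \<longrightarrow>
           Q (quot_word sc V RS vs) =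
             quot_scalar sc V RW (1 / fact (length vs)) \<otimes>\<^bsub>W\<^esub>
             (\<Oplus>\<^bsub>W\<^esub>\<sigma>\<in>{\<sigma>. \<sigma> permutes {..<length vs}}. quot_word sc V RW (permute_list \<sigma> vs))))"

definition eta ::
  "('k::field_char_0 \<Rightarrow> 'v::ab_group_add \<Rightarrow> 'v) \<Rightarrow> 'v set \<Rightarrow> ('v \<Rightarrow> 'v \<Rightarrow> 'k)
     \<Rightarrow> ('k, 'v) quot \<Rightarrow> ('k, 'v) quot" where
  "eta sc V \<omega> = inv_into (carrier (symmetric_algebra sc V)) (symmetrization sc V \<omega>)"

definition symmetric_power ::
  "('k::comm_ring_1 \<Rightarrow> 'v::ab_group_add \<Rightarrow> 'v) \<Rightarrow> 'v set \<Rightarrow> nat \<Rightarrow> ('k, 'v) quot set" where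
  "symmetric_power sc V d =
     (let S = symmetric_algebra sc V; R = symmetric_relations sc V in
      {(\<Oplus>\<^bsub>S\<^esub>vs\<in>X. quot_scalar sc V R (c vs) \<otimes>\<^bsub>S\<^esub> quot_word sc V R vs) | X c.
         finite X \<and> X \<subseteq> {vs. length vs = d \<and> set vs \<subseteq> V}})"

text \<open>The components with respect to the grading of the symmetric algebra by the symmetric
  powers.\<close>

definition symmetric_component ::
  "('k::comm_ring_1 \<Rightarrow> 'v::ab_group_add \<Rightarrow> 'v) \<Rightarrow> 'v set \<Rightarrow> ('k, 'v) quot \<Rightarrow> nat \<Rightarrow> ('k, 'v) quot"
  where
  "symmetric_component sc V s =
     (let S = symmetric_algebra sc V in
      THE a. (\<forall>d. a d \<in> symmetric_power sc V d) \<and> finite {d. a d \<noteq> \<zero>\<^bsub>S\<^esub>} \<and>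
             (\<Oplus>\<^bsub>S\<^esub>d\<in>{d. a d \<noteq> \<zero>\<^bsub>S\<^esub>}. a d) = s)"


section \<open>The Casimir element and its image in the Weyl algebra\<close>

text \<open>\<open>double \<pp>\<close> is \<open>\<pp> \<oplus> \<pp>\<^sup>*\<close>, with scalar multiplication \<open>double_scale\<close>; the symplectic form
  \<open>double_form\<close> takes the value \<open>\<alpha> w\<close> on the pair \<open>(\<alpha>, w)\<close> with \<open>\<alpha>\<close> first.\<close>

definition double_scale :: "('k::field \<Rightarrow> 'g \<Rightarrow> 'g) \<Rightarrow> 'k \<Rightarrow> 'g \<times> ('g \<Rightarrow> 'k) \<Rightarrow> 'g \<times> ('g \<Rightarrow> 'k)" where
  "double_scale scale c = (\<lambda>(v, \<alpha>). (scale c v, \<lambda>x. c * \<alpha> x))"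

definition (in vector_space) double :: "'b set \<Rightarrow> ('b \<times> ('b \<Rightarrow> 'a)) set" where
  "double \<pp> = \<pp> \<times> dual_space \<pp>"

definition double_form :: "'g \<times> ('g \<Rightarrow> 'k) \<Rightarrow> 'g \<times> ('g \<Rightarrow> 'k) \<Rightarrow> 'k::field" where
  "double_form = (\<lambda>(v, \<alpha>) (w, \<beta>). \<alpha> w - \<beta> v)"

definition (in vector_space) is_basis_of :: "'b set \<Rightarrow> 'b set \<Rightarrow> bool" where
  "is_basis_of X U \<longleftrightarrow> independent X \<and> span X = U"

context lie_algebra
begin

definition form_dual_vector :: "('g \<Rightarrow> 'g \<Rightarrow> 'k) \<Rightarrow> 'g set \<Rightarrow> 'g set \<Rightarrow> 'g \<Rightarrow> 'g" where
  "form_dual_vector B L X w = (THE y. y \<in> L \<and> (\<forall>v\<in>X. B v y = (if v = w then 1 else 0)))"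

definition casimir :: "('g \<Rightarrow> 'g \<Rightarrow> 'k) \<Rightarrow> 'g set \<Rightarrow> 'g set \<Rightarrow> ('k, 'g) quot" where
  "casimir B L X =
     (let U = enveloping_algebra L; \<iota> = quot_gen scale L (enveloping_relations L) in
      \<Oplus>\<^bsub>U\<^esub>w\<in>X. \<iota> w \<otimes>\<^bsub>U\<^esub> \<iota> (form_dual_vector B L X w))"

text \<open>In \<open>nu\<close>, the set \<open>Z\<close> is a basis of \<open>\<pp>\<close>. The coordinate function of \<open>z \<in> Z\<close> is the element
  of the dual basis belonging to \<open>z\<close>; by definition of \<open>representation\<close> it vanishes outside
  \<open>span Z = \<pp>\<close>.\<close>

definition nu :: "'g set \<Rightarrow> 'g set \<Rightarrow> 'g \<Rightarrow> ('k, 'g \<times> ('g \<Rightarrow> 'k)) quot" where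
  "nu \<pp> Z x =
     (let W = weyl_algebra (double_scale scale) (double \<pp>) double_form;
          \<iota> = quot_gen (double_scale scale) (double \<pp>)
                (weyl_relations (double_scale scale) (double \<pp>) double_form) in
      \<Oplus>\<^bsub>W\<^esub>z\<in>Z. \<iota> (bracket x z, 0) \<otimes>\<^bsub>W\<^esub> \<iota> (0, \<lambda>y. representation Z y z))"

text \<open>The morphism of unital \<open>k\<close>-algebras from the enveloping algebra of \<open>\<kk>\<close> which extends
  \<open>nu\<close>.\<close>

definition nu_hom ::
  "'g set \<Rightarrow> 'g set \<Rightarrow> 'g set \<Rightarrow> ('k, 'g) quot \<Rightarrow> ('k, 'g \<times> ('g \<Rightarrow> 'k)) quot" where
  "nu_hom \<kk> \<pp> Z =
     (let U = enveloping_algebra \<kk>; RU = enveloping_relations \<kk>;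
          W = weyl_algebra (double_scale scale) (double \<pp>) double_form;
          RW = weyl_relations (double_scale scale) (double \<pp>) double_form in
      THE N. N \<in> ring_hom U W \<and> N \<in> extensional (carrier U) \<and>
        (\<forall>c. N (quot_scalar scale \<kk> RU c) =
               quot_scalar (double_scale scale) (double \<pp>) RW c) \<and>
        (\<forall>x\<in>\<kk>. N (quot_gen scale \<kk> RU x) = nu \<pp> Z x))"

end

end

theory Submission
  imports Defs "HOL-Combinatorics.Multiset_Permutations"
begin

text \<open>
  The Weyl algebra acts on \<open>S(\<pp> \<oplus> \<pp>\<^sup>*)\<close> by letting \<open>v\<close> act as multiplication by \<open>v\<close> plus half of the
  contraction with \<open>v\<close>, and applying this action to \<open>1\<close> gives \<open>\<eta>\<close>. The constant term of \<open>\<eta>\<close> on a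
  product of four vectors is then a sum over pairings, so that the constant term belonging to
  \<open>\<Omega>(\<kk>)\<close> is \<open>- 1/4\<close> times the trace \<open>T\<close> of \<open>\<Omega>(\<kk>)\<close> on \<open>\<pp>\<close>; the remaining terms vanish since \<open>ad w\<close> is
  skew. Splitting the trace of \<open>\<Omega>(\<gg>)\<close> on \<open>\<gg>\<close> along \<open>\<gg> = \<kk> \<oplus> \<pp>\<close> shows that it exceeds the trace of
  \<open>\<Omega>(\<kk>)\<close> on \<open>\<kk>\<close> by \<open>3 T\<close>. By the strange formula of Freudenthal and de Vries these two traces are
  \<open>24 B(\<rho>\<^sub>\<gg>, \<rho>\<^sub>\<gg>)\<close> and \<open>24 B(\<rho>\<^sub>\<kk>, \<rho>\<^sub>\<kk>)\<close>, whence \<open>T = 8 (B(\<rho>\<^sub>\<gg>, \<rho>\<^sub>\<gg>) - B(\<rho>\<^sub>\<kk>, \<rho>\<^sub>\<kk>))\<close>.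

  The strange formula is proved without classification. The invariance of \<open>B\<close> and the Jacobi
  identity express the trace of the Casimir element through the numbers
  \<open>c \<alpha> \<beta> = B([e \<alpha>, e \<beta>], [e (- \<beta>), e (- \<alpha>)])\<close>, which satisfy \<open>c (- \<alpha>) \<beta> - c \<alpha> \<beta> = (\<alpha>, \<beta>)\<close> and
  \<open>c \<alpha> \<beta> = c \<beta> \<gamma>\<close> whenever \<open>\<alpha> + \<beta> + \<gamma> = 0\<close>; summing over pairs of positive roots gives the result.
  That root spaces are lines and that \<open>B\<close> is nondegenerate on a Cartan subalgebra is derived from
  complete reducibility of the adjoint representation by means of Engel's theorem and Cartan's
  criterion.
\<close>

section \<open>The free algebra\<close>

text \<open>Every algebra involved is an iterated quotient, and \<open>symmetrization\<close>,
  \<open>eta\<close>, \<open>symmetric_component\<close> and \<open>nu_hom\<close> are definite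
  descriptions or inverses, so nothing can be computed in place. Each map is therefore first given
  as a linear map on free algebras, by its values on words, and shown to respect the ideals;
  existence and uniqueness then resolve the description. On the side of structure theory the
  obstacle is the centre: the algebras are only reductive, so the Killing form may be degenerate,
  and \<open>B\<close> is an arbitrary invariant form. The Killing form merely serves to recognize
  central elements, and a commutator that is central must vanish. The factor 3 arises as follows.
  The trace of the Casimir element of \<gg> has four blocks along \<kk> and \<pp>. The block of
  \<kk> on \<kk> is the trace belonging to \<kk>, and invariance of \<open>B\<close> makes each of
  the other three equal to the trace of the Casimir element of \<kk> on \<pp>.\<close>

abbreviation word :: "'v list \<Rightarrow> ('k::comm_ring_1, 'v) free" where
  "word vs \<equiv> Poly_Mapping.single (Word vs) 1"

abbreviation free_scale :: "'k::comm_ring_1 \<Rightarrow> ('k, 'v) free \<Rightarrow> ('k, 'v) free" where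
  "free_scale c f \<equiv> free_scalar c * f"

lemma word_append: "word (us @ vs) = word us * word vs"
  by (simp add: mult_single plus_free_monoid_def)

lemma word_Cons: "word (v # vs) = free_gen v * word vs"
  using word_append[of "[v]" vs] by (simp add: free_gen_def)

lemma word_Nil: "word [] = 1"
  by (metis single_one zero_free_monoid_def)

lemma free_scalar_mult_single: "free_scale c (Poly_Mapping.single w d) = Poly_Mapping.single w (c * d)"
  by (simp add: free_scalar_def mult_single)

lemma single_mult_free_scalar: "Poly_Mapping.single w d * free_scalar c = Poly_Mapping.single w (c * d)"
  by (simp add: free_scalar_def mult_single mult.commute)

lemma free_expansion:
  "f = (\<Sum>w\<in>Poly_Mapping.keys f. free_scale (Poly_Mapping.lookup f w) (word (letters w)))"
proof (rule poly_mapping_eqI)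
  fix u
  have "Poly_Mapping.lookup (\<Sum>w\<in>Poly_Mapping.keys f. Poly_Mapping.single w (Poly_Mapping.lookup f w)) u
      = (\<Sum>w\<in>Poly_Mapping.keys f. if w = u then Poly_Mapping.lookup f u else 0)"
    unfolding lookup_sum by (intro sum.cong) (auto simp: lookup_single when_def)
  also have "\<dots> = Poly_Mapping.lookup f u"
    by (simp add: sum.delta' in_keys_iff)
  finally show "Poly_Mapping.lookup f u = Poly_Mapping.lookup (\<Sum>w\<in>Poly_Mapping.keys f.
      free_scale (Poly_Mapping.lookup f w) (word (letters w))) u"
    by (simp add: free_scalar_mult_single)
qed

lemma free_scalar_commute: "f * free_scalar c = free_scale c f"
proof -
  have "(\<Sum>w\<in>Poly_Mapping.keys f. free_scale (Poly_Mapping.lookup f w) (word (letters w))) * free_scalar c =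
      free_scale c (\<Sum>w\<in>Poly_Mapping.keys f. free_scale (Poly_Mapping.lookup f w) (word (letters w)))"
    by (simp add: sum_distrib_left sum_distrib_right free_scalar_mult_single single_mult_free_scalar)
  then show ?thesis using free_expansion[of f] by metis
qed

lemma free_scalar_add: "free_scalar (c + d) = free_scalar c + free_scalar d"
  by (simp add: free_scalar_def single_add)
lemma free_scalar_uminus: "free_scalar (- c) = - free_scalar c"
  by (simp add: free_scalar_def single_uminus)
lemma free_scalar_mult: "free_scalar (c * d) = free_scalar c * free_scalar d"
  by (simp add: free_scalar_def mult_single)
lemma free_scalar_one [simp]: "free_scalar 1 = 1"
  by (simp add: free_scalar_def)
lemma free_scalar_zero [simp]: "free_scalar 0 = 0"
  by (simp add: free_scalar_def)
lemma free_scale_left_commute: "f * free_scale c g = free_scale c (f * g)"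
  by (metis free_scalar_commute mult.assoc)

lemma lookup_free_scale: "Poly_Mapping.lookup (free_scale c f) w = c * Poly_Mapping.lookup f w"
proof -
  have "free_scale c f = (\<Sum>u\<in>Poly_Mapping.keys f. Poly_Mapping.single u (c * Poly_Mapping.lookup f u))"
    by (subst (1) free_expansion) (simp add: sum_distrib_left free_scalar_mult_single)
  moreover have "Poly_Mapping.lookup (\<Sum>u\<in>Poly_Mapping.keys f. Poly_Mapping.single u (c * Poly_Mapping.lookup f u)) w =
      (\<Sum>u\<in>Poly_Mapping.keys f. if u = w then c * Poly_Mapping.lookup f w else 0)"
    unfolding lookup_sum by (intro sum.cong) (auto simp: lookup_single when_def)
  moreover have "\<dots> = c * Poly_Mapping.lookup f w"
    by (simp add: in_keys_iff)
  ultimately show ?thesis by simp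
qed

lemma keys_free_scale: "Poly_Mapping.keys (free_scale c f) \<subseteq> Poly_Mapping.keys f"
  by (auto simp: in_keys_iff lookup_free_scale)

text \<open>The linear extension of a map on words. All maps between the algebras arise in this way
  and are only afterwards shown to respect the ideals; this also covers maps that are not
  multiplicative, such as symmetrization.\<close>

definition free_lift :: "('v list \<Rightarrow> ('k, 'w) free) \<Rightarrow> ('k::comm_ring_1, 'v) free \<Rightarrow> ('k, 'w) free" where
  "free_lift g f = (\<Sum>w\<in>Poly_Mapping.keys f. free_scale (Poly_Mapping.lookup f w) (g (letters w)))"

lemma free_lift_superset:
  assumes "finite S" "Poly_Mapping.keys f \<subseteq> S"
  shows "free_lift g f = (\<Sum>w\<in>S. free_scale (Poly_Mapping.lookup f w) (g (letters w)))"
  unfolding free_lift_def using assms by (intro sum.mono_neutral_left) (auto simp: in_keys_iff)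

lemma free_lift_add: "free_lift g (f1 + f2) = free_lift g f1 + free_lift g f2"
proof -
  let ?S = "Poly_Mapping.keys f1 \<union> Poly_Mapping.keys f2"
  have S: "finite ?S" "Poly_Mapping.keys (f1 + f2) \<subseteq> ?S" by (auto simp: keys_add[THEN subsetD])
      (meson UnE keys_add subsetD)
  show ?thesis
    by (simp add: free_lift_superset[OF S] free_lift_superset[of ?S f1] free_lift_superset[of ?S f2]
        lookup_add free_scalar_add distrib_right sum.distrib)
qed

lemma free_lift_scale: "free_lift g (free_scale c f) = free_scale c (free_lift g f)"
  unfolding free_lift_superset[OF finite_keys keys_free_scale]
  by (simp add: free_lift_def lookup_free_scale free_scalar_mult sum_distrib_left mult.assoc)

lemma free_lift_word: "free_lift g (word vs) = g vs"
  by (simp add: free_lift_def)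

lemma free_lift_zero [simp]: "free_lift g 0 = 0"
  by (simp add: free_lift_def)

lemma free_lift_uminus: "free_lift g (- f) = - free_lift g f"
  by (metis add_eq_0_iff free_lift_add free_lift_zero)

lemma free_lift_diff: "free_lift g (f1 - f2) = free_lift g f1 - free_lift g f2"
  by (simp add: free_lift_add free_lift_uminus diff_conv_add_uminus del: add_uminus_conv_diff)

lemma free_lift_sum: "free_lift g (sum h X) = (\<Sum>x\<in>X. free_lift g (h x))"
  by (induction X rule: infinite_finite_induct) (auto simp: free_lift_add)

definition free_carrier :: "'v set \<Rightarrow> ('k::comm_ring_1, 'v) free set" where
  "free_carrier V = {f. \<forall>w\<in>Poly_Mapping.keys f. set (letters w) \<subseteq> V}"

lemma free_carrier_zero [simp]: "0 \<in> free_carrier V"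
  by (simp add: free_carrier_def)
lemma free_carrier_add: "f \<in> free_carrier V \<Longrightarrow> g \<in> free_carrier V \<Longrightarrow> f + g \<in> free_carrier V"
  unfolding free_carrier_def using keys_add[of f g] by auto
lemma free_carrier_scale: "f \<in> free_carrier V \<Longrightarrow> free_scale c f \<in> free_carrier V"
  unfolding free_carrier_def using keys_free_scale[of c f] by auto
lemma free_carrier_uminus: "f \<in> free_carrier V \<Longrightarrow> - f \<in> free_carrier V"
  by (simp add: free_carrier_def)
lemma free_carrier_diff: "f \<in> free_carrier V \<Longrightarrow> g \<in> free_carrier V \<Longrightarrow> f - g \<in> free_carrier V"
  by (metis free_carrier_add free_carrier_uminus diff_conv_add_uminus)
lemma free_carrier_sum: "(\<And>x. x \<in> X \<Longrightarrow> h x \<in> free_carrier V) \<Longrightarrow> sum h X \<in> free_carrier V"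
  by (induction X rule: infinite_finite_induct) (auto simp: free_carrier_add)
lemma free_carrier_word: "set vs \<subseteq> V \<Longrightarrow> word vs \<in> free_carrier V"
  by (simp add: free_carrier_def)
lemma free_carrier_mult: "f \<in> free_carrier V \<Longrightarrow> g \<in> free_carrier V \<Longrightarrow> f * g \<in> free_carrier V"
  unfolding free_carrier_def using keys_mult[of f g] by (fastforce simp: plus_free_monoid_def)
lemma free_carrier_scalar: "free_scalar c \<in> free_carrier V"
  using free_carrier_scale[OF free_carrier_word[of "[]" V], of c] by (simp add: word_Nil)
lemma free_carrier_one [simp]: "1 \<in> free_carrier V"
  using free_carrier_word[of "[]" V] by (simp add: word_Nil)
lemma free_carrier_gen: "v \<in> V \<Longrightarrow> free_gen v \<in> free_carrier V"
  by (simp add: free_carrier_def free_gen_def)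

lemma free_lift_carrier:
  assumes "f \<in> free_carrier V" "\<And>vs. set vs \<subseteq> V \<Longrightarrow> g vs \<in> free_carrier U"
  shows "free_lift g f \<in> free_carrier U"
  unfolding free_lift_def
  by (intro free_carrier_sum free_carrier_scale assms(2)) (use assms(1) in \<open>auto simp: free_carrier_def\<close>)

definition free_subspace :: "('k::comm_ring_1, 'v) free set \<Rightarrow> bool" where
  "free_subspace K \<longleftrightarrow> 0 \<in> K \<and> (\<forall>f\<in>K. \<forall>g\<in>K. f + g \<in> K) \<and> (\<forall>c. \<forall>f\<in>K. free_scale c f \<in> K)"

lemma free_subspaceD:
  assumes "free_subspace K"
  shows "0 \<in> K" "f \<in> K \<Longrightarrow> g \<in> K \<Longrightarrow> f + g \<in> K" "f \<in> K \<Longrightarrow> free_scale c f \<in> K"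
    "f \<in> K \<Longrightarrow> - f \<in> K" "f \<in> K \<Longrightarrow> g \<in> K \<Longrightarrow> f - g \<in> K"
    "(\<And>x. x \<in> X \<Longrightarrow> h x \<in> K) \<Longrightarrow> sum h X \<in> K"
proof -
  show *: "0 \<in> K" "f \<in> K \<Longrightarrow> g \<in> K \<Longrightarrow> f + g \<in> K" "f \<in> K \<Longrightarrow> free_scale c f \<in> K" for f g c
    using assms by (auto simp: free_subspace_def)
  show **: "f \<in> K \<Longrightarrow> - f \<in> K" for f
    using *(3)[of f "- 1"] by (simp add: free_scalar_uminus)
  show "f \<in> K \<Longrightarrow> g \<in> K \<Longrightarrow> f - g \<in> K"
    using *(2)[of f "- g"] **[of g] by simp
  show "(\<And>x. x \<in> X \<Longrightarrow> h x \<in> K) \<Longrightarrow> sum h X \<in> K"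
    by (induction X rule: infinite_finite_induct) (auto simp: *)
qed

text \<open>Words span, so a linear property is decided on words. Below, \<open>K\<close> is
  typically the solution set of the identity to be proved.\<close>

lemma free_subspace_induct:
  assumes "f \<in> free_carrier V" "free_subspace K" "\<And>vs. set vs \<subseteq> V \<Longrightarrow> word vs \<in> K"
  shows "f \<in> K"
proof -
  have "(\<Sum>w\<in>Poly_Mapping.keys f. free_scale (Poly_Mapping.lookup f w) (word (letters w))) \<in> K"
    by (intro free_subspaceD(3,6)[OF assms(2)] assms(3)) (use assms(1) in \<open>auto simp: free_carrier_def\<close>)
  then show ?thesis using free_expansion[of f] by simp
qed

lemma carrier_free_algebra [simp]: "carrier (free_algebra V) = free_carrier V"
  by (simp add: free_algebra_def free_carrier_def)

lemma free_algebra_simps [simp]: "monoid.mult (free_algebra V) = (*)" "one (free_algebra V) = 1"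
    "zero (free_algebra V) = 0" "add (free_algebra V) = (+)"
  by (simp_all add: free_algebra_def)

lemma ring_free_algebra: "ring (free_algebra V :: ('k::comm_ring_1, 'v) free ring)" (is "ring ?R")
proof (rule ringI)
  show "abelian_group ?R"
  proof (rule abelian_groupI)
    fix x assume "x \<in> carrier ?R"
    then show "\<exists>y\<in>carrier ?R. y \<oplus>\<^bsub>?R\<^esub> x = \<zero>\<^bsub>?R\<^esub>"
      by (intro bexI[of _ "- x"]) (auto simp: free_carrier_uminus)
  qed (auto simp: free_carrier_add add_ac)
  show "monoid ?R"
    by (rule monoidI) (auto simp: free_carrier_mult mult.assoc)
qed (auto simp: algebra_simps)

lemma a_minus_free_algebra:
  assumes "g \<in> free_carrier V"
  shows "a_minus (free_algebra V) f g = f - g"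
proof -
  interpret ring "free_algebra V" by (rule ring_free_algebra)
  have "a_inv (free_algebra V) g = - g"
    by (rule minus_equality) (use assms in \<open>auto simp: free_carrier_uminus\<close>)
  then show ?thesis by (simp add: a_minus_def)
qed

section \<open>Quotients of the free algebra\<close>

lemma ideal_free_subspace:
  assumes "ideal I (free_algebra V)"
  shows "free_subspace I" "I \<subseteq> free_carrier V"
    "f \<in> I \<Longrightarrow> g \<in> free_carrier V \<Longrightarrow> g * f \<in> I" "f \<in> I \<Longrightarrow> g \<in> free_carrier V \<Longrightarrow> f * g \<in> I"
proof -
  interpret ideal I "free_algebra V" by fact
  show "I \<subseteq> free_carrier V" using a_subset by simp
  show l: "f \<in> I \<Longrightarrow> g \<in> free_carrier V \<Longrightarrow> g * f \<in> I" for f g using I_l_closed[of f g] by simp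
  show "f \<in> I \<Longrightarrow> g \<in> free_carrier V \<Longrightarrow> f * g \<in> I" using I_r_closed[of f g] by simp
  show "free_subspace I"
    unfolding free_subspace_def using additive_subgroup.a_closed[OF is_additive_subgroup] additive_subgroup.zero_closed[OF is_additive_subgroup]
      l[OF _ free_carrier_scalar] by simp
qed

lemma free_idealI:
  assumes "free_subspace K" "K \<subseteq> free_carrier V"
    "\<And>f g. f \<in> K \<Longrightarrow> g \<in> free_carrier V \<Longrightarrow> g * f \<in> K" "\<And>f g. f \<in> K \<Longrightarrow> g \<in> free_carrier V \<Longrightarrow> f * g \<in> K"
  shows "ideal K (free_algebra V)"
proof (rule idealI)
  interpret ring "free_algebra V" by (rule ring_free_algebra)
  show "ring (free_algebra V)" by (rule ring_free_algebra)
  show "subgroup K (add_monoid (free_algebra V))"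
  proof (rule add.subgroupI)
    fix a assume "a \<in> K"
    then have "- a \<in> K" "a \<in> free_carrier V" using assms(1,2) free_subspaceD(4) by auto
    moreover have "\<ominus>\<^bsub>free_algebra V\<^esub> a = - a"
      by (rule minus_equality) (use calculation in \<open>auto simp: free_carrier_uminus\<close>)
    ultimately show "\<ominus>\<^bsub>free_algebra V\<^esub> a \<in> K" by simp
  qed (use assms free_subspaceD(1,2)[OF assms(1)] in auto)
qed (use assms in auto)

text \<open>\<open>K\<close> is only a linear subspace. The elements whose products with words on
  both sides all stay in \<open>K\<close> nevertheless form a two-sided ideal, and it contains
  \<open>R0\<close>. This lets linear maps that are not multiplicative pass to the
  quotients.\<close>

lemma genideal_induct:
  fixes V :: "'v set"
  assumes "R0 \<subseteq> free_carrier V" "free_subspace K"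
    and K: "\<And>r u u'. r \<in> R0 \<Longrightarrow> set u \<subseteq> V \<Longrightarrow> set u' \<subseteq> V \<Longrightarrow> word u * r * word u' \<in> K"
    and f: "f \<in> Idl\<^bsub>free_algebra V\<^esub> R0"
  shows "f \<in> K"
proof -
  define K' where "K' = {f \<in> free_carrier V. \<forall>u u'. set u \<subseteq> V \<longrightarrow> set u' \<subseteq> V \<longrightarrow> word u * f * word u' \<in> K}"
  note s = free_subspaceD[OF assms(2)]
  have K'D: "word u * f * word u' \<in> K" if "f \<in> K'" "set u \<subseteq> V" "set u' \<subseteq> V" for f u u'
    using that by (auto simp: K'_def)
  have sub: "free_subspace K'"
    unfolding free_subspace_def
  proof (intro conjI ballI allI)
    show "0 \<in> K'" using s(1) by (simp add: K'_def)
    fix f g assume fg: "f \<in> K'" "g \<in> K'"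
    show "f + g \<in> K'" using fg s(2) by (auto simp: K'_def free_carrier_add distrib_left distrib_right)
  next
    fix c f assume f: "f \<in> K'"
    have "word u * (free_scale c f) * word u' = free_scale c (word u * f * word u')" for u u'
      by (simp only: free_scale_left_commute mult.assoc)
    then show "free_scale c f \<in> K'" using f s(3) by (auto simp: K'_def free_carrier_scale)
  qed
  have l: "g * f \<in> K'" and r: "f * g \<in> K'" if f: "f \<in> K'" and g: "g \<in> free_carrier V" for f g
  proof -
    have fc: "f \<in> free_carrier V" using f by (simp add: K'_def)
    have "g \<in> {g \<in> free_carrier V. g * f \<in> K' \<and> f * g \<in> K'}"
    proof (rule free_subspace_induct[OF g])
      show "free_subspace {g \<in> free_carrier V. g * f \<in> K' \<and> f * g \<in> K'}"
        unfolding free_subspace_def using free_subspaceD(1-3)[OF sub]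
        by (auto simp: distrib_left distrib_right mult.assoc free_carrier_add free_carrier_scale
            free_scale_left_commute[of f])
      fix vs :: "'v list" assume vs: "set vs \<subseteq> V"
      have "word u * (word vs * f) * word u' \<in> K" "word u * (f * word vs) * word u' \<in> K"
        if "set u \<subseteq> V" "set u' \<subseteq> V" for u u'
        using K'D[OF f, of "u @ vs" u'] K'D[OF f, of u "vs @ u'"] that vs
        by (simp_all add: word_append mult.assoc)
      then show "word vs \<in> {g \<in> free_carrier V. g * f \<in> K' \<and> f * g \<in> K'}"
        using vs fc by (auto simp: free_carrier_word K'_def free_carrier_mult)
    qed
    then show "g * f \<in> K'" "f * g \<in> K'" by auto
  qed
  have "ideal K' (free_algebra V)"
    by (rule free_idealI[OF sub _ l r]) (auto simp: K'_def)
  moreover have "R0 \<subseteq> K'" using assms(1) K by (auto simp: K'_def)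
  ultimately have "f \<in> K'" using f by (auto simp: genideal_def)
  from K'D[OF this, of "[]" "[]"] show ?thesis by (simp add: word_Nil)
qed

definition quot_proj ::
  "('k::comm_ring_1 \<Rightarrow> 'v::ab_group_add \<Rightarrow> 'v) \<Rightarrow> 'v set \<Rightarrow> ('k, 'v) tensor set
     \<Rightarrow> ('k, 'v) free \<Rightarrow> ('k, 'v) quot" where
  "quot_proj sc V R f =
     (Idl\<^bsub>tensor_algebra sc V\<^esub> R) +>\<^bsub>tensor_algebra sc V\<^esub> (linear_ideal sc V +>\<^bsub>free_algebra V\<^esub> f)"

lemma quot_gen_eq: "quot_gen sc V R v = quot_proj sc V R (free_gen v)"
  by (simp add: quot_gen_def quot_proj_def tensor_gen_def)

lemma quot_scalar_eq: "quot_scalar sc V R c = quot_proj sc V R (free_scalar c)"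
  by (simp add: quot_scalar_def quot_proj_def tensor_scalar_def)

text \<open>Dividing by the linear relations first and by \<open>R\<close> afterwards amounts to dividing the free
  algebra by a single ideal, the ideal \<open>I\<close> below, of which \<open>R0\<close> are the additional generators.\<close>

locale free_quotient =
  fixes sc :: "'k::comm_ring_1 \<Rightarrow> 'v::ab_group_add \<Rightarrow> 'v" and V :: "'v set"
    and R0 :: "('k, 'v) free set" and R :: "('k, 'v) tensor set"
  assumes V_zero: "0 \<in> V" and V_add: "v \<in> V \<Longrightarrow> w \<in> V \<Longrightarrow> v + w \<in> V" and V_sc: "v \<in> V \<Longrightarrow> sc c v \<in> V"
    and R0_carrier: "R0 \<subseteq> free_carrier V"
    and R_eq: "R = (\<lambda>r. linear_ideal sc V +>\<^bsub>free_algebra V\<^esub> r) ` R0"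
begin

abbreviation "\<pi> \<equiv> quot_proj sc V R"
abbreviation "A \<equiv> quot_algebra sc V R"

definition "I = Idl\<^bsub>free_algebra V\<^esub> (linear_relations sc V \<union> R0)"

lemma rels_carrier: "linear_relations sc V \<union> R0 \<subseteq> free_carrier V"
  using R0_carrier unfolding linear_relations_def
  by (auto intro!: free_carrier_diff free_carrier_gen free_carrier_mult free_carrier_scalar V_add V_sc)

lemma ideal_I: "ideal I (free_algebra V)"
  unfolding I_def using rels_carrier
  by (intro ring.genideal_ideal ring_free_algebra) simp

lemmas I_subspace = ideal_free_subspace(1)[OF ideal_I]
lemmas I_carrier = ideal_free_subspace(2)[OF ideal_I]
lemmas I_mult = ideal_free_subspace(3,4)[OF ideal_I]

lemma rels_I: "linear_relations sc V \<union> R0 \<subseteq> I"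
  unfolding I_def using rels_carrier by (intro ring.genideal_self ring_free_algebra) simp

lemma I_induct:
  assumes "free_subspace K"
    and "\<And>v w u u'. v \<in> V \<Longrightarrow> w \<in> V \<Longrightarrow> set u \<subseteq> V \<Longrightarrow> set u' \<subseteq> V \<Longrightarrow>
      word (u @ [v + w] @ u') - word (u @ [v] @ u') - word (u @ [w] @ u') \<in> K"
    and "\<And>v c u u'. v \<in> V \<Longrightarrow> set u \<subseteq> V \<Longrightarrow> set u' \<subseteq> V \<Longrightarrow>
      word (u @ [sc c v] @ u') - free_scale c (word (u @ [v] @ u')) \<in> K"
    and R0: "\<And>r u u'. r \<in> R0 \<Longrightarrow> set u \<subseteq> V \<Longrightarrow> set u' \<subseteq> V \<Longrightarrow> word u * r * word u' \<in> K"
    and "f \<in> I"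
  shows "f \<in> K"
proof (rule genideal_induct[OF rels_carrier assms(1) _ assms(5)[unfolded I_def]])
  fix r and u u' :: "'v list" assume r: "r \<in> linear_relations sc V \<union> R0" and u: "set u \<subseteq> V" "set u' \<subseteq> V"
  have gen: "free_gen v = word [v]" for v :: 'v by (simp add: free_gen_def)
  have "word u * (word [v + w] - word [v] - word [w]) * word u' \<in> K" if "v \<in> V" "w \<in> V" for v w
    using assms(2)[OF that u] by (simp add: word_append algebra_simps del: append.simps)
  moreover have "word u * (word [sc c v] - free_scale c (word [v])) * word u' \<in> K" if "v \<in> V" for v c
    using assms(3)[OF that u, of c]
    by (simp add: word_append left_diff_distrib right_diff_distrib free_scale_left_commute[of "word u"] mult.assoc
        del: append.simps)
  ultimately show "word u * r * word u' \<in> K"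
    using r R0[OF _ u] unfolding linear_relations_def gen by auto
qed

lemma ideal_linear: "ideal (linear_ideal sc V) (free_algebra V)"
  unfolding linear_ideal_def using rels_carrier
  by (intro ring.genideal_ideal ring_free_algebra) simp

lemma ring_tensor: "ring (tensor_algebra sc V)"
  unfolding tensor_algebra_def by (rule ideal.quotient_is_ring[OF ideal_linear])

abbreviation "\<tau> \<equiv> \<lambda>f. linear_ideal sc V +>\<^bsub>free_algebra V\<^esub> f"

lemma tau_hom: "ring_hom_ring (free_algebra V) (tensor_algebra sc V) \<tau>"
  unfolding tensor_algebra_def by (rule ideal.rcos_ring_hom_ring[OF ideal_linear])

lemma tau_surj: "carrier (tensor_algebra sc V) = \<tau> ` free_carrier V"
  by (auto simp: tensor_algebra_def FactRing_def A_RCOSETS_def RCOSETS_def a_r_coset_def)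

lemma R_carrier: "R \<subseteq> carrier (tensor_algebra sc V)"
  unfolding R_eq tau_surj using R0_carrier by auto

lemma ideal_R: "ideal (Idl\<^bsub>tensor_algebra sc V\<^esub> R) (tensor_algebra sc V)"
  by (rule ring.genideal_ideal[OF ring_tensor R_carrier])

lemma ring_A: "ring A"
  unfolding quot_algebra_def by (rule ideal.quotient_is_ring[OF ideal_R])

lemma pi_hom: "ring_hom_ring (free_algebra V) A \<pi>"
proof -
  interpret t: ring_hom_ring "free_algebra V" "tensor_algebra sc V" \<tau> by (rule tau_hom)
  interpret q: ring_hom_ring "tensor_algebra sc V" A "\<lambda>f. (Idl\<^bsub>tensor_algebra sc V\<^esub> R) +>\<^bsub>tensor_algebra sc V\<^esub> f"
    unfolding quot_algebra_def by (rule ideal.rcos_ring_hom_ring[OF ideal_R])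
  have "(\<lambda>f. (Idl\<^bsub>tensor_algebra sc V\<^esub> R) +>\<^bsub>tensor_algebra sc V\<^esub> f) \<circ> \<tau> \<in> ring_hom (free_algebra V) A"
    by (rule ring_hom_trans[OF t.homh q.homh])
  moreover have "(\<lambda>f. (Idl\<^bsub>tensor_algebra sc V\<^esub> R) +>\<^bsub>tensor_algebra sc V\<^esub> f) \<circ> \<tau> = \<pi>"
    by (simp add: quot_proj_def fun_eq_iff)
  ultimately show ?thesis
    by (intro ring_hom_ringI2 ring_free_algebra ring_A) simp
qed

lemma carrier_A: "carrier A = \<pi> ` free_carrier V"
proof -
  have "carrier A = (\<lambda>f. (Idl\<^bsub>tensor_algebra sc V\<^esub> R) +>\<^bsub>tensor_algebra sc V\<^esub> f) ` carrier (tensor_algebra sc V)"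
    by (auto simp: quot_algebra_def FactRing_def A_RCOSETS_def RCOSETS_def a_r_coset_def)
  then show ?thesis by (simp add: tau_surj image_image quot_proj_def)
qed

lemma pi_closed: "f \<in> free_carrier V \<Longrightarrow> \<pi> f \<in> carrier A"
  by (auto simp: carrier_A)

lemma pi_simps:
  "f \<in> free_carrier V \<Longrightarrow> g \<in> free_carrier V \<Longrightarrow> \<pi> (f + g) = \<pi> f \<oplus>\<^bsub>A\<^esub> \<pi> g"
  "f \<in> free_carrier V \<Longrightarrow> g \<in> free_carrier V \<Longrightarrow> \<pi> (f * g) = \<pi> f \<otimes>\<^bsub>A\<^esub> \<pi> g"
  "\<pi> 1 = \<one>\<^bsub>A\<^esub>" "\<pi> 0 = \<zero>\<^bsub>A\<^esub>"
proof -
  interpret ring_hom_ring "free_algebra V" A \<pi> by (rule pi_hom)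
  show "f \<in> free_carrier V \<Longrightarrow> g \<in> free_carrier V \<Longrightarrow> \<pi> (f + g) = \<pi> f \<oplus>\<^bsub>A\<^esub> \<pi> g" using hom_add by simp
  show "f \<in> free_carrier V \<Longrightarrow> g \<in> free_carrier V \<Longrightarrow> \<pi> (f * g) = \<pi> f \<otimes>\<^bsub>A\<^esub> \<pi> g" using hom_mult by simp
  show "\<pi> 1 = \<one>\<^bsub>A\<^esub>" using hom_one by simp
  show "\<pi> 0 = \<zero>\<^bsub>A\<^esub>" using hom_zero by simp
qed

lemma pi_finsum:
  assumes "\<And>x. x \<in> X \<Longrightarrow> h x \<in> free_carrier V" "finite X"
  shows "\<pi> (sum h X) = (\<Oplus>\<^bsub>A\<^esub>x\<in>X. \<pi> (h x))"
proof -
  interpret ring A by (rule ring_A)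
  show ?thesis using assms(2,1)
    by (induction X) (auto simp: pi_simps free_carrier_sum pi_closed Pi_def)
qed

lemma pi_word: "set vs \<subseteq> V \<Longrightarrow> quot_word sc V R vs = \<pi> (word vs)"
proof (induction vs)
  case Nil
  then show ?case by (simp add: quot_word_def word_Nil pi_simps)
next
  case (Cons v vs)
  then show ?case
    by (simp add: quot_word_def quot_gen_eq word_Cons pi_simps free_carrier_gen free_carrier_word)
qed

text \<open>The kernel of \<open>\<pi>\<close> is an ideal that contains all relations, hence
  contains \<open>I\<close>. Conversely the image of \<open>I\<close> in the tensor algebra is an
  ideal containing \<open>R\<close>; an element of the kernel therefore differs from some element of
  \<open>I\<close> by an element of \<open>linear_ideal sc V\<close>, which lies in \<open>I\<close>
  as well.\<close>

lemma pi_I: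
  assumes f: "f \<in> free_carrier V"
  shows "\<pi> f = \<zero>\<^bsub>A\<^esub> \<longleftrightarrow> f \<in> I"
proof
  interpret h: ring_hom_ring "free_algebra V" A \<pi> by (rule pi_hom)
  interpret t: ring_hom_ring "free_algebra V" "tensor_algebra sc V" \<tau> by (rule tau_hom)
  interpret L: ideal "linear_ideal sc V" "free_algebra V" by (rule ideal_linear)
  interpret J: ideal "Idl\<^bsub>tensor_algebra sc V\<^esub> R" "tensor_algebra sc V" by (rule ideal_R)
  interpret I: ideal I "free_algebra V" by (rule ideal_I)
  let ?K = "{f \<in> free_carrier V. \<pi> f = \<zero>\<^bsub>A\<^esub>}"
  have Z: "\<zero>\<^bsub>A\<^esub> = Idl\<^bsub>tensor_algebra sc V\<^esub> R" by (simp add: quot_algebra_def FactRing_def)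
  have "ideal ?K (free_algebra V)"
    using h.kernel_is_ideal unfolding a_kernel_def' carrier_free_algebra .
  moreover have "linear_relations sc V \<union> R0 \<subseteq> ?K"
  proof
    fix r assume r: "r \<in> linear_relations sc V \<union> R0"
    then have rc: "r \<in> free_carrier V" using rels_carrier by auto
    have "\<tau> r \<in> Idl\<^bsub>tensor_algebra sc V\<^esub> R"
    proof (cases "r \<in> R0")
      case True
      then show ?thesis using ring.genideal_self[OF ring_tensor R_carrier] R_eq by auto
    next
      case False
      then have "r \<in> linear_ideal sc V"
        using r ring.genideal_self[OF ring_free_algebra, of "linear_relations sc V" V] rels_carrier
        by (auto simp: linear_ideal_def)
      then have "\<tau> r = \<zero>\<^bsub>tensor_algebra sc V\<^esub>"
        by (simp add: tensor_algebra_def FactRing_def L.a_rcos_const)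
      then show ?thesis by simp
    qed
    then have "\<pi> r = \<zero>\<^bsub>A\<^esub>" by (simp add: quot_proj_def Z J.a_rcos_const)
    then show "r \<in> ?K" using rc by simp
  qed
  ultimately have "I \<subseteq> ?K" unfolding I_def by (auto simp: genideal_def)
  then show "f \<in> I \<Longrightarrow> \<pi> f = \<zero>\<^bsub>A\<^esub>" by auto
  have LI: "linear_ideal sc V \<subseteq> I"
    unfolding linear_ideal_def using rels_I ideal_I by (auto simp: genideal_def)
  assume "\<pi> f = \<zero>\<^bsub>A\<^esub>"
  then have "\<tau> f \<in> Idl\<^bsub>tensor_algebra sc V\<^esub> R"
    unfolding quot_proj_def Z using J.a_rcos_self[of "\<tau> f"] f tau_surj by auto
  moreover have "ideal (\<tau> ` I) (tensor_algebra sc V)"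
    using ring.ring_ideal_imp_quot_ideal[OF ring_free_algebra ideal_linear ideal_I]
    by (simp add: tensor_algebra_def)
  moreover have "R \<subseteq> \<tau> ` I" using rels_I R_eq by auto
  ultimately have "\<tau> f \<in> \<tau> ` I" by (auto simp: genideal_def)
  then obtain g where g: "g \<in> I" "\<tau> f = \<tau> g" by auto
  then have gc: "g \<in> free_carrier V" using I_carrier by auto
  have "f \<in> \<tau> g" using L.a_rcos_self[of f] f g by simp
  then obtain l where "l \<in> linear_ideal sc V" "f = l + g"
    by (auto simp: a_r_coset_def')
  then show "f \<in> I" using LI g I_subspace free_subspaceD(2) by blast
qed

lemma pi_eq_iff:
  assumes f: "f \<in> free_carrier V" and g: "g \<in> free_carrier V"
  shows "\<pi> f = \<pi> g \<longleftrightarrow> f - g \<in> I"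
proof -
  interpret ring A by (rule ring_A)
  have "\<pi> f = \<pi> (f - g) \<oplus>\<^bsub>A\<^esub> \<pi> g"
    using pi_simps(1)[OF free_carrier_diff[OF f g] g] by simp
  then show ?thesis
    using pi_I[OF free_carrier_diff[OF f g]] pi_closed f g free_carrier_diff[OF f g]
    by (metis l_zero add.r_cancel_one)
qed

end

section \<open>The symmetric algebra and the Weyl algebra\<close>

lemma free_scale_commute:
  fixes f :: "('k::comm_ring_1, 'v) free"
  shows "free_scale c (free_scale d f) = free_scale d (free_scale c f)"
proof -
  have "free_scalar c * free_scalar d = (free_scalar d * free_scalar c :: ('k, 'v) free)"
    unfolding free_scalar_mult[symmetric] by (simp add: mult.commute)
  then show ?thesis by (simp only: mult.assoc[symmetric])
qed

context free_quotient
begin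

lemma tau_simps:
  "f \<in> free_carrier V \<Longrightarrow> g \<in> free_carrier V \<Longrightarrow> \<tau> (f * g) = \<tau> f \<otimes>\<^bsub>tensor_algebra sc V\<^esub> \<tau> g"
  "f \<in> free_carrier V \<Longrightarrow> g \<in> free_carrier V \<Longrightarrow> \<tau> (f - g) = \<tau> f \<ominus>\<^bsub>tensor_algebra sc V\<^esub> \<tau> g"
proof -
  interpret ring_hom_ring "free_algebra V" "tensor_algebra sc V" \<tau> by (rule tau_hom)
  show "f \<in> free_carrier V \<Longrightarrow> g \<in> free_carrier V \<Longrightarrow> \<tau> (f * g) = \<tau> f \<otimes>\<^bsub>tensor_algebra sc V\<^esub> \<tau> g"
    using hom_mult[of f g] by simp
  assume fg: "f \<in> free_carrier V" "g \<in> free_carrier V"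
  have "\<tau> (f - g) = \<tau> (f \<ominus>\<^bsub>free_algebra V\<^esub> g)" by (simp only: a_minus_free_algebra[OF fg(2)])
  also have "\<dots> = \<tau> f \<oplus>\<^bsub>tensor_algebra sc V\<^esub> \<tau> (\<ominus>\<^bsub>free_algebra V\<^esub> g)"
    unfolding a_minus_def by (rule hom_add) (use fg R.a_inv_closed[of g] in auto)
  also have "\<tau> (\<ominus>\<^bsub>free_algebra V\<^esub> g) = \<ominus>\<^bsub>tensor_algebra sc V\<^esub> \<tau> g"
    by (rule hom_a_inv) (use fg in simp)
  finally show "\<tau> (f - g) = \<tau> f \<ominus>\<^bsub>tensor_algebra sc V\<^esub> \<tau> g"
    unfolding a_minus_def[of "tensor_algebra sc V"] .
qed

end

lemma image_setcompr2:
  "(\<And>v w. v \<in> V \<Longrightarrow> w \<in> V \<Longrightarrow> h (G v w) = F v w) \<Longrightarrow>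
    {F v w | v w. v \<in> V \<and> w \<in> V} = h ` {G v w | v w. v \<in> V \<and> w \<in> V}"
proof -
  assume eq: "\<And>v w. v \<in> V \<Longrightarrow> w \<in> V \<Longrightarrow> h (G v w) = F v w"
  have "{F v w | v w. v \<in> V \<and> w \<in> V} = (\<lambda>(v, w). F v w) ` (V \<times> V)" by force
  also have "\<dots> = h ` (\<lambda>(v, w). G v w) ` (V \<times> V)"
    unfolding image_image by (intro image_cong) (auto simp: eq)
  also have "(\<lambda>(v, w). G v w) ` (V \<times> V) = {G v w | v w. v \<in> V \<and> w \<in> V}" by force
  finally show ?thesis .
qed

text \<open>For \<omega> = 0 these are the relations of the symmetric algebra, so both algebras are
  instances of one construction and share the induction over the ideal.\<close>

definition weyl_free :: "'v set \<Rightarrow> ('v \<Rightarrow> 'v \<Rightarrow> 'k) \<Rightarrow> ('k::comm_ring_1, 'v) free set" where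
  "weyl_free V \<omega> = {free_gen v * free_gen w - free_gen w * free_gen v - free_scalar (\<omega> v w) | v w. v \<in> V \<and> w \<in> V}"

lemma weyl_free_carrier: "weyl_free V \<omega> \<subseteq> free_carrier V"
  unfolding weyl_free_def
  by (auto intro!: free_carrier_diff free_carrier_mult free_carrier_gen free_carrier_scalar)

locale free_generators =
  fixes sc :: "'k::comm_ring_1 \<Rightarrow> 'v::ab_group_add \<Rightarrow> 'v" and V :: "'v set"
  assumes V_zero: "0 \<in> V" and V_add: "v \<in> V \<Longrightarrow> w \<in> V \<Longrightarrow> v + w \<in> V" and V_sc: "v \<in> V \<Longrightarrow> sc c v \<in> V"
begin

lemma trivial_quotient: "free_quotient sc V {} {}"
  by unfold_locales (auto simp: V_zero V_add V_sc)

lemma weyl_quotient: "free_quotient sc V (weyl_free V \<omega>) (weyl_relations sc V \<omega>)"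
proof unfold_locales
  interpret t: free_quotient sc V "{}" "{}" by (rule trivial_quotient)
  note c = free_carrier_diff free_carrier_mult free_carrier_gen free_carrier_scalar
  have "t.\<tau> (free_gen v * free_gen w - free_gen w * free_gen v - free_scalar (\<omega> v w)) =
     tensor_gen sc V v \<otimes>\<^bsub>tensor_algebra sc V\<^esub> tensor_gen sc V w
       \<ominus>\<^bsub>tensor_algebra sc V\<^esub> tensor_gen sc V w \<otimes>\<^bsub>tensor_algebra sc V\<^esub> tensor_gen sc V v
       \<ominus>\<^bsub>tensor_algebra sc V\<^esub> tensor_scalar sc V (\<omega> v w)" if "v \<in> V" "w \<in> V" for v w
    using that by (simp add: t.tau_simps c tensor_gen_def tensor_scalar_def)
  then show "weyl_relations sc V \<omega> = t.\<tau> ` weyl_free V \<omega>"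
    unfolding weyl_relations_def weyl_free_def Let_def by (intro image_setcompr2) auto
qed (auto simp: V_zero V_add V_sc weyl_free_carrier)

lemma symmetric_quotient: "free_quotient sc V (weyl_free V (\<lambda>_ _. 0)) (symmetric_relations sc V)"
proof unfold_locales
  interpret t: free_quotient sc V "{}" "{}" by (rule trivial_quotient)
  note c = free_carrier_diff free_carrier_mult free_carrier_gen free_carrier_scalar
  have "t.\<tau> (free_gen v * free_gen w - free_gen w * free_gen v - free_scalar 0) =
     tensor_gen sc V v \<otimes>\<^bsub>tensor_algebra sc V\<^esub> tensor_gen sc V w
       \<ominus>\<^bsub>tensor_algebra sc V\<^esub> tensor_gen sc V w \<otimes>\<^bsub>tensor_algebra sc V\<^esub> tensor_gen sc V v"
    if "v \<in> V" "w \<in> V" for v w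
    using that by (simp add: t.tau_simps c tensor_gen_def)
  then show "symmetric_relations sc V = t.\<tau> ` weyl_free V (\<lambda>_ _. 0)"
    unfolding symmetric_relations_def weyl_free_def Let_def by (intro image_setcompr2) auto
qed (auto simp: V_zero V_add V_sc weyl_free_carrier)

end

locale weyl_system = free_generators sc V
  for sc :: "'k::field_char_0 \<Rightarrow> 'v::ab_group_add \<Rightarrow> 'v" and V :: "'v set" +
  fixes \<omega> :: "'v \<Rightarrow> 'v \<Rightarrow> 'k"
  assumes omega_add: "\<And>u v w. u \<in> V \<Longrightarrow> v \<in> V \<Longrightarrow> w \<in> V \<Longrightarrow> \<omega> u (v + w) = \<omega> u v + \<omega> u w"
    and omega_sc: "\<And>u v c. u \<in> V \<Longrightarrow> v \<in> V \<Longrightarrow> \<omega> u (sc c v) = c * \<omega> u v"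
    and omega_skew: "\<And>u v. u \<in> V \<Longrightarrow> v \<in> V \<Longrightarrow> \<omega> u v = - \<omega> v u"
begin

lemma omega_add_left: "u \<in> V \<Longrightarrow> v \<in> V \<Longrightarrow> w \<in> V \<Longrightarrow> \<omega> (v + w) u = \<omega> v u + \<omega> w u"
  using omega_add[of u v w] omega_skew[of u] V_add by (metis minus_add_distrib omega_skew)

lemma omega_sc_left: "u \<in> V \<Longrightarrow> v \<in> V \<Longrightarrow> \<omega> (sc c v) u = c * \<omega> v u"
  using omega_sc[of u v c] omega_skew[of u] V_sc by (metis mult_minus_right omega_skew)

sublocale W: free_quotient sc V "weyl_free V \<omega>" "weyl_relations sc V \<omega>"
  by (rule weyl_quotient)

sublocale S: free_quotient sc V "weyl_free V (\<lambda>_ _. 0)" "symmetric_relations sc V"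
  by (rule symmetric_quotient)

text \<open>The contraction with \<open>v\<close>: the derivation of the free algebra that sends the
  letter \<open>w\<close> to the scalar \<open>\<omega> v w\<close>.\<close>

primrec deriv_word :: "'v \<Rightarrow> 'v list \<Rightarrow> ('k, 'v) free" where
  "deriv_word v [] = 0"
| "deriv_word v (w # ws) = free_scale (\<omega> v w) (word ws) + free_gen w * deriv_word v ws"

definition deriv :: "'v \<Rightarrow> ('k, 'v) free \<Rightarrow> ('k, 'v) free" where
  "deriv v = free_lift (deriv_word v)"

lemma deriv_linear:
  "deriv v (f + g) = deriv v f + deriv v g" "deriv v (f - g) = deriv v f - deriv v g"
  "deriv v (free_scale c f) = free_scale c (deriv v f)" "deriv v 0 = 0" "deriv v (word ws) = deriv_word v ws"
  "deriv v (sum h X) = (\<Sum>x\<in>X. deriv v (h x))"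
  by (simp_all add: deriv_def free_lift_add free_lift_diff free_lift_scale free_lift_word free_lift_sum)

lemma deriv_word_append: "deriv_word v (us @ ws) = deriv_word v us * word ws + word us * deriv_word v ws"
  by (induction us) (simp_all add: word_Nil word_append word_Cons algebra_simps)

lemma deriv_word_carrier: "set ws \<subseteq> V \<Longrightarrow> deriv_word v ws \<in> free_carrier V"
  by (induction ws) (auto intro!: free_carrier_add free_carrier_scale free_carrier_mult free_carrier_word free_carrier_gen)

lemma deriv_carrier: "f \<in> free_carrier V \<Longrightarrow> deriv v f \<in> free_carrier V"
  unfolding deriv_def by (erule free_lift_carrier) (rule deriv_word_carrier)

lemma deriv_gen_mult:
  "deriv v (free_gen w * f) = free_scale (\<omega> v w) f + free_gen w * deriv v f"
proof -
  have "f \<in> {f. deriv v (free_gen w * f) = free_scale (\<omega> v w) f + free_gen w * deriv v f}"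
  proof (rule free_subspace_induct[of f UNIV])
    show "free_subspace {f. deriv v (free_gen w * f) = free_scale (\<omega> v w) f + free_gen w * deriv v f}"
      unfolding free_subspace_def
      by (auto simp: deriv_linear distrib_left add_ac free_scale_left_commute[of "free_gen w"] intro: free_scale_commute)
  qed (simp_all add: deriv_linear flip: word_Cons, simp add: free_carrier_def)
  then show ?thesis by simp
qed

lemma deriv_left:
  assumes "v \<in> V" "w \<in> V" "f \<in> free_carrier V"
  shows "deriv (v + w) f = deriv v f + deriv w f" "deriv (sc c v) f = free_scale c (deriv v f)"
proof -
  have 1: "deriv_word (v + w) ws = deriv_word v ws + deriv_word w ws" if "set ws \<subseteq> V" for ws
    using that by (induction ws) (simp_all add: omega_add_left assms algebra_simps free_scalar_add)
  have 2: "deriv_word (sc c v) ws = free_scale c (deriv_word v ws)" if "set ws \<subseteq> V" for ws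
    using that
    by (induction ws) (simp_all add: omega_sc_left assms distrib_left free_scalar_mult mult.assoc free_scale_left_commute[of "free_gen _"])
  have "f \<in> {f. deriv (v + w) f = deriv v f + deriv w f \<and> deriv (sc c v) f = free_scale c (deriv v f)}"
    apply (rule free_subspace_induct[OF assms(3)])
     apply (auto simp: free_subspace_def deriv_linear 1 2 distrib_left intro: free_scale_commute)
    done
  then show "deriv (v + w) f = deriv v f + deriv w f" "deriv (sc c v) f = free_scale c (deriv v f)" by auto
qed

text \<open>The contraction of a letter is a scalar, which is killed by every further contraction;
  what remains is symmetric in the two vectors, already in the free algebra.\<close>

lemma deriv_commute: "deriv v (deriv w f) = deriv w (deriv v f)"
proof -
  have 1: "deriv v (deriv_word w ws) = deriv w (deriv_word v ws)" for ws
    by (induction ws) (simp_all add: deriv_linear deriv_gen_mult add_ac)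
  have "f \<in> {f. deriv v (deriv w f) = deriv w (deriv v f)}"
    by (rule free_subspace_induct[of f UNIV])
      (auto simp: free_subspace_def deriv_linear 1 free_carrier_def)
  then show ?thesis by simp
qed

lemma gen_add_I:
  "v \<in> V \<Longrightarrow> w \<in> V \<Longrightarrow> free_gen (v + w) - free_gen v - free_gen w \<in> S.I"
  "v \<in> V \<Longrightarrow> free_gen (sc c v) - free_scale c (free_gen v) \<in> S.I"
  "v \<in> V \<Longrightarrow> w \<in> V \<Longrightarrow> free_gen v * free_gen w - free_gen w * free_gen v \<in> S.I"
  "v \<in> V \<Longrightarrow> w \<in> V \<Longrightarrow> free_gen (v + w) - free_gen v - free_gen w \<in> W.I"
  "v \<in> V \<Longrightarrow> free_gen (sc c v) - free_scale c (free_gen v) \<in> W.I"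
  "v \<in> V \<Longrightarrow> w \<in> V \<Longrightarrow> free_gen v * free_gen w - free_gen w * free_gen v - free_scalar (\<omega> v w) \<in> W.I"
proof -
  have "free_gen (v + w) - free_gen v - free_gen w \<in> linear_relations sc V" if "v \<in> V" "w \<in> V"
    using that unfolding linear_relations_def by blast
  then show "v \<in> V \<Longrightarrow> w \<in> V \<Longrightarrow> free_gen (v + w) - free_gen v - free_gen w \<in> S.I"
    "v \<in> V \<Longrightarrow> w \<in> V \<Longrightarrow> free_gen (v + w) - free_gen v - free_gen w \<in> W.I"
    using S.rels_I W.rels_I by auto
  have "free_gen (sc c v) - free_scale c (free_gen v) \<in> linear_relations sc V" if "v \<in> V"
    using that unfolding linear_relations_def by blast
  then show "v \<in> V \<Longrightarrow> free_gen (sc c v) - free_scale c (free_gen v) \<in> S.I"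
    "v \<in> V \<Longrightarrow> free_gen (sc c v) - free_scale c (free_gen v) \<in> W.I"
    using S.rels_I W.rels_I by auto
  have r: "free_gen v * free_gen w - free_gen w * free_gen v - free_scalar (\<omega>' v w) \<in> weyl_free V \<omega>'"
    if "v \<in> V" "w \<in> V" for \<omega>' using that unfolding weyl_free_def by blast
  show "v \<in> V \<Longrightarrow> w \<in> V \<Longrightarrow> free_gen v * free_gen w - free_gen w * free_gen v - free_scalar (\<omega> v w) \<in> W.I"
    using r[of \<omega>] W.rels_I by auto
  show "v \<in> V \<Longrightarrow> w \<in> V \<Longrightarrow> free_gen v * free_gen w - free_gen w * free_gen v \<in> S.I"
    using r[of "\<lambda>_ _. 0"] S.rels_I by auto
qed

lemma word_middle: "word (u @ [v] @ u') = word u * (free_gen v * word u')"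
  by (simp add: word_append word_Cons)

text \<open>By the Leibniz rule a contraction hits the outer words or the relation in the middle.
  The latter contributes nothing: linear relations cancel because \<omega> is linear in its second
  argument, commutators because scalars are central.\<close>

lemma deriv_I:
  assumes v: "v \<in> V" and f: "f \<in> S.I"
  shows "deriv v f \<in> S.I"
proof -
  note s = free_subspaceD[OF S.I_subspace] note m = S.I_mult
  have dmid: "deriv v (word (p @ a # q)) =
      deriv_word v p * (free_gen a * word q) + word p * (free_scale (\<omega> v a) (word q) + free_gen a * deriv_word v q)"
    for p a q
    by (simp add: deriv_linear deriv_word_append word_Cons)
  have mid: "word p * (x * word q) \<in> S.I" "deriv_word v p * (x * word q) \<in> S.I" "word p * (x * deriv_word v q) \<in> S.I"
    if "x \<in> S.I" "set p \<subseteq> V" "set q \<subseteq> V" for x p q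
    by (rule m(1)[OF m(2)[OF that(1)]]; use that(2,3) in \<open>simp add: deriv_word_carrier free_carrier_word\<close>)+
  have "f \<in> {f. deriv v f \<in> S.I}"
  proof (rule S.I_induct[OF _ _ _ _ f])
    show "free_subspace {f. deriv v f \<in> S.I}"
      using s(1-3) by (auto simp: free_subspace_def deriv_linear)
  next
    fix a b and u u' :: "'v list" assume ab: "a \<in> V" "b \<in> V" and u: "set u \<subseteq> V" "set u' \<subseteq> V"
    let ?x = "free_gen (a + b) - free_gen a - free_gen b"
    have "deriv v (word (u @ [a + b] @ u') - word (u @ [a] @ u') - word (u @ [b] @ u')) =
      deriv_word v u * (?x * word u') + word u * (?x * deriv_word v u')"
      by (simp add: deriv_linear(1,2) dmid omega_add[OF v ab] free_scalar_add algebra_simps)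
    then show "word (u @ [a + b] @ u') - word (u @ [a] @ u') - word (u @ [b] @ u') \<in> {f. deriv v f \<in> S.I}"
      using mid[OF gen_add_I(1)[OF ab] u] s(2) by simp
  next
    fix a c and u u' :: "'v list" assume a: "a \<in> V" and u: "set u \<subseteq> V" "set u' \<subseteq> V"
    let ?x = "free_gen (sc c a) - free_scale c (free_gen a)"
    have "free_scale c (p * f) = p * free_scale c f" for p f :: "('k, 'v) free"
      by (rule free_scale_left_commute[symmetric])
    note sw = this[of "deriv_word v u"] this[of "word u"]
    have "deriv v (word (u @ [sc c a] @ u') - free_scale c (word (u @ [a] @ u'))) =
      deriv_word v u * (?x * word u') + word u * (?x * deriv_word v u')"
      by (simp add: deriv_linear(2,3) dmid omega_sc[OF v a] free_scalar_mult algebra_simps sw)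
    then show "word (u @ [sc c a] @ u') - free_scale c (word (u @ [a] @ u')) \<in> {f. deriv v f \<in> S.I}"
      using mid[OF gen_add_I(2)[OF a] u] s(2) by simp
  next
    fix r :: "('k, 'v) free" and u u' :: "'v list" assume r: "r \<in> weyl_free V (\<lambda>_ _. 0)" and u: "set u \<subseteq> V" "set u' \<subseteq> V"
    then obtain a b where ab: "a \<in> V" "b \<in> V" "r = free_gen a * free_gen b - free_gen b * free_gen a"
      by (auto simp: weyl_free_def)
    have w: "word u * r * word u' = word (u @ a # b # u') - word (u @ b # a # u')"
      by (simp only: ab(3) word_append word_Cons algebra_simps)
    have "deriv v (word u * r * word u') = deriv_word v u * (r * word u') + word u * (r * deriv_word v u')"
      unfolding w by (simp add: deriv_linear(2) dmid ab(3) word_Cons algebra_simps free_scale_left_commute[of "free_gen a"]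
         free_scale_left_commute[of "free_gen b"])
    then show "word u * r * word u' \<in> {f. deriv v f \<in> S.I}"
      using mid[OF gen_add_I(3)[OF ab(1,2)] u] s(2) ab(3) by simp
  qed
  then show ?thesis by simp
qed

text \<open>The factor 1/2 is forced by the Weyl relation: in the commutator of \<open>act v\<close>
  and \<open>act w\<close> the mixed terms contribute \<open>\<omega> v w / 2\<close> and
  \<open>- \<omega> w v / 2\<close>, which add up to \<open>\<omega> v w\<close>.\<close>

definition act :: "'v \<Rightarrow> ('k, 'v) free \<Rightarrow> ('k, 'v) free" where
  "act v f = free_gen v * f + free_scale (1/2) (deriv v f)"

lemma act_linear:
  "act v (f + g) = act v f + act v g" "act v (f - g) = act v f - act v g"
  "act v (free_scale c f) = free_scale c (act v f)" "act v 0 = 0"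
  "act v (sum h X) = (\<Sum>x\<in>X. act v (h x))"
proof -
  show "act v (free_scale c f) = free_scale c (act v f)"
    unfolding act_def deriv_linear distrib_left free_scale_left_commute[of "free_gen v"]
    using free_scale_commute[of "1/2" c] by simp
  show "act v (f - g) = act v f - act v g"
    by (simp add: act_def deriv_linear algebra_simps)
qed (simp_all add: act_def deriv_linear distrib_left add_ac sum_distrib_left sum.distrib)

lemma act_I: "v \<in> V \<Longrightarrow> f \<in> S.I \<Longrightarrow> act v f \<in> S.I"
  unfolding act_def
  by (intro free_subspaceD(2,3)[OF S.I_subspace] S.I_mult free_carrier_gen deriv_I)

lemma act_carrier: "v \<in> V \<Longrightarrow> f \<in> free_carrier V \<Longrightarrow> act v f \<in> free_carrier V"
  unfolding act_def by (intro free_carrier_add free_carrier_mult free_carrier_scale free_carrier_gen deriv_carrier)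

text \<open>The Weyl algebra acts on the symmetric algebra: \<open>v\<close> acts as multiplication by \<open>v\<close> plus half of
  the contraction with \<open>v\<close>. Applying this action to \<open>1\<close> inverts the symmetrization map.\<close>

primrec normal_word :: "'v list \<Rightarrow> ('k, 'v) free" where
  "normal_word [] = 1"
| "normal_word (v # vs) = act v (normal_word vs)"

definition normal :: "('k, 'v) free \<Rightarrow> ('k, 'v) free" where
  "normal = free_lift normal_word"

lemma normal_linear:
  "normal (f + g) = normal f + normal g" "normal (f - g) = normal f - normal g"
  "normal (free_scale c f) = free_scale c (normal f)" "normal 0 = 0" "normal (word ws) = normal_word ws"
  "normal (sum h X) = (\<Sum>x\<in>X. normal (h x))"
  by (simp_all add: normal_def free_lift_add free_lift_diff free_lift_scale free_lift_word free_lift_sum)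

lemma normal_word_carrier: "set ws \<subseteq> V \<Longrightarrow> normal_word ws \<in> free_carrier V"
  by (induction ws) (auto intro!: act_carrier)

lemma normal_carrier: "f \<in> free_carrier V \<Longrightarrow> normal f \<in> free_carrier V"
  unfolding normal_def by (erule free_lift_carrier) (rule normal_word_carrier)

lemma normal_gen_mult: "normal (free_gen v * f) = act v (normal f)"
proof -
  have "f \<in> {f. normal (free_gen v * f) = act v (normal f)}"
    by (rule free_subspace_induct[of f UNIV])
      (auto simp: free_subspace_def free_carrier_def act_linear normal_linear distrib_left
        free_scale_left_commute[of "free_gen v"] simp flip: word_Cons)
  then show ?thesis by simp
qed

lemma normal_word_mult_I:
  assumes "set u \<subseteq> V" "normal f \<in> S.I"
  shows "normal (word u * f) \<in> S.I"
  using assms by (induction u) (auto simp: word_Nil word_Cons mult.assoc normal_gen_mult act_I)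

text \<open>Modulo \<open>S.I\<close> the operators \<open>act\<close> depend linearly on the vector
  and satisfy the Weyl relations, so a relation followed by a word takes 1 into \<open>S.I\<close>;
  the letters in front of it preserve \<open>S.I\<close>.\<close>

lemma normal_I:
  assumes f: "f \<in> W.I"
  shows "normal f \<in> S.I"
proof -
  note s = free_subspaceD[OF S.I_subspace] note m = S.I_mult
  have "f \<in> {f. normal f \<in> S.I}"
  proof (rule W.I_induct[OF _ _ _ _ f])
    show "free_subspace {f. normal f \<in> S.I}"
      using s(1-3) by (auto simp: free_subspace_def normal_linear)
  next
    fix a b and u u' :: "'v list" assume ab: "a \<in> V" "b \<in> V" and u: "set u \<subseteq> V" "set u' \<subseteq> V"
    let ?x = "free_gen (a + b) - free_gen a - free_gen b" and ?g = "normal_word u'"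
    have "act (a + b) ?g - act a ?g - act b ?g = ?x * ?g"
      by (simp add: act_def deriv_left(1)[OF ab normal_word_carrier[OF u(2)]] algebra_simps)
    then have "normal (?x * word u') \<in> S.I"
      using m(2)[OF gen_add_I(1)[OF ab] normal_word_carrier[OF u(2)]]
      by (simp add: left_diff_distrib normal_linear normal_gen_mult)
    from normal_word_mult_I[OF u(1) this]
    show "word (u @ [a + b] @ u') - word (u @ [a] @ u') - word (u @ [b] @ u') \<in> {f. normal f \<in> S.I}"
      by (simp add: word_middle[simplified] right_diff_distrib left_diff_distrib)
  next
    fix a c and u u' :: "'v list" assume a: "a \<in> V" and u: "set u \<subseteq> V" "set u' \<subseteq> V"
    let ?x = "free_gen (sc c a) - free_scale c (free_gen a)" and ?g = "normal_word u'"
    have "free_scale (1/2) (free_scale c h) = free_scale c (free_scale (1/2) h)" for h :: "('k, 'v) free"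
      by (rule free_scale_commute)
    then have "act (sc c a) ?g - free_scale c (act a ?g) = ?x * ?g"
      by (simp add: act_def deriv_left(2)[OF a a normal_word_carrier[OF u(2)]] algebra_simps)
    then have "normal (?x * word u') \<in> S.I"
      using m(2)[OF gen_add_I(2)[OF a] normal_word_carrier[OF u(2)]]
      by (simp add: left_diff_distrib mult.assoc normal_linear normal_gen_mult)
    from normal_word_mult_I[OF u(1) this]
    show "word (u @ [sc c a] @ u') - free_scale c (word (u @ [a] @ u')) \<in> {f. normal f \<in> S.I}"
      by (simp add: word_middle[simplified] right_diff_distrib left_diff_distrib mult.assoc free_scale_left_commute[of "word u"])
  next
    fix r :: "('k, 'v) free" and u u' :: "'v list" assume r: "r \<in> weyl_free V \<omega>" and u: "set u \<subseteq> V" "set u' \<subseteq> V"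
    then obtain a b where ab: "a \<in> V" "b \<in> V" "r = free_gen a * free_gen b - free_gen b * free_gen a - free_scalar (\<omega> a b)"
      by (auto simp: weyl_free_def)
    let ?g = "normal_word u'"
    have half: "free_scale (1/2) (free_scale (\<omega> a b) ?g) - free_scale (1/2) (free_scale (\<omega> b a) ?g) = free_scale (\<omega> a b) ?g"
      by (simp add: omega_skew[OF ab(2,1)] free_scalar_uminus)
        (simp flip: mult.assoc free_scalar_mult distrib_right free_scalar_add)
    have half2: "free_gen x * free_scale (1/2) (deriv y ?g) = free_scale (1/2) (free_gen x * deriv y ?g)" for x y
      by (rule free_scale_left_commute)
    have "act a (act b ?g) - act b (act a ?g) - free_scale (\<omega> a b) ?g = (free_gen a * free_gen b - free_gen b * free_gen a) * ?g"
      unfolding act_def deriv_linear deriv_gen_mult distrib_left half2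
      using half deriv_commute[of a b ?g] by (simp add: algebra_simps)
    then have "normal (r * word u') \<in> S.I"
      using m(2)[OF gen_add_I(3)[OF ab(1,2)] normal_word_carrier[OF u(2)]]
      by (simp add: ab(3) left_diff_distrib mult.assoc normal_linear normal_gen_mult)
    from normal_word_mult_I[OF u(1) this]
    show "word u * r * word u' \<in> {f. normal f \<in> S.I}" by (simp add: mult.assoc)
  qed
  then show ?thesis by simp
qed

end

section \<open>Symmetrization on the free algebra\<close>

context weyl_system
begin

lemma word_move_front_S:
  assumes "set (p @ x # q) \<subseteq> V"
  shows "word (p @ x # q) - word (x # p @ q) \<in> S.I"
  using assms
proof (induction p)
  case Nil
  then show ?case using free_subspaceD(1)[OF S.I_subspace] by simp
next
  case (Cons y p)
  note s = free_subspaceD[OF S.I_subspace]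
  have 1: "free_gen y * (word (p @ x # q) - word (x # p @ q)) \<in> S.I"
    using Cons by (intro S.I_mult free_carrier_gen) auto
  have 2: "(free_gen y * free_gen x - free_gen x * free_gen y) * word (p @ q) \<in> S.I"
    using Cons.prems by (intro S.I_mult gen_add_I free_carrier_word) auto
  show ?case using s(2)[OF 1 2] by (simp add: word_Cons algebra_simps)
qed

lemma word_mset_S:
  assumes "mset us = mset ws" "set us \<subseteq> V"
  shows "word us - word ws \<in> S.I"
  using assms
proof (induction us arbitrary: ws)
  case Nil
  then show ?case using free_subspaceD(1)[OF S.I_subspace] by simp
next
  case (Cons x us)
  note s = free_subspaceD[OF S.I_subspace]
  have "x \<in> set ws" using Cons.prems(1) by (metis list.set_intros(1) set_mset_mset)
  then obtain p q where ws: "ws = p @ x # q" by (meson split_list)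
  then have m: "mset us = mset (p @ q)" using Cons.prems(1) by simp
  have V: "set ws \<subseteq> V" using Cons.prems by (metis set_mset_mset)
  have 1: "free_gen x * (word us - word (p @ q)) \<in> S.I"
    using Cons.IH[OF m] Cons.prems by (intro S.I_mult free_carrier_gen) auto
  have 2: "word (p @ x # q) - word (x # p @ q) \<in> S.I"
    using V ws by (intro word_move_front_S) simp
  show ?case using s(5)[OF 1 2] by (simp add: ws word_Cons algebra_simps)
qed

text \<open>The indices are permuted, not the vectors, so that repeated vectors count with
  multiplicity. Lists of indices make a recursion over the first factor available.\<close>

definition perm_sum :: "('i \<Rightarrow> 'v) \<Rightarrow> 'i set \<Rightarrow> ('k, 'v) free" where
  "perm_sum v J = (\<Sum>xs\<in>permutations_of_set J. word (map v xs))"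

lemma perm_sum_rec:
  assumes "finite J" "J \<noteq> {}"
  shows "perm_sum v J = (\<Sum>b\<in>J. free_gen (v b) * perm_sum v (J - {b}))"
proof -
  have "perm_sum v J = (\<Sum>xs\<in>(\<Union>b\<in>J. (#) b ` permutations_of_set (J - {b})). word (map v xs))"
    unfolding perm_sum_def using permutations_of_set_nonempty[OF assms(2)] by simp
  also have "\<dots> = (\<Sum>b\<in>J. \<Sum>xs\<in>(#) b ` permutations_of_set (J - {b}). word (map v xs))"
    using assms(1) by (intro sum.UNION_disjoint) auto
  also have "\<dots> = (\<Sum>b\<in>J. \<Sum>xs\<in>permutations_of_set (J - {b}). free_gen (v b) * word (map v xs))"
    by (rule sum.cong[OF refl]) (simp add: sum.reindex word_Cons inj_on_def)
  finally show ?thesis by (simp add: perm_sum_def sum_distrib_left)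
qed

text \<open>Modulo \<open>S.I\<close> all orders of the factors agree; the sorted one is a canonical
  choice.\<close>

definition mono :: "(nat \<Rightarrow> 'v) \<Rightarrow> nat set \<Rightarrow> ('k, 'v) free" where
  "mono v J = word (map v (sorted_list_of_set J))"

lemma deriv_word_map:
  "distinct xs \<Longrightarrow> deriv_word x (map v xs) = (\<Sum>c\<in>set xs. free_scale (\<omega> x (v c)) (word (map v (remove1 c xs))))"
proof (induction xs)
  case (Cons a xs)
  have "(\<Sum>c\<in>set xs. free_scale (\<omega> x (v c)) (word (map v (remove1 c (a # xs))))) =
     (\<Sum>c\<in>set xs. free_gen (v a) * free_scale (\<omega> x (v c)) (word (map v (remove1 c xs))))"
    using Cons.prems
    by (intro sum.cong) (auto simp: word_Cons free_scale_left_commute[of "free_gen _"])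
  then show ?case using Cons by (simp add: sum_distrib_left)
qed simp

lemma deriv_mono:
  assumes "finite J"
  shows "deriv x (mono v J) = (\<Sum>c\<in>J. free_scale (\<omega> x (v c)) (mono v (J - {c})))"
  unfolding mono_def deriv_linear
  by (subst deriv_word_map) (use assms in \<open>auto simp: sorted_list_of_set_remove[symmetric] intro!: sum.cong\<close>)

text \<open>Exchanging the two contracted indices changes the sign because \<omega> is skew, so the
  sum equals its own negative. This cancellation is why averaging over all orders removes every
  contraction term.\<close>

lemma contraction_sum_zero:
  assumes J: "finite J" "v ` J \<subseteq> V"
  shows "(\<Sum>b\<in>J. \<Sum>c\<in>J - {b}. free_scale (\<omega> (v b) (v c)) (mono v (J - {b} - {c}))) = 0" (is "?T = 0")
proof -
  have "?T = (\<Sum>b\<in>J. \<Sum>c\<in>{c \<in> J. c \<noteq> b}. free_scale (\<omega> (v b) (v c)) (mono v (J - {b} - {c})))"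
    by (intro sum.cong) auto
  also have "\<dots> = (\<Sum>c\<in>J. \<Sum>b\<in>{b \<in> J. c \<noteq> b}. free_scale (\<omega> (v b) (v c)) (mono v (J - {b} - {c})))"
    by (rule sum.swap_restrict) (use J in auto)
  also have "\<dots> = (\<Sum>c\<in>J. \<Sum>b\<in>J - {c}. - free_scale (\<omega> (v c) (v b)) (mono v (J - {c} - {b})))"
  proof (intro sum.cong refl)
    fix c b assume "c \<in> J" "b \<in> J - {c}"
    then have V: "v b \<in> V" "v c \<in> V" and "J - {b} - {c} = J - {c} - {b}" using J by auto
    then show "free_scale (\<omega> (v b) (v c)) (mono v (J - {b} - {c})) =
        - free_scale (\<omega> (v c) (v b)) (mono v (J - {c} - {b}))"
      using omega_skew[OF V] by (simp add: free_scalar_uminus)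
  qed auto
  also have "\<dots> = - ?T" by (simp add: sum_negf)
  finally have "?T = - ?T" .
  then have "?T + ?T = 0" unfolding eq_neg_iff_add_eq_0 .
  then have "free_scale (1/2) (?T + ?T) = 0" by simp
  then have "(free_scalar (1/2) + free_scalar (1/2)) * ?T = 0" by (simp only: distrib_left distrib_right)
  then show ?thesis by (simp flip: free_scalar_add)
qed

text \<open>Induction over the first factor. Each shorter permutation sum normalizes to n! times a
  monomial; multiplying by the missing vector restores the full monomial, once for each of the n + 1
  choices, and the half contractions cancel by \<open>contraction_sum_zero\<close>.\<close>

lemma normal_perm_sum:
  assumes "finite J" "v ` J \<subseteq> V"
  shows "normal (perm_sum v J) - free_scale (fact (card J)) (mono v J) \<in> S.I"
  using assms
proof (induction "card J" arbitrary: J)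
  case 0
  have "normal 1 = 1" using normal_linear(5)[of "[]"] by (simp add: word_Nil)
  with 0 show ?case using free_subspaceD(1)[OF S.I_subspace]
    by (simp add: word_Nil perm_sum_def mono_def)
next
  case (Suc n)
  note s = free_subspaceD[OF S.I_subspace]
  have J: "J \<noteq> {}" "finite J" using Suc by auto
  have cd: "card (J - {b}) = n" if "b \<in> J" for b using Suc(2) that J by simp
  have 1: "act (v b) (normal (perm_sum v (J - {b})) - free_scale (fact n) (mono v (J - {b}))) \<in> S.I" if "b \<in> J" for b
    using Suc(1)[of "J - {b}"] cd[OF that] Suc.prems that by (intro act_I) auto
  have 2: "free_gen (v b) * mono v (J - {b}) - mono v J \<in> S.I" if b: "b \<in> J" for b
  proof -
    have "word (map v (b # sorted_list_of_set (J - {b}))) - word (map v (sorted_list_of_set J)) \<in> S.I"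
    proof (rule word_mset_S)
      have "mset (b # sorted_list_of_set (J - {b})) = mset (sorted_list_of_set J)"
        using J b mset_set_set[of "sorted_list_of_set J"] mset_set_set[of "sorted_list_of_set (J - {b})"]
        by (simp add: mset_set.remove[of J b])
      then show "mset (map v (b # sorted_list_of_set (J - {b}))) = mset (map v (sorted_list_of_set J))"
        unfolding mset_map by simp
    qed (use Suc.prems b in auto)
    then show ?thesis by (simp add: mono_def word_Cons)
  qed
  have n: "normal (perm_sum v J) = (\<Sum>b\<in>J. act (v b) (normal (perm_sum v (J - {b}))))"
    by (simp add: perm_sum_rec[OF J(2,1)] normal_linear normal_gen_mult)
  have f: "(\<Sum>b\<in>J. mono v J) = free_scale (of_nat (Suc n)) (mono v J)"
    using Suc(2) by (simp only: sum_constant free_scalar_def single_of_nat)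
  have z: "(\<Sum>b\<in>J. deriv (v b) (mono v (J - {b}))) = 0"
    using contraction_sum_zero[OF Suc.prems] J by (simp add: deriv_mono)
  have "(\<Sum>b\<in>J. act (v b) (mono v (J - {b}))) = (\<Sum>b\<in>J. free_gen (v b) * mono v (J - {b}))"
    unfolding act_def sum.distrib sum_distrib_left[symmetric] z by simp
  then have "(\<Sum>b\<in>J. free_gen (v b) * mono v (J - {b}) - mono v J) =
     (\<Sum>b\<in>J. act (v b) (mono v (J - {b}))) - free_scale (of_nat (Suc n)) (mono v J)"
    unfolding sum_subtractf f by simp
  moreover have "(\<Sum>b\<in>J. free_gen (v b) * mono v (J - {b}) - mono v J) \<in> S.I"
    using 2 by (intro s(6)) auto
  ultimately have "free_scale (fact n) ((\<Sum>b\<in>J. act (v b) (mono v (J - {b}))) - free_scale (of_nat (Suc n)) (mono v J)) \<in> S.I"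
    using s(3) by simp
  moreover have "(\<Sum>b\<in>J. act (v b) (normal (perm_sum v (J - {b})) - free_scale (fact n) (mono v (J - {b})))) \<in> S.I"
    using 1 by (intro s(6)) auto
  ultimately have "(\<Sum>b\<in>J. act (v b) (normal (perm_sum v (J - {b})) - free_scale (fact n) (mono v (J - {b})))) +
    free_scale (fact n) ((\<Sum>b\<in>J. act (v b) (mono v (J - {b}))) - free_scale (of_nat (Suc n)) (mono v J)) \<in> S.I"
    using s(2) by blast
  moreover have "free_scale (fact n) (free_scale (of_nat (Suc n)) (mono v J)) = free_scale (fact (Suc n)) (mono v J)"
    by (simp only: mult.assoc[symmetric] free_scalar_mult[symmetric] fact_Suc mult.commute)
  ultimately show ?case
    using Suc(2)[symmetric] by (simp add: act_linear sum_subtractf n right_diff_distrib sum_distrib_left)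
qed

definition sym_word :: "'v list \<Rightarrow> ('k, 'v) free" where
  "sym_word vs = free_scale (1 / fact (length vs)) (perm_sum ((!) vs) {..<length vs})"

definition sym :: "('k, 'v) free \<Rightarrow> ('k, 'v) free" where
  "sym = free_lift sym_word"

lemma sym_linear:
  "sym (f + g) = sym f + sym g" "sym (f - g) = sym f - sym g"
  "sym (free_scale c f) = free_scale c (sym f)" "sym 0 = 0" "sym (word ws) = sym_word ws"
  by (simp_all add: sym_def free_lift_add free_lift_diff free_lift_scale free_lift_word)

lemma sym_word_carrier:
  assumes "set vs \<subseteq> V"
  shows "sym_word vs \<in> free_carrier V"
  unfolding sym_word_def perm_sum_def using assms
  by (intro free_carrier_scale free_carrier_sum free_carrier_word)
    (auto dest!: permutations_of_setD(1) simp: nth_mem subset_iff)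

lemma sym_carrier: "f \<in> free_carrier V \<Longrightarrow> sym f \<in> free_carrier V"
  unfolding sym_def by (erule free_lift_carrier) (rule sym_word_carrier)

text \<open>The recursion needs lists of indices, the definition of symmetrization permutations of
  positions; a permutation corresponds to the list of its values.\<close>

lemma perm_sum_permutes:
  "perm_sum ((!) vs) {..<length vs} = (\<Sum>\<sigma>\<in>{\<sigma>. \<sigma> permutes {..<length vs}}. word (permute_list \<sigma> vs))"
proof -
  let ?n = "length vs"
  have "bij_betw (\<lambda>\<sigma>. map \<sigma> [0..<?n]) {\<sigma>. \<sigma> permutes {..<?n}} (permutations_of_set {..<?n})"
  \<comment> \<open>Outside the range the inverse has to be the identity, as \<open>permutes\<close>
    demands.\<close>
  proof (rule bij_betw_byWitness[where f' = "\<lambda>xs i. if i < ?n then xs ! i else i"])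
    show "(\<lambda>\<sigma>. map \<sigma> [0..<?n]) ` {\<sigma>. \<sigma> permutes {..<?n}} \<subseteq> permutations_of_set {..<?n}"
    proof (rule image_subsetI)
      fix \<sigma> assume "\<sigma> \<in> {\<sigma>. \<sigma> permutes {..<?n}}"
      then have \<sigma>: "\<sigma> permutes {..<?n}" by simp
      have "set (map \<sigma> [0..<?n]) = {..<?n}"
        using permutes_image[OF \<sigma>] by (simp add: atLeast0LessThan)
      moreover have "distinct (map \<sigma> [0..<?n])"
        using permutes_inj_on[OF \<sigma>] by (simp add: distinct_map)
      ultimately show "map \<sigma> [0..<?n] \<in> permutations_of_set {..<?n}" by (rule permutations_of_setI)
    qed
    show "(\<lambda>xs i. if i < ?n then xs ! i else i) ` permutations_of_set {..<?n} \<subseteq> {\<sigma>. \<sigma> permutes {..<?n}}"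
    proof (rule image_subsetI, rule CollectI)
      fix xs assume xs: "xs \<in> permutations_of_set {..<?n}"
      have l: "length xs = ?n" using length_finite_permutations_of_set[OF xs] by simp
      note d = permutations_of_setD[OF xs]
      show "(\<lambda>i. if i < ?n then xs ! i else i) permutes {..<?n}"
      proof (rule bij_imp_permutes)
        have "bij_betw (\<lambda>i. xs ! i) {..<?n} {..<?n}"
          by (rule bij_betw_nth[OF d(2)]) (simp_all add: l d(1))
        then show "bij_betw (\<lambda>i. if i < ?n then xs ! i else i) {..<?n} {..<?n}"
          by (rule bij_betw_cong[THEN iffD1, rotated]) auto
      qed auto
    qed
    show "\<forall>\<sigma>\<in>{\<sigma>. \<sigma> permutes {..<?n}}. (\<lambda>i. if i < ?n then map \<sigma> [0..<?n] ! i else i) = \<sigma>"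
      by (auto simp: fun_eq_iff permutes_not_in)
    show "\<forall>xs\<in>permutations_of_set {..<?n}. map (\<lambda>i. if i < ?n then xs ! i else i) [0..<?n] = xs"
      by (auto simp: length_finite_permutations_of_set intro!: nth_equalityI)
  qed
  then have "perm_sum ((!) vs) {..<?n} = (\<Sum>\<sigma>\<in>{\<sigma>. \<sigma> permutes {..<?n}}. word (map ((!) vs) (map \<sigma> [0..<?n])))"
    unfolding perm_sum_def by (rule sum.reindex_bij_betw[symmetric])
  then show ?thesis by (simp add: permute_list_def comp_def)
qed

lemma sym_word_mset:
  assumes "mset us = mset ws"
  shows "sym_word us = sym_word ws"
proof -
  have l: "length us = length ws" using assms by (metis size_mset)
  obtain p where p: "p permutes {..<length ws}" "permute_list p ws = us"
    using mset_eq_permutation[OF assms] by blast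
  have "(\<Sum>\<sigma>\<in>{\<sigma>. \<sigma> permutes {..<length ws}}. word (permute_list \<sigma> us)) =
     (\<Sum>\<sigma>\<in>{\<sigma>. \<sigma> permutes {..<length ws}}. word (permute_list (p \<circ> \<sigma>) ws))"
    using p by (intro sum.cong refl) (auto simp: permute_list_compose)
  also have "\<dots> = (\<Sum>\<sigma>\<in>{\<sigma>. \<sigma> permutes {..<length ws}}. word (permute_list \<sigma> ws))"
    by (rule setum_permutations_compose_left[OF p(1), of "\<lambda>\<sigma>. word (permute_list \<sigma> ws)", symmetric])
  finally have "perm_sum ((!) us) {..<length ws} = perm_sum ((!) ws) {..<length ws}"
    using perm_sum_permutes[of us] perm_sum_permutes[of ws] l by simp
  then show ?thesis by (simp add: sym_word_def l)
qed

text \<open>Every summand of the symmetrization contains the letter in the middle exactly once.\<close>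

lemma sym_word_middle:
  assumes u: "set u \<subseteq> V" "set u' \<subseteq> V"
    and x: "(\<Sum>(a, c)\<leftarrow>as. free_scale c (free_gen a)) \<in> W.I"
  shows "(\<Sum>(a, c)\<leftarrow>as. free_scale c (sym_word (u @ a # u'))) \<in> W.I"
proof -
  note s = free_subspaceD[OF W.I_subspace]
  let ?i = "length u" and ?n = "length u + Suc (length u')"
  have 1: "(\<Sum>(a, c)\<leftarrow>as. free_scale c (word (map ((!) (u @ a # u')) xs))) \<in> W.I"
    if xs: "xs \<in> permutations_of_set {..<?n}" for xs
  proof -
    have "?i \<in> set xs" "distinct xs" "set xs = {..<?n}" using permutations_of_setD[OF xs] by auto
    moreover from this(1) obtain p q where "xs = p @ ?i # q" using split_list by metis
    ultimately have pq: "xs = p @ ?i # q" "?i \<notin> set p" "?i \<notin> set q" "set p \<subseteq> {..<?n}" "set q \<subseteq> {..<?n}"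
      by auto
    \<comment> \<open>Off the distinguished position the letter does not depend on \<open>a\<close>,
      so 0 stands in for it and the outer words \<open>P\<close> and \<open>Q\<close> become
      independent of \<open>a\<close>.\<close>
    have nth: "(u @ a # u') ! j = (u @ 0 # u') ! j" if "j \<noteq> ?i" for j a
      using that by (auto simp: nth_append nth_Cons split: nat.split)
    have V: "(u @ 0 # u') ! j \<in> V" if "j < ?n" for j
      using nth_mem[of j "u @ 0 # u'"] that u V_zero by auto
    define P where "P = map ((!) (u @ 0 # u')) p"
    define Q where "Q = map ((!) (u @ 0 # u')) q"
    have "map ((!) (u @ a # u')) xs = P @ a # Q" for a
      using pq(2,3) by (auto simp: pq(1) P_def Q_def intro!: nth)
    then have w: "word (map ((!) (u @ a # u')) xs) = word P * (free_gen a * word Q)" for a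
      by (simp only: word_append word_Cons)
    have "(\<Sum>(a, c)\<leftarrow>as. free_scale c (word (map ((!) (u @ a # u')) xs))) =
       word P * (\<Sum>(a, c)\<leftarrow>as. free_scale c (free_gen a)) * word Q"
      unfolding w
    proof (induction as)
      case (Cons ac as)
      then show ?case
        by (cases ac) (simp add: distrib_left distrib_right mult.assoc free_scale_left_commute[of "word P"])
    qed simp
    moreover have "set P \<subseteq> V" "set Q \<subseteq> V"
      unfolding set_map P_def Q_def using pq(4,5) V by blast+
    then have "word P \<in> free_carrier V" "word Q \<in> free_carrier V"
      using free_carrier_word by blast+
    ultimately show ?thesis using W.I_mult(2)[OF W.I_mult(1)[OF x]] by simp
  qed
  define K :: "('k, 'v) free" where "K = free_scalar (1 / fact ?n)"
  define w :: "'v \<Rightarrow> nat list \<Rightarrow> ('k, 'v) free" where "w a xs = word (map ((!) (u @ a # u')) xs)" for a xs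
  define X where "X = permutations_of_set {..<?n}"
  have sw: "sym_word (u @ a # u') = K * (\<Sum>xs\<in>X. w a xs)" for a
    by (simp add: sym_word_def perm_sum_def K_def w_def X_def)
  have K: "free_scale c (K * f) = K * (free_scale c f)" for c f
    unfolding K_def by (rule free_scale_commute)
  have "(\<Sum>(a, c)\<leftarrow>as. free_scale c (sym_word (u @ a # u'))) = K * (\<Sum>xs\<in>X. \<Sum>(a, c)\<leftarrow>as. free_scale c (w a xs))"
  proof (induction as)
    case (Cons ac as)
    then show ?case
      by (cases ac) (simp add: sw K sum.distrib distrib_left sum_distrib_left[symmetric])
  qed simp
  moreover have "(\<Sum>xs\<in>X. \<Sum>(a, c)\<leftarrow>as. free_scale c (w a xs)) \<in> W.I"
    using 1 unfolding X_def w_def by (rule s(6))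
  ultimately show ?thesis unfolding K_def using s(3) by simp
qed

text \<open>A linear relation between letters survives in every summand by
  \<open>sym_word_middle\<close>, whose list of letters with coefficients covers both kinds of
  linear relation. Words that differ by a transposition have literally the same
  symmetrization.\<close>

lemma sym_I:
  assumes f: "f \<in> S.I"
  shows "sym f \<in> W.I"
proof -
  note s = free_subspaceD[OF W.I_subspace]
  have "f \<in> {f. sym f \<in> W.I}"
  proof (rule S.I_induct[OF _ _ _ _ f])
    show "free_subspace {f. sym f \<in> W.I}"
      using s(1-3) by (auto simp: free_subspace_def sym_linear)
  next
    fix a b and u u' :: "'v list" assume ab: "a \<in> V" "b \<in> V" and u: "set u \<subseteq> V" "set u' \<subseteq> V"
    have "(\<Sum>(x, c)\<leftarrow>[(a + b, 1), (a, - 1), (b, - 1)]. free_scale c (free_gen x)) \<in> W.I"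
      using gen_add_I(4)[OF ab] by (simp add: free_scalar_uminus algebra_simps)
    from sym_word_middle[OF u this]
    show "word (u @ [a + b] @ u') - word (u @ [a] @ u') - word (u @ [b] @ u') \<in> {f. sym f \<in> W.I}"
      by (simp add: free_scalar_uminus algebra_simps sym_linear(1,2,5))
  next
    fix a c and u u' :: "'v list" assume a: "a \<in> V" and u: "set u \<subseteq> V" "set u' \<subseteq> V"
    have "(\<Sum>(x, c)\<leftarrow>[(sc c a, 1), (a, - c)]. free_scale c (free_gen x)) \<in> W.I"
      using gen_add_I(5)[OF a] by (simp add: free_scalar_uminus)
    from sym_word_middle[OF u this]
    show "word (u @ [sc c a] @ u') - free_scale c (word (u @ [a] @ u')) \<in> {f. sym f \<in> W.I}"
      by (simp add: free_scalar_uminus sym_linear)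
  next
    fix r :: "('k, 'v) free" and u u' :: "'v list" assume r: "r \<in> weyl_free V (\<lambda>_ _. 0)" and u: "set u \<subseteq> V" "set u' \<subseteq> V"
    then obtain a b where ab: "a \<in> V" "b \<in> V" "r = free_gen a * free_gen b - free_gen b * free_gen a"
      by (auto simp: weyl_free_def)
    have w: "word u * r * word u' = word (u @ a # b # u') - word (u @ b # a # u')"
      by (simp only: ab(3) word_append word_Cons algebra_simps)
    have "sym_word (u @ a # b # u') = sym_word (u @ b # a # u')"
      by (rule sym_word_mset) simp
    then show "word u * r * word u' \<in> {f. sym f \<in> W.I}"
      using s(1) by (simp add: w sym_linear)
  qed
  then show ?thesis by simp
qed

end

section \<open>Bijectivity of the symmetrization map\<close>

context weyl_system
begin

text \<open>This left inverse yields injectivity of the symmetrization map and, together with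
  surjectivity, identifies \<open>eta\<close> with \<open>normal\<close>.\<close>

lemma normal_sym:
  assumes "f \<in> free_carrier V"
  shows "normal (sym f) - f \<in> S.I"
proof -
  note s = free_subspaceD[OF S.I_subspace]
  have "f \<in> {f. normal (sym f) - f \<in> S.I}"
  proof (rule free_subspace_induct[OF assms])
    show "free_subspace {f. normal (sym f) - f \<in> S.I}"
      unfolding free_subspace_def
    proof (intro conjI ballI allI)
      show "0 \<in> {f. normal (sym f) - f \<in> S.I}" using s(1) by (simp add: normal_linear sym_linear)
    next
      fix f g assume "f \<in> {f. normal (sym f) - f \<in> S.I}" "g \<in> {f. normal (sym f) - f \<in> S.I}"
      then have "(normal (sym f) - f) + (normal (sym g) - g) \<in> S.I" using s(2) by blast
      then show "f + g \<in> {f. normal (sym f) - f \<in> S.I}"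
        by (simp add: normal_linear(1) sym_linear(1) algebra_simps)
    next
      fix c f assume "f \<in> {f. normal (sym f) - f \<in> S.I}"
      then show "free_scale c f \<in> {f. normal (sym f) - f \<in> S.I}"
        using s(3)[of "normal (sym f) - f" c] by (simp add: normal_linear sym_linear right_diff_distrib)
    qed
  next
    fix vs assume vs: "set vs \<subseteq> V"
    let ?n = "length vs"
    have m: "mono ((!) vs) {..<?n} = word vs"
      by (simp add: mono_def lessThan_atLeast0 map_nth)
    have 1: "normal (perm_sum ((!) vs) {..<?n}) - free_scale (fact ?n) (word vs) \<in> S.I"
    proof -
      have "(!) vs ` {..<?n} \<subseteq> V" using vs nth_mem by fastforce
      then show ?thesis using normal_perm_sum[of "{..<?n}" "(!) vs"] by (simp add: m)
    qed
    have "free_scale (1 / fact ?n) (free_scale (fact ?n) (word vs)) = (word vs :: ('k, 'v) free)"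
      by (simp only: mult.assoc[symmetric] free_scalar_mult[symmetric]) simp
    then show "word vs \<in> {f. normal (sym f) - f \<in> S.I}"
      using s(3)[OF 1, of "1 / fact ?n"] by (simp add: sym_linear sym_word_def normal_linear right_diff_distrib)
  qed
  then show ?thesis by simp
qed

text \<open>The filtration by length, with strict inequality: reordering a word of length n in the
  Weyl algebra costs terms from \<open>low n\<close> only, which drives the induction for
  surjectivity.\<close>

definition low :: "nat \<Rightarrow> ('k, 'v) free set" where
  "low n = {f \<in> free_carrier V. \<forall>w\<in>Poly_Mapping.keys f. length (letters w) < n}"

lemma low_subspace: "free_subspace (low n)"
  unfolding free_subspace_def
proof (intro conjI ballI allI)
  fix f g assume "f \<in> low n" "g \<in> low n"
  then show "f + g \<in> low n" using keys_add[of f g] by (auto simp: low_def free_carrier_add)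
next
  fix c f assume "f \<in> low n"
  then show "free_scale c f \<in> low n" using keys_free_scale[of c f] by (auto simp: low_def free_carrier_scale)
qed (simp add: low_def)

lemma low_word: "set vs \<subseteq> V \<Longrightarrow> length vs < n \<Longrightarrow> word vs \<in> low n"
  by (simp add: low_def free_carrier_word)

lemma low_gen_mult:
  assumes "v \<in> V" "f \<in> low n"
  shows "free_gen v * f \<in> low (Suc n)"
proof -
  have "length (letters w) < Suc n" if w: "w \<in> Poly_Mapping.keys (free_gen v * f)" for w
  proof -
    obtain a b where ab: "w = a + b" "a \<in> Poly_Mapping.keys (free_gen v :: ('k, 'v) free)" "b \<in> Poly_Mapping.keys f"
      using subsetD[OF keys_mult w] by blast
    then have "a = Word [v]" by (simp add: free_gen_def)
    then show ?thesis using ab assms(2) by (simp add: low_def plus_free_monoid_def)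
  qed
  moreover have "free_gen v * f \<in> free_carrier V"
    using assms by (simp add: low_def free_carrier_mult free_carrier_gen)
  ultimately show ?thesis by (simp add: low_def)
qed

text \<open>Each transposition produces a scalar times a word with two letters fewer. The bound
  \<open>Suc (length (p @ q))\<close> is the length of the word itself, so the correction is
  strictly shorter.\<close>

lemma word_move_front_W:
  assumes "set (p @ x # q) \<subseteq> V"
  shows "\<exists>g\<in>low (Suc (length (p @ q))). word (p @ x # q) - word (x # p @ q) - g \<in> W.I"
  using assms
proof (induction p)
  case Nil
  then show ?case
    using free_subspaceD(1)[OF W.I_subspace] free_subspaceD(1)[OF low_subspace] by (intro bexI[of _ 0]) auto
next
  case (Cons y p)
  note s = free_subspaceD[OF W.I_subspace]
  obtain g where g: "g \<in> low (Suc (length (p @ q)))" "word (p @ x # q) - word (x # p @ q) - g \<in> W.I"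
    using Cons by auto
  have 1: "free_gen y * (word (p @ x # q) - word (x # p @ q) - g) \<in> W.I"
    using Cons.prems by (intro W.I_mult g free_carrier_gen) auto
  have 2: "(free_gen y * free_gen x - free_gen x * free_gen y - free_scalar (\<omega> y x)) * word (p @ q) \<in> W.I"
    using Cons.prems by (intro W.I_mult gen_add_I free_carrier_word) auto
  have "free_gen y * g + free_scale (\<omega> y x) (word (p @ q)) \<in> low (Suc (length ((y # p) @ q)))"
    using low_gen_mult[OF _ g(1), of y] Cons.prems
    by (intro free_subspaceD(2,3)[OF low_subspace] low_word) auto
  then show ?case using s(2)[OF 1 2] by (intro bexI) (simp_all add: word_Cons algebra_simps)
qed

lemma word_mset_W:
  assumes "mset us = mset ws" "set us \<subseteq> V"
  shows "\<exists>g\<in>low (length us). word us - word ws - g \<in> W.I"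
  using assms
proof (induction us arbitrary: ws)
  case Nil
  then show ?case
    using free_subspaceD(1)[OF W.I_subspace] free_subspaceD(1)[OF low_subspace] by (intro bexI[of _ 0]) auto
next
  case (Cons x us)
  note s = free_subspaceD[OF W.I_subspace]
  have "x \<in> set ws" using Cons.prems(1) by (metis list.set_intros(1) set_mset_mset)
  then obtain p q where ws: "ws = p @ x # q" by (meson split_list)
  then have m: "mset us = mset (p @ q)" using Cons.prems(1) by simp
  have V: "set ws \<subseteq> V" using Cons.prems by (metis set_mset_mset)
  obtain g where g: "g \<in> low (length us)" "word us - word (p @ q) - g \<in> W.I"
    using Cons.IH[OF m] Cons.prems by auto
  have l: "length (p @ q) = length us" using m by (metis size_mset)
  obtain h where h: "h \<in> low (Suc (length us))" "word (p @ x # q) - word (x # p @ q) - h \<in> W.I"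
    using word_move_front_W[of p x q] V ws l by auto
  have 1: "free_gen x * (word us - word (p @ q) - g) \<in> W.I"
    using Cons.prems by (intro W.I_mult g free_carrier_gen) auto
  have "free_gen x * g - h \<in> low (length (x # us))"
    using low_gen_mult[OF _ g(1), of x] Cons.prems h(1)
    by (intro free_subspaceD(5)[OF low_subspace]) auto
  then show ?case using s(5)[OF 1 h(2)] by (intro bexI) (simp_all add: ws word_Cons algebra_simps)
qed

lemma sym_surj_word:
  assumes "set vs \<subseteq> V"
  shows "\<exists>g\<in>low (length vs). sym_word vs - word vs - g \<in> W.I"
proof -
  let ?n = "length vs" and ?P = "{\<sigma>. \<sigma> permutes {..<length vs}}"
  note s = free_subspaceD[OF W.I_subspace]
  have "\<forall>\<sigma>\<in>?P. \<exists>g\<in>low ?n. word (permute_list \<sigma> vs) - word vs - g \<in> W.I"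
    using word_mset_W[of "permute_list _ vs" vs] assms by auto
  then obtain g where g: "\<And>\<sigma>. \<sigma> \<in> ?P \<Longrightarrow> g \<sigma> \<in> low ?n \<and> word (permute_list \<sigma> vs) - word vs - g \<sigma> \<in> W.I"
    by metis
  have "(\<Sum>\<sigma>\<in>?P. word (permute_list \<sigma> vs) - word vs - g \<sigma>) \<in> W.I"
    using g by (intro s(6)) blast
  then have "free_scale (1 / fact ?n) (\<Sum>\<sigma>\<in>?P. word (permute_list \<sigma> vs) - word vs - g \<sigma>) \<in> W.I"
    by (rule s(3))
  moreover have "(\<Sum>\<sigma>\<in>?P. word vs) = free_scale (fact ?n) (word vs :: ('k, 'v) free)"
  proof -
    have "card ?P = fact ?n" using card_permutations[OF card_lessThan finite_lessThan] .
    then have "(\<Sum>\<sigma>\<in>?P. word vs) = of_nat (fact ?n) * (word vs :: ('k, 'v) free)"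
      by (simp only: sum_constant)
    also have "of_nat (fact ?n) = (free_scalar (of_nat (fact ?n)) :: ('k, 'v) free)"
      unfolding free_scalar_def by (simp only: single_of_nat)
    finally show ?thesis unfolding of_nat_fact .
  qed
  moreover have "free_scale (1 / fact ?n) (free_scale (fact ?n) (word vs)) = (word vs :: ('k, 'v) free)"
    by (simp only: mult.assoc[symmetric] free_scalar_mult[symmetric]) simp
  ultimately have "sym_word vs - word vs - free_scale (1 / fact ?n) (\<Sum>\<sigma>\<in>?P. g \<sigma>) \<in> W.I"
    by (simp add: sym_word_def perm_sum_permutes sum_subtractf right_diff_distrib)
  moreover have "free_scale (1 / fact ?n) (\<Sum>\<sigma>\<in>?P. g \<sigma>) \<in> low ?n"
    using g by (intro free_subspaceD(3,6)[OF low_subspace]) blast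
  ultimately show ?thesis by blast
qed

text \<open>By \<open>sym_surj_word\<close> a word equals its own symmetrization up to strictly
  shorter words, and those are reached by induction.\<close>

lemma sym_surj_low: "f \<in> low n \<Longrightarrow> \<exists>g\<in>free_carrier V. sym g - f \<in> W.I"
proof (induction n arbitrary: f)
  case 0
  then have "Poly_Mapping.keys f = {}" by (auto simp: low_def)
  then have "f = 0" by simp
  then show ?case using free_subspaceD(1)[OF W.I_subspace] by (intro bexI[of _ 0]) (auto simp: sym_linear)
next
  case (Suc n)
  note s = free_subspaceD[OF W.I_subspace]
  let ?K = "{f. \<exists>g\<in>free_carrier V. sym g - f \<in> W.I}"
  have K: "free_subspace ?K"
    unfolding free_subspace_def
  proof (intro conjI ballI allI)
    show "0 \<in> ?K" using s(1) by (auto simp: sym_linear intro!: bexI[of _ 0])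
  next
    fix f f' assume "f \<in> ?K" "f' \<in> ?K"
    then obtain g g' where "g \<in> free_carrier V" "g' \<in> free_carrier V" "sym g - f \<in> W.I" "sym g' - f' \<in> W.I" by auto
    then show "f + f' \<in> ?K" using s(2)[of "sym g - f" "sym g' - f'"]
      by (auto intro!: bexI[of _ "g + g'"] simp: sym_linear(1) free_carrier_add algebra_simps)
  next
    fix c f assume "f \<in> ?K"
    then obtain g where "g \<in> free_carrier V" "sym g - f \<in> W.I" by auto
    then show "free_scale c f \<in> ?K" using s(3)[of "sym g - f" c]
      by (auto intro!: bexI[of _ "free_scale c g"] simp: sym_linear free_carrier_scale right_diff_distrib)
  qed
  have w: "word vs \<in> ?K" if vs: "set vs \<subseteq> V" "length vs < Suc n" for vs
  proof -
    obtain g where g: "g \<in> low (length vs)" "sym_word vs - word vs - g \<in> W.I"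
      using sym_surj_word[OF vs(1)] by auto
    have "low (length vs) \<subseteq> low n" using vs(2) by (auto simp: low_def)
    then obtain h where h: "h \<in> free_carrier V" "sym h - g \<in> W.I" using Suc.IH[of g] g by auto
    have "sym (word vs - h) - word vs \<in> W.I"
      using s(5)[OF g(2) h(2)] by (simp add: sym_linear algebra_simps)
    then show ?thesis using vs h by (auto intro!: bexI[of _ "word vs - h"] free_carrier_diff free_carrier_word)
  qed
  have "(\<Sum>w\<in>Poly_Mapping.keys f. free_scale (Poly_Mapping.lookup f w) (word (letters w))) \<in> ?K"
    by (intro free_subspaceD(3,6)[OF K] w) (use Suc.prems in \<open>auto simp: low_def free_carrier_def\<close>)
  then have "f \<in> ?K" using free_expansion[of f] by simp
  then show ?case by simp
qed

lemma sym_surj: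
  assumes "f \<in> free_carrier V"
  shows "\<exists>g\<in>free_carrier V. sym g - f \<in> W.I"
proof (rule sym_surj_low)
  have "length (letters w) \<le> (\<Sum>w\<in>Poly_Mapping.keys f. length (letters w))" if "w \<in> Poly_Mapping.keys f" for w
    by (rule member_le_sum) (use that in auto)
  then show "f \<in> low (Suc (\<Sum>w\<in>Poly_Mapping.keys f. length (letters w)))"
    unfolding low_def using assms by (simp add: less_Suc_eq_le)
qed

text \<open>Here the definite description is resolved. The candidate applies \<open>sym\<close> to a
  chosen representative and is well defined by \<open>sym_I\<close>; it is the only one because
  additivity and homogeneity determine a map from its values on words.\<close>

lemma symmetrization_eq:
  assumes f: "f \<in> free_carrier V"
  shows "symmetrization sc V \<omega> (S.\<pi> f) = W.\<pi> (sym f)"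
proof -
  note c = free_carrier_add free_carrier_mult free_carrier_scalar free_carrier_word free_carrier_scale sym_carrier
  define rep where "rep a = (SOME f. f \<in> free_carrier V \<and> S.\<pi> f = a)" for a
  define Q where "Q = restrict (\<lambda>a. W.\<pi> (sym (rep a))) (carrier S.A)"
  have rep: "rep (S.\<pi> f) \<in> free_carrier V" "S.\<pi> (rep (S.\<pi> f)) = S.\<pi> f" if "f \<in> free_carrier V" for f
    using someI[of "\<lambda>g. g \<in> free_carrier V \<and> S.\<pi> g = S.\<pi> f" f] that by (auto simp: rep_def)
  have Q: "Q (S.\<pi> f) = W.\<pi> (sym f)" if f: "f \<in> free_carrier V" for f
  proof -
    have "rep (S.\<pi> f) - f \<in> S.I" using rep[OF f] f S.pi_eq_iff by metis
    then have "sym (rep (S.\<pi> f)) - sym f \<in> W.I" using sym_I by (metis sym_linear(2))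
    then show ?thesis using rep[OF f] f by (simp add: Q_def S.pi_closed W.pi_eq_iff sym_carrier)
  qed
  have word_sum: "quot_scalar sc V (weyl_relations sc V \<omega>) (1 / fact (length vs)) \<otimes>\<^bsub>W.A\<^esub>
       (\<Oplus>\<^bsub>W.A\<^esub>\<sigma>\<in>{\<sigma>. \<sigma> permutes {..<length vs}}. quot_word sc V (weyl_relations sc V \<omega>) (permute_list \<sigma> vs))
      = W.\<pi> (sym_word vs)" if vs: "set vs \<subseteq> V" for vs
  proof -
    have "(\<Oplus>\<^bsub>W.A\<^esub>\<sigma>\<in>{\<sigma>. \<sigma> permutes {..<length vs}}. quot_word sc V (weyl_relations sc V \<omega>) (permute_list \<sigma> vs))
       = (\<Oplus>\<^bsub>W.A\<^esub>\<sigma>\<in>{\<sigma>. \<sigma> permutes {..<length vs}}. W.\<pi> (word (permute_list \<sigma> vs)))"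
      using vs ring.ring_simprules(1)[OF W.ring_A]
      by (intro abelian_monoid.finsum_cong' [OF abelian_group.axioms(1)[OF ring.axioms(1)[OF W.ring_A]]])
        (auto simp: W.pi_word W.pi_closed free_carrier_word)
    also have "\<dots> = W.\<pi> (perm_sum ((!) vs) {..<length vs})"
      unfolding perm_sum_permutes using vs
      by (intro W.pi_finsum[symmetric]) (auto intro!: free_carrier_word finite_permutations)
    moreover have "perm_sum ((!) vs) {..<length vs} \<in> free_carrier V"
      unfolding perm_sum_permutes using vs by (intro free_carrier_sum) (auto intro!: free_carrier_word)
    ultimately show ?thesis
      by (simp only: quot_scalar_eq sym_word_def W.pi_simps(2) free_carrier_scalar)
  qed
  let ?P = "\<lambda>Q. Q \<in> carrier S.A \<rightarrow>\<^sub>E carrier W.A \<and>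
        (\<forall>a\<in>carrier S.A. \<forall>b\<in>carrier S.A. Q (a \<oplus>\<^bsub>S.A\<^esub> b) = Q a \<oplus>\<^bsub>W.A\<^esub> Q b) \<and>
        (\<forall>c. \<forall>a\<in>carrier S.A. Q (quot_scalar sc V (symmetric_relations sc V) c \<otimes>\<^bsub>S.A\<^esub> a) =
            quot_scalar sc V (weyl_relations sc V \<omega>) c \<otimes>\<^bsub>W.A\<^esub> Q a) \<and>
        (\<forall>vs. set vs \<subseteq> V \<longrightarrow>
           Q (quot_word sc V (symmetric_relations sc V) vs) =
             quot_scalar sc V (weyl_relations sc V \<omega>) (1 / fact (length vs)) \<otimes>\<^bsub>W.A\<^esub>
             (\<Oplus>\<^bsub>W.A\<^esub>\<sigma>\<in>{\<sigma>. \<sigma> permutes {..<length vs}}. quot_word sc V (weyl_relations sc V \<omega>) (permute_list \<sigma> vs)))"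
  have PQ: "?P Q"
  proof (intro conjI ballI allI impI)
    show "Q \<in> carrier S.A \<rightarrow>\<^sub>E carrier W.A"
      using Q by (auto simp: S.carrier_A W.pi_closed c) (auto simp: Q_def S.carrier_A)
  next
    fix a b assume "a \<in> carrier S.A" "b \<in> carrier S.A"
    then obtain f g where "f \<in> free_carrier V" "g \<in> free_carrier V" "a = S.\<pi> f" "b = S.\<pi> g" by (auto simp: S.carrier_A)
    then show "Q (a \<oplus>\<^bsub>S.A\<^esub> b) = Q a \<oplus>\<^bsub>W.A\<^esub> Q b"
      by (simp add: Q c sym_linear W.pi_simps flip: S.pi_simps)
  next
    fix d a assume "a \<in> carrier S.A"
    then obtain f where "f \<in> free_carrier V" "a = S.\<pi> f" by (auto simp: S.carrier_A)
    then show "Q (quot_scalar sc V (symmetric_relations sc V) d \<otimes>\<^bsub>S.A\<^esub> a) =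
        quot_scalar sc V (weyl_relations sc V \<omega>) d \<otimes>\<^bsub>W.A\<^esub> Q a"
      by (simp add: Q c quot_scalar_eq sym_linear flip: S.pi_simps W.pi_simps)
  next
    fix vs assume vs: "set vs \<subseteq> V"
    then show "Q (quot_word sc V (symmetric_relations sc V) vs) =
       quot_scalar sc V (weyl_relations sc V \<omega>) (1 / fact (length vs)) \<otimes>\<^bsub>W.A\<^esub>
       (\<Oplus>\<^bsub>W.A\<^esub>\<sigma>\<in>{\<sigma>. \<sigma> permutes {..<length vs}}. quot_word sc V (weyl_relations sc V \<omega>) (permute_list \<sigma> vs))"
      unfolding word_sum[OF vs] by (simp add: S.pi_word Q c sym_linear)
  qed
  have unique: "Q' = Q" if P: "?P Q'" for Q'
  proof (rule PiE_ext[of _ "carrier S.A" "\<lambda>_. carrier W.A"])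
    fix a assume "a \<in> carrier S.A"
    then obtain f where f: "f \<in> free_carrier V" "a = S.\<pi> f" by (auto simp: S.carrier_A)
    have "f \<in> {f \<in> free_carrier V. Q' (S.\<pi> f) = W.\<pi> (sym f)}"
    proof (rule free_subspace_induct[OF f(1)])
      interpret WA: ring W.A by (rule W.ring_A)
      note P1 = P[THEN conjunct1] and P2 = P[THEN conjunct2, THEN conjunct1]
        and P3 = P[THEN conjunct2, THEN conjunct2, THEN conjunct1]
      have add: "Q' (S.\<pi> f \<oplus>\<^bsub>S.A\<^esub> S.\<pi> g) = Q' (S.\<pi> f) \<oplus>\<^bsub>W.A\<^esub> Q' (S.\<pi> g)"
        if "f \<in> free_carrier V" "g \<in> free_carrier V" for f g
        by (rule P2[rule_format, OF S.pi_closed[OF that(1)] S.pi_closed[OF that(2)]])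
      have scal: "Q' (S.\<pi> (free_scalar d) \<otimes>\<^bsub>S.A\<^esub> S.\<pi> f) = W.\<pi> (free_scalar d) \<otimes>\<^bsub>W.A\<^esub> Q' (S.\<pi> f)"
        if "f \<in> free_carrier V" for f d
        by (rule P3[rule_format, OF S.pi_closed[OF that], unfolded quot_scalar_eq])
      show "free_subspace {f \<in> free_carrier V. Q' (S.\<pi> f) = W.\<pi> (sym f)}"
        unfolding free_subspace_def
      proof (intro conjI ballI allI)
        \<comment> \<open>Homogeneity with the scalar 0 shows that zero goes to zero.\<close>
        have "Q' (S.\<pi> (free_scalar 0) \<otimes>\<^bsub>S.A\<^esub> S.\<pi> 0) = W.\<pi> (free_scalar 0) \<otimes>\<^bsub>W.A\<^esub> Q' (S.\<pi> 0)"
          by (rule scal) simp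
        moreover have "S.\<pi> (free_scalar 0) \<otimes>\<^bsub>S.A\<^esub> S.\<pi> 0 = S.\<pi> 0"
          using S.pi_simps(2)[of "free_scalar 0" 0] by simp
        moreover have "Q' (S.\<pi> 0) \<in> carrier W.A" by (rule PiE_mem[OF P1 S.pi_closed]) simp
        ultimately have "Q' (S.\<pi> 0) = W.\<pi> 0"
          by (simp only: free_scalar_zero W.pi_simps(4) WA.l_null)
        then show "0 \<in> {f \<in> free_carrier V. Q' (S.\<pi> f) = W.\<pi> (sym f)}" by (simp add: sym_linear)
      next
        fix f g assume "f \<in> {f \<in> free_carrier V. Q' (S.\<pi> f) = W.\<pi> (sym f)}" "g \<in> {f \<in> free_carrier V. Q' (S.\<pi> f) = W.\<pi> (sym f)}"
        then show "f + g \<in> {f \<in> free_carrier V. Q' (S.\<pi> f) = W.\<pi> (sym f)}"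
          using add[of f g] by (simp add: c S.pi_simps(1) sym_linear(1) W.pi_simps(1))
      next
        fix d f assume "f \<in> {f \<in> free_carrier V. Q' (S.\<pi> f) = W.\<pi> (sym f)}"
        then show "free_scale d f \<in> {f \<in> free_carrier V. Q' (S.\<pi> f) = W.\<pi> (sym f)}"
          using scal[of f d] by (simp add: c S.pi_simps(2) sym_linear(3) W.pi_simps(2))
      qed
    next
      fix vs assume vs: "set vs \<subseteq> V"
      have "Q' (quot_word sc V (symmetric_relations sc V) vs) = W.\<pi> (sym_word vs)"
        using P[THEN conjunct2, THEN conjunct2, THEN conjunct2, rule_format, OF vs] word_sum[OF vs] by (rule trans)
      then show "word vs \<in> {f \<in> free_carrier V. Q' (S.\<pi> f) = W.\<pi> (sym f)}"
        using vs by (simp add: S.pi_word c sym_linear)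
    qed
    then show "Q' a = Q a" using f Q by simp
  qed (use P PQ in auto)
  have "symmetrization sc V \<omega> = (THE Q. ?P Q)" by (simp add: symmetrization_def Let_def)
  also have "\<dots> = Q" by (rule the_equality[of ?P Q]) (rule PQ, rule unique)
  finally show ?thesis using Q[OF f] by simp
qed

text \<open>As \<open>eta\<close> is an \<open>inv_into\<close>, injectivity comes first. For a
  preimage \<open>g\<close> of \<open>f\<close> the classes of \<open>g\<close>, of
  \<open>normal (sym g)\<close> and of \<open>normal f\<close> agree.\<close>

lemma eta_eq:
  assumes f: "f \<in> free_carrier V"
  shows "eta sc V \<omega> (W.\<pi> f) = S.\<pi> (normal f)"
proof -
  obtain g where g: "g \<in> free_carrier V" "sym g - f \<in> W.I" using sym_surj[OF f] by auto
  have inj: "inj_on (symmetrization sc V \<omega>) (carrier S.A)"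
  proof (rule inj_onI)
    fix a b assume "a \<in> carrier S.A" "b \<in> carrier S.A" and eq: "symmetrization sc V \<omega> a = symmetrization sc V \<omega> b"
    then obtain f g where fg: "f \<in> free_carrier V" "g \<in> free_carrier V" "a = S.\<pi> f" "b = S.\<pi> g" by (auto simp: S.carrier_A)
    then have "sym f - sym g \<in> W.I" using eq by (simp add: symmetrization_eq W.pi_eq_iff sym_carrier)
    then have 1: "normal (sym f) - normal (sym g) \<in> S.I" using normal_I by (metis normal_linear(2))
    note s = free_subspaceD[OF S.I_subspace]
    have "(normal (sym f) - normal (sym g)) - (normal (sym f) - f) + (normal (sym g) - g) \<in> S.I"
      by (rule s(2)[OF s(5)[OF 1 normal_sym[OF fg(1)]] normal_sym[OF fg(2)]])
    then show "a = b" using fg by (simp add: S.pi_eq_iff)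
  qed
  have "symmetrization sc V \<omega> (S.\<pi> g) = W.\<pi> f"
    using g f by (simp add: symmetrization_eq W.pi_eq_iff sym_carrier)
  then have "eta sc V \<omega> (W.\<pi> f) = S.\<pi> g"
    unfolding eta_def using inv_into_f_f[OF inj S.pi_closed[OF g(1)]] by simp
  moreover have "S.\<pi> g = S.\<pi> (normal f)"
  proof -
    note s = free_subspaceD[OF S.I_subspace]
    have "normal (sym g - f) \<in> S.I" using g(2) by (rule normal_I)
    then have "normal (sym g) - normal f - (normal (sym g) - g) \<in> S.I"
      using normal_sym[OF g(1)] unfolding normal_linear by (rule s(5))
    then show ?thesis using g f by (simp add: S.pi_eq_iff normal_carrier)
  qed
  ultimately show ?thesis by simp
qed

end

section \<open>The grading of the symmetric algebra\<close>

context weyl_system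
begin

definition part :: "nat \<Rightarrow> ('k, 'v) free \<Rightarrow> ('k, 'v) free" where
  "part d = free_lift (\<lambda>ws. if length ws = d then word ws else 0)"

lemma part_linear:
  "part d (f + g) = part d f + part d g" "part d (f - g) = part d f - part d g"
  "part d (free_scale c f) = free_scale c (part d f)" "part d 0 = 0"
  "part d (word ws) = (if length ws = d then word ws else 0)"
  "part d (sum h X) = (\<Sum>x\<in>X. part d (h x))"
  unfolding part_def free_lift_add free_lift_diff free_lift_scale free_lift_word free_lift_sum free_lift_zero by simp_all

lemma part_eq:
  "part d f = (\<Sum>w\<in>{w \<in> Poly_Mapping.keys f. length (letters w) = d}.
     free_scale (Poly_Mapping.lookup f w) (word (letters w)))"
  unfolding part_def free_lift_def by (subst sum.inter_filter) (auto intro!: sum.cong)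

lemma part_carrier: "f \<in> free_carrier V \<Longrightarrow> part d f \<in> free_carrier V"
  unfolding part_eq by (intro free_carrier_sum free_carrier_scale free_carrier_word) (auto simp: free_carrier_def)

text \<open>The relations of the symmetric algebra are homogeneous, so a homogeneous part of such a
  relation between words is the relation itself or zero.\<close>

lemma part_I:
  assumes f: "f \<in> S.I"
  shows "part d f \<in> S.I"
proof -
  note s = free_subspaceD[OF S.I_subspace]
  have hom: "part d r \<in> S.I" if "part (length u) r = r" "\<And>e. e \<noteq> length u \<Longrightarrow> part e r = 0" "r \<in> S.I"
    for r and u :: "'v list"
    using that s(1) by (cases "d = length u") auto
  have "f \<in> {f. part d f \<in> S.I}"
  proof (rule S.I_induct[OF _ _ _ _ f])
    show "free_subspace {f. part d f \<in> S.I}"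
      using s(1-3) by (auto simp: free_subspace_def part_linear)
  next
    fix a b and u u' :: "'v list" assume ab: "a \<in> V" "b \<in> V" and u: "set u \<subseteq> V" "set u' \<subseteq> V"
    have "word u * ((free_gen (a + b) - free_gen a - free_gen b) * word u') \<in> S.I"
      by (rule S.I_mult(1)[OF S.I_mult(2)[OF gen_add_I(1)[OF ab]]]) (simp_all add: free_carrier_word u)
    then have "word (u @ [a + b] @ u') - word (u @ [a] @ u') - word (u @ [b] @ u') \<in> S.I"
      by (simp add: word_append word_Cons algebra_simps)
    then show "word (u @ [a + b] @ u') - word (u @ [a] @ u') - word (u @ [b] @ u') \<in> {f. part d f \<in> S.I}"
      using s(1) by (simp add: part_linear(2,5))
  next
    fix a c and u u' :: "'v list" assume a: "a \<in> V" and u: "set u \<subseteq> V" "set u' \<subseteq> V"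
    have "word u * ((free_gen (sc c a) - free_scale c (free_gen a)) * word u') \<in> S.I"
      by (rule S.I_mult(1)[OF S.I_mult(2)[OF gen_add_I(2)[OF a]]]) (simp_all add: free_carrier_word u)
    then have "word (u @ [sc c a] @ u') - free_scale c (word (u @ [a] @ u')) \<in> S.I"
      by (simp add: word_append word_Cons left_diff_distrib right_diff_distrib mult.assoc free_scale_left_commute[of "word u"])
    then show "word (u @ [sc c a] @ u') - free_scale c (word (u @ [a] @ u')) \<in> {f. part d f \<in> S.I}"
      using s(1) by (simp add: part_linear(2,3,5))
  next
    fix r :: "('k, 'v) free" and u u' :: "'v list" assume r: "r \<in> weyl_free V (\<lambda>_ _. 0)" and u: "set u \<subseteq> V" "set u' \<subseteq> V"
    then obtain a b where ab: "a \<in> V" "b \<in> V" "r = free_gen a * free_gen b - free_gen b * free_gen a"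
      by (auto simp: weyl_free_def)
    have w: "word u * r * word u' = word (u @ a # b # u') - word (u @ b # a # u')"
      by (simp only: ab(3) word_append word_Cons algebra_simps)
    have "word u * (r * word u') \<in> S.I"
      unfolding ab(3) by (rule S.I_mult(1)[OF S.I_mult(2)[OF gen_add_I(3)[OF ab(1,2)]]]) (simp_all add: free_carrier_word u)
    then have "word (u @ a # b # u') - word (u @ b # a # u') \<in> S.I" by (simp only: mult.assoc flip: w)
    then show "word u * r * word u' \<in> {f. part d f \<in> S.I}"
      using s(1) unfolding w by (simp add: part_linear(2,5))
  qed
  then show ?thesis by simp
qed

lemma part_expansion: "f = (\<Sum>d\<in>(\<lambda>w. length (letters w)) ` Poly_Mapping.keys f. part d f)"
proof -
  have "(\<Sum>d\<in>(\<lambda>w. length (letters w)) ` Poly_Mapping.keys f. part d f) =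
     (\<Sum>w\<in>Poly_Mapping.keys f. free_scale (Poly_Mapping.lookup f w) (word (letters w)))"
    unfolding part_eq by (rule sum.group) auto
  then show ?thesis using free_expansion[of f] by simp
qed

lemma part_part: "part e (part d f) = (if e = d then part d f else 0)"
  by (auto simp: part_eq[of d] part_linear simp del: free_monoid.collapse intro!: sum.neutral sum.cong)

lemma symmetric_power_eq:
  "symmetric_power sc V d = {S.\<pi> f | f. f \<in> free_carrier V \<and> part d f = f}"
proof -
  note c = free_carrier_add free_carrier_mult free_carrier_scalar free_carrier_word free_carrier_scale
  have fin: "(\<Oplus>\<^bsub>S.A\<^esub>vs\<in>X. quot_scalar sc V (symmetric_relations sc V) (k vs) \<otimes>\<^bsub>S.A\<^esub> quot_word sc V (symmetric_relations sc V) vs)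
    = S.\<pi> (\<Sum>vs\<in>X. free_scale (k vs) (word vs))"
    if "finite X" "X \<subseteq> {vs. length vs = d \<and> set vs \<subseteq> V}" for X k
  proof -
    have "(\<Oplus>\<^bsub>S.A\<^esub>vs\<in>X. quot_scalar sc V (symmetric_relations sc V) (k vs) \<otimes>\<^bsub>S.A\<^esub> quot_word sc V (symmetric_relations sc V) vs)
      = (\<Oplus>\<^bsub>S.A\<^esub>vs\<in>X. S.\<pi> (free_scale (k vs) (word vs)))"
      using that
      by (intro abelian_monoid.finsum_cong' [OF abelian_group.axioms(1)[OF ring.axioms(1)[OF S.ring_A]]])
        (auto simp: quot_scalar_eq S.pi_word S.pi_simps(2) c intro!: S.pi_closed)
    also have "\<dots> = S.\<pi> (\<Sum>vs\<in>X. free_scale (k vs) (word vs))"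
      using that by (intro S.pi_finsum[symmetric]) (auto intro!: c)
    finally show ?thesis .
  qed
  show ?thesis
  proof (intro equalityI subsetI)
    fix a assume "a \<in> symmetric_power sc V d"
    then obtain X k where X: "finite X" "X \<subseteq> {vs. length vs = d \<and> set vs \<subseteq> V}"
      "a = S.\<pi> (\<Sum>vs\<in>X. free_scale (k vs) (word vs))"
      unfolding symmetric_power_def Let_def using fin by auto
    have "part d (\<Sum>vs\<in>X. free_scale (k vs) (word vs)) = (\<Sum>vs\<in>X. free_scale (k vs) (word vs))"
      unfolding part_linear(6,3) by (intro sum.cong) (use X(2) in \<open>auto simp: part_linear(5)\<close>)
    moreover have "(\<Sum>vs\<in>X. free_scale (k vs) (word vs)) \<in> free_carrier V"
      by (intro free_carrier_sum c) (use X(2) in auto)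
    ultimately show "a \<in> {S.\<pi> f | f. f \<in> free_carrier V \<and> part d f = f}" using X(3) by blast
  next
    fix a assume "a \<in> {S.\<pi> f | f. f \<in> free_carrier V \<and> part d f = f}"
    then obtain f where f: "f \<in> free_carrier V" "part d f = f" "a = S.\<pi> f" by auto
    let ?Y = "{w \<in> Poly_Mapping.keys f. length (letters w) = d}"
    have inj: "inj_on letters ?Y" by (auto intro!: inj_onI free_monoid.expand)
    have "f = (\<Sum>w\<in>?Y. free_scale (Poly_Mapping.lookup f (Word (letters w))) (word (letters w)))"
      using f(2) part_eq[of d f] by simp
    also have "\<dots> = (\<Sum>vs\<in>letters ` ?Y. free_scale (Poly_Mapping.lookup f (Word vs)) (word vs))"
      by (simp only: sum.reindex[OF inj] comp_def)
    finally have "f = (\<Sum>vs\<in>letters ` ?Y. free_scale (Poly_Mapping.lookup f (Word vs)) (word vs))" .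
    moreover have Y: "finite (letters ` ?Y)" "letters ` ?Y \<subseteq> {vs. length vs = d \<and> set vs \<subseteq> V}"
      using f(1) by (auto simp: free_carrier_def)
    ultimately have "a = (\<Oplus>\<^bsub>S.A\<^esub>vs\<in>letters ` ?Y. quot_scalar sc V (symmetric_relations sc V) (Poly_Mapping.lookup f (Word vs))
        \<otimes>\<^bsub>S.A\<^esub> quot_word sc V (symmetric_relations sc V) vs)"
      unfolding fin[OF Y] f(3) by simp
    then show "a \<in> symmetric_power sc V d"
      unfolding symmetric_power_def Let_def mem_Collect_eq
      by (intro exI[of _ "letters ` ?Y"] exI[of _ "\<lambda>vs. Poly_Mapping.lookup f (Word vs)"]) (use Y in simp)
  qed
qed

text \<open>Uniqueness expresses that the grading is direct: if homogeneous representatives add up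
  to \<open>f\<close> modulo \<open>S.I\<close>, taking the part of degree e preserves the
  congruence by \<open>part_I\<close> and isolates one of them.\<close>

lemma symmetric_component_eq:
  assumes f: "f \<in> free_carrier V"
  shows "symmetric_component sc V (S.\<pi> f) = (\<lambda>d. S.\<pi> (part d f))"
proof -
  note s = free_subspaceD[OF S.I_subspace]
  let ?P = "\<lambda>a. (\<forall>d. a d \<in> symmetric_power sc V d) \<and> finite {d. a d \<noteq> \<zero>\<^bsub>S.A\<^esub>} \<and>
             (\<Oplus>\<^bsub>S.A\<^esub>d\<in>{d. a d \<noteq> \<zero>\<^bsub>S.A\<^esub>}. a d) = S.\<pi> f"
  \<comment> \<open>A nonzero part may vanish in the quotient, so the degrees with nonzero class can
    be fewer than the lengths of the occurring words; the surplus parts lie in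
    \<open>S.I\<close>.\<close>
  let ?L = "(\<lambda>w. length (letters w)) ` Poly_Mapping.keys f"
  let ?a = "\<lambda>d. S.\<pi> (part d f)"
  let ?D = "{d. ?a d \<noteq> \<zero>\<^bsub>S.A\<^esub>}"
  have "part d f = 0" if "d \<notin> ?L" for d
    unfolding part_eq by (rule sum.neutral) (use that in auto)
  then have D: "?D \<subseteq> ?L" by (auto simp: S.pi_simps(4))
  then have finD: "finite ?D" by (rule finite_subset) simp
  have "f = (\<Sum>d\<in>?D. part d f) + (\<Sum>d\<in>?L - ?D. part d f)"
    using part_expansion[of f] sum.subset_diff[OF D, of "\<lambda>d. part d f"] by (simp add: add.commute)
  moreover have "(\<Sum>d\<in>?L - ?D. part d f) \<in> S.I"
    by (rule s(6)) (use part_carrier[OF f] S.pi_I in auto)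
  ultimately have "f - (\<Sum>d\<in>?D. part d f) \<in> S.I" by (metis add_diff_cancel_left')
  then have "S.\<pi> f = S.\<pi> (\<Sum>d\<in>?D. part d f)"
    using S.pi_eq_iff f free_carrier_sum part_carrier by (metis (no_types, lifting))
  also have "\<dots> = (\<Oplus>\<^bsub>S.A\<^esub>d\<in>?D. ?a d)"
    by (rule S.pi_finsum) (use finD part_carrier[OF f] in auto)
  finally have sum: "(\<Oplus>\<^bsub>S.A\<^esub>d\<in>?D. ?a d) = S.\<pi> f" by simp
  have P: "?P ?a"
    using sum finD part_carrier[OF f] part_part by (auto simp: symmetric_power_eq)
  have unique: "b = ?a" if b: "?P b" for b
  proof -
    have "\<exists>g. \<forall>d. b d = S.\<pi> (g d) \<and> g d \<in> free_carrier V \<and> part d (g d) = g d"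
    proof (rule choice, rule allI)
      fix d
      have "b d \<in> symmetric_power sc V d" using b by blast
      then show "\<exists>g. b d = S.\<pi> g \<and> g \<in> free_carrier V \<and> part d g = g" by (auto simp: symmetric_power_eq)
    qed
    then obtain g where "\<forall>d. b d = S.\<pi> (g d) \<and> g d \<in> free_carrier V \<and> part d (g d) = g d" ..
    then have g: "b d = S.\<pi> (g d)" "g d \<in> free_carrier V" "part d (g d) = g d" for d by blast+
    define E where "E = {d. b d \<noteq> \<zero>\<^bsub>S.A\<^esub>}"
    have E: "finite E" "(\<Oplus>\<^bsub>S.A\<^esub>d\<in>E. b d) = S.\<pi> f"
      using b[THEN conjunct2] unfolding E_def by blast+
    have "S.\<pi> (\<Sum>d\<in>E. g d) = (\<Oplus>\<^bsub>S.A\<^esub>d\<in>E. b d)"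
      unfolding g(1) by (rule S.pi_finsum[OF g(2) E(1)])
    then have "S.\<pi> (\<Sum>d\<in>E. g d) = S.\<pi> f" using E(2) by simp
    then have I: "(\<Sum>d\<in>E. g d) - f \<in> S.I" using f g(2) by (simp add: S.pi_eq_iff free_carrier_sum)
    have "S.\<pi> (g e) = S.\<pi> (part e f)" for e
    proof -
      have pe: "part e (g d) = (if d = e then g e else 0)" for d
        using part_part[of e d "g d"] g(3) by auto
      have "part e (\<Sum>d\<in>E. g d) = (if e \<in> E then g e else 0)"
        unfolding part_linear(6) pe using E(1) by simp
      then have "(if e \<in> E then g e else 0) - part e f \<in> S.I"
        using part_I[OF I, of e] by (simp only: part_linear(2))
      then have "S.\<pi> (if e \<in> E then g e else 0) = S.\<pi> (part e f)"
        by (subst S.pi_eq_iff) (auto simp: g(2) part_carrier[OF f])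
      then show ?thesis using g(1)[of e] by (auto simp: E_def S.pi_simps(4) split: if_splits)
    qed
    then show "b = ?a" using g(1) by auto
  qed
  have "symmetric_component sc V (S.\<pi> f) = (THE a. ?P a)"
    by (simp add: symmetric_component_def Let_def)
  also have "\<dots> = ?a" by (rule the_equality[of ?P ?a]) (rule P, rule unique)
  finally show ?thesis .
qed

lemma part_0: "part 0 f = free_scalar (Poly_Mapping.lookup f 0)"
proof -
  have "f \<in> {f. part 0 f = free_scalar (Poly_Mapping.lookup f 0)}"
  proof (rule free_subspace_induct[of f UNIV])
    show "free_subspace {f. part 0 f = free_scalar (Poly_Mapping.lookup f 0)}"
      by (auto simp: free_subspace_def part_linear lookup_add lookup_free_scale free_scalar_add free_scalar_mult)
    show "word vs \<in> {f. part 0 f = free_scalar (Poly_Mapping.lookup f 0)}" for vs :: "'v list"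
      by (auto simp: part_linear lookup_single zero_free_monoid_def when_def word_Nil)
  qed (simp add: free_carrier_def)
  then show ?thesis by simp
qed

lemma symmetric_component_0:
  "f \<in> free_carrier V \<Longrightarrow>
   symmetric_component sc V (S.\<pi> f) 0 = quot_scalar sc V (symmetric_relations sc V) (Poly_Mapping.lookup f 0)"
  by (simp add: symmetric_component_eq part_0 quot_scalar_eq)

end

section \<open>Traces of endomorphisms of subspaces\<close>

text \<open>A copy of \<^locale>\<open>finite_dimensional_vector_space\<close> without the global interpretations of the
  original, which would hide the constants defined here.\<close>

locale fin_space = finite_dimensional_vector_space scale Basis
  for scale :: "'a::field \<Rightarrow> 'b::ab_group_add \<Rightarrow> 'b" and Basis
begin

text \<open>Linearity is asked on \<open>V\<close> only, because operators built from the
  projections of a direct sum have no meaning outside that sum.\<close>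

definition lin_on :: "'b set \<Rightarrow> ('b \<Rightarrow> 'b) \<Rightarrow> bool" where
  "lin_on V T \<longleftrightarrow> (\<forall>x\<in>V. \<forall>y\<in>V. T (x + y) = T x + T y) \<and> (\<forall>c. \<forall>x\<in>V. T (scale c x) = scale c (T x))"

lemma lin_onD:
  assumes "lin_on V T"
  shows "x \<in> V \<Longrightarrow> y \<in> V \<Longrightarrow> T (x + y) = T x + T y" "x \<in> V \<Longrightarrow> T (scale c x) = scale c (T x)"
  using assms by (auto simp: lin_on_def)

lemma lin_on_sum:
  assumes "lin_on V T" "subspace V" "\<And>i. i \<in> I \<Longrightarrow> x i \<in> V"
  shows "T (\<Sum>i\<in>I. x i) = (\<Sum>i\<in>I. T (x i))" "T 0 = 0"
proof -
  show 0: "T 0 = 0" using lin_onD(2)[OF assms(1) subspace_0[OF assms(2)], of 0] by simp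
  show "T (\<Sum>i\<in>I. x i) = (\<Sum>i\<in>I. T (x i))"
    using assms(3)
  proof (induction I rule: infinite_finite_induct)
    case (insert i I)
    then show ?case using lin_onD(1)[OF assms(1)] subspace_sum[OF assms(2), of I x] by simp
  qed (simp_all add: 0)
qed

lemma lin_on_diff:
  assumes "lin_on V T" "subspace V" "x \<in> V" "y \<in> V"
  shows "T (x - y) = T x - T y"
  using lin_onD(1)[OF assms(1), of x "scale (- 1) y"] lin_onD(2)[OF assms(1,4), of "- 1"] assms
    subspace_scale[OF assms(2,4), of "- 1"] by simp

lemma lin_on_subset: "lin_on V T \<Longrightarrow> U \<subseteq> V \<Longrightarrow> lin_on U T"
  unfolding lin_on_def by blast

lemma lin_on_comp: "lin_on V T \<Longrightarrow> (\<And>x. x \<in> V \<Longrightarrow> T x \<in> U) \<Longrightarrow> lin_on U S \<Longrightarrow> lin_on V (\<lambda>x. S (T x))"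
  by (auto simp: lin_on_def)

lemma lin_on_add: "lin_on V T \<Longrightarrow> lin_on V S \<Longrightarrow> lin_on V (\<lambda>x. T x + S x)"
  by (auto simp: lin_on_def scale_right_distrib algebra_simps)

lemma lin_on_minus: "lin_on V T \<Longrightarrow> lin_on V S \<Longrightarrow> lin_on V (\<lambda>x. T x - S x)"
  by (auto simp: lin_on_def scale_right_diff_distrib algebra_simps)

lemma lin_on_scale: "lin_on V T \<Longrightarrow> lin_on V (\<lambda>x. scale c (T x))"
  by (auto simp: lin_on_def scale_right_distrib mult.commute)

lemma lin_on_id: "lin_on V (\<lambda>x. x)"
  by (auto simp: lin_on_def)

definition coord_sum :: "'b set \<Rightarrow> ('b \<Rightarrow> 'b) \<Rightarrow> 'a" where
  "coord_sum X T = (\<Sum>b\<in>X. representation X (T b) b)"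

definition tr :: "'b set \<Rightarrow> ('b \<Rightarrow> 'b) \<Rightarrow> 'a" where
  "tr V T = coord_sum (SOME X. is_basis_of X V) T"

lemma is_basis_ofD:
  assumes "is_basis_of X V"
  shows "independent X" "span X = V" "subspace V" "b \<in> X \<Longrightarrow> b \<in> V"
  using assms subspace_span span_base unfolding is_basis_of_def by auto

lemma basis_expansion:
  assumes "is_basis_of X V" "finite X" "v \<in> V"
  shows "v = (\<Sum>b\<in>X. scale (representation X v b) b)"
  using sum_representation_eq[of X v X] assms by (auto simp: is_basis_of_def)

text \<open>Two spaces and two bases at once: with one of the maps the identity this is independence
  of the trace from the basis, with a single basis it is the cyclic property.\<close>

lemma coord_sum_commute:
  assumes X: "is_basis_of X V" "finite X" and Y: "is_basis_of Y U" "finite Y"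
    and S: "lin_on V S" "\<And>x. x \<in> V \<Longrightarrow> S x \<in> U" and T: "lin_on U T" "\<And>x. x \<in> U \<Longrightarrow> T x \<in> V"
  shows "coord_sum X (\<lambda>x. T (S x)) = coord_sum Y (\<lambda>x. S (T x))"
proof -
  have 1: "coord_sum X (\<lambda>x. T (S x)) = (\<Sum>b\<in>X. \<Sum>c\<in>Y. representation Y (S b) c * representation X (T c) b)"
    if X: "is_basis_of X V" "finite X" and Y: "is_basis_of Y U" "finite Y"
    and S: "\<And>x. x \<in> V \<Longrightarrow> S x \<in> U" and T: "lin_on U T" "\<And>x. x \<in> U \<Longrightarrow> T x \<in> V" for X Y S T U V
    unfolding coord_sum_def
  proof (rule sum.cong[OF refl])
    fix b assume b: "b \<in> X"
    note y = is_basis_ofD[OF Y(1)] and x = is_basis_ofD[OF X(1)]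
    have "T (S b) = T (\<Sum>c\<in>Y. scale (representation Y (S b) c) c)"
      using basis_expansion[OF Y S[OF x(4)[OF b]]] by simp
    also have "\<dots> = (\<Sum>c\<in>Y. scale (representation Y (S b) c) (T c))"
      using lin_on_sum(1)[OF T(1) y(3), of Y "\<lambda>c. scale (representation Y (S b) c) c"] y(4) subspace_scale[OF y(3)]
        lin_onD(2)[OF T(1)] by simp
    finally have "representation X (T (S b)) b = representation X (\<Sum>c\<in>Y. scale (representation Y (S b) c) (T c)) b" by simp
    also have "\<dots> = (\<Sum>c\<in>Y. representation X (scale (representation Y (S b) c) (T c)) b)"
      by (subst representation_sum[OF x(1)]) (use x T(2) y(4) subspace_scale in auto)
    also have "\<dots> = (\<Sum>c\<in>Y. representation Y (S b) c * representation X (T c) b)"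
      by (intro sum.cong refl) (use x T(2) y(4) in \<open>simp add: representation_scale\<close>)
    finally show "representation X (T (S b)) b = (\<Sum>c\<in>Y. representation Y (S b) c * representation X (T c) b)" .
  qed
  have "(\<Sum>b\<in>X. \<Sum>c\<in>Y. representation Y (S b) c * representation X (T c) b) =
      (\<Sum>c\<in>Y. \<Sum>b\<in>X. representation X (T c) b * representation Y (S b) c)"
    by (subst sum.swap) (simp add: mult.commute)
  then show ?thesis using 1[OF X Y S(2) T] 1[OF Y X T(2) S] by simp
qed

lemma subspace_basis:
  assumes "subspace V"
  obtains X where "is_basis_of X V" "finite X" "card X = dim V"
proof -
  obtain X where X: "X \<subseteq> V" "independent X" "V \<subseteq> span X" "card X = dim V" using basis_exists by blast
  then have "span X = V" using span_minimal[OF X(1) assms] by auto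
  then show ?thesis using that X finiteI_independent by (auto simp: is_basis_of_def)
qed

lemma is_basis_of_finite: "is_basis_of X V \<Longrightarrow> finite X"
  using finiteI_independent by (auto simp: is_basis_of_def)

lemma tr_basis:
  assumes X: "is_basis_of X V" and T: "lin_on V T" "\<And>x. x \<in> V \<Longrightarrow> T x \<in> V"
  shows "tr V T = coord_sum X T"
proof -
  have "is_basis_of (SOME X. is_basis_of X V) V" using X by (rule someI)
  then show ?thesis
    unfolding tr_def
    using coord_sum_commute[OF _ is_basis_of_finite X is_basis_of_finite[OF X] T lin_on_id, of "SOME X. is_basis_of X V"] by simp
qed

lemma tr_commute:
  assumes V: "subspace V" and S: "lin_on V S" "\<And>x. x \<in> V \<Longrightarrow> S x \<in> V" and T: "lin_on V T" "\<And>x. x \<in> V \<Longrightarrow> T x \<in> V"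
  shows "tr V (\<lambda>x. S (T x)) = tr V (\<lambda>x. T (S x))"
proof -
  obtain X where X: "is_basis_of X V" "finite X" using subspace_basis[OF V] by metis
  show ?thesis
    using coord_sum_commute[OF X X T S] lin_on_comp[OF S(1,2) T(1)] lin_on_comp[OF T(1,2) S(1)] S(2) T(2)
    by (subst (1 2) tr_basis[OF X(1)]) auto
qed

lemma tr_cong:
  assumes "subspace V" "\<And>x. x \<in> V \<Longrightarrow> S x = T x"
  shows "tr V S = tr V T"
proof -
  obtain X where "is_basis_of X V" using subspace_basis[OF assms(1)] by metis
  then have "is_basis_of (SOME X. is_basis_of X V) V" by (rule someI)
  from is_basis_ofD(4)[OF this] show ?thesis
    unfolding tr_def coord_sum_def by (intro sum.cong) (auto simp: assms(2))
qed

lemma tr_add: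
  assumes V: "subspace V" and S: "lin_on V S" "\<And>x. x \<in> V \<Longrightarrow> S x \<in> V" and T: "lin_on V T" "\<And>x. x \<in> V \<Longrightarrow> T x \<in> V"
  shows "tr V (\<lambda>x. S x + T x) = tr V S + tr V T"
proof -
  obtain X where X: "is_basis_of X V" "finite X" using subspace_basis[OF V] by metis
  note x = is_basis_ofD[OF X(1)]
  have "coord_sum X (\<lambda>x. S x + T x) = coord_sum X S + coord_sum X T"
    unfolding coord_sum_def sum.distrib[symmetric]
    by (intro sum.cong refl) (use x S(2) T(2) in \<open>simp add: representation_add\<close>)
  then show ?thesis
    using S T V by (subst (1 2 3) tr_basis[OF X(1)]) (auto intro: lin_on_add subspace_add)
qed

lemma tr_scale:
  assumes V: "subspace V" and T: "lin_on V T" "\<And>x. x \<in> V \<Longrightarrow> T x \<in> V"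
  shows "tr V (\<lambda>x. scale c (T x)) = c * tr V T"
proof -
  obtain X where X: "is_basis_of X V" "finite X" using subspace_basis[OF V] by metis
  note x = is_basis_ofD[OF X(1)]
  have "coord_sum X (\<lambda>x. scale c (T x)) = c * coord_sum X T"
    unfolding coord_sum_def sum_distrib_left
    by (intro sum.cong refl) (use x T(2) in \<open>simp add: representation_scale\<close>)
  then show ?thesis
    using T V by (subst (1 2) tr_basis[OF X(1)]) (auto intro: lin_on_scale subspace_scale)
qed

lemma tr_minus:
  assumes V: "subspace V" and S: "lin_on V S" "\<And>x. x \<in> V \<Longrightarrow> S x \<in> V" and T: "lin_on V T" "\<And>x. x \<in> V \<Longrightarrow> T x \<in> V"
  shows "tr V (\<lambda>x. S x - T x) = tr V S - tr V T"
proof -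
  have "scale (- 1) (T x) \<in> V" if "x \<in> V" for x by (rule subspace_scale[OF V T(2)[OF that]])
  then show ?thesis
    using tr_add[OF V S lin_on_scale[OF T(1), of "- 1"]] tr_scale[OF V T, of "- 1"] by simp
qed

lemma tr_sum:
  assumes V: "subspace V" and S: "\<And>i. i \<in> I \<Longrightarrow> lin_on V (S i)" "\<And>i x. i \<in> I \<Longrightarrow> x \<in> V \<Longrightarrow> S i x \<in> V"
  shows "tr V (\<lambda>x. \<Sum>i\<in>I. S i x) = (\<Sum>i\<in>I. tr V (S i))" "lin_on V (\<lambda>x. \<Sum>i\<in>I. S i x)"
proof -
  have 0: "tr V (\<lambda>x. 0) = 0" using tr_scale[OF V lin_on_id, of 0] by simp
  have l0: "lin_on V (\<lambda>x. 0)" by (simp add: lin_on_def)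
  have "tr V (\<lambda>x. \<Sum>i\<in>I. S i x) = (\<Sum>i\<in>I. tr V (S i)) \<and> lin_on V (\<lambda>x. \<Sum>i\<in>I. S i x)"
    using S
  proof (induction I rule: infinite_finite_induct)
    case (insert i I)
    then show ?case
      using tr_add[OF V, of "S i" "\<lambda>x. \<Sum>i\<in>I. S i x"] lin_on_add[of V "S i" "\<lambda>x. \<Sum>i\<in>I. S i x"]
        subspace_sum[OF V, of I "\<lambda>i. S i _"] by simp
  qed (simp_all add: 0 l0)
  then show "tr V (\<lambda>x. \<Sum>i\<in>I. S i x) = (\<Sum>i\<in>I. tr V (S i))" "lin_on V (\<lambda>x. \<Sum>i\<in>I. S i x)" by auto
qed

text \<open>Extend a basis of \<open>U\<close> to one of \<open>V\<close>. The added vectors have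
  images in \<open>U\<close>, so their diagonal entries are zero.\<close>

lemma tr_subspace:
  assumes V: "subspace V" and U: "subspace U" "U \<subseteq> V" and T: "lin_on V T" "\<And>x. x \<in> V \<Longrightarrow> T x \<in> U"
  shows "tr V T = tr U T"
proof -
  obtain X where X: "is_basis_of X U" "finite X" using subspace_basis[OF U(1)] by metis
  note x = is_basis_ofD[OF X(1)]
  obtain Y where Y: "X \<subseteq> Y" "Y \<subseteq> V" "independent Y" "V \<subseteq> span Y"
    using maximal_independent_subset_extend[of X V] x U(2) by blast
  then have YV: "is_basis_of Y V" using span_minimal[OF Y(2) V] by (auto simp: is_basis_of_def)
  have fin: "finite Y" using Y(3) by (rule finiteI_independent)
  have rep: "representation Y (T b) = representation X (T b)" if "b \<in> V" for b
    by (rule representation_extend[OF Y(3) _ Y(1)]) (use T(2)[OF that] x(2) in simp)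
  have "representation X (T b) b = 0" if "b \<notin> X" for b
    using that representation_ne_zero by blast
  then have "coord_sum Y T = coord_sum X T"
    unfolding coord_sum_def using Y(1,2) fin by (intro sum.mono_neutral_cong_right) (auto simp: rep)
  then show ?thesis
    using tr_basis[OF YV T(1)] tr_basis[OF X(1) lin_on_subset[OF T(1) U(2)]] T(2) U(2) by (simp add: subset_iff)
qed

lemma tr_zero_space: "tr {0} T = 0"
proof -
  have "is_basis_of {} {0}" by (simp add: is_basis_of_def independent_empty)
  then have b: "is_basis_of (SOME X. is_basis_of X {0}) {0}" by (rule someI)
  then have "(SOME X. is_basis_of X {0}) = {}"
    using is_basis_ofD(4)[OF b] dependent_zero is_basis_ofD(1)[OF b] by blast
  then show ?thesis by (simp add: tr_def coord_sum_def)
qed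

text \<open>Restricting \<open>T\<close> to its image keeps the trace by \<open>tr_subspace\<close>
  and lowers the exponent by one, which avoids a triangular basis.\<close>

lemma tr_nilpotent:
  assumes "subspace V" "lin_on V T" "\<And>x. x \<in> V \<Longrightarrow> T x \<in> V" "\<And>x. x \<in> V \<Longrightarrow> (T ^^ n) x = 0"
  shows "tr V T = 0"
  using assms
proof (induction n arbitrary: V)
  case 0
  then have "V = {0}" using subspace_0[OF 0(1)] by auto
  then show ?case by (simp add: tr_zero_space)
next
  case (Suc n)
  let ?U = "T ` V"
  have U: "subspace ?U"
  proof (rule subspaceI)
    show "0 \<in> ?U" using subspace_0[OF Suc.prems(1)] lin_on_sum(2)[OF Suc.prems(2,1), of "{}"] by (auto intro!: image_eqI[of _ _ 0])
    fix x y assume "x \<in> ?U" "y \<in> ?U"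
    then show "x + y \<in> ?U" using lin_onD(1)[OF Suc.prems(2)] subspace_add[OF Suc.prems(1)] by (metis (no_types, lifting) image_iff)
  next
    fix c x assume "x \<in> ?U"
    then show "scale c x \<in> ?U" using lin_onD(2)[OF Suc.prems(2)] subspace_scale[OF Suc.prems(1)] by (metis (no_types, lifting) image_iff)
  qed
  have UV: "?U \<subseteq> V" using Suc.prems(3) by auto
  have "tr V T = tr ?U T" by (rule tr_subspace[OF Suc.prems(1) U UV Suc.prems(2)]) auto
  also have "\<dots> = 0"
    by (rule Suc.IH[OF U lin_on_subset[OF Suc.prems(2) UV]]) (use Suc.prems(3,4) in \<open>auto simp: funpow_swap1\<close>)
  finally show ?case .
qed

lemma tr_id:
  assumes "subspace V"
  shows "tr V (\<lambda>x. scale c x) = of_nat (dim V) * c"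
proof -
  obtain X where X: "is_basis_of X V" "finite X" "card X = dim V" using subspace_basis[OF assms] by metis
  have 1: "tr V (\<lambda>x. x) = of_nat (dim V)"
    using tr_basis[OF X(1) lin_on_id] X is_basis_ofD[OF X(1)] by (simp add: coord_sum_def representation_basis)
  show ?thesis using tr_scale[OF assms lin_on_id, of c] by (simp add: 1 mult.commute)
qed

lemma tr_single_eigenvalue:
  assumes V: "subspace V" and T: "lin_on V T" "\<And>x. x \<in> V \<Longrightarrow> T x \<in> V"
    and n: "\<And>x. x \<in> V \<Longrightarrow> ((\<lambda>x. T x - scale c x) ^^ n) x = 0"
  shows "tr V T = of_nat (dim V) * c"
proof -
  have l: "lin_on V (\<lambda>x. T x - scale c x)" by (rule lin_on_minus[OF T(1) lin_on_scale[OF lin_on_id]])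
  have "tr V (\<lambda>x. T x - scale c x) = 0"
    by (rule tr_nilpotent[OF V l _ n]) (use T V subspace_diff subspace_scale in auto)
  moreover have "tr V (\<lambda>x. T x - scale c x) = tr V T - tr V (\<lambda>x. scale c x)"
    by (rule tr_minus[OF V T lin_on_scale[OF lin_on_id]]) (use V subspace_scale in auto)
  ultimately show ?thesis using tr_id[OF V] by simp
qed

end

section \<open>Traces along direct sums\<close>

locale direct_sum = fin_space scale Basis
  for scale :: "'a::field \<Rightarrow> 'b::ab_group_add \<Rightarrow> 'b" and Basis +
  fixes L :: "'b set" and I :: "'i set" and W :: "'i \<Rightarrow> 'b set"
  assumes finite_I: "finite I" and W_subspace: "\<And>i. i \<in> I \<Longrightarrow> subspace (W i)"
    and W_indep: "\<And>x. (\<And>i. i \<in> I \<Longrightarrow> x i \<in> W i) \<Longrightarrow> (\<Sum>i\<in>I. x i) = 0 \<Longrightarrow> (\<And>i. i \<in> I \<Longrightarrow> x i = 0)"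
    and L_eq: "L = {\<Sum>i\<in>I. x i | x. \<forall>i\<in>I. x i \<in> W i}"
begin

lemma W_unique:
  assumes "\<And>i. i \<in> I \<Longrightarrow> x i \<in> W i" "\<And>i. i \<in> I \<Longrightarrow> y i \<in> W i" "(\<Sum>i\<in>I. x i) = (\<Sum>i\<in>I. y i)" "i \<in> I"
  shows "x i = y i"
  using W_indep[of "\<lambda>i. x i - y i" i] assms W_subspace by (simp add: sum_subtractf subspace_diff)

definition proj :: "'i \<Rightarrow> 'b \<Rightarrow> 'b" where
  "proj i v = (SOME x. (\<forall>i\<in>I. x i \<in> W i) \<and> v = (\<Sum>i\<in>I. x i)) i"

lemma proj_props:
  assumes "v \<in> L"
  shows "i \<in> I \<Longrightarrow> proj i v \<in> W i" "v = (\<Sum>i\<in>I. proj i v)"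
proof -
  have "\<exists>x. (\<forall>i\<in>I. x i \<in> W i) \<and> v = (\<Sum>i\<in>I. x i)" using assms unfolding L_eq by blast
  from someI_ex[OF this] show "i \<in> I \<Longrightarrow> proj i v \<in> W i" "v = (\<Sum>i\<in>I. proj i v)"
    unfolding proj_def by blast+
qed

lemma proj_eqI:
  assumes "\<And>i. i \<in> I \<Longrightarrow> x i \<in> W i" "v = (\<Sum>i\<in>I. x i)" "i \<in> I"
  shows "proj i v = x i"
proof -
  have "v \<in> L" using assms(1,2) unfolding L_eq by blast
  then show ?thesis using W_unique[of "\<lambda>i. proj i v" x i] proj_props[of v] assms by simp
qed

lemma sum_in_L: "(\<And>i. i \<in> I \<Longrightarrow> x i \<in> W i) \<Longrightarrow> (\<Sum>i\<in>I. x i) \<in> L"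
  unfolding L_eq by blast

lemma W_L: "i \<in> I \<Longrightarrow> W i \<subseteq> L"
proof
  fix v assume i: "i \<in> I" "v \<in> W i"
  have "(\<Sum>j\<in>I. if j = i then v else 0) \<in> L"
    by (rule sum_in_L) (use i W_subspace subspace_0 in auto)
  then show "v \<in> L" using i finite_I by simp
qed

lemma proj_W: "i \<in> I \<Longrightarrow> j \<in> I \<Longrightarrow> v \<in> W j \<Longrightarrow> proj i v = (if i = j then v else 0)"
  using proj_eqI[of "\<lambda>i. if i = j then v else 0" v i] finite_I W_subspace subspace_0 by simp

lemma L_subspace: "subspace L"
proof (rule subspaceI)
  show "0 \<in> L" using sum_in_L[of "\<lambda>_. 0"] W_subspace subspace_0 by simp
next
  fix v w assume "v \<in> L" "w \<in> L"
  note p = proj_props[OF this(1)] proj_props[OF this(2)]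
  have "(\<Sum>i\<in>I. proj i v + proj i w) \<in> L" by (rule sum_in_L) (use p W_subspace subspace_add in auto)
  then show "v + w \<in> L" using p by (simp add: sum.distrib)
next
  fix c v assume "v \<in> L"
  note p = proj_props[OF this]
  have "(\<Sum>i\<in>I. scale c (proj i v)) \<in> L" by (rule sum_in_L) (use p W_subspace subspace_scale in auto)
  then show "scale c v \<in> L" using p(2) by (simp add: scale_sum_right[symmetric])
qed

lemma proj_lin: "i \<in> I \<Longrightarrow> lin_on L (proj i)"
  unfolding lin_on_def
proof (intro conjI ballI allI)
  fix v w assume i: "i \<in> I" and "v \<in> L" "w \<in> L"
  note p = proj_props[OF this(2)] proj_props[OF this(3)]
  show "proj i (v + w) = proj i v + proj i w"
    by (rule proj_eqI[OF _ _ i]) (use p W_subspace subspace_add in \<open>auto simp: sum.distrib\<close>)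
next
  fix c v assume i: "i \<in> I" and "v \<in> L"
  note p = proj_props[OF this(2)]
  show "proj i (scale c v) = scale c (proj i v)"
    by (rule proj_eqI[OF _ _ i]) (use p W_subspace subspace_scale in \<open>auto simp: scale_sum_right[symmetric]\<close>)
qed

lemma tr_proj:
  assumes T: "lin_on L T" "\<And>x. x \<in> L \<Longrightarrow> T x \<in> L"
  shows "tr L T = (\<Sum>i\<in>I. tr (W i) (\<lambda>x. proj i (T x)))"
proof -
  have pL: "proj i x \<in> L" if "i \<in> I" "x \<in> L" for i x using proj_props(1)[OF that(2,1)] W_L that by auto
  have l: "lin_on L (\<lambda>x. proj i (T x))" if "i \<in> I" for i by (rule lin_on_comp[OF T proj_lin[OF that]])
  have "tr L T = tr L (\<lambda>x. \<Sum>i\<in>I. proj i (T x))"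
    by (rule tr_cong[OF L_subspace]) (use proj_props(2)[OF T(2)] in simp)
  also have "\<dots> = (\<Sum>i\<in>I. tr L (\<lambda>x. proj i (T x)))"
    by (rule tr_sum[OF L_subspace]) (use l pL T(2) in auto)
  also have "\<dots> = (\<Sum>i\<in>I. tr (W i) (\<lambda>x. proj i (T x)))"
    by (intro sum.cong refl tr_subspace[OF L_subspace W_subspace W_L l]) (use proj_props(1) T(2) in auto)
  finally show ?thesis .
qed

lemma tr_direct:
  assumes T: "lin_on L T" "\<And>x i. i \<in> I \<Longrightarrow> x \<in> W i \<Longrightarrow> T x \<in> W i"
  shows "tr L T = (\<Sum>i\<in>I. tr (W i) T)"
proof -
  have "T x \<in> L" if x: "x \<in> L" for x
  proof -
    have "T x = (\<Sum>i\<in>I. T (proj i x))"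
      using lin_on_sum(1)[OF T(1) L_subspace, of I "\<lambda>i. proj i x"] proj_props[OF x] W_L by (simp add: subset_iff)
    then show ?thesis using sum_in_L[of "\<lambda>i. T (proj i x)"] T(2) proj_props(1)[OF x] by simp
  qed
  then have "tr L T = (\<Sum>i\<in>I. tr (W i) (\<lambda>x. proj i (T x)))" by (rule tr_proj[OF T(1)])
  also have "\<dots> = (\<Sum>i\<in>I. tr (W i) T)"
    by (intro sum.cong tr_cong W_subspace refl) (use T(2) proj_W in auto)
  finally show ?thesis .
qed

lemma dim_pos_W: "i \<in> I \<Longrightarrow> W i \<noteq> {0} \<Longrightarrow> dim (W i) > 0"
  using subspace_0[OF W_subspace, of i] by (auto simp: dim_eq_0)

end

section \<open>Generalized weight spaces\<close>

context fin_space
begin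

definition shift :: "('b \<Rightarrow> 'b) \<Rightarrow> 'a \<Rightarrow> 'b \<Rightarrow> 'b" where
  "shift T c x = T x - scale c x"

lemma pow_Suc_right: "(f ^^ Suc n) x = (f ^^ n) (f x)"
  by (simp_all add: funpow_swap1)

definition gen_eigenspace :: "'b set \<Rightarrow> ('b \<Rightarrow> 'b) \<Rightarrow> 'a \<Rightarrow> 'b set" where
  "gen_eigenspace V T c = {x \<in> V. \<exists>n. (shift T c ^^ n) x = 0}"

lemma funpow_mono_zero:
  fixes f :: "'b \<Rightarrow> 'b"
  assumes "(f ^^ n) x = (0 :: 'b)" "f 0 = 0" "n \<le> m"
  shows "(f ^^ m) x = 0"
proof -
  have z: "(f ^^ k) (0 :: 'b) = 0" for k
  proof (induction k)
    case (Suc k)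
    then show ?case using assms(2) by simp
  qed simp
  have "(f ^^ m) x = (f ^^ (m - n)) ((f ^^ n) x)"
    using assms(3) funpow_add[of "m - n" n f] by simp
  then show ?thesis by (simp add: assms(1) z)
qed

lemma sequence_dependent: "\<exists>m. f m \<in> span (f ` {..<m})" for f :: "nat \<Rightarrow> 'b"
proof (rule ccontr)
  assume "\<not> (\<exists>m. f m \<in> span (f ` {..<m}))"
  then have n: "f m \<notin> span (f ` {..<m})" for m by blast
  have ic: "independent (f ` {..<m}) \<and> card (f ` {..<m}) = m" for m
  proof (induction m)
    case (Suc m)
    have "f m \<notin> f ` {..<m}" using n[of m] span_base[of "f m" "f ` {..<m}"] by auto
    then show ?case
      using Suc independent_insertI[OF n[of m]] unfolding lessThan_Suc image_insert by simp
  qed (simp add: independent_empty)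
  have "card (f ` {..<Suc (dim UNIV)}) \<le> dim UNIV"
    by (rule independent_card_le_dim[OF subset_UNIV conjunct1[OF ic]])
  then show False using ic[of "Suc (dim UNIV)"] by linarith
qed

context
  fixes V T assumes V: "subspace V" and T: "lin_on V T" "\<And>x. x \<in> V \<Longrightarrow> T x \<in> V"
begin

lemma shift_lin: "lin_on V (shift T c)"
  using lin_on_minus[OF T(1) lin_on_scale[OF lin_on_id]] by (simp add: shift_def lin_on_def)

lemma shift_closed: "x \<in> V \<Longrightarrow> shift T c x \<in> V"
  using T(2) V by (simp add: shift_def subspace_diff subspace_scale)

lemma shift_zero: "shift T c 0 = 0"
  using lin_on_sum(2)[OF T(1) V, of "{}"] by (simp add: shift_def)

lemma shift_pow: "lin_on V (shift T c ^^ n) \<and> (\<forall>x\<in>V. (shift T c ^^ n) x \<in> V)"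
proof (induction n)
  case (Suc n)
  then show ?case using lin_on_comp[of V "shift T c ^^ n" V "shift T c"] shift_lin shift_closed
    by (simp add: comp_def)
qed (simp add: lin_on_def)

lemma shift_commute: "x \<in> V \<Longrightarrow> shift T c (shift T d x) = shift T d (shift T c x)"
  using lin_on_diff[OF T(1) V] lin_onD(2)[OF T(1)] T(2) subspace_scale[OF V]
  by (simp add: shift_def scale_right_diff_distrib mult.commute)

lemma shift_pow_commute: "x \<in> V \<Longrightarrow> shift T c ((shift T d ^^ n) x) = (shift T d ^^ n) (shift T c x)"
proof (induction n)
  case (Suc n)
  then show ?case using shift_commute[of "(shift T d ^^ n) x" c d] shift_pow[of n d] by auto
qed simp

lemma gen_eigenspace_subspace: "subspace (gen_eigenspace V T c)"
proof (rule subspaceI)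
  show "0 \<in> gen_eigenspace V T c"
    using subspace_0[OF V] by (auto simp: gen_eigenspace_def intro: exI[of _ 0])
next
  fix x y assume "x \<in> gen_eigenspace V T c" "y \<in> gen_eigenspace V T c"
  then obtain n m where nm: "x \<in> V" "y \<in> V" "(shift T c ^^ n) x = 0" "(shift T c ^^ m) y = 0"
    by (auto simp: gen_eigenspace_def)
  then have "(shift T c ^^ max n m) x = 0" "(shift T c ^^ max n m) y = 0"
    using funpow_mono_zero[of _ "shift T c", OF _ shift_zero] by auto
  then have "(shift T c ^^ max n m) (x + y) = 0"
    using lin_onD(1)[OF conjunct1[OF shift_pow] nm(1,2)] by simp
  then show "x + y \<in> gen_eigenspace V T c" using nm subspace_add[OF V] by (auto simp: gen_eigenspace_def)
next
  fix k x assume "x \<in> gen_eigenspace V T c"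
  then obtain n where n: "x \<in> V" "(shift T c ^^ n) x = 0" by (auto simp: gen_eigenspace_def)
  then have "(shift T c ^^ n) (scale k x) = 0" using lin_onD(2)[OF conjunct1[OF shift_pow] n(1)] by simp
  then show "scale k x \<in> gen_eigenspace V T c" using n subspace_scale[OF V] by (auto simp: gen_eigenspace_def)
qed

lemma gen_eigenspace_pow: "x \<in> gen_eigenspace V T c \<Longrightarrow> (shift T d ^^ m) x \<in> gen_eigenspace V T c"
proof (induction m)
  case (Suc m)
  then obtain n where n: "(shift T d ^^ m) x \<in> V" "(shift T c ^^ n) ((shift T d ^^ m) x) = 0"
    by (auto simp: gen_eigenspace_def)
  then have "(shift T c ^^ n) (shift T d ((shift T d ^^ m) x)) = 0"
    using shift_pow_commute[OF n(1), of d n c] shift_zero by simp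
  then show ?case using shift_closed[OF n(1)] by (auto simp: gen_eigenspace_def)
qed simp

lemma gen_eigenspace_shift: "x \<in> gen_eigenspace V T c \<Longrightarrow> shift T d x \<in> gen_eigenspace V T c"
  using gen_eigenspace_pow[of x c 1 d] by simp

lemma gen_eigenspace_T: "x \<in> gen_eigenspace V T c \<Longrightarrow> T x \<in> gen_eigenspace V T c"
  using gen_eigenspace_shift[of x c 0] by (simp add: shift_def)

text \<open>An element killed by T - d is an eigenvector, on which a power of T - c acts as the same
  power of the nonzero number d - c. Higher powers of T - d reduce to the first by
  induction.\<close>

lemma gen_eigenspace_disjoint:
  assumes "x \<in> gen_eigenspace V T c" "(shift T d ^^ m) x = 0" "c \<noteq> d"
  shows "x = 0"
  using assms(1,2)
proof (induction m arbitrary: x)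
  case (Suc m)
  have "(shift T d ^^ m) (shift T d x) = 0" using Suc.prems(2) by (simp only: pow_Suc_right)
  then have "shift T d x = 0" using Suc.IH gen_eigenspace_shift[OF Suc.prems(1)] by blast
  then have Tx: "T x = scale d x" by (simp add: shift_def)
  obtain n where x: "x \<in> V" and n: "(shift T c ^^ n) x = 0" using Suc.prems(1) by (auto simp: gen_eigenspace_def)
  have "(shift T c ^^ k) x = scale ((d - c) ^ k) x" for k
  proof (induction k)
    case (Suc k)
    have "shift T c (scale ((d - c) ^ k) x) = scale ((d - c) ^ k) (shift T c x)"
      using lin_onD(2)[OF shift_lin x] by simp
    then show ?case using Suc Tx by (simp add: shift_def[of T c x] scale_left_diff_distrib[symmetric] mult.commute)
  qed simp
  then show ?case using n assms(3) by simp
qed simp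

text \<open>On elements killed by a power of T - c the operator T - d is invertible. As (T - d) y -
  (T - c) y = (c - d) y, a solution \<open>z'\<close> for (T - c) y gives the solution (y - z') / (c
  - d) for \<open>y\<close>.\<close>

lemma shift_solve:
  assumes "(shift T c ^^ n) y = 0" "y \<in> V" "c \<noteq> d"
  shows "\<exists>z\<in>V. shift T d z = y \<and> (shift T c ^^ n) z = 0"
  using assms(1,2)
proof (induction n arbitrary: y)
  case 0
  then show ?case using subspace_0[OF V] shift_zero[of d] by (intro bexI[of _ 0]) auto
next
  case (Suc n)
  have y': "shift T c y \<in> V" "(shift T c ^^ n) (shift T c y) = 0"
    using Suc.prems shift_closed by (simp_all only: pow_Suc_right)
  then obtain z' where z': "z' \<in> V" "shift T d z' = shift T c y" "(shift T c ^^ n) z' = 0" using Suc.IH by blast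
  let ?k = "1 / (c - d)"
  let ?z = "scale ?k (y - z')"
  have yz: "y - z' \<in> V" using Suc.prems z' V by (simp add: subspace_diff)
  have "shift T d (y - z') = shift T d y - shift T c y"
    using lin_on_diff[OF shift_lin V Suc.prems(2) z'(1), of d] z'(2) by simp
  also have "\<dots> = scale (c - d) y" by (simp add: shift_def scale_left_diff_distrib)
  finally have "shift T d ?z = y" using lin_onD(2)[OF shift_lin yz, of d ?k] assms(3) by simp
  moreover have "(shift T c ^^ Suc n) (y - z') = 0"
    using lin_on_diff[OF conjunct1[OF shift_pow] V Suc.prems(2) z'(1), of "Suc n" c] Suc.prems(1) z'(3) shift_zero by simp
  then have "(shift T c ^^ Suc n) ?z = 0"
    using lin_onD(2)[OF conjunct1[OF shift_pow] yz, of "Suc n" c ?k] by simp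
  ultimately show ?case using subspace_scale[OF V yz] by blast
qed

abbreviation "gen_span \<equiv> span (\<Union>c. gen_eigenspace V T c)"

lemma gen_span_V: "gen_span \<subseteq> V"
  by (rule span_minimal[OF _ V]) (auto simp: gen_eigenspace_def)

text \<open>T - d is surjective on the span up to an error in the generalized eigenspace of d:
  contributions of other eigenvalues are solved exactly by \<open>shift_solve\<close>, that of d
  itself is left as the error.\<close>

lemma gen_span_lift:
  assumes "y \<in> gen_span"
  shows "\<exists>z\<in>gen_span. shift T d z - y \<in> gen_eigenspace V T d"
  using assms
proof (induction rule: span_induct_alt)
  case base
  then show ?case using span_zero subspace_0[OF gen_eigenspace_subspace] shift_zero by (intro bexI[of _ 0]) auto
next
  case (step k x y)
  then obtain c where c: "x \<in> gen_eigenspace V T c" by auto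
  obtain z where z: "z \<in> gen_span" "shift T d z - y \<in> gen_eigenspace V T d" using step by auto
  obtain w where w: "w \<in> gen_span" "shift T d w - x \<in> gen_eigenspace V T d"
  proof (cases "c = d")
    case True
    have "shift T d 0 - x \<in> gen_eigenspace V T d"
      using c True subspace_neg[OF gen_eigenspace_subspace] shift_zero by simp
    then show ?thesis using that span_zero by blast
  next
    case False
    obtain n where "x \<in> V" "(shift T c ^^ n) x = 0" using c by (auto simp: gen_eigenspace_def)
    then obtain w where w: "w \<in> V" "shift T d w = x" "(shift T c ^^ n) w = 0"
      using shift_solve[of n c x d] False by blast
    then have "w \<in> gen_eigenspace V T c" by (auto simp: gen_eigenspace_def)
    then have "w \<in> gen_span" by (intro span_base) auto
    then show ?thesis using that w(2) subspace_0[OF gen_eigenspace_subspace] by auto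
  qed
  have zw: "w \<in> V" "z \<in> V" using w(1) z(1) gen_span_V by auto
  have "shift T d (scale k w + z) = scale k (shift T d w) + shift T d z"
    using lin_onD(1)[OF shift_lin subspace_scale[OF V zw(1)] zw(2)] lin_onD(2)[OF shift_lin zw(1)] by simp
  then have "shift T d (scale k w + z) - (scale k x + y) = scale k (shift T d w - x) + (shift T d z - y)"
    by (simp add: scale_right_diff_distrib algebra_simps)
  then have "shift T d (scale k w + z) - (scale k x + y) \<in> gen_eigenspace V T d"
    using w(2) z(2) subspace_add[OF gen_eigenspace_subspace] subspace_scale[OF gen_eigenspace_subspace] by metis
  then show ?case using w(1) z(1) span_add span_scale by blast
qed

text \<open>This removes one linear factor of an annihilating polynomial, in place of an argument
  with coprime factors. The approximate preimage found in the span differs from \<open>x\<close> by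
  a generalized eigenvector for d.\<close>

lemma gen_span_step:
  assumes "x \<in> V" "shift T d x \<in> gen_span"
  shows "x \<in> gen_span"
proof -
  obtain z where z: "z \<in> gen_span" "shift T d z - shift T d x \<in> gen_eigenspace V T d"
    using gen_span_lift[OF assms(2)] by blast
  have zV: "z \<in> V" using z(1) gen_span_V by auto
  then have "shift T d (z - x) \<in> gen_eigenspace V T d"
    using z(2) lin_on_diff[OF shift_lin V zV assms(1), of d] by simp
  then obtain n where "(shift T d ^^ n) (shift T d (z - x)) = 0" by (auto simp: gen_eigenspace_def)
  then have "(shift T d ^^ Suc n) (z - x) = 0" by (simp only: pow_Suc_right)
  then have "z - x \<in> gen_eigenspace V T d"
    using subspace_diff[OF V zV assms(1)] unfolding gen_eigenspace_def by blast
  then have "z - x \<in> gen_span" by (intro span_base) auto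
  then show ?thesis using span_diff[OF z(1)] by fastforce
qed

definition poly_act :: "'a poly \<Rightarrow> 'b \<Rightarrow> 'b" where
  "poly_act p x = (\<Sum>i\<le>degree p. scale (coeff p i) ((T ^^ i) x))"

lemma poly_act_bound: "degree p \<le> n \<Longrightarrow> poly_act p x = (\<Sum>i\<le>n. scale (coeff p i) ((T ^^ i) x))"
  unfolding poly_act_def by (rule sum.mono_neutral_left) (auto simp: coeff_eq_0)

lemma poly_act_add: "poly_act (p + q) x = poly_act p x + poly_act q x"
  by (simp add: poly_act_bound[of _ "max (degree p) (degree q)"] degree_add_le_max scale_left_distrib sum.distrib)

lemma poly_act_monom: "poly_act (monom c i) x = scale c ((T ^^ i) x)"
  by (simp add: poly_act_bound[of _ i] degree_monom_le if_distrib[of "\<lambda>c. scale c _"] cong: if_cong)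

lemma poly_act_linear_factor: "poly_act ([:- a, 1:] * q) x = poly_act q (shift T a x)" if x: "x \<in> V"
proof -
  have pow: "lin_on V (T ^^ i)" for i
  proof -
    have "shift T 0 = T" by (simp add: fun_eq_iff shift_def)
    then show ?thesis using shift_pow[of i 0] by simp
  qed
  have "poly_act ([:- a, 1:] * q) x = (\<Sum>i\<le>Suc (degree q). scale (coeff ([:- a, 1:] * q) i) ((T ^^ i) x))"
    by (rule poly_act_bound) (use degree_mult_le[of "[:- a, 1:]" q] in simp)
  also have "\<dots> = (\<Sum>i\<le>Suc (degree q). scale (coeff (pCons 0 q) i) ((T ^^ i) x)) - (\<Sum>i\<le>Suc (degree q). scale (a * coeff q i) ((T ^^ i) x))"
    by (simp add: sum_subtractf[symmetric] scale_left_diff_distrib[symmetric] del: sum.atMost_Suc coeff_pCons_Suc)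
  also have "(\<Sum>i\<le>Suc (degree q). scale (coeff (pCons 0 q) i) ((T ^^ i) x)) = (\<Sum>i\<le>degree q. scale (coeff q i) ((T ^^ i) (T x)))"
    by (subst sum.atMost_Suc_shift) (simp add: funpow_swap1)
  also have "(\<Sum>i\<le>Suc (degree q). scale (a * coeff q i) ((T ^^ i) x)) = (\<Sum>i\<le>degree q. scale (coeff q i) ((T ^^ i) (scale a x)))"
    using lin_onD(2)[OF pow x] by (simp add: coeff_eq_0 mult.commute)
  also have "(\<Sum>i\<le>degree q. scale (coeff q i) ((T ^^ i) (T x))) - (\<Sum>i\<le>degree q. scale (coeff q i) ((T ^^ i) (scale a x))) =
      (\<Sum>i\<le>degree q. scale (coeff q i) ((T ^^ i) (shift T a x)))"
    using lin_on_diff[OF pow V T(2)[OF x] subspace_scale[OF V x, of a]]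
    by (simp add: shift_def sum_subtractf scale_right_diff_distrib)
  finally show ?thesis by (simp add: poly_act_def)
qed

lemma annihilating_poly:
  assumes x: "x \<in> V"
  shows "\<exists>p. p \<noteq> 0 \<and> poly_act p x = 0"
proof -
  obtain m where m: "(T ^^ m) x \<in> span ((\<lambda>i. (T ^^ i) x) ` {..<m})"
    using sequence_dependent[of "\<lambda>i. (T ^^ i) x"] by blast
  have sp: "u \<in> span (f ` {..<k}) \<Longrightarrow> \<exists>c. u = (\<Sum>i<k. scale (c i) (f i))" for u k and f :: "nat \<Rightarrow> 'b"
  proof (induction k arbitrary: u)
    case (Suc k)
    then obtain c where "u - scale c (f k) \<in> span (f ` {..<k})"
      by (auto simp: lessThan_Suc span_breakdown_eq)
    with Suc.IH obtain d where "u - scale c (f k) = (\<Sum>i<k. scale (d i) (f i))" by blast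
    then have "u = (\<Sum>i<k. scale (d i) (f i)) + scale c (f k)" by (simp add: algebra_simps)
    also have "\<dots> = (\<Sum>i<Suc k. scale (if i = k then c else d i) (f i))"
      by (auto intro!: sum.cong)
    finally show ?case by (intro exI)
  qed auto
  obtain c where c: "(T ^^ m) x = (\<Sum>i<m. scale (c i) ((T ^^ i) x))" using sp[OF m] by blast
  \<comment> \<open>The coefficient at m is 1, which keeps the polynomial from being zero.\<close>
  let ?p = "monom 1 m + (\<Sum>i<m. monom (- c i) i)"
  have s: "poly_act (\<Sum>i\<in>J. monom (- c i) i) x = (\<Sum>i\<in>J. scale (- c i) ((T ^^ i) x))" if "finite J" for J
    using that by (induction J) (simp_all add: poly_act_add poly_act_monom, simp add: poly_act_def)
  have "coeff ?p m = 1" by (simp add: coeff_sum)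
  then have "?p \<noteq> 0" by (metis coeff_0 zero_neq_one)
  moreover have "poly_act ?p x = 0"
    by (simp add: poly_act_add poly_act_monom s c sum_negf)
  ultimately show ?thesis by blast
qed

end

end

section \<open>Weight decompositions over an algebraically closed field\<close>

locale closed_fin_space = fin_space scale Basis
  for scale :: "'a::{alg_closed_field, field_char_0} \<Rightarrow> 'b::ab_group_add \<Rightarrow> 'b" and Basis
begin

text \<open>Induction on the degree of a polynomial that annihilates the vector: it has a root, the
  cofactor annihilates the shifted vector, and \<open>gen_span_step\<close> returns to the original
  one.\<close>

lemma gen_eigenspaces_span:
  assumes V: "subspace V" and T: "lin_on V T" "\<And>x. x \<in> V \<Longrightarrow> T x \<in> V" and x: "x \<in> V"
  shows "x \<in> span (\<Union>c. gen_eigenspace V T c)"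
proof -
  have "p \<noteq> 0 \<Longrightarrow> poly_act T p x = 0 \<Longrightarrow> x \<in> V \<Longrightarrow> x \<in> span (\<Union>c. gen_eigenspace V T c)" for p x
  proof (induction "degree p" arbitrary: p x)
    case 0
    then obtain c where c: "p = [:c:]" by (metis degree_eq_zeroE)
    then have "scale c x = 0" using 0(3) by (simp add: poly_act_def[OF V T])
    then have "x = 0" using 0(2) c by simp
    then show ?case using span_zero by simp
  next
    case (Suc n)
    then obtain a where "poly p a = 0" using alg_closed_imp_poly_has_root[of p] by auto
    then obtain q where q: "p = [:- a, 1:] * q" by (auto simp: poly_eq_0_iff_dvd)
    have "q \<noteq> 0" using q Suc.prems(1) by auto
    moreover have "degree p = degree [:- a, 1:] + degree q"
      unfolding q by (rule degree_mult_eq) (use \<open>q \<noteq> 0\<close> in auto)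
    then have "degree q = n" using Suc.hyps(2) by simp
    moreover have "poly_act T q (shift T a x) = 0"
      using poly_act_linear_factor[OF V T Suc.prems(3)] Suc.prems(2) q by simp
    ultimately have "shift T a x \<in> span (\<Union>c. gen_eigenspace V T c)"
      by (intro Suc.hyps(1)[OF sym]) (use shift_closed[OF V T Suc.prems(3)] in auto)
    then show ?case using gen_span_step[OF V T Suc.prems(3)] by simp
  qed
  then show ?thesis using annihilating_poly[OF V T x] x by blast
qed

end

text \<open>Stability of the generalized eigenspaces takes the place of commuting operators. It
  holds for the adjoint action of a nilpotent subalgebra, which is not yet known to be abelian when
  the decomposition is applied to it.\<close>

locale operator_family = closed_fin_space scale Basis
  for scale :: "'a::{alg_closed_field, field_char_0} \<Rightarrow> 'b::ab_group_add \<Rightarrow> 'b" and Basis +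
  fixes L :: "'b set" and H :: "'h set" and A :: "'h \<Rightarrow> 'b \<Rightarrow> 'b"
  assumes L_subspace: "subspace L" and A_lin: "\<And>h. h \<in> H \<Longrightarrow> lin_on L (A h)"
    and A_closed: "\<And>h x. h \<in> H \<Longrightarrow> x \<in> L \<Longrightarrow> A h x \<in> L"
    and A_stable: "\<And>h h' c x. h \<in> H \<Longrightarrow> h' \<in> H \<Longrightarrow> x \<in> gen_eigenspace L (A h) c \<Longrightarrow> A h' x \<in> gen_eigenspace L (A h) c"
begin

definition weight_space :: "('h \<Rightarrow> 'a) \<Rightarrow> 'b set" where
  "weight_space \<alpha> = {x \<in> L. \<forall>h\<in>H. x \<in> gen_eigenspace L (A h) (\<alpha> h)}"

text \<open>Weights are plain functions, normalized to 0 outside \<open>H\<close> so that their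
  values on \<open>H\<close> determine them, as in \<open>dual_space\<close>. Their linearity is a
  later result, \<open>weight_linear\<close>.\<close>

definition weights :: "('h \<Rightarrow> 'a) set" where
  "weights = {\<alpha>. (\<forall>h. h \<notin> H \<longrightarrow> \<alpha> h = 0) \<and> weight_space \<alpha> \<noteq> {0}}"

lemma weight_space_L: "weight_space \<alpha> \<subseteq> L"
  by (auto simp: weight_space_def)

lemma weight_space_subspace: "subspace (weight_space \<alpha>)"
proof -
  have s: "subspace (gen_eigenspace L (A h) (\<alpha> h))" if "h \<in> H" for h
    using gen_eigenspace_subspace[OF L_subspace A_lin A_closed] that by blast
  show ?thesis
    unfolding weight_space_def
    by (rule subspaceI) (auto simp: subspace_0 subspace_add subspace_scale L_subspace s)
qed

lemma weight_space_cong: "(\<And>h. h \<in> H \<Longrightarrow> \<alpha> h = \<beta> h) \<Longrightarrow> weight_space \<alpha> = weight_space \<beta>"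
  by (auto simp: weight_space_def)

lemma weight_space_A: "h \<in> H \<Longrightarrow> x \<in> weight_space \<alpha> \<Longrightarrow> A h x \<in> weight_space \<alpha>"
  using A_stable A_closed by (auto simp: weight_space_def)

lemma weight_space_shift_pow:
  assumes "h \<in> H" "x \<in> weight_space \<alpha>"
  shows "(shift (A h) c ^^ n) x \<in> weight_space \<alpha>"
proof (induction n)
  case (Suc n)
  then show ?case
    using weight_space_A[OF assms(1)] subspace_diff[OF weight_space_subspace] subspace_scale[OF weight_space_subspace]
    by (simp add: shift_def)
qed (simp add: assms)

lemma weight_space_disjoint:
  assumes "x \<in> weight_space \<alpha>" "h \<in> H" "\<alpha> h \<noteq> c" "(shift (A h) c ^^ n) x = 0"
  shows "x = 0"
  using gen_eigenspace_disjoint[OF L_subspace A_lin A_closed, of h x "\<alpha> h" n c] assms by (auto simp: weight_space_def)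

text \<open>Apply a power of a shift that kills the component at one other weight. The rest stay in
  their weight spaces, so by induction their images vanish, and at \<alpha> the shift is injective
  because the two weights differ at \<open>h\<close>.\<close>

lemma weight_space_indep:
  assumes "finite F" "\<And>\<alpha> \<beta>. \<alpha> \<in> F \<Longrightarrow> \<beta> \<in> F \<Longrightarrow> \<alpha> \<noteq> \<beta> \<Longrightarrow> \<exists>h\<in>H. \<alpha> h \<noteq> \<beta> h"
    "\<And>\<alpha>. \<alpha> \<in> F \<Longrightarrow> x \<alpha> \<in> weight_space \<alpha>" "(\<Sum>\<alpha>\<in>F. x \<alpha>) = 0" "\<alpha> \<in> F"
  shows "x \<alpha> = 0"
  using assms
proof (induction "card F" arbitrary: F x \<alpha>)
  case (Suc n)
  show ?case
  proof (cases "F = {\<alpha>}")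
    case False
    then obtain \<beta> where \<beta>: "\<beta> \<in> F" "\<alpha> \<noteq> \<beta>" using Suc.prems(5) by blast
    then obtain h where h: "h \<in> H" "\<alpha> h \<noteq> \<beta> h" using Suc.prems(2,5) by blast
    obtain m where m: "(shift (A h) (\<beta> h) ^^ m) (x \<beta>) = 0"
      using Suc.prems(3)[OF \<beta>(1)] h(1) by (auto simp: weight_space_def gen_eigenspace_def)
    let ?y = "\<lambda>\<gamma>. (shift (A h) (\<beta> h) ^^ m) (x \<gamma>)"
    have lin: "lin_on L (shift (A h) (\<beta> h) ^^ m)"
      using shift_pow[OF L_subspace A_lin A_closed] h(1) by blast
    have "(\<Sum>\<gamma>\<in>F. ?y \<gamma>) = (shift (A h) (\<beta> h) ^^ m) (\<Sum>\<gamma>\<in>F. x \<gamma>)"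
    proof (rule lin_on_sum(1)[OF lin L_subspace, symmetric])
      show "x i \<in> L" if "i \<in> F" for i using Suc.prems(3)[OF that] weight_space_L by auto
    qed
    also have "\<dots> = 0" unfolding Suc.prems(4) by (rule lin_on_sum(2)[OF lin L_subspace, of "{}"]) simp
    finally have "(\<Sum>\<gamma>\<in>F - {\<beta>}. ?y \<gamma>) = 0"
      using m Suc.prems(1) \<beta>(1) by (simp add: sum.remove)
    then have "?y \<alpha> = 0"
      by (intro Suc.hyps(1)[of "F - {\<beta>}" ?y])
        (use Suc \<beta> weight_space_shift_pow[OF h(1)] in auto)
    then show ?thesis using weight_space_disjoint Suc.prems(3,5) h by blast
  qed (use Suc.prems in simp)
qed simp

lemma weights_sep: "\<alpha> \<in> weights \<Longrightarrow> \<beta> \<in> weights \<Longrightarrow> \<alpha> \<noteq> \<beta> \<Longrightarrow> \<exists>h\<in>H. \<alpha> h \<noteq> \<beta> h"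
proof (rule ccontr)
  assume "\<alpha> \<in> weights" "\<beta> \<in> weights" "\<alpha> \<noteq> \<beta>" "\<not> (\<exists>h\<in>H. \<alpha> h \<noteq> \<beta> h)"
  then have "\<alpha> h = \<beta> h" for h by (cases "h \<in> H") (auto simp: weights_def)
  then show False using \<open>\<alpha> \<noteq> \<beta>\<close> by auto
qed

lemma finite_weights: "finite weights"
proof -
  have "\<forall>\<alpha>\<in>weights. \<exists>x. x \<in> weight_space \<alpha> \<and> x \<noteq> 0"
    using subspace_0[OF weight_space_subspace] by (auto simp: weights_def)
  then obtain x where x: "\<And>\<alpha>. \<alpha> \<in> weights \<Longrightarrow> x \<alpha> \<in> weight_space \<alpha> \<and> x \<alpha> \<noteq> 0" by metis
  have "card F \<le> dim UNIV" if F: "F \<subseteq> weights" "finite F" for F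
  proof -
    have sep: "\<And>\<alpha> \<beta>. \<alpha> \<in> F \<Longrightarrow> \<beta> \<in> F \<Longrightarrow> \<alpha> \<noteq> \<beta> \<Longrightarrow> \<exists>h\<in>H. \<alpha> h \<noteq> \<beta> h"
      using weights_sep F(1) by blast
    have z: "c \<alpha> = 0" if "(\<Sum>\<alpha>\<in>F. scale (c \<alpha>) (x \<alpha>)) = 0" "\<alpha> \<in> F" for c \<alpha>
    proof -
      have "scale (c \<alpha>) (x \<alpha>) = 0"
        by (rule weight_space_indep[OF F(2) sep _ that]) (use F(1) x subspace_scale[OF weight_space_subspace] in auto)
      then show ?thesis using x F(1) that(2) by auto
    qed
    have inj: "inj_on x F"
    proof (rule inj_onI, rule ccontr)
      fix \<alpha> \<beta> assume ab: "\<alpha> \<in> F" "\<beta> \<in> F" "x \<alpha> = x \<beta>" "\<alpha> \<noteq> \<beta>"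
      \<comment> \<open>If two representatives coincided, the coefficients 1 and - 1 would form a
        nontrivial relation.\<close>
      have "(\<Sum>\<gamma>\<in>F. scale ((if \<gamma> = \<alpha> then 1 else 0) - (if \<gamma> = \<beta> then 1 else 0)) (x \<gamma>)) = 0"
        using F(2) ab by (simp add: scale_left_diff_distrib sum_subtractf if_distrib[of "\<lambda>c. scale c _"] cong: if_cong)
      from z[OF this ab(1)] ab(4) show False by simp
    qed
    have "independent (x ` F)"
    proof (rule independent_if_scalars_zero)
      fix f u assume "(\<Sum>v\<in>x ` F. scale (f v) v) = 0" "u \<in> x ` F"
      then show "f u = 0" using z[of "\<lambda>\<alpha>. f (x \<alpha>)"] by (auto simp: sum.reindex[OF inj])
    qed (use F(2) in simp)
    then have "card (x ` F) \<le> dim UNIV" by (intro independent_card_le_dim) auto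
    then show ?thesis using card_image[OF inj] by simp
  qed
  then show ?thesis using finite_if_finite_subsets_card_bdd by blast
qed

text \<open>If some operator has a proper nonzero generalized eigenspace on \<open>U\<close>, all
  its generalized eigenspaces on \<open>U\<close> are stable and of smaller dimension. Otherwise, on
  a nonzero \<open>U\<close>, each operator has a single eigenvalue and \<open>U\<close> lies in one
  weight space.\<close>

lemma weight_spaces_span:
  assumes "subspace U" "U \<subseteq> L" "\<And>h x. h \<in> H \<Longrightarrow> x \<in> U \<Longrightarrow> A h x \<in> U"
  shows "U \<subseteq> span (\<Union>\<alpha>\<in>weights. weight_space \<alpha>)"
  using assms
proof (induction "dim U" arbitrary: U rule: less_induct)
  case less
  let ?S = "span (\<Union>\<alpha>\<in>weights. weight_space \<alpha>)"
  have lin: "lin_on U (A h)" if "h \<in> H" for h using lin_on_subset[OF A_lin[OF that] less.prems(2)] .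
  have G: "subspace (gen_eigenspace U (A h) c)" if "h \<in> H" for h c
    by (rule gen_eigenspace_subspace[OF less.prems(1) lin[OF that] less.prems(3)[OF that]])
  have sub: "gen_eigenspace U (A h) c \<subseteq> U" for h c by (auto simp: gen_eigenspace_def)
  have dec: "U \<subseteq> span (\<Union>c. gen_eigenspace U (A h) c)" if "h \<in> H" for h
    using gen_eigenspaces_span[OF less.prems(1) lin less.prems(3)] that by blast
  show ?case
  proof (cases "\<exists>h\<in>H. \<exists>c. gen_eigenspace U (A h) c \<noteq> U \<and> gen_eigenspace U (A h) c \<noteq> {0}")
    case True
    then obtain h c where h: "h \<in> H" and c: "gen_eigenspace U (A h) c \<noteq> U" "gen_eigenspace U (A h) c \<noteq> {0}" by blast
    obtain x where x: "x \<in> gen_eigenspace U (A h) c" "x \<noteq> 0" using c(2) subspace_0[OF G[OF h]] by blast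
    have "gen_eigenspace U (A h) d \<subseteq> ?S" for d
    proof (rule less.hyps)
      have "gen_eigenspace U (A h) d \<noteq> U"
      proof (cases "d = c")
        case False
        show ?thesis
        proof
          assume "gen_eigenspace U (A h) d = U"
          then have "x \<in> gen_eigenspace U (A h) d" using x(1) sub by auto
          then obtain n where "(shift (A h) d ^^ n) x = 0" by (auto simp: gen_eigenspace_def)
          then show False
            using gen_eigenspace_disjoint[OF less.prems(1) lin less.prems(3) x(1)] h False x(2) by blast
        qed
      qed (use c in simp)
      then show "dim (gen_eigenspace U (A h) d) < dim U"
        using dim_psubset[of "gen_eigenspace U (A h) d" U] sub[of h d] G[OF h] less.prems(1)
        by (simp add: span_eq_iff[THEN iffD2] psubset_eq)
      show "subspace (gen_eigenspace U (A h) d)" by (rule G[OF h])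
      show "gen_eigenspace U (A h) d \<subseteq> L" using sub less.prems(2) by blast
      fix h' y assume h': "h' \<in> H" and y: "y \<in> gen_eigenspace U (A h) d"
      then have "y \<in> gen_eigenspace L (A h) d" using less.prems(2) by (auto simp: gen_eigenspace_def)
      then have "A h' y \<in> gen_eigenspace L (A h) d" using A_stable[OF h h'] by blast
      then show "A h' y \<in> gen_eigenspace U (A h) d"
        using less.prems(3)[OF h', of y] y by (auto simp: gen_eigenspace_def)
    qed
    then have "span (\<Union>d. gen_eigenspace U (A h) d) \<subseteq> ?S" by (intro span_minimal) auto
    then show ?thesis using dec[OF h] by blast
  next
    case False
    show ?thesis
    proof (cases "U = {0}")
      case True
      then show ?thesis using span_zero by simp
    next
      case nz: False
      have "\<exists>c. gen_eigenspace U (A h) c = U" if h: "h \<in> H" for h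
      proof (rule ccontr)
        assume "\<not> ?thesis"
        then have "gen_eigenspace U (A h) c = {0}" for c using False h by blast
        then have "U \<subseteq> span {0}" using dec[OF h] by simp
        then show False using nz subspace_0[OF less.prems(1)] by auto
      qed
      then obtain \<alpha> where \<alpha>: "\<And>h. h \<in> H \<Longrightarrow> gen_eigenspace U (A h) (\<alpha> h) = U" by metis
      define \<beta> where "\<beta> h = (if h \<in> H then \<alpha> h else 0)" for h
      have U: "U \<subseteq> weight_space \<beta>"
      proof
        fix x assume x: "x \<in> U"
        have "x \<in> gen_eigenspace L (A h) (\<alpha> h)" if "h \<in> H" for h
          using \<alpha>[OF that] x less.prems(2) by (auto simp: gen_eigenspace_def)
        then show "x \<in> weight_space \<beta>" using x less.prems(2) by (auto simp: weight_space_def \<beta>_def)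
      qed
      then have "\<beta> \<in> weights" using nz subspace_0[OF less.prems(1)] by (auto simp: weights_def \<beta>_def)
      then have "weight_space \<beta> \<subseteq> ?S" using span_superset[of "\<Union>\<alpha>\<in>weights. weight_space \<alpha>"] by blast
      then show ?thesis using U by blast
    qed
  qed
qed

lemma weight_decomposition: "direct_sum scale Basis L weights weight_space"
proof unfold_locales
  show "finite weights" by (rule finite_weights)
  show "subspace (weight_space \<alpha>)" for \<alpha> by (rule weight_space_subspace)
  show "x \<alpha> = 0" if "\<And>\<alpha>. \<alpha> \<in> weights \<Longrightarrow> x \<alpha> \<in> weight_space \<alpha>" "(\<Sum>\<alpha>\<in>weights. x \<alpha>) = 0" "\<alpha> \<in> weights" for x \<alpha>
    by (rule weight_space_indep[OF finite_weights weights_sep that])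
  let ?D = "{\<Sum>\<alpha>\<in>weights. x \<alpha> | x. \<forall>\<alpha>\<in>weights. x \<alpha> \<in> weight_space \<alpha>}"
  have "subspace ?D"
  proof (rule subspaceI)
    show "0 \<in> ?D" using subspace_0[OF weight_space_subspace] by (auto intro!: exI[of _ "\<lambda>_. 0"])
  next
    fix u v assume "u \<in> ?D" "v \<in> ?D"
    then obtain x y where "u = (\<Sum>\<alpha>\<in>weights. x \<alpha>)" "v = (\<Sum>\<alpha>\<in>weights. y \<alpha>)"
      "\<forall>\<alpha>\<in>weights. x \<alpha> \<in> weight_space \<alpha>" "\<forall>\<alpha>\<in>weights. y \<alpha> \<in> weight_space \<alpha>" by blast
    then show "u + v \<in> ?D" using subspace_add[OF weight_space_subspace]
      by (auto intro!: exI[of _ "\<lambda>\<alpha>. x \<alpha> + y \<alpha>"] simp: sum.distrib)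
  next
    fix c u assume "u \<in> ?D"
    then obtain x where "u = (\<Sum>\<alpha>\<in>weights. x \<alpha>)" "\<forall>\<alpha>\<in>weights. x \<alpha> \<in> weight_space \<alpha>" by blast
    then show "scale c u \<in> ?D" using subspace_scale[OF weight_space_subspace]
      by (auto intro!: exI[of _ "\<lambda>\<alpha>. scale c (x \<alpha>)"] simp: scale_sum_right)
  qed
  moreover have "(\<Union>\<alpha>\<in>weights. weight_space \<alpha>) \<subseteq> ?D"
  proof clarify
    fix v \<alpha> assume v: "\<alpha> \<in> weights" "v \<in> weight_space \<alpha>"
    show "\<exists>x. v = (\<Sum>\<alpha>\<in>weights. x \<alpha>) \<and> (\<forall>\<alpha>\<in>weights. x \<alpha> \<in> weight_space \<alpha>)"
      using v finite_weights subspace_0[OF weight_space_subspace]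
      by (intro exI[of _ "\<lambda>\<beta>. if \<beta> = \<alpha> then v else 0"]) simp
  qed
  ultimately have "span (\<Union>\<alpha>\<in>weights. weight_space \<alpha>) \<subseteq> ?D" by (intro span_minimal)
  then have "L \<subseteq> ?D" using weight_spaces_span[OF L_subspace order_refl A_closed] by blast
  moreover have "?D \<subseteq> L" using weight_space_L by (auto intro!: subspace_sum[OF L_subspace])
  ultimately show "L = ?D" by blast
qed

sublocale W: direct_sum scale Basis L weights weight_space
  by (rule weight_decomposition)

text \<open>The exponents of finitely many basis vectors have a maximum, which makes the exponent
  uniform.\<close>

lemma weight_space_nil:
  assumes "h \<in> H"
  shows "\<exists>n. \<forall>x\<in>weight_space \<alpha>. (shift (A h) (\<alpha> h) ^^ n) x = 0"
proof -
  obtain X where X: "is_basis_of X (weight_space \<alpha>)" "finite X" using subspace_basis[OF weight_space_subspace] by metis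
  have "\<forall>b\<in>X. \<exists>n. (shift (A h) (\<alpha> h) ^^ n) b = 0"
    using is_basis_ofD(4)[OF X(1)] assms by (auto simp: weight_space_def gen_eigenspace_def)
  then obtain n where n: "\<And>b. b \<in> X \<Longrightarrow> (shift (A h) (\<alpha> h) ^^ n b) b = 0" by metis
  have z: "shift (A h) (\<alpha> h) 0 = 0" by (rule shift_zero[OF L_subspace A_lin A_closed]) (use assms in auto)
  have lin: "lin_on L (shift (A h) (\<alpha> h) ^^ m)" for m using shift_pow[OF L_subspace A_lin A_closed] assms by blast
  have m: "(shift (A h) (\<alpha> h) ^^ Max (n ` X)) b = 0" if "b \<in> X" for b
    by (rule funpow_mono_zero[OF n[OF that] z]) (use that X(2) in simp)
  have "(shift (A h) (\<alpha> h) ^^ Max (n ` X)) x = 0" if x: "x \<in> weight_space \<alpha>" for x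
  proof -
    have XL: "b \<in> L" if "b \<in> X" for b using is_basis_ofD(4)[OF X(1) that] weight_space_L by auto
    have "(shift (A h) (\<alpha> h) ^^ Max (n ` X)) x =
        (\<Sum>b\<in>X. (shift (A h) (\<alpha> h) ^^ Max (n ` X)) (scale (representation X x b) b))"
      by (subst (1) basis_expansion[OF X x], rule lin_on_sum(1)[OF lin L_subspace]) (use XL subspace_scale[OF L_subspace] in auto)
    also have "\<dots> = 0" by (rule sum.neutral) (use lin_onD(2)[OF lin XL] m in auto)
    finally show ?thesis .
  qed
  then show ?thesis by blast
qed

lemma tr_weight_space:
  assumes "h \<in> H"
  shows "tr (weight_space \<alpha>) (A h) = of_nat (dim (weight_space \<alpha>)) * \<alpha> h"
proof -
  obtain n where n: "\<forall>x\<in>weight_space \<alpha>. (shift (A h) (\<alpha> h) ^^ n) x = 0" using weight_space_nil[OF assms] by blast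
  have sh: "shift (A h) (\<alpha> h) = (\<lambda>x. A h x - scale (\<alpha> h) x)" by (simp add: fun_eq_iff shift_def)
  show ?thesis
    by (rule tr_single_eigenvalue[OF weight_space_subspace lin_on_subset[OF A_lin[OF assms] weight_space_L]
       weight_space_A[OF assms] n[unfolded sh, rule_format]])
qed

end

section \<open>Engel's theorem and the radical of the Killing form\<close>

context lie_algebra
begin

lemma bracket_simps:
  "bracket (x + y) z = bracket x z + bracket y z" "bracket (scale c x) z = scale c (bracket x z)"
  "bracket z (x + y) = bracket z x + bracket z y" "bracket z (scale c x) = scale c (bracket z x)"
  "bracket z (sum h X) = (\<Sum>x\<in>X. bracket z (h x))" "bracket (sum h X) z = (\<Sum>x\<in>X. bracket (h x) z)"
  "bracket 0 z = 0" "bracket z 0 = 0" "bracket (- x) z = - bracket x z" "bracket z (- x) = - bracket z x"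
  "bracket (x - y) z = bracket x z - bracket y z" "bracket z (x - y) = bracket z x - bracket z y"
proof -
  note l = Vector_Spaces.linear.axioms(3)[OF bracket_linear_left[of z]]
    and r = Vector_Spaces.linear.axioms(3)[OF bracket_linear_right[of z]]
  show "bracket (x + y) z = bracket x z + bracket y z" "bracket (scale c x) z = scale c (bracket x z)"
     "bracket (sum h X) z = (\<Sum>x\<in>X. bracket (h x) z)" "bracket 0 z = 0" "bracket (- x) z = - bracket x z"
     "bracket (x - y) z = bracket x z - bracket y z"
    using module_hom.add[OF l] module_hom.scale[OF l] module_hom.sum[OF l] module_hom.zero[OF l] module_hom.neg[OF l]
      module_hom.diff[OF l] by auto
  show "bracket z (x + y) = bracket z x + bracket z y" "bracket z (scale c x) = scale c (bracket z x)"
    "bracket z (sum h X) = (\<Sum>x\<in>X. bracket z (h x))" "bracket z 0 = 0" "bracket z (- x) = - bracket z x"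
    "bracket z (x - y) = bracket z x - bracket z y"
    using module_hom.add[OF r] module_hom.scale[OF r] module_hom.sum[OF r] module_hom.zero[OF r] module_hom.neg[OF r]
      module_hom.diff[OF r] by auto
qed

lemma bracket_swap: "bracket x y = - bracket y x"
proof -
  have "bracket x y + bracket y x = 0"
    using bracket_self[of "x + y"] unfolding bracket_simps(1,3) bracket_self[of x] bracket_self[of y] by (simp add: add.commute)
  then show ?thesis by (simp add: eq_neg_iff_add_eq_0)
qed

lemma bracket_bracket: "bracket (bracket x y) z = bracket x (bracket y z) - bracket y (bracket x z)"
proof -
  have "bracket z (bracket x y) = - bracket (bracket x y) z" by (rule bracket_swap)
  moreover have "bracket y (bracket z x) = - bracket y (bracket x z)"
    using bracket_swap[of z x] by (simp add: bracket_simps)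
  ultimately show ?thesis using jacobi[of x y z] by (simp add: algebra_simps)
qed

end

section \<open>Simultaneous nilpotency and Engel's theorem\<close>

locale fin_lie = closed_fin_space scale Basis + lie_algebra scale bracket
  for scale :: "'k::{alg_closed_field, field_char_0} \<Rightarrow> 'g::ab_group_add \<Rightarrow> 'g" and Basis and bracket
begin

lemma bracket_lin: "lin_on V (bracket x)"
  by (simp add: lin_on_def bracket_simps)

text \<open>Bracket with elements of \<open>K\<close> as long as the result stays outside
  \<open>K\<close>. Products of N brackets end in \<open>K\<close>, so the process stops, and it
  stops at an element that normalizes \<open>K\<close>.\<close>

lemma last_outside:
  assumes "x \<in> D - K" "\<And>k z. k \<in> K \<Longrightarrow> z \<in> D \<Longrightarrow> bracket k z \<in> D"
    and "\<And>ds. set ds \<subseteq> K \<Longrightarrow> length ds = N \<Longrightarrow> foldr bracket ds x \<in> K"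
  shows "\<exists>y\<in>D - K. \<forall>k\<in>K. bracket k y \<in> K"
  using assms(1,3)
proof (induction N arbitrary: x)
  case 0
  then show ?case using 0(2)[of "[]"] by simp
next
  case (Suc N)
  show ?case
  proof (cases "\<forall>k\<in>K. bracket k x \<in> K")
    case False
    then obtain k where k: "k \<in> K" "bracket k x \<notin> K" by blast
    show ?thesis
    proof (rule Suc.IH[of "bracket k x"])
      show "bracket k x \<in> D - K" using k assms(2) Suc.prems(1) by blast
      show "foldr bracket ds (bracket k x) \<in> K" if "set ds \<subseteq> K" "length ds = N" for ds
        using Suc.prems(2)[of "ds @ [k]"] that k(1) by simp
    qed
  qed (use Suc.prems in blast)
qed

text \<open>Simultaneous nilpotency: any product of N operators from \<open>K\<close> vanishes on
  \<open>V\<close>, which is stronger than nilpotency of each of them.\<close>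

definition kills :: "'g set \<Rightarrow> 'g set \<Rightarrow> bool" where
  "kills K V \<longleftrightarrow> (\<exists>N. \<forall>ds. set ds \<subseteq> K \<longrightarrow> length ds = N \<longrightarrow> (\<forall>x\<in>V. foldr bracket ds x = 0))"

text \<open>Filter \<open>V\<close> by the spans \<open>U i\<close> of all products of i operators
  from \<open>K\<close>. Operators from \<open>K\<close> go one step down, and ad y preserves each
  step since it normalizes \<open>K\<close>. On a single layer every operator of the larger space is
  therefore a multiple of ad y, so m of them go one step down and N m of them reach zero.\<close>

lemma kills_extend:
  assumes K: "subspace K" and V: "subspace V" and KV: "\<And>k v. k \<in> K \<Longrightarrow> v \<in> V \<Longrightarrow> bracket k v \<in> V"
    and y: "\<And>k. k \<in> K \<Longrightarrow> bracket k y \<in> K" "\<And>v. v \<in> V \<Longrightarrow> bracket y v \<in> V" "\<And>v. v \<in> V \<Longrightarrow> (bracket y ^^ m) v = 0"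
    and "kills K V"
  shows "kills (span (insert y K)) V"
proof -
  obtain N where N: "\<And>ds x. set ds \<subseteq> K \<Longrightarrow> length ds = N \<Longrightarrow> x \<in> V \<Longrightarrow> foldr bracket ds x = 0"
    using assms(7) unfolding kills_def by metis
  define U where "U i = span {foldr bracket ds v | ds v. set ds \<subseteq> K \<and> length ds = i \<and> v \<in> V}" for i
  have wV: "foldr bracket ds v \<in> V" if "set ds \<subseteq> K" "v \<in> V" for ds v
    using that by (induction ds) (auto intro: KV)
  have U0: "V \<subseteq> U 0" unfolding U_def by (intro subset_trans[OF _ span_superset]) force
  have UN: "U N \<subseteq> {0}" unfolding U_def by (rule span_minimal) (use N subspace_0 in auto)
  have Uk: "bracket k u \<in> U (Suc i)" if k: "k \<in> K" and u: "u \<in> U i" for k u i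
    using u unfolding U_def
  proof (induction rule: span_induct_alt)
    case base
    show ?case unfolding bracket_simps by (rule span_zero)
  next
    case (step c x z)
    then obtain ds v where d: "x = foldr bracket ds v" "set ds \<subseteq> K" "length ds = i" "v \<in> V" by blast
    have "bracket k x \<in> span {foldr bracket ds v | ds v. set ds \<subseteq> K \<and> length ds = Suc i \<and> v \<in> V}"
      by (rule span_base) (use d k in \<open>auto intro!: exI[of _ "k # ds"] exI[of _ v]\<close>)
    then show ?case unfolding bracket_simps by (intro span_add span_scale step)
  qed
  have Usub: "U (Suc i) \<subseteq> U i" for i
    unfolding U_def
  proof (rule span_minimal[OF _ subspace_span], clarify)
    fix ds v assume d: "set ds \<subseteq> K" "length ds = Suc i" "v \<in> V"
    then obtain es k where ds: "ds = es @ [k]" by (metis length_Suc_conv_rev)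
    show "foldr bracket ds v \<in> span {foldr bracket ds v | ds v. set ds \<subseteq> K \<and> length ds = i \<and> v \<in> V}"
      by (rule span_base) (use d ds KV in \<open>auto intro!: exI[of _ es] exI[of _ "bracket k v"]\<close>)
  qed
  \<comment> \<open>Moving \<open>y\<close> inwards past a letter costs a commutator that is again a
    letter from \<open>K\<close>, so the length of the word is kept.\<close>
  have yword: "bracket y (foldr bracket ds v) \<in> span {foldr bracket es w | es w. set es \<subseteq> K \<and> length es = length ds \<and> w \<in> V}"
    if "set ds \<subseteq> K" "v \<in> V" for ds v
    using that
  proof (induction ds)
    case Nil
    show ?case by (rule span_base) (use y(2) Nil in \<open>auto intro!: exI[of _ "[]"]\<close>)
  next
    case (Cons k ds)
    have "bracket y (bracket k (foldr bracket ds v)) =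
      bracket (bracket y k) (foldr bracket ds v) + bracket k (bracket y (foldr bracket ds v))"
      by (simp add: bracket_bracket)
    moreover have "bracket y k \<in> K"
      using y(1)[of k] Cons.prems subspace_neg[OF K] bracket_swap[of y k] by auto
    then have "bracket (bracket y k) (foldr bracket ds v) \<in> U (Suc (length ds))"
      by (intro Uk) (use Cons.prems in \<open>auto simp: U_def intro!: span_base\<close>)
    moreover have "bracket k (bracket y (foldr bracket ds v)) \<in> U (Suc (length ds))"
      by (intro Uk) (use Cons in \<open>auto simp: U_def\<close>)
    ultimately show ?case by (simp add: U_def span_add)
  qed
  have Uy: "bracket y u \<in> U i" if u: "u \<in> U i" for u i
    using u unfolding U_def
  proof (induction rule: span_induct_alt)
    case base
    show ?case unfolding bracket_simps by (rule span_zero)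
  next
    case (step c x z)
    then obtain ds v where d: "x = foldr bracket ds v" "set ds \<subseteq> K" "length ds = i" "v \<in> V" by blast
    then have "bracket y x \<in> span {foldr bracket ds v | ds v. set ds \<subseteq> K \<and> length ds = i \<and> v \<in> V}"
      using yword[of ds v] by simp
    then show ?case unfolding bracket_simps by (intro span_add span_scale step)
  qed
  have Us: "subspace (U i)" for i by (simp add: U_def)
  have Uyp: "(bracket y ^^ n) u \<in> U i" if "u \<in> U i" for u i n
    using that by (induction n) (auto intro: Uy)
  have UV: "U i \<subseteq> V" for i unfolding U_def by (rule span_minimal[OF _ V]) (use wV in auto)
  have spK: "span K = K" using K by simp
  have K'U: "bracket d u \<in> U i" if d: "d \<in> span (insert y K)" and u: "u \<in> U i" for d u i
  proof -
    obtain c where "d - scale c y \<in> K" using d unfolding span_breakdown_eq spK by blast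
    then have "bracket (d - scale c y) u \<in> U i" using Uk[OF _ u] Usub by blast
    then have "bracket (d - scale c y) u + scale c (bracket y u) \<in> U i"
      by (intro subspace_add[OF Us] subspace_scale[OF Us] Uy u)
    then show ?thesis by (simp add: bracket_simps)
  qed
  \<comment> \<open>The scalar collects the coefficients of \<open>y\<close> in the letters;
    everything else falls into the next layer.\<close>
  have step: "\<exists>c. foldr bracket ds u - scale c ((bracket y ^^ length ds) u) \<in> U (Suc i)"
    if "set ds \<subseteq> span (insert y K)" "u \<in> U i" for ds u i
    using that
  proof (induction ds)
    case Nil
    then show ?case using subspace_0[OF Us] by (intro exI[of _ 1]) simp
  next
    case (Cons d ds)
    then obtain c where c: "foldr bracket ds u - scale c ((bracket y ^^ length ds) u) \<in> U (Suc i)" by auto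
    let ?w = "foldr bracket ds u - scale c ((bracket y ^^ length ds) u)" and ?v = "scale c ((bracket y ^^ length ds) u)"
    obtain a where a: "d - scale a y \<in> K" using Cons.prems(1) unfolding list.set insert_subset span_breakdown_eq spK by blast
    have v: "?v \<in> U i" by (intro subspace_scale[OF Us] Uyp Cons.prems)
    have "bracket d ?w + bracket (d - scale a y) ?v \<in> U (Suc i)"
      by (intro subspace_add[OF Us] K'U Uk a v c) (use Cons.prems in auto)
    moreover have "bracket d ?w + bracket (d - scale a y) ?v = foldr bracket (d # ds) u - scale (a * c) ((bracket y ^^ length (d # ds)) u)"
      by (simp add: bracket_simps scale_right_diff_distrib mult.commute)
    ultimately show ?case by metis
  qed
  have down: "foldr bracket ds v \<in> U i" if "set ds \<subseteq> span (insert y K)" "length ds = i * m" "v \<in> V" for ds v i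
    using that
  proof (induction i arbitrary: ds)
    case 0
    then show ?case using U0 by auto
  next
    case (Suc i)
    let ?u = "foldr bracket (drop m ds) v"
    have u: "?u \<in> U i" by (rule Suc.IH) (use Suc.prems set_drop_subset[of m ds] in auto)
    have l: "length (take m ds) = m" using Suc.prems by simp
    obtain c where "foldr bracket (take m ds) ?u - scale c ((bracket y ^^ m) ?u) \<in> U (Suc i)"
      using step[OF _ u, of "take m ds"] Suc.prems(1) set_take_subset[of m ds] unfolding l by blast
    moreover have "(bracket y ^^ m) ?u = 0" using y(3) u UV by blast
    ultimately have "foldr bracket (take m ds @ drop m ds) v \<in> U (Suc i)" unfolding foldr_append by simp
    then show ?case by simp
  qed
  show ?thesis unfolding kills_def
    by (rule exI[of _ "N * m"]) (use down UN in blast)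
qed

text \<open>Take \<open>K\<close> of greatest dimension among the subalgebras that are
  simultaneously nilpotent on \<open>V\<close>. If it were proper, \<open>last_outside\<close> would
  give an element of \<open>D\<close> outside \<open>K\<close> that normalizes it, and
  \<open>kills_extend\<close> a larger such subalgebra. As \<open>D\<close> lies in
  \<open>V\<close>, the action of \<open>K\<close> on \<open>D\<close> is controlled as
  well.\<close>

theorem engel:
  assumes D: "subspace D" "\<And>x y. x \<in> D \<Longrightarrow> y \<in> D \<Longrightarrow> bracket x y \<in> D"
    and V: "subspace V" "D \<subseteq> V" "\<And>d v. d \<in> D \<Longrightarrow> v \<in> V \<Longrightarrow> bracket d v \<in> V"
    and nil: "\<And>d. d \<in> D \<Longrightarrow> \<exists>m. \<forall>v\<in>V. (bracket d ^^ m) v = 0"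
  shows "kills D V"
proof -
  let ?P = "\<lambda>K. subspace K \<and> K \<subseteq> D \<and> (\<forall>x\<in>K. \<forall>y\<in>K. bracket x y \<in> K) \<and> kills K V"
  have "foldr bracket ds x = 0" if "set ds \<subseteq> {0}" "length ds = 1" for ds x
    using that by (cases ds) (auto simp: bracket_simps)
  then have "kills {0} V" unfolding kills_def by blast
  then have P0: "?P {0}" using subspace_0[OF D(1)] by (simp add: bracket_simps)
  have bound: "\<forall>K. ?P K \<longrightarrow> dim K < Suc (dim D)"
  proof (intro allI impI)
    fix K assume "?P K"
    then have "dim K \<le> dim D" by (intro dim_subset) simp
    then show "dim K < Suc (dim D)" by simp
  qed
  obtain K where "?P K \<and> (\<forall>K'. ?P K' \<longrightarrow> dim K' \<le> dim K)"
    using ex_has_greatest_nat[of ?P "{0}" dim "Suc (dim D)", OF P0 bound] by (elim exE)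
  note K = conjunct1[OF this] conjunct2[OF this]
  have "K = D"
  proof (rule ccontr)
    assume "K \<noteq> D"
    then obtain x where x: "x \<in> D - K" using K(1) by blast
    obtain N where N: "\<And>ds x. set ds \<subseteq> K \<Longrightarrow> length ds = N \<Longrightarrow> x \<in> V \<Longrightarrow> foldr bracket ds x = 0"
      using K(1) unfolding kills_def by metis
    have K0: "0 \<in> K" using K(1) subspace_0 by blast
    have "\<exists>y\<in>D - K. \<forall>k\<in>K. bracket k y \<in> K"
    proof (rule last_outside[OF x])
      show "bracket k z \<in> D" if "k \<in> K" "z \<in> D" for k z using that D(2) K(1) by blast
      show "foldr bracket ds x \<in> K" if "set ds \<subseteq> K" "length ds = N" for ds
        using N[OF that, of x] x V(2) K0 by auto
    qed
    then obtain y where y: "y \<in> D" "y \<notin> K" "\<And>k. k \<in> K \<Longrightarrow> bracket k y \<in> K" by blast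
    obtain m where m: "\<forall>v\<in>V. (bracket y ^^ m) v = 0" using nil[OF y(1)] by blast
    let ?K' = "span (insert y K)"
    have K'D: "?K' \<subseteq> D" by (rule span_minimal[OF _ D(1)]) (use y K(1) in auto)
    have spK: "span K = K" using K(1) by simp
    have br: "bracket d e \<in> ?K'" if de: "d \<in> ?K'" "e \<in> ?K'" for d e
    proof -
      obtain a b where ab: "d - scale a y \<in> K" "e - scale b y \<in> K" using de unfolding span_breakdown_eq spK by blast
      let ?d = "d - scale a y" and ?e = "e - scale b y"
      have "bracket ?d ?e + scale b (bracket ?d y) - scale a (bracket ?e y) \<in> K"
        using ab y(3) K(1) by (intro subspace_add subspace_diff subspace_scale) auto
      moreover have "bracket d e = bracket ?d ?e + scale b (bracket ?d y) - scale a (bracket ?e y)"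
        using bracket_swap[of y e] by (simp add: bracket_simps bracket_self algebra_simps)
      ultimately show ?thesis using span_superset[of "insert y K"] by auto
    qed
    have "kills ?K' V"
      by (rule kills_extend[of K V y m]) (use K(1) V D y m in blast)+
    then have "dim ?K' \<le> dim K" using K(2)[rule_format, of ?K'] K'D br by simp
    moreover have "dim K < dim ?K'"
    proof (rule dim_psubset)
      show "span K \<subset> span ?K'"
        unfolding spK span_span using y(2) span_superset[of "insert y K"] by blast
    qed
    ultimately show False by simp
  qed
  then show ?thesis using K(1) by simp
qed

text \<open>The last nonzero product of brackets applied to a nonzero element is central.\<close>

lemma kills_center:
  assumes "kills D D" "D \<noteq> {0}" "0 \<in> D" "\<And>x y. x \<in> D \<Longrightarrow> y \<in> D \<Longrightarrow> bracket x y \<in> D"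
  shows "\<exists>v\<in>D. v \<noteq> 0 \<and> (\<forall>d\<in>D. bracket d v = 0)"
proof -
  obtain N where N: "\<And>ds x. set ds \<subseteq> D \<Longrightarrow> length ds = N \<Longrightarrow> x \<in> D \<Longrightarrow> foldr bracket ds x = 0"
    using assms(1) unfolding kills_def by metis
  have "\<exists>v\<in>D. v \<noteq> 0 \<and> (\<forall>d\<in>D. bracket d v = 0)"
    if "x \<in> D" "x \<noteq> 0" "\<And>ds. set ds \<subseteq> D \<Longrightarrow> length ds = N \<Longrightarrow> foldr bracket ds x = 0" for x N
    using that
  proof (induction N arbitrary: x)
    case 0
    then show ?case using 0(3)[of "[]"] by simp
  next
    case (Suc N)
    show ?case
    proof (cases "\<forall>d\<in>D. bracket d x = 0")
      case False
      then obtain d where d: "d \<in> D" "bracket d x \<noteq> 0" by blast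
      show ?thesis
        by (rule Suc.IH[of "bracket d x"]) (use d Suc.prems assms(4) Suc.prems(3)[of "_ @ [d]"] in auto)
    qed (use Suc.prems in blast)
  qed
  moreover obtain x where "x \<in> D" "x \<noteq> 0" using assms(2,3) by blast
  ultimately show ?thesis using N by blast
qed

text \<open>By the Leibniz rule, ad h - (c + d) on a bracket is ad h - c on the first factor plus ad
  h - d on the second. Induction on the sum of the two exponents replaces the binomial
  formula.\<close>

lemma gen_eigenspace_bracket:
  assumes L: "subspace L" "\<And>x y. x \<in> L \<Longrightarrow> y \<in> L \<Longrightarrow> bracket x y \<in> L" and h: "h \<in> L"
    and "x \<in> gen_eigenspace L (bracket h) c" "y \<in> gen_eigenspace L (bracket h) d"
  shows "bracket x y \<in> gen_eigenspace L (bracket h) (c + d)"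
proof -
  note sz = shift_zero[OF L(1) bracket_lin L(2)[OF h]]
  have der: "shift (bracket h) (c + d) (bracket x y) = bracket (shift (bracket h) c x) y + bracket x (shift (bracket h) d y)" for x y
    using bracket_bracket[of h x y] by (simp add: shift_def bracket_simps scale_left_distrib algebra_simps)
  have "\<exists>n. (shift (bracket h) (c + d) ^^ n) (bracket x y) = 0"
    if "(shift (bracket h) c ^^ a) x = 0" "(shift (bracket h) d ^^ b) y = 0" for a b x y
    using that
  proof (induction "a + b" arbitrary: a b x y)
    case 0
    then show ?case by (intro exI[of _ 0]) (simp add: bracket_simps)
  next
    case (Suc k)
    show ?case
    proof (cases "a = 0 \<or> b = 0")
      case True
      then show ?thesis using Suc.prems by (intro exI[of _ 0]) (auto simp: bracket_simps)
    next
      case False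
      then obtain a' b' where ab: "a = Suc a'" "b = Suc b'" by (metis not0_implies_Suc)
      obtain n where n: "(shift (bracket h) (c + d) ^^ n) (bracket (shift (bracket h) c x) y) = 0"
        using Suc.hyps(1)[of a' b] Suc.hyps(2) Suc.prems by (auto simp: ab pow_Suc_right simp del: funpow.simps)
      obtain m where m: "(shift (bracket h) (c + d) ^^ m) (bracket x (shift (bracket h) d y)) = 0"
        using Suc.hyps(1)[of a b'] Suc.hyps(2) Suc.prems by (auto simp: ab pow_Suc_right simp del: funpow.simps)
      have lin: "lin_on UNIV (shift (bracket h) (c + d) ^^ j)" for j
        using shift_pow[OF subspace_UNIV bracket_lin] by blast
      let ?M = "max n m"
      have "(shift (bracket h) (c + d) ^^ ?M) (bracket (shift (bracket h) c x) y) = 0"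
        "(shift (bracket h) (c + d) ^^ ?M) (bracket x (shift (bracket h) d y)) = 0"
        using funpow_mono_zero[OF n sz, of ?M] funpow_mono_zero[OF m sz, of ?M] by auto
      then have "(shift (bracket h) (c + d) ^^ Suc ?M) (bracket x y) = 0"
        unfolding pow_Suc_right der using lin_onD(1)[OF lin] by simp
      then show ?thesis by blast
    qed
  qed
  then show ?thesis using assms by (auto simp: gen_eigenspace_def)
qed

lemma family_single:
  assumes L: "subspace L" "\<And>x y. x \<in> L \<Longrightarrow> y \<in> L \<Longrightarrow> bracket x y \<in> L" and x: "x \<in> L"
  shows "operator_family scale Basis L {x} bracket"
  using gen_eigenspace_T[OF L(1) bracket_lin L(2)[OF x]] L x
  by unfold_locales (auto simp: bracket_lin)

end

text \<open>Complete \<open>a\<close> to a basis of the field over the rationals and take the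
  coordinate at \<open>a\<close>. In Cartan's criterion this functional replaces complex conjugation
  of the eigenvalues.\<close>

lemma rational_functional:
  fixes a :: "'k::field_char_0"
  assumes "a \<noteq> 0"
  obtains \<phi> :: "'k \<Rightarrow> rat" where "\<And>x y. \<phi> (x + y) = \<phi> x + \<phi> y" "\<And>q x. \<phi> (of_rat q * x) = q * \<phi> x" "\<phi> a \<noteq> 0"
proof -
  interpret Q: vector_space "\<lambda>(q :: rat) (x :: 'k). of_rat q * x"
    by unfold_locales (auto simp: algebra_simps of_rat_add of_rat_mult)
  have i: "Q.independent {a}" using assms Q.dependent_single by simp
  note b = Q.extend_basis_superset[OF i] Q.independent_extend_basis[OF i] Q.span_extend_basis[OF i]
  show ?thesis
  proof (rule that[of "\<lambda>x. Q.representation (Q.extend_basis {a}) x a"])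
    show "Q.representation (Q.extend_basis {a}) a a \<noteq> 0"
      using Q.representation_basis[OF b(2)] b(1) by auto
  qed (simp_all add: Q.representation_add[OF b(2)] Q.representation_scale[OF b(2)] b(3))
qed

section \<open>Cartan subalgebras of reductive quadratic Lie algebras\<close>

locale fin_quadratic = fin_lie scale Basis bracket
  for scale :: "'k::{alg_closed_field, field_char_0} \<Rightarrow> 'g::ab_group_add \<Rightarrow> 'g" and Basis and bracket +
  fixes B :: "'g \<Rightarrow> 'g \<Rightarrow> 'k"
  assumes B_add: "\<And>x y z. B (x + y) z = B x z + B y z" and B_scale: "\<And>c x y. B (scale c x) y = c * B x y"
    and B_sym: "\<And>x y. B x y = B y x"
    and B_inv: "\<And>x y z. B (bracket x y) z = B x (bracket y z)"
begin

lemma B_simps: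
  "B (x + y) z = B x z + B y z" "B (scale c x) y = c * B x y" "B z (x + y) = B z x + B z y" "B y (scale c x) = c * B y x"
  "B 0 z = 0" "B z 0 = 0" "B (- x) z = - B x z" "B z (- x) = - B z x" "B (x - y) z = B x z - B y z" "B z (x - y) = B z x - B z y"
proof -
  show 1: "B (x + y) z = B x z + B y z" "B (scale c x) y = c * B x y" for x y z c by (rule B_add, rule B_scale)
  show 2: "B z (x + y) = B z x + B z y" "B y (scale c x) = c * B y x" for x y z c
    using 1(1)[of x y z] 1(2)[of c x y] by (simp_all only: B_sym[of z "x + y"] B_sym[of z x] B_sym[of z y] B_sym[of y "scale c x"] B_sym[of y x])
  show "B 0 z = 0" "B z 0 = 0" using 1(2)[of 0 0 z] 2(2)[of z 0 0] by simp_all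
  show 3: "B (- x) z = - B x z" "B z (- x) = - B z x" for x z using 1(2)[of "- 1" x z] 2(2)[of z "- 1" x] by simp_all
  show "B (x - y) z = B x z - B y z" "B z (x - y) = B z x - B z y"
    using 1(1)[of x "- y" z] 2(1)[of z x "- y"] 3 by simp_all
qed

lemma B_sum: "B z (sum h J) = (\<Sum>i\<in>J. B z (h i))" "B (sum h J) z = (\<Sum>i\<in>J. B (h i) z)"
  by (induction J rule: infinite_finite_induct) (auto simp: B_simps)

end

text \<open>The carrier \<open>L\<close> is a parameter because the theory is applied to \<gg> and
  to \<kk> with the same form. Reductivity enters as the absence of nonzero abelian ideals inside
  the derived algebra, which \<open>reductive_abelian_ideal\<close> extracts from complete
  reducibility.\<close>

locale reductive_quadratic = fin_quadratic scale Basis bracket B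
  for scale :: "'k::{alg_closed_field, field_char_0} \<Rightarrow> 'g::ab_group_add \<Rightarrow> 'g" and Basis and bracket and B +
  fixes L :: "'g set"
  assumes B_nondeg: "\<And>x. x \<in> L \<Longrightarrow> (\<And>y. y \<in> L \<Longrightarrow> B x y = 0) \<Longrightarrow> x = 0"
    and L_sub: "subspace L" and L_closed: "\<And>x y. x \<in> L \<Longrightarrow> y \<in> L \<Longrightarrow> bracket x y \<in> L"
    and L_reductive: "\<And>I. lie_ideal I L \<Longrightarrow> (\<And>x y. x \<in> I \<Longrightarrow> y \<in> I \<Longrightarrow> bracket x y = 0) \<Longrightarrow>
      I \<subseteq> span {bracket x y | x y. x \<in> L \<and> y \<in> L} \<Longrightarrow> I = {0}"
begin

definition kf :: "'g \<Rightarrow> 'g \<Rightarrow> 'k" where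
  "kf x y = tr L (\<lambda>z. bracket x (bracket y z))"

lemma br2_lin: "lin_on V (\<lambda>z. bracket x (bracket y z))"
  by (simp add: lin_on_def bracket_simps)

lemma kf_add: "x \<in> L \<Longrightarrow> y \<in> L \<Longrightarrow> z \<in> L \<Longrightarrow> kf (x + y) z = kf x z + kf y z"
  unfolding kf_def using tr_add[OF L_sub br2_lin _ br2_lin, of x z y z] L_closed by (simp add: bracket_simps)

lemma kf_scale: "x \<in> L \<Longrightarrow> z \<in> L \<Longrightarrow> kf (scale c x) z = c * kf x z"
  unfolding kf_def using tr_scale[OF L_sub br2_lin, of x z c] L_closed by (simp add: bracket_simps)

lemma kf_sym: "x \<in> L \<Longrightarrow> y \<in> L \<Longrightarrow> kf x y = kf y x"
  unfolding kf_def by (rule tr_commute[OF L_sub bracket_lin _ bracket_lin]) (auto intro: L_closed)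

lemma kf_inv:
  assumes "x \<in> L" "y \<in> L" "z \<in> L"
  shows "kf (bracket x y) z = kf x (bracket y z)"
proof -
  have l3: "lin_on L (\<lambda>w. bracket a (bracket b (bracket c w)))" for a b c
    by (simp add: lin_on_def bracket_simps)
  have "kf (bracket x y) z = tr L (\<lambda>w. bracket x (bracket y (bracket z w)) - bracket y (bracket x (bracket z w)))"
    unfolding kf_def bracket_bracket ..
  also have "\<dots> = tr L (\<lambda>w. bracket x (bracket y (bracket z w))) - tr L (\<lambda>w. bracket y (bracket x (bracket z w)))"
    by (rule tr_minus[OF L_sub l3 _ l3]) (use assms L_closed in auto)
  also have "tr L (\<lambda>w. bracket y (bracket x (bracket z w))) = tr L (\<lambda>w. bracket x (bracket z (bracket y w)))"
    by (rule tr_commute[OF L_sub bracket_lin _ br2_lin]) (use assms L_closed in auto)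
  also have "tr L (\<lambda>w. bracket x (bracket y (bracket z w))) - tr L (\<lambda>w. bracket x (bracket z (bracket y w))) =
     tr L (\<lambda>w. bracket x (bracket y (bracket z w)) - bracket x (bracket z (bracket y w)))"
    by (rule tr_minus[OF L_sub l3 _ l3, symmetric]) (use assms L_closed in auto)
  also have "\<dots> = kf x (bracket y z)" unfolding kf_def bracket_bracket bracket_simps ..
  finally show ?thesis .
qed

definition center :: "'g set" where "center = {z \<in> L. \<forall>x\<in>L. bracket x z = 0}"

abbreviation "derived \<equiv> span {bracket x y | x y. x \<in> L \<and> y \<in> L}"

lemma center_derived: "z \<in> center \<Longrightarrow> z \<in> derived \<Longrightarrow> z = 0"
proof -
  assume z: "z \<in> center" "z \<in> derived"
  have "center \<inter> derived = {0}"
  proof (rule L_reductive)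
    show "lie_ideal (center \<inter> derived) L"
      unfolding lie_ideal_def
    proof (intro conjI ballI)
      show "subspace (center \<inter> derived)"
        by (rule subspace_inter[OF _ subspace_span], rule subspaceI)
          (auto simp: center_def bracket_simps subspace_0[OF L_sub] subspace_add[OF L_sub] subspace_scale[OF L_sub])
      show "bracket x y \<in> center \<inter> derived" if "x \<in> L" "y \<in> center \<inter> derived" for x y
        using that subspace_0[OF L_sub] by (auto simp: center_def bracket_simps span_zero)
    qed (auto simp: center_def)
  qed (auto simp: center_def)
  then show ?thesis using z by blast
qed

lemma family_bracket:
  assumes "x \<in> L"
  shows "operator_family scale Basis L {x} bracket"
  using family_single[OF L_sub L_closed assms] .

text \<open>Cartan's criterion, in the form in which it is needed: with \<open>\<phi>\<close> a rational functional on the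
  eigenvalues of \<open>ad x\<close>, the operator acting by \<open>\<phi> \<lambda>\<close> on the generalized eigenspace of \<open>\<lambda>\<close> is a
  derivation, which makes the trace of its product with \<open>ad x\<close> vanish.\<close>

lemma radical_nilpotent:
  assumes x: "x \<in> span {bracket a b | a b. a \<in> L \<and> (\<forall>y\<in>L. kf a y = 0) \<and> b \<in> L}" and xL: "x \<in> L"
  shows "\<exists>n. \<forall>z\<in>L. (bracket x ^^ n) z = 0"
proof -
  interpret O: operator_family scale Basis L "{x}" bracket by (rule family_bracket[OF xL])
  have zero: "\<alpha> x = 0" if \<alpha>: "\<alpha> \<in> O.weights" for \<alpha>
  proof (rule ccontr)
    assume "\<alpha> x \<noteq> 0"
    then obtain \<phi> :: "'k \<Rightarrow> rat" where \<phi>: "\<And>x y. \<phi> (x + y) = \<phi> x + \<phi> y"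
      "\<And>q x. \<phi> (of_rat q * x) = q * \<phi> x" "\<phi> (\<alpha> x) \<noteq> 0"
      using rational_functional[of "\<alpha> x"] by metis
    define T where "T z = (\<Sum>\<beta>\<in>O.weights. scale (of_rat (\<phi> (\<beta> x))) (O.W.proj \<beta> z))" for z
    have Tlin: "lin_on L T"
      unfolding T_def by (rule tr_sum(2)[OF L_sub lin_on_scale[OF O.W.proj_lin]])
        (use O.W.proj_props(1) O.weight_space_L subspace_scale[OF L_sub] in blast)+
    have TL: "T z \<in> L" if "z \<in> L" for z
      unfolding T_def by (intro subspace_sum[OF L_sub] subspace_scale[OF L_sub])
        (use O.W.proj_props(1)[OF that] O.weight_space_L in blast)
    have Tw: "T z = scale (of_rat (\<phi> (\<beta> x))) z" if "z \<in> O.weight_space \<beta>" "\<beta> \<in> O.weights" for z \<beta>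
    proof -
      have "T z = (\<Sum>\<gamma>\<in>O.weights. if \<gamma> = \<beta> then scale (of_rat (\<phi> (\<beta> x))) z else 0)"
        unfolding T_def using O.W.proj_W[OF _ that(2,1)] by (intro sum.cong) auto
      then show ?thesis using that O.finite_weights by simp
    qed
    have der_w: "T (bracket b z) = bracket (T b) z + bracket b (T z)"
      if b: "b \<in> O.weight_space \<beta>" "\<beta> \<in> O.weights" and z: "z \<in> O.weight_space \<gamma>" "\<gamma> \<in> O.weights" for b z \<beta> \<gamma>
    proof -
      have bz: "bracket b z \<in> O.weight_space (\<beta> + \<gamma>)"
        using gen_eigenspace_bracket[OF L_sub L_closed xL] b(1) z(1) L_closed by (auto simp: O.weight_space_def)
      show ?thesis
      proof (cases "\<beta> + \<gamma> \<in> O.weights")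
        case True
        show ?thesis unfolding Tw[OF bz True] Tw[OF b] Tw[OF z]
          by (simp add: \<phi>(1) bracket_simps of_rat_add scale_left_distrib)
      next
        \<comment> \<open>Here the bracket is zero, and the right-hand side is a multiple of
          it.\<close>
        case False
        then have "O.weight_space (\<beta> + \<gamma>) = {0}" using b(2) z(2) by (auto simp: O.weights_def)
        then have "bracket b z = 0" using bz by auto
        moreover have "T 0 = 0" by (rule lin_on_sum(2)[OF Tlin L_sub, of "{}"]) simp
        ultimately show ?thesis unfolding Tw[OF b] Tw[OF z] by (simp add: bracket_simps)
      qed
    qed
    have der: "T (bracket b z) = bracket (T b) z + bracket b (T z)" if b: "b \<in> L" and z: "z \<in> L" for b z
    proof -
      note pb = O.W.proj_props[OF b] and pz = O.W.proj_props[OF z]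
      have pbL: "O.W.proj \<beta> b \<in> L" and pzL: "O.W.proj \<beta> z \<in> L" if "\<beta> \<in> O.weights" for \<beta>
        using pb(1)[OF that] pz(1)[OF that] O.weight_space_L by auto
      have Tb: "T b = (\<Sum>\<beta>\<in>O.weights. T (O.W.proj \<beta> b))"
        by (subst pb(2)) (rule lin_on_sum(1)[OF Tlin L_sub pbL])
      have Tz: "T z = (\<Sum>\<beta>\<in>O.weights. T (O.W.proj \<beta> z))"
        by (subst pz(2)) (rule lin_on_sum(1)[OF Tlin L_sub pzL])
      have bz: "bracket b z = (\<Sum>\<beta>\<in>O.weights. \<Sum>\<gamma>\<in>O.weights. bracket (O.W.proj \<beta> b) (O.W.proj \<gamma> z))"
        by (subst pb(2), subst pz(2)) (simp only: bracket_simps(6), simp only: bracket_simps(5))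
      have "T (bracket b z) = (\<Sum>\<beta>\<in>O.weights. \<Sum>\<gamma>\<in>O.weights. T (bracket (O.W.proj \<beta> b) (O.W.proj \<gamma> z)))"
        unfolding bz
        by (subst lin_on_sum(1)[OF Tlin L_sub] ; (intro sum.cong refl lin_on_sum(1)[OF Tlin L_sub])?)
          (auto intro!: subspace_sum[OF L_sub] L_closed pbL pzL)
      also have "\<dots> = (\<Sum>\<beta>\<in>O.weights. \<Sum>\<gamma>\<in>O.weights. bracket (T (O.W.proj \<beta> b)) (O.W.proj \<gamma> z) + bracket (O.W.proj \<beta> b) (T (O.W.proj \<gamma> z)))"
        by (intro sum.cong refl, rule der_w[OF pb(1) _ pz(1)], assumption+)
      also have "\<dots> = bracket (T b) (\<Sum>\<gamma>\<in>O.weights. O.W.proj \<gamma> z) + bracket (\<Sum>\<beta>\<in>O.weights. O.W.proj \<beta> b) (T z)"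
        unfolding sum.distrib by (simp only: Tb Tz bracket_simps(6), simp only: bracket_simps(5))
      finally show ?thesis using pb(2) pz(2) by simp
    qed
    have l: "lin_on L (\<lambda>z. bracket y (T z))" for y
      by (rule lin_on_comp[OF Tlin TL bracket_lin])
    have l2: "lin_on L (\<lambda>z. bracket a (bracket b (T z)))" for a b
      by (rule lin_on_comp[OF Tlin TL br2_lin])
    \<comment> \<open>For a bracket [a, b] the derivation property rewrites the trace as minus the
      Killing form of \<open>a\<close> and \<open>T b\<close>, which is zero because
      \<open>a\<close> lies in the radical.\<close>
    have f: "y \<in> L \<and> tr L (\<lambda>z. bracket y (T z)) = 0"
      if "y \<in> span {bracket a b | a b. a \<in> L \<and> (\<forall>y\<in>L. kf a y = 0) \<and> b \<in> L}" for y
      using that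
    proof (induction rule: span_induct_alt)
      case base
      have "tr L (\<lambda>z. bracket 0 (T z)) = tr L (\<lambda>z. scale 0 z)" by (rule tr_cong[OF L_sub]) (simp add: bracket_simps)
      then show ?case using subspace_0[OF L_sub] tr_id[OF L_sub, of 0] by simp
    next
      case (step c w y)
      then obtain a b where ab: "w = bracket a b" "a \<in> L" "\<And>y. y \<in> L \<Longrightarrow> kf a y = 0" "b \<in> L" by blast
      have wL: "w \<in> L" using ab L_closed by simp
      have "tr L (\<lambda>z. bracket w (T z)) = tr L (\<lambda>z. bracket a (bracket b (T z)) - bracket b (bracket a (T z)))"
        unfolding ab(1) bracket_bracket ..
      also have "\<dots> = tr L (\<lambda>z. bracket a (bracket b (T z))) - tr L (\<lambda>z. bracket b (bracket a (T z)))"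
        by (rule tr_minus[OF L_sub l2 _ l2]) (use ab L_closed TL in auto)
      also have "tr L (\<lambda>z. bracket b (bracket a (T z))) = tr L (\<lambda>z. bracket a (T (bracket b z)))"
        by (rule tr_commute[OF L_sub bracket_lin _ l]) (use ab L_closed TL in auto)
      also have "\<dots> = tr L (\<lambda>z. bracket a (bracket (T b) z) + bracket a (bracket b (T z)))"
        by (rule tr_cong[OF L_sub]) (simp add: der[OF ab(4)] bracket_simps)
      also have "\<dots> = kf a (T b) + tr L (\<lambda>z. bracket a (bracket b (T z)))"
        unfolding kf_def by (rule tr_add[OF L_sub br2_lin _ l2]) (use ab L_closed TL in auto)
      finally have w0: "tr L (\<lambda>z. bracket w (T z)) = 0" using ab(3)[OF TL[OF ab(4)]] by simp
      have "tr L (\<lambda>z. bracket (scale c w + y) (T z)) = tr L (\<lambda>z. scale c (bracket w (T z)) + bracket y (T z))"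
        unfolding bracket_simps ..
      also have "\<dots> = tr L (\<lambda>z. scale c (bracket w (T z))) + tr L (\<lambda>z. bracket y (T z))"
        by (rule tr_add[OF L_sub lin_on_scale[OF l] _ l]) (use wL step L_closed TL subspace_scale[OF L_sub] in auto)
      also have "tr L (\<lambda>z. scale c (bracket w (T z))) = 0"
        using tr_scale[OF L_sub l, of w c] w0 wL L_closed TL by simp
      finally show ?case using step wL subspace_add[OF L_sub] subspace_scale[OF L_sub] by simp
    qed
    have "tr L (\<lambda>z. bracket x (T z)) = (\<Sum>\<beta>\<in>O.weights. tr (O.weight_space \<beta>) (\<lambda>z. bracket x (T z)))"
      by (rule O.W.tr_direct[OF l])
        (use O.weight_space_A subspace_scale[OF O.weight_space_subspace] in \<open>simp add: Tw bracket_simps\<close>)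
    also have "\<dots> = (\<Sum>\<beta>\<in>O.weights. of_rat (\<phi> (\<beta> x)) * (of_nat (dim (O.weight_space \<beta>)) * \<beta> x))"
    proof (rule sum.cong[OF refl])
      fix \<beta> assume \<beta>: "\<beta> \<in> O.weights"
      have "tr (O.weight_space \<beta>) (\<lambda>z. bracket x (T z)) = tr (O.weight_space \<beta>) (\<lambda>z. scale (of_rat (\<phi> (\<beta> x))) (bracket x z))"
        by (rule tr_cong[OF O.weight_space_subspace]) (simp add: Tw[OF _ \<beta>] bracket_simps)
      also have "\<dots> = of_rat (\<phi> (\<beta> x)) * tr (O.weight_space \<beta>) (bracket x)"
        by (rule tr_scale[OF O.weight_space_subspace bracket_lin]) (use O.weight_space_A in simp)
      finally show "tr (O.weight_space \<beta>) (\<lambda>z. bracket x (T z)) = of_rat (\<phi> (\<beta> x)) * (of_nat (dim (O.weight_space \<beta>)) * \<beta> x)"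
        using O.tr_weight_space by simp
    qed
    finally have "(\<Sum>\<beta>\<in>O.weights. of_rat (\<phi> (\<beta> x)) * (of_nat (dim (O.weight_space \<beta>)) * \<beta> x)) = 0"
      using f[OF x] by simp
    moreover have "\<phi> 0 = 0" using \<phi>(2)[of 0 0] by simp
    moreover have "\<phi> (\<Sum>\<beta>\<in>J. h \<beta>) = (\<Sum>\<beta>\<in>J. \<phi> (h \<beta>))" for J :: "('g \<Rightarrow> 'k) set" and h
      by (induction J rule: infinite_finite_induct) (auto simp: \<phi>(1) \<open>\<phi> 0 = 0\<close>)
    \<comment> \<open>Applying the functional once more turns the vanishing trace into a sum of
      rational squares weighted by dimensions.\<close>
    ultimately have "(\<Sum>\<beta>\<in>O.weights. \<phi> (of_rat (\<phi> (\<beta> x)) * (of_nat (dim (O.weight_space \<beta>)) * \<beta> x))) = 0" by metis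
    moreover have "\<phi> (of_rat (\<phi> (\<beta> x)) * (of_nat (dim (O.weight_space \<beta>)) * \<beta> x)) = of_nat (dim (O.weight_space \<beta>)) * (\<phi> (\<beta> x))\<^sup>2" for \<beta>
      using \<phi>(2)[of "of_nat (dim (O.weight_space \<beta>))" "\<beta> x"] by (simp add: \<phi>(2) power2_eq_square)
    ultimately have "(\<Sum>\<beta>\<in>O.weights. of_nat (dim (O.weight_space \<beta>)) * (\<phi> (\<beta> x))\<^sup>2) = 0" by simp
    then have "of_nat (dim (O.weight_space \<alpha>)) * (\<phi> (\<alpha> x))\<^sup>2 = 0"
      using \<alpha> by (subst (asm) sum_nonneg_eq_0_iff) (auto simp: O.finite_weights)
    then have "dim (O.weight_space \<alpha>) = 0"
      using \<phi>(3) unfolding mult_eq_0_iff power_eq_0_iff of_nat_eq_0_iff by blast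
    moreover have "O.weight_space \<alpha> \<noteq> {0}" using \<alpha> by (simp add: O.weights_def)
    ultimately show False using O.W.dim_pos_W[OF \<alpha>] by linarith
  qed
  have "L \<subseteq> O.weight_space 0"
  proof
    fix z assume z: "z \<in> L"
    have "O.W.proj \<beta> z \<in> O.weight_space 0" if "\<beta> \<in> O.weights" for \<beta>
      using O.W.proj_props(1)[OF z that] O.weight_space_cong[of \<beta> 0] zero[OF that] by simp
    then have "(\<Sum>\<beta>\<in>O.weights. O.W.proj \<beta> z) \<in> O.weight_space 0"
      by (rule subspace_sum[OF O.weight_space_subspace])
    then show "z \<in> O.weight_space 0" using O.W.proj_props(2)[OF z] by simp
  qed
  moreover have "shift (bracket x) 0 = bracket x" by (simp add: fun_eq_iff shift_def)
  ultimately show ?thesis using O.weight_space_nil[of x 0] by auto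
qed

text \<open>The brackets of radical elements with \<open>L\<close> span an ideal \<open>D\<close>
  inside the derived algebra, and its elements are ad-nilpotent. By Engel's theorem a nonzero
  \<open>D\<close> would have a nonzero centre, an abelian ideal of \<open>L\<close> that
  reductivity excludes.\<close>

lemma radical_central:
  assumes a: "a \<in> L" "\<And>y. y \<in> L \<Longrightarrow> kf a y = 0"
  shows "a \<in> center"
proof -
  let ?S = "{bracket a b | a b. a \<in> L \<and> (\<forall>y\<in>L. kf a y = 0) \<and> b \<in> L}"
  define D where "D = span ?S"
  have D: "subspace D" by (simp add: D_def)
  have DL: "D \<subseteq> L" unfolding D_def by (rule span_minimal[OF _ L_sub]) (auto intro: L_closed)
  have DD: "D \<subseteq> derived" unfolding D_def by (rule span_mono) blast
  have ideal: "bracket x d \<in> D" if x: "x \<in> L" and d: "d \<in> D" for x d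
    using d unfolding D_def
  proof (induction rule: span_induct_alt)
    case base
    show ?case unfolding bracket_simps by (rule span_zero)
  next
    case (step c w z)
    then obtain a b where ab: "w = bracket a b" "a \<in> L" "\<And>y. y \<in> L \<Longrightarrow> kf a y = 0" "b \<in> L" by blast
    have "kf (bracket x a) y = 0" if "y \<in> L" for y
    proof -
      have "kf (bracket x a) y = kf x (bracket a y)" using kf_inv x ab that by blast
      also have "\<dots> = kf (bracket a y) x" using kf_sym x ab that L_closed by blast
      also have "\<dots> = kf a (bracket y x)" using kf_inv x ab that by blast
      finally show ?thesis using ab(3) L_closed that x by simp
    qed
    then have 1: "bracket (bracket x a) b \<in> span ?S" by (intro span_base) (use ab x L_closed in blast)
    have 2: "bracket a (bracket x b) \<in> span ?S" by (intro span_base) (use ab x L_closed in blast)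
    have "bracket x w = bracket (bracket x a) b + bracket a (bracket x b)" by (simp add: ab(1) bracket_bracket)
    then have "bracket x w \<in> span ?S" using span_add[OF 1 2] by simp
    then show ?case unfolding bracket_simps by (intro span_add span_scale step)
  qed
  have "D = {0}"
  proof (rule ccontr)
    assume ne: "D \<noteq> {0}"
    have DDL: "bracket x y \<in> D" if "x \<in> D" "y \<in> D" for x y using ideal that DL by blast
    have "kills D L"
    proof (rule engel[OF D DDL L_sub DL])
      show "bracket d v \<in> L" if "d \<in> D" "v \<in> L" for d v using that DL L_closed by blast
      show "\<exists>m. \<forall>v\<in>L. (bracket d ^^ m) v = 0" if "d \<in> D" for d
        using radical_nilpotent[of d] that DL unfolding D_def by blast
    qed
    then have "kills D D" unfolding kills_def using DL by blast
    then obtain v where v: "v \<in> D" "v \<noteq> 0" "\<forall>d\<in>D. bracket d v = 0"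
      using kills_center[OF _ ne subspace_0[OF D] DDL] by blast
    define Z where "Z = {v \<in> D. \<forall>d\<in>D. bracket d v = 0}"
    have "Z = {0}"
    proof (rule L_reductive)
      show "lie_ideal Z L" unfolding lie_ideal_def
      proof (intro conjI ballI)
        show "subspace Z"
          by (rule subspaceI) (auto simp: Z_def bracket_simps subspace_0[OF D] subspace_add[OF D] subspace_scale[OF D])
        show "Z \<subseteq> L" using DL by (auto simp: Z_def)
        fix x y assume x: "x \<in> L" and y: "y \<in> Z"
        have "bracket d (bracket x y) = 0" if d: "d \<in> D" for d
        proof -
          have "bracket x d \<in> D" using ideal[OF x d] .
          then have "bracket d x \<in> D" using subspace_neg[OF D] bracket_swap[of d x] by metis
          then have "bracket (bracket d x) y = 0" "bracket d y = 0" using y d by (auto simp: Z_def)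
          then show ?thesis using bracket_bracket[of d x y] by (simp add: bracket_simps)
        qed
        then show "bracket x y \<in> Z" using ideal[OF x] y by (auto simp: Z_def)
      qed
    qed (use DD in \<open>auto simp: Z_def\<close>)
    then show False using v by (auto simp: Z_def)
  qed
  moreover have "bracket a x \<in> D" if "x \<in> L" for x
    unfolding D_def by (rule span_base) (use a that in blast)
  ultimately have "bracket a x = 0" if "x \<in> L" for x using that by blast
  then have "bracket x a = 0" if "x \<in> L" for x using that bracket_swap[of x a] by simp
  then show ?thesis using a(1) by (simp add: center_def)
qed

end

section \<open>Representing functionals by a nondegenerate form\<close>

context fin_space
begin

text \<open>A basis turns the functional of \<open>t\<close> into the vector with coordinates
  \<open>F t b\<close>. This is an injective endomorphism of \<open>V\<close>, hence surjective, and
  it hits the vector of the values of \<open>f\<close>.\<close>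

lemma functional_representation:
  assumes V: "subspace V" and F: "\<And>x y z. F (x + y) z = F x z + F y z" "\<And>c x y. F (scale c x) y = c * F x y"
    "\<And>x y z. F z (x + y) = F z x + F z y" "\<And>c x y. F y (scale c x) = c * F y x"
    and nondeg: "\<And>x. x \<in> V \<Longrightarrow> (\<And>y. y \<in> V \<Longrightarrow> F x y = 0) \<Longrightarrow> x = 0"
    and f: "\<And>x y. x \<in> V \<Longrightarrow> y \<in> V \<Longrightarrow> f (x + y) = f x + f y" "\<And>c x. x \<in> V \<Longrightarrow> f (scale c x) = c * f x"
  shows "\<exists>t\<in>V. \<forall>v\<in>V. F t v = f v"
proof -
  obtain X where X: "is_basis_of X V" "finite X" "card X = dim V" using subspace_basis[OF V] by metis
  note x = is_basis_ofD[OF X(1)]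
  have F0: "F z 0 = 0" "F 0 z = 0" for z using F(4)[of z 0 0] F(2)[of 0 0 z] by simp_all
  have Fs: "F z (\<Sum>i\<in>J. h i) = (\<Sum>i\<in>J. F z (h i))" for z h and J :: "'b set"
    by (induction J rule: infinite_finite_induct) (auto simp: F F0)
  have Fs': "F (\<Sum>i\<in>J. h i) z = (\<Sum>i\<in>J. F (h i) z)" for z h and J :: "'b set"
    by (induction J rule: infinite_finite_induct) (auto simp: F F0)
  have f0: "f 0 = 0" using f(2)[OF subspace_0[OF V], of 0] by simp
  have fs: "f (\<Sum>i\<in>J. h i) = (\<Sum>i\<in>J. f (h i))" if "\<And>i. i \<in> J \<Longrightarrow> h i \<in> V" for h and J :: "'b set"
    using that by (induction J rule: infinite_finite_induct) (auto simp: f f0 subspace_sum[OF V])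
  define \<Phi> where "\<Phi> t = (\<Sum>b\<in>X. scale (F t b) b)" for t
  have \<Phi>lin: "\<Phi> (\<Sum>i\<in>J. scale (c i) (h i)) = (\<Sum>i\<in>J. scale (c i) (\<Phi> (h i)))" for J :: "'b set" and c h
    by (simp only: \<Phi>_def Fs' F(2) scale_sum_left scale_sum_right scale_scale) (rule sum.swap)
  have inj: "v = 0" if v: "v \<in> V" "\<Phi> v = 0" for v
  proof (rule nondeg[OF v(1)])
    have z: "F v b = 0" if "b \<in> X" for b
      using independentD[OF x(1) X(2) order_refl _ that, of "F v"] v(2) unfolding \<Phi>_def by simp
    fix y assume "y \<in> V"
    then have "F v y = F v (\<Sum>b\<in>X. scale (representation X y b) b)" using basis_expansion[OF X(1,2)] by simp
    then show "F v y = 0" using z by (simp add: Fs F)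
  qed
  have XV: "(\<Sum>b\<in>X. scale (c b) b) \<in> V" for c by (intro subspace_sum[OF V] subspace_scale[OF V] x(4))
  have cz: "\<forall>b\<in>X. c b = 0" if "(\<Sum>b\<in>X. scale (c b) (\<Phi> b)) = 0" for c
  proof -
    have "(\<Sum>b\<in>X. scale (c b) b) = 0" by (rule inj[OF XV]) (use that \<Phi>lin[of c "\<lambda>b. b" X] in simp)
    then show ?thesis using independentD[OF x(1) X(2) order_refl, of c] by simp
  qed
  have i\<Phi>: "inj_on \<Phi> X"
  proof (rule inj_onI, rule ccontr)
    fix a b assume ab: "a \<in> X" "b \<in> X" "\<Phi> a = \<Phi> b" "a \<noteq> b"
    have "(\<Sum>c\<in>X. scale ((if c = a then 1 else 0) - (if c = b then 1 else 0)) (\<Phi> c)) = 0"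
      using X(2) ab by (simp add: scale_left_diff_distrib sum_subtractf if_distrib[of "\<lambda>c. scale c _"] cong: if_cong)
    from bspec[OF cz[OF this] ab(1)] ab(4) show False by simp
  qed
  have "independent (\<Phi> ` X)"
  proof (rule independent_if_scalars_zero)
    fix g u assume "(\<Sum>v\<in>\<Phi> ` X. scale (g v) v) = 0" "u \<in> \<Phi> ` X"
    then show "g u = 0" using cz[of "\<lambda>b. g (\<Phi> b)"] by (auto simp: sum.reindex[OF i\<Phi>])
  qed (use X(2) in simp)
  moreover have "\<Phi> ` X \<subseteq> V" using XV by (auto simp: \<Phi>_def)
  moreover have "dim V \<le> card (\<Phi> ` X)" using card_image[OF i\<Phi>] X(3) by simp
  ultimately have span: "V \<subseteq> span (\<Phi> ` X)" using card_ge_dim_independent by blast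
  define w where "w = (\<Sum>b\<in>X. scale (f b) b)"
  have "w \<in> span (\<Phi> ` X)" unfolding w_def by (rule subsetD[OF span XV])
  then obtain c where "w = (\<Sum>v\<in>\<Phi> ` X. scale (c v) v)" using X(2) by (auto simp: span_finite)
  then have w: "w = \<Phi> (\<Sum>b\<in>X. scale (c (\<Phi> b)) b)"
    using \<Phi>lin[of "\<lambda>b. c (\<Phi> b)" "\<lambda>b. b" X] by (simp add: sum.reindex[OF i\<Phi>])
  let ?t = "\<Sum>b\<in>X. scale (c (\<Phi> b)) b"
  have "(\<Sum>b\<in>X. scale (F ?t b - f b) b) = 0"
    using w unfolding w_def \<Phi>_def by (simp add: scale_left_diff_distrib sum_subtractf)
  then have tb: "F ?t b = f b" if "b \<in> X" for b
    using independentD[OF x(1) X(2) order_refl, of "\<lambda>b. F ?t b - f b" b] that by simp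
  have "F ?t v = f v" if v: "v \<in> V" for v
  proof -
    have "F ?t v = F ?t (\<Sum>b\<in>X. scale (representation X v b) b)" using basis_expansion[OF X(1,2) v] by simp
    also have "\<dots> = (\<Sum>b\<in>X. f (scale (representation X v b) b))" by (simp add: Fs F tb f x(4))
    also have "\<dots> = f (\<Sum>b\<in>X. scale (representation X v b) b)" by (rule fs[symmetric]) (use subspace_scale[OF V] x(4) in simp)
    finally show ?thesis using basis_expansion[OF X(1,2) v] by simp
  qed
  then show ?thesis by (intro bexI[of _ ?t] ballI XV)
qed

end

lemma (in direct_sum) sub_direct_sum:
  fixes J :: "'j set" and g :: "'j \<Rightarrow> 'i"
  assumes J: "finite J" "inj_on g J" "g ` J \<subseteq> I" and U: "\<And>j. j \<in> J \<Longrightarrow> subspace (U j)" "\<And>j. j \<in> J \<Longrightarrow> U j \<subseteq> W (g j)"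
  shows "direct_sum scale Basis {\<Sum>j\<in>J. x j | x. \<forall>j\<in>J. x j \<in> U j} J U"
proof unfold_locales
  fix x j assume x: "\<And>j. j \<in> J \<Longrightarrow> x j \<in> U j" "(\<Sum>j\<in>J. x j) = 0" and j: "j \<in> J"
  let ?y = "\<lambda>i. if i \<in> g ` J then x (the_inv_into J g i) else 0"
  have inv: "the_inv_into J g (g j) = j" if "j \<in> J" for j using the_inv_into_f_f[OF J(2) that] .
  have "(\<Sum>i\<in>I. ?y i) = (\<Sum>i\<in>g ` J. ?y i)" by (rule sum.mono_neutral_right) (use J finite_I in auto)
  also have "\<dots> = (\<Sum>j\<in>J. x j)" by (simp add: sum.reindex[OF J(2)] inv)
  finally have "(\<Sum>i\<in>I. ?y i) = 0" using x(2) by simp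
  moreover have "?y i \<in> W i" if i: "i \<in> I" for i
  proof (cases "i \<in> g ` J")
    case True
    then obtain j where "j \<in> J" "i = g j" by blast
    then show ?thesis using x(1)[of j] U(2)[of j] inv[of j] by auto
  qed (use subspace_0[OF W_subspace[OF i]] in simp)
  ultimately have "?y (g j) = 0" using W_indep[of ?y "g j"] J(3) j by blast
  then show "x j = 0" using j inv by simp
qed (use J U in auto)

section \<open>Weight spaces of a Cartan subalgebra\<close>

locale cartan_setup = reductive_quadratic scale Basis bracket B L
  for scale :: "'k::{alg_closed_field, field_char_0} \<Rightarrow> 'g::ab_group_add \<Rightarrow> 'g" and Basis and bracket and B and L +
  fixes H :: "'g set"
  assumes cartan: "cartan_subalgebra H L"
begin

lemma H_sub: "subspace H" and H_closed: "x \<in> H \<Longrightarrow> y \<in> H \<Longrightarrow> bracket x y \<in> H" and HL: "H \<subseteq> L"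
  and H_nil: "nilpotent H" and H_norm: "x \<in> L \<Longrightarrow> (\<And>h. h \<in> H \<Longrightarrow> bracket x h \<in> H) \<Longrightarrow> x \<in> H"
  using cartan by (auto simp: cartan_subalgebra_def subalgebra_def normalizer_def)

lemma H_ad_nil:
  assumes "h \<in> H" "h' \<in> H"
  shows "\<exists>n. (bracket h ^^ n) h' = 0"
proof -
  obtain n where n: "lower_central H n = {0}" using H_nil by (auto simp: nilpotent_def)
  have "(bracket h ^^ m) h' \<in> lower_central H m" for m
  proof (induction m)
    case (Suc m)
    then show ?case using assms(1) by (auto intro!: span_base)
  qed (simp add: assms)
  then show ?thesis using n by blast
qed

lemma shift0: "shift T 0 = T"
  by (simp add: fun_eq_iff shift_def)

lemma H_gen: "h \<in> H \<Longrightarrow> h' \<in> H \<Longrightarrow> h' \<in> gen_eigenspace L (bracket h) 0"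
  using H_ad_nil HL by (auto simp: gen_eigenspace_def shift0)

sublocale O: operator_family scale Basis L H bracket
proof unfold_locales
  fix h h' c x assume h: "h \<in> H" "h' \<in> H" "x \<in> gen_eigenspace L (bracket h) c"
  then have "h \<in> L" using HL by blast
  from gen_eigenspace_bracket[OF L_sub L_closed this H_gen[OF h(1,2)] h(3)]
  show "bracket h' x \<in> gen_eigenspace L (bracket h) c" by simp
qed (use L_sub L_closed HL bracket_lin in auto)

abbreviation "Wt \<equiv> O.weight_space"
abbreviation "\<Phi> \<equiv> O.weights"

lemma Wt_bracket: "x \<in> Wt \<alpha> \<Longrightarrow> y \<in> Wt \<beta> \<Longrightarrow> bracket x y \<in> Wt (\<alpha> + \<beta>)"
  using gen_eigenspace_bracket[OF L_sub L_closed] HL L_closed by (auto simp: O.weight_space_def)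

text \<open>By Engel's theorem \<open>H\<close> is simultaneously nilpotent on its zero weight
  space. If that were larger than \<open>H\<close>, \<open>last_outside\<close> would produce an
  element outside \<open>H\<close> that normalizes it, against the definition of a Cartan
  subalgebra.\<close>

lemma Wt_0: "Wt 0 = H"
proof
  show sub: "H \<subseteq> Wt 0" using H_gen HL by (auto simp: O.weight_space_def)
  have "kills H (Wt 0)"
  proof (rule engel[OF H_sub H_closed O.weight_space_subspace sub O.weight_space_A])
    show "\<exists>m. \<forall>v\<in>Wt 0. (bracket d ^^ m) v = 0" if "d \<in> H" for d
      using O.weight_space_nil[OF that, of 0] by (simp add: shift0)
  qed
  then obtain N where N: "\<And>ds x. set ds \<subseteq> H \<Longrightarrow> length ds = N \<Longrightarrow> x \<in> Wt 0 \<Longrightarrow> foldr bracket ds x = 0"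
    unfolding kills_def by metis
  show "Wt 0 \<subseteq> H"
  proof (rule ccontr)
    assume "\<not> Wt 0 \<subseteq> H"
    then obtain x where x: "x \<in> Wt 0 - H" by blast
    have "\<exists>y\<in>Wt 0 - H. \<forall>k\<in>H. bracket k y \<in> H"
    proof (rule last_outside[OF x])
      show "foldr bracket ds x \<in> H" if "set ds \<subseteq> H" "length ds = N" for ds
        using N[OF that, of x] x subspace_0[OF H_sub] by auto
    qed (rule O.weight_space_A)
    then obtain y where y: "y \<in> Wt 0" "y \<notin> H" "\<And>k. k \<in> H \<Longrightarrow> bracket k y \<in> H" by blast
    have "bracket y h \<in> H" if "h \<in> H" for h
      using y(3)[OF that] subspace_neg[OF H_sub] bracket_swap[of y h] by simp
    then show False using H_norm y(1,2) O.weight_space_L by blast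
  qed
qed

text \<open>By invariance the sum of the two eigenvalues times \<open>F x y\<close> equals, up to
  sign, the sum of two values in which one argument needs one shift less to vanish; induction
  applies. The hypotheses are restricted to \<open>L\<close> so that the Killing form qualifies
  along with \<open>B\<close>.\<close>

lemma form_orthogonal:
  assumes F: "\<And>x y z. x \<in> L \<Longrightarrow> y \<in> L \<Longrightarrow> z \<in> L \<Longrightarrow> F (x + y) z = F x z + F y z"
    "\<And>c x y. x \<in> L \<Longrightarrow> y \<in> L \<Longrightarrow> F (scale c x) y = c * F x y" "\<And>x y. x \<in> L \<Longrightarrow> y \<in> L \<Longrightarrow> F x y = F y x"
    "\<And>x y z. x \<in> L \<Longrightarrow> y \<in> L \<Longrightarrow> z \<in> L \<Longrightarrow> F (bracket x y) z = F x (bracket y z)"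
    and x: "x \<in> Wt \<alpha>" and y: "y \<in> Wt \<beta>" and h: "h \<in> H" "\<alpha> h + \<beta> h \<noteq> 0"
  shows "F x y = 0"
proof -
  have hL: "h \<in> L" using h HL by blast
  have F': "F z (x + y) = F z x + F z y" "F x (scale c y) = c * F x y" if "x \<in> L" "y \<in> L" "z \<in> L" for x y z c
    using F(1-3) that subspace_add[OF L_sub] subspace_scale[OF L_sub] by metis+
  have skew: "F (bracket h x) y = - F x (bracket h y)" if "x \<in> L" "y \<in> L" for x y
  proof -
    have "F (bracket h x) y = F (scale (- 1) (bracket x h)) y" using bracket_swap[of h x] by simp
    also have "\<dots> = - F (bracket x h) y" using F(2) L_closed that hL by (metis mult_minus1)
    also have "\<dots> = - F x (bracket h y)" using F(4) that hL by simp
    finally show ?thesis .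
  qed
  have sh: "shift (bracket h) c z \<in> L" if "z \<in> L" for c z
    using that L_closed[OF hL] subspace_diff[OF L_sub] subspace_scale[OF L_sub] by (simp add: shift_def)
  have key: "(\<alpha> h + \<beta> h) * F x y = - F (shift (bracket h) (\<alpha> h) x) y - F x (shift (bracket h) (\<beta> h) y)"
    if "x \<in> L" "y \<in> L" for x y
  proof -
    have "F (bracket h x) y = F (shift (bracket h) (\<alpha> h) x + scale (\<alpha> h) x) y" by (simp add: shift_def)
    also have "\<dots> = F (shift (bracket h) (\<alpha> h) x) y + \<alpha> h * F x y"
      using F(1)[OF sh subspace_scale[OF L_sub]] F(2) that by simp
    finally have 1: "F (bracket h x) y = F (shift (bracket h) (\<alpha> h) x) y + \<alpha> h * F x y" .
    have "F x (bracket h y) = F x (shift (bracket h) (\<beta> h) y + scale (\<beta> h) y)" by (simp add: shift_def)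
    also have "\<dots> = F x (shift (bracket h) (\<beta> h) y) + \<beta> h * F x y"
      using F'(1)[OF sh subspace_scale[OF L_sub]] F'(2) that by simp
    finally have 2: "F x (bracket h y) = F x (shift (bracket h) (\<beta> h) y) + \<beta> h * F x y" .
    have "(\<alpha> h + \<beta> h) * F x y = (F (bracket h x) y - F (shift (bracket h) (\<alpha> h) x) y) +
        (F x (bracket h y) - F x (shift (bracket h) (\<beta> h) y))"
      unfolding 1 2 by (simp add: distrib_right)
    then show ?thesis using skew[OF that] by simp
  qed
  have "F x y = 0" if "x \<in> L" "y \<in> L" "(shift (bracket h) (\<alpha> h) ^^ a) x = 0" "(shift (bracket h) (\<beta> h) ^^ b) y = 0" for a b x y
    using that
  proof (induction "a + b" arbitrary: a b x y)
    case 0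
    then show ?case using F(2)[of 0 y 0] by simp
  next
    case (Suc k)
    show ?case
    proof (cases "a = 0 \<or> b = 0")
      case True
      then show ?thesis using Suc.prems F(2)[of 0 y 0] F'(2)[of x 0 0 0] subspace_0[OF L_sub] by auto
    next
      case False
      then obtain a' b' where ab: "a = Suc a'" "b = Suc b'" by (metis not0_implies_Suc)
      have "F (shift (bracket h) (\<alpha> h) x) y = 0"
        by (rule Suc.hyps(1)[of a' b]) (use Suc.hyps(2) Suc.prems sh in \<open>auto simp: ab pow_Suc_right simp del: funpow.simps\<close>)
      moreover have "F x (shift (bracket h) (\<beta> h) y) = 0"
        by (rule Suc.hyps(1)[of a b']) (use Suc.hyps(2) Suc.prems sh in \<open>auto simp: ab pow_Suc_right simp del: funpow.simps\<close>)
      ultimately show ?thesis using key[OF Suc.prems(1,2)] h(2) by simp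
    qed
  qed
  moreover obtain a b where "(shift (bracket h) (\<alpha> h) ^^ a) x = 0" "(shift (bracket h) (\<beta> h) ^^ b) y = 0"
    using x y h(1) unfolding O.weight_space_def gen_eigenspace_def by blast
  ultimately show ?thesis using x y O.weight_space_L by blast
qed

lemma B_orth: "x \<in> Wt \<alpha> \<Longrightarrow> y \<in> Wt \<beta> \<Longrightarrow> h \<in> H \<Longrightarrow> \<alpha> h + \<beta> h \<noteq> 0 \<Longrightarrow> B x y = 0"
  by (rule form_orthogonal[where F = B]; (assumption | rule B_add B_scale B_inv | rule B_sym))

lemma kf_orth: "x \<in> Wt \<alpha> \<Longrightarrow> y \<in> Wt \<beta> \<Longrightarrow> h \<in> H \<Longrightarrow> \<alpha> h + \<beta> h \<noteq> 0 \<Longrightarrow> kf x y = 0"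
  by (rule form_orthogonal[where F = kf]) (auto simp: kf_add kf_scale kf_inv kf_sym)

lemma dim_Wt_pos: "\<alpha> \<in> \<Phi> \<Longrightarrow> dim (Wt \<alpha>) > 0"
proof -
  assume a: "\<alpha> \<in> \<Phi>"
  then have "Wt \<alpha> \<noteq> {0}" by (simp add: O.weights_def)
  then show ?thesis by (rule O.W.dim_pos_W[OF a])
qed

text \<open>The trace of ad h on the weight space is its dimension times the value of the weight.
  Traces are linear and vanish on commutators, and the dimension is invertible in characteristic
  zero.\<close>

lemma weight_linear:
  assumes a: "\<alpha> \<in> \<Phi>"
  shows "h \<in> H \<Longrightarrow> h' \<in> H \<Longrightarrow> \<alpha> (h + h') = \<alpha> h + \<alpha> h'" "h \<in> H \<Longrightarrow> \<alpha> (scale c h) = c * \<alpha> h"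
    "h \<in> H \<Longrightarrow> h' \<in> H \<Longrightarrow> \<alpha> (bracket h h') = 0"
proof -
  have d: "\<not> Wt \<alpha> \<subseteq> {0}"
    using a subspace_0[OF O.weight_space_subspace[of \<alpha>]] unfolding O.weights_def by blast
  note t = O.tr_weight_space[of _ \<alpha>] and A = O.weight_space_A[of _ _ \<alpha>]
  note ws = O.weight_space_subspace[of \<alpha>]
  { assume h: "h \<in> H" "h' \<in> H"
    have "tr (Wt \<alpha>) (bracket (h + h')) = tr (Wt \<alpha>) (bracket h) + tr (Wt \<alpha>) (bracket h')"
      using tr_add[OF ws bracket_lin A bracket_lin A, of h h'] h by (simp add: bracket_simps(1)[symmetric])
    then show "\<alpha> (h + h') = \<alpha> h + \<alpha> h'"
      using t h d subspace_add[OF H_sub h] by (simp add: distrib_left[symmetric])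
    have "tr (Wt \<alpha>) (bracket (bracket h h')) =
        tr (Wt \<alpha>) (\<lambda>z. bracket h (bracket h' z)) - tr (Wt \<alpha>) (\<lambda>z. bracket h' (bracket h z))"
      using tr_minus[OF ws br2_lin _ br2_lin, of h h' h' h] h A by (simp add: bracket_bracket[abs_def])
    also have "tr (Wt \<alpha>) (\<lambda>z. bracket h (bracket h' z)) = tr (Wt \<alpha>) (\<lambda>z. bracket h' (bracket h z))"
      by (rule tr_commute[OF ws bracket_lin _ bracket_lin]) (use A h in auto)
    finally show "\<alpha> (bracket h h') = 0" using t[OF H_closed[OF h]] d by simp
  next
    assume h: "h \<in> H"
    have "tr (Wt \<alpha>) (bracket (scale c h)) = c * tr (Wt \<alpha>) (bracket h)"
      using tr_scale[OF ws bracket_lin A, of h c] h by (simp add: bracket_simps(2)[symmetric])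
    then show "\<alpha> (scale c h) = c * \<alpha> h"
      using t h d subspace_scale[OF H_sub h] by simp
  }
qed

text \<open>On one weight space write ad h as its eigenvalue plus a nilpotent part
  \<open>?S\<close>. In the square of this sum the square of \<open>?S\<close> and the mixed term
  are nilpotent, hence traceless.\<close>

lemma kf_diag:
  assumes h: "h \<in> H"
  shows "kf h h = (\<Sum>\<alpha>\<in>\<Phi>. of_nat (dim (Wt \<alpha>)) * (\<alpha> h)\<^sup>2)"
proof -
  have "kf h h = (\<Sum>\<alpha>\<in>\<Phi>. tr (Wt \<alpha>) (\<lambda>z. bracket h (bracket h z)))"
    unfolding kf_def by (rule O.W.tr_direct[OF br2_lin]) (use O.weight_space_A h in auto)
  also have "\<dots> = (\<Sum>\<alpha>\<in>\<Phi>. of_nat (dim (Wt \<alpha>)) * (\<alpha> h)\<^sup>2)"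
  proof (rule sum.cong[OF refl])
    fix \<alpha>
    note ws = O.weight_space_subspace[of \<alpha>] and A = O.weight_space_A[OF h, of _ \<alpha>]
    let ?S = "shift (bracket h) (\<alpha> h)"
    obtain n where n: "\<forall>x\<in>Wt \<alpha>. (?S ^^ n) x = 0" using O.weight_space_nil[OF h] by blast
    have SA: "?S x \<in> Wt \<alpha>" if "x \<in> Wt \<alpha>" for x using O.weight_space_shift_pow[OF h that, of 1] by simp
    have Sl: "lin_on V ?S" for V using lin_on_minus[OF bracket_lin lin_on_scale[OF lin_on_id]] by (simp add: shift_def[abs_def])
    have "tr (Wt \<alpha>) ?S = 0" by (rule tr_nilpotent[OF ws Sl SA]) (use n in auto)
    have SS: "((\<lambda>z. ?S (?S z)) ^^ m) x = (?S ^^ (2 * m)) x" for m x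
      by (induction m) simp_all
    have SSl: "lin_on (Wt \<alpha>) (\<lambda>z. ?S (?S z))" by (rule lin_on_comp[OF Sl SA Sl])
    have "tr (Wt \<alpha>) (\<lambda>z. ?S (?S z)) = 0"
    proof (rule tr_nilpotent[OF ws SSl])
      fix x assume x: "x \<in> Wt \<alpha>"
      have "?S 0 = 0" by (simp add: shift_def bracket_simps)
      from funpow_mono_zero[OF n[rule_format, OF x] this, of "2 * n"]
      show "((\<lambda>z. ?S (?S z)) ^^ n) x = 0" by (simp add: SS)
    qed (use SA in auto)
    moreover have "tr (Wt \<alpha>) (\<lambda>z. scale (2 * \<alpha> h) (?S z)) = 0"
      using tr_scale[OF ws Sl SA] \<open>tr (Wt \<alpha>) ?S = 0\<close> by simp
    moreover have "tr (Wt \<alpha>) (\<lambda>z. bracket h (bracket h z)) =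
       tr (Wt \<alpha>) (\<lambda>z. ?S (?S z) + (scale (2 * \<alpha> h) (?S z) + scale ((\<alpha> h)\<^sup>2) z))"
    proof (rule tr_cong[OF ws])
      fix z
      have two: "scale (2 * \<alpha> h) v = scale (\<alpha> h) v + scale (\<alpha> h) v" for v
        by (simp only: mult_2 scale_left_distrib)
      show "bracket h (bracket h z) = ?S (?S z) + (scale (2 * \<alpha> h) (?S z) + scale ((\<alpha> h)\<^sup>2) z)"
        unfolding two by (simp add: shift_def bracket_simps scale_right_diff_distrib power2_eq_square)
    qed
    moreover have "\<dots> = tr (Wt \<alpha>) (\<lambda>z. ?S (?S z)) + tr (Wt \<alpha>) (\<lambda>z. scale (2 * \<alpha> h) (?S z) + scale ((\<alpha> h)\<^sup>2) z)"
      by (rule tr_add[OF ws SSl _ lin_on_add[OF lin_on_scale[OF Sl] lin_on_scale[OF lin_on_id]]])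
        (use SA subspace_add[OF ws] subspace_scale[OF ws] in auto)
    moreover have "tr (Wt \<alpha>) (\<lambda>z. scale (2 * \<alpha> h) (?S z) + scale ((\<alpha> h)\<^sup>2) z) =
       tr (Wt \<alpha>) (\<lambda>z. scale (2 * \<alpha> h) (?S z)) + tr (Wt \<alpha>) (\<lambda>z. scale ((\<alpha> h)\<^sup>2) z)"
      by (rule tr_add[OF ws lin_on_scale[OF Sl] _ lin_on_scale[OF lin_on_id]]) (use SA subspace_scale[OF ws] in auto)
    ultimately show "tr (Wt \<alpha>) (\<lambda>z. bracket h (bracket h z)) = of_nat (dim (Wt \<alpha>)) * (\<alpha> h)\<^sup>2"
      using tr_id[OF ws] by simp
  qed
  finally show ?thesis .
qed

text \<open>Adding \<open>n\<close> to an element of \<open>H\<close> changes no value of a weight,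
  so \<open>kf_diag\<close> and polarization make \<open>n\<close> orthogonal to \<open>H\<close>
  under the Killing form. The other weight spaces are orthogonal to \<open>H\<close>, so
  \<open>n\<close> lies in the radical.\<close>

lemma null_central:
  assumes n: "n \<in> H" and z: "\<And>\<alpha>. \<alpha> \<in> \<Phi> \<Longrightarrow> \<alpha> n = 0"
  shows "n \<in> center"
proof (rule radical_central)
  show nL: "n \<in> L" using n HL by blast
  have kH: "kf n h = 0" if h: "h \<in> H" for h
  proof -
    have hL: "h \<in> L" using h HL by blast
    have nh: "n + h \<in> H" using subspace_add[OF H_sub n h] .
    have "kf (n + h) (n + h) = kf h h" "kf n n = 0"
      unfolding kf_diag[OF nh] kf_diag[OF h] kf_diag[OF n]
      by (auto intro!: sum.cong sum.neutral simp: z weight_linear(1)[OF _ n h])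
    moreover have "kf (n + h) (n + h) = kf n n + kf n h + (kf h n + kf h h)"
    proof -
      have nhL: "n + h \<in> L" using subspace_add[OF L_sub nL hL] .
      have "kf (n + h) (n + h) = kf n (n + h) + kf h (n + h)" by (rule kf_add[OF nL hL nhL])
      also have "\<dots> = kf (n + h) n + kf (n + h) h" by (simp only: kf_sym[OF nL nhL] kf_sym[OF hL nhL])
      also have "\<dots> = (kf n n + kf h n) + (kf n h + kf h h)"
        by (simp only: kf_add[OF nL hL nL] kf_add[OF nL hL hL])
      finally show ?thesis by (simp add: add_ac)
    qed
    ultimately have "kf h h = 0 + kf n h + (kf n h + kf h h)" using kf_sym[OF nL hL] by metis
    then have "2 * kf n h = 0" by (simp only: mult_2 add_0_left) (metis add.assoc add_right_cancel add_0_left)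
    then show ?thesis by simp
  qed
  fix y assume y: "y \<in> L"
  note p = O.W.proj_props[OF y]
  have pL: "O.W.proj \<beta> y \<in> L" if "\<beta> \<in> \<Phi>" for \<beta> using p(1)[OF that] O.weight_space_L by blast
  have z: "kf n (O.W.proj \<beta> y) = 0" if b: "\<beta> \<in> \<Phi>" for \<beta>
  proof (cases "\<exists>h\<in>H. \<beta> h \<noteq> 0")
    case True
    then obtain h where h: "h \<in> H" "\<beta> h \<noteq> 0" by blast
    show ?thesis by (rule kf_orth[of n 0 _ \<beta> h]) (use h n Wt_0 p(1)[OF b] in auto)
  next
    case False
    then have "Wt \<beta> = Wt 0" by (intro O.weight_space_cong) auto
    then show ?thesis using kH p(1)[OF b] Wt_0 by blast
  qed
  have "kf (\<Sum>\<beta>\<in>J. O.W.proj \<beta> y) n = 0 \<and> (\<Sum>\<beta>\<in>J. O.W.proj \<beta> y) \<in> L" if "finite J" "J \<subseteq> \<Phi>" for J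
    using that
  proof (induction J)
    case empty
    then show ?case using kf_scale[of 0 n 0] subspace_0[OF L_sub] nL by simp
  next
    case (insert \<beta> J)
    then have b: "\<beta> \<in> \<Phi>" and IH: "kf (\<Sum>\<beta>\<in>J. O.W.proj \<beta> y) n = 0" "(\<Sum>\<beta>\<in>J. O.W.proj \<beta> y) \<in> L" by auto
    have "kf (O.W.proj \<beta> y) n = 0" using z[OF b] kf_sym[OF nL pL[OF b]] by simp
    then show ?case
      unfolding sum.insert[OF insert.hyps] kf_add[OF pL[OF b] IH(2) nL] IH(1)
      using subspace_add[OF L_sub pL[OF b] IH(2)] by simp
  qed
  from this[OF O.finite_weights order_refl] have "kf y n = 0" unfolding p(2)[symmetric] ..
  then show "kf n y = 0" using kf_sym[OF nL y] by simp
qed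

text \<open>All weights vanish on a bracket of elements of \<open>H\<close>, so it is central, and
  it lies in the derived algebra.\<close>

lemma H_abelian: "x \<in> H \<Longrightarrow> y \<in> H \<Longrightarrow> bracket x y = 0"
proof (rule center_derived[OF null_central[OF H_closed]])
  assume "x \<in> H" "y \<in> H"
  then show "bracket x y \<in> derived" using HL by (intro span_base) blast
qed (use weight_linear(3) in auto)

lemma B_H_nondeg:
  assumes h: "h \<in> H" "\<And>x. x \<in> H \<Longrightarrow> B h x = 0"
  shows "h = 0"
proof (rule B_nondeg)
  show "h \<in> L" using h(1) HL by blast
  fix y assume y: "y \<in> L"
  note p = O.W.proj_props[OF y]
  have "B h (O.W.proj \<beta> y) = 0" if b: "\<beta> \<in> \<Phi>" for \<beta>
  proof (cases "\<exists>h\<in>H. \<beta> h \<noteq> 0")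
    case True
    then obtain k where k: "k \<in> H" "\<beta> k \<noteq> 0" by blast
    show ?thesis by (rule B_orth[of h 0 _ \<beta> k]) (use k h Wt_0 p(1)[OF b] in auto)
  next
    case False
    then have "Wt \<beta> = Wt 0" by (intro O.weight_space_cong) auto
    then show ?thesis using h(2) p(1)[OF b] Wt_0 by blast
  qed
  then have "B h (\<Sum>\<beta>\<in>\<Phi>. O.W.proj \<beta> y) = 0" by (simp add: B_sum)
  then show "B h y = 0" using p(2) by simp
qed

lemma form_representative_eqI:
  assumes "t \<in> H" "\<And>h. h \<in> H \<Longrightarrow> B t h = \<alpha> h"
  shows "form_representative B H \<alpha> = t"
  unfolding form_representative_def
proof (rule the_equality)
  fix s assume s: "s \<in> H \<and> (\<forall>x\<in>H. B s x = \<alpha> x)"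
  have "s - t = 0" by (rule B_H_nondeg) (use s assms subspace_diff[OF H_sub] in \<open>auto simp: B_simps\<close>)
  then show "s = t" by simp
qed (use assms in blast)

lemma representative:
  assumes "\<And>h h'. h \<in> H \<Longrightarrow> h' \<in> H \<Longrightarrow> \<alpha> (h + h') = \<alpha> h + \<alpha> h'" "\<And>c h. h \<in> H \<Longrightarrow> \<alpha> (scale c h) = c * \<alpha> h"
  shows "form_representative B H \<alpha> \<in> H" "h \<in> H \<Longrightarrow> B (form_representative B H \<alpha>) h = \<alpha> h"
proof -
  have "\<exists>t\<in>H. \<forall>v\<in>H. B t v = \<alpha> v"
    by (rule functional_representation[where F = B, OF H_sub B_simps(1) B_simps(2) B_simps(3) B_simps(4)])
      (rule B_H_nondeg assms; assumption)+
  then obtain t where t: "t \<in> H" "\<forall>v\<in>H. B t v = \<alpha> v" by blast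
  have "form_representative B H \<alpha> = t" by (rule form_representative_eqI) (use t in auto)
  then show "form_representative B H \<alpha> \<in> H" "h \<in> H \<Longrightarrow> B (form_representative B H \<alpha>) h = \<alpha> h" using t by auto
qed

abbreviation "rp \<equiv> form_representative B H"

lemma rp_weight: "\<alpha> \<in> \<Phi> \<Longrightarrow> rp \<alpha> \<in> H" "\<alpha> \<in> \<Phi> \<Longrightarrow> h \<in> H \<Longrightarrow> B (rp \<alpha>) h = \<alpha> h"
  by (rule representative(1)[OF weight_linear(1,2)]; assumption)
     (rule representative(2)[OF weight_linear(1,2)]; assumption)

end

lemma (in direct_sum) stable:
  assumes T: "lin_on L T" "\<And>i x. i \<in> I \<Longrightarrow> x \<in> W i \<Longrightarrow> T x \<in> L" and v: "v \<in> L"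
  shows "T v \<in> L"
proof -
  note p = proj_props[OF v]
  have "T v = (\<Sum>i\<in>I. T (proj i v))"
    by (subst p(2)) (rule lin_on_sum(1)[OF T(1) L_subspace], use p(1) W_L in blast)
  also have "\<dots> \<in> L" by (rule subspace_sum[OF L_subspace]) (use T(2) p(1) in blast)
  finally show ?thesis .
qed

section \<open>Roots and their root spaces\<close>

context cartan_setup
begin

lemma weight_outside: "\<alpha> \<in> \<Phi> \<Longrightarrow> h \<notin> H \<Longrightarrow> \<alpha> h = 0"
  by (simp add: O.weights_def)

lemma weightI: "x \<in> Wt \<alpha> \<Longrightarrow> x \<noteq> 0 \<Longrightarrow> (\<And>h. h \<notin> H \<Longrightarrow> \<alpha> h = 0) \<Longrightarrow> \<alpha> \<in> \<Phi>"
  by (auto simp: O.weights_def)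

lemma weight_obtain:
  assumes "\<alpha> \<in> \<Phi>"
  obtains x where "x \<in> Wt \<alpha>" "x \<noteq> 0"
  using assms subspace_0[OF O.weight_space_subspace[of \<alpha>]] unfolding O.weights_def by blast

text \<open>All weight spaces except that of - \<alpha> are orthogonal to \<open>e\<close>, so
  nondegeneracy forces a partner there; scaling normalizes the value to 1.\<close>

lemma weight_pairing:
  assumes e: "e \<in> Wt \<alpha>" "e \<noteq> 0" and a: "\<And>h. h \<notin> H \<Longrightarrow> \<alpha> h = 0"
  shows "\<exists>f\<in>Wt (- \<alpha>). B e f = 1"
proof (rule ccontr)
  assume n: "\<not> (\<exists>f\<in>Wt (- \<alpha>). B e f = 1)"
  have z: "B e f = 0" if f: "f \<in> Wt (- \<alpha>)" for f
  proof (rule ccontr)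
    assume nz: "B e f \<noteq> 0"
    have "scale (1 / B e f) f \<in> Wt (- \<alpha>)" using f subspace_scale[OF O.weight_space_subspace] by blast
    moreover have "B e (scale (1 / B e f) f) = 1" using nz by (simp add: B_simps)
    ultimately show False using n by blast
  qed
  have "e = 0"
  proof (rule B_nondeg)
    show "e \<in> L" using e(1) O.weight_space_L by blast
    fix y assume y: "y \<in> L"
    note p = O.W.proj_props[OF y]
    have "B e (O.W.proj \<beta> y) = 0" if b: "\<beta> \<in> \<Phi>" for \<beta>
    proof (cases "\<beta> = - \<alpha>")
      case True
      then show ?thesis using z p(1)[OF b] by simp
    next
      case False
      then obtain h where h: "\<beta> h \<noteq> - \<alpha> h" by (auto simp: fun_eq_iff)
      then have "h \<in> H" using a weight_outside[OF b] by force
      moreover have "\<alpha> h + \<beta> h \<noteq> 0" using h by (metis add.commute eq_neg_iff_add_eq_0)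
      ultimately show ?thesis by (rule B_orth[OF e(1) p(1)[OF b]])
    qed
    then have "B e (\<Sum>\<beta>\<in>\<Phi>. O.W.proj \<beta> y) = 0" by (simp add: B_sum)
    then show "B e y = 0" unfolding p(2)[symmetric] .
  qed
  then show False using e(2) by simp
qed

lemma weight_neg: "\<alpha> \<in> \<Phi> \<Longrightarrow> - \<alpha> \<in> \<Phi>"
proof -
  assume a: "\<alpha> \<in> \<Phi>"
  obtain e where e: "e \<in> Wt \<alpha>" "e \<noteq> 0" using weight_obtain[OF a] .
  obtain f where "f \<in> Wt (- \<alpha>)" "B e f = 1" using weight_pairing[OF e weight_outside[OF a]] by blast
  moreover from this have "f \<noteq> 0" by (auto simp: B_simps)
  ultimately show ?thesis using weight_outside[OF a] by (intro weightI) auto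
qed

text \<open>In a nonzero stable subspace of least dimension the kernel of ad h minus its eigenvalue
  is nonzero by nilpotency and stable because \<open>H\<close> is abelian, hence everything. Genuine
  eigenvectors are thus available before root spaces are known to be lines.\<close>

lemma common_eigenvector:
  assumes a: "\<alpha> \<in> \<Phi>"
  shows "\<exists>x\<in>Wt \<alpha>. x \<noteq> 0 \<and> (\<forall>h\<in>H. bracket h x = scale (\<alpha> h) x)"
proof -
  let ?P = "\<lambda>M. subspace M \<and> M \<subseteq> Wt \<alpha> \<and> (\<exists>x\<in>M. x \<noteq> 0) \<and> (\<forall>h\<in>H. \<forall>x\<in>M. bracket h x \<in> M)"
  have P0: "?P (Wt \<alpha>)" using O.weight_space_subspace O.weight_space_A weight_obtain[OF a] by blast
  obtain M where M: "?P M" and min: "\<And>N. ?P N \<Longrightarrow> dim M \<le> dim N"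
    using ex_has_least_nat[of ?P "Wt \<alpha>" dim, OF P0] by blast
  have Msub: "subspace M" using M by blast
  have "bracket h x = scale (\<alpha> h) x" if h: "h \<in> H" and x: "x \<in> M" for h x
  proof -
    let ?S = "shift (bracket h) (\<alpha> h)"
    define K where "K = {x \<in> M. ?S x = 0}"
    have Sl: "?S (x + y) = ?S x + ?S y" "?S (scale c x) = scale c (?S x)" for x y c
      by (simp_all add: shift_def bracket_simps scale_right_distrib scale_right_diff_distrib mult.commute)
    have SM: "?S x \<in> M" if "x \<in> M" for x
      using M h that subspace_scale[OF Msub] subspace_diff[OF Msub] by (simp add: shift_def)
    obtain n where n: "\<forall>x\<in>Wt \<alpha>. (?S ^^ n) x = 0" using O.weight_space_nil[OF h] by blast
    obtain y where y: "y \<in> M" "y \<noteq> 0" using M by blast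
    \<comment> \<open>The vector just before the first vanishing power is a nonzero element of the
      kernel.\<close>
    define m where "m = (LEAST m. (?S ^^ m) y = 0)"
    have m0: "(?S ^^ m) y = 0" unfolding m_def by (rule LeastI[of _ n]) (use n y M in blast)
    then obtain k where k: "m = Suc k" using y(2) by (cases m) auto
    have "(?S ^^ k) y \<noteq> 0" using not_less_Least[of k "\<lambda>m. (?S ^^ m) y = 0"] k by (simp add: m_def)
    moreover have "(?S ^^ i) y \<in> M" for i by (induction i) (use y SM in auto)
    ultimately have ex: "\<exists>x\<in>K. x \<noteq> 0" using m0 k by (auto simp: K_def)
    have Ksub: "subspace K"
    proof (rule subspaceI)
      show "0 \<in> K" using subspace_0[OF Msub] Sl(2)[of 0 0] by (simp add: K_def)
    qed (auto simp: K_def Sl subspace_add[OF Msub] subspace_scale[OF Msub])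
    have "bracket h' x \<in> K" if h': "h' \<in> H" and x: "x \<in> K" for h' x
    proof -
      have "bracket (bracket h h') x = 0" using H_abelian[OF h h'] by (simp add: bracket_simps)
      then have "bracket h (bracket h' x) = bracket h' (bracket h x)" by (simp add: bracket_bracket)
      moreover have "bracket h x = scale (\<alpha> h) x" using x by (simp add: K_def shift_def)
      ultimately have "?S (bracket h' x) = 0" by (simp add: shift_def bracket_simps)
      then show ?thesis using x M h' by (simp add: K_def)
    qed
    then have "dim M \<le> dim K" using ex Ksub M by (intro min) (auto simp: K_def)
    then have "K = M" by (intro subspace_dim_equal Ksub Msub) (auto simp: K_def)
    then show ?thesis using x by (auto simp: K_def shift_def)
  qed
  then show ?thesis using M by blast
qed

text \<open>The bracket lies in the zero weight space \<open>H\<close>, where it is determined by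
  its pairings with \<open>H\<close>. Only \<open>f\<close> is asked to be a genuine eigenvector;
  \<open>x\<close> may be a generalized one.\<close>

lemma bracket_pair:
  assumes a: "\<alpha> \<in> \<Phi>" and x: "x \<in> Wt \<alpha>" and f: "f \<in> Wt (- \<alpha>)" "\<And>h. h \<in> H \<Longrightarrow> bracket h f = scale (- \<alpha> h) f"
  shows "bracket x f = scale (B x f) (rp \<alpha>)"
proof -
  have "bracket x f \<in> Wt (\<alpha> + - \<alpha>)" by (rule Wt_bracket[OF x f(1)])
  then have xf: "bracket x f \<in> H" using Wt_0 by simp
  have "bracket x f - scale (B x f) (rp \<alpha>) = 0"
  proof (rule B_H_nondeg)
    show "bracket x f - scale (B x f) (rp \<alpha>) \<in> H"
      by (intro subspace_diff[OF H_sub xf] subspace_scale[OF H_sub] rp_weight(1)[OF a])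
    fix h assume h: "h \<in> H"
    have "B (bracket x f) h = B x (bracket f h)" by (rule B_inv)
    also have "bracket f h = scale (\<alpha> h) f" using f(2)[OF h] bracket_swap[of f h] by simp
    finally show "B (bracket x f - scale (B x f) (rp \<alpha>)) h = 0" using rp_weight(2)[OF a h] by (simp add: B_simps)
  qed
  then show ?thesis by simp
qed

lemma root_triple:
  assumes a: "\<alpha> \<in> \<Phi>"
  obtains e f where "e \<in> Wt \<alpha>" "f \<in> Wt (- \<alpha>)" "bracket e f = rp \<alpha>" "f \<noteq> 0"
    "\<And>h. h \<in> H \<Longrightarrow> bracket h f = scale (- \<alpha> h) f"
proof -
  have na: "- \<alpha> \<in> \<Phi>" using weight_neg[OF a] .
  obtain f where f: "f \<in> Wt (- \<alpha>)" "f \<noteq> 0" "\<And>h. h \<in> H \<Longrightarrow> bracket h f = scale ((- \<alpha>) h) f"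
    using common_eigenvector[OF na] by blast
  obtain e where e: "e \<in> Wt (- (- \<alpha>))" "B f e = 1" using weight_pairing[OF f(1,2) weight_outside[OF na]] by blast
  have e': "e \<in> Wt \<alpha>" using e(1) by simp
  have "bracket e f = scale (B e f) (rp \<alpha>)" by (rule bracket_pair[OF a e' f(1)]) (use f(3) in simp)
  then have "bracket e f = rp \<alpha>" using e(2) B_sym[of e f] by simp
  then show ?thesis using that[OF e' f(1) _ f(2)] f(3) by simp
qed

lemma tr_bracket_zero:
  assumes M: "subspace M" and "\<And>v. v \<in> M \<Longrightarrow> bracket e v \<in> M" "\<And>v. v \<in> M \<Longrightarrow> bracket f v \<in> M"
  shows "tr M (bracket (bracket e f)) = 0"
proof -
  have "tr M (bracket (bracket e f)) = tr M (\<lambda>z. bracket e (bracket f z) - bracket f (bracket e z))"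
    by (simp add: bracket_bracket[abs_def])
  also have "\<dots> = tr M (\<lambda>z. bracket e (bracket f z)) - tr M (\<lambda>z. bracket f (bracket e z))"
    by (rule tr_minus[OF M br2_lin _ br2_lin]) (use assms in auto)
  also have "tr M (\<lambda>z. bracket e (bracket f z)) = tr M (\<lambda>z. bracket f (bracket e z))"
    by (rule tr_commute[OF M bracket_lin _ bracket_lin]) (use assms in auto)
  finally show ?thesis by simp
qed

lemma rp_nonzero:
  assumes a: "\<alpha> \<in> \<Phi>" "\<alpha> \<noteq> 0"
  shows "rp \<alpha> \<noteq> 0"
proof
  assume "rp \<alpha> = 0"
  then have "\<alpha> h = 0" for h using rp_weight(2)[OF a(1), of h] weight_outside[OF a(1), of h] by (auto simp: B_simps)
  then show False using a(2) by (auto simp: fun_eq_iff)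
qed

text \<open>If \<open>\<alpha>\<close> vanished at its representative \<open>t\<close>, then \<open>ad t\<close>, being a commutator on the \<open>\<alpha>\<close>-string
  through any weight \<open>\<beta>\<close>, would have trace zero there, so \<open>\<beta> t = 0\<close> and \<open>t\<close> would be central.\<close>

lemma rp_self:
  assumes a: "\<alpha> \<in> \<Phi>" "\<alpha> \<noteq> 0"
  shows "\<alpha> (rp \<alpha>) \<noteq> 0"
proof
  assume z: "\<alpha> (rp \<alpha>) = 0"
  obtain e f where e: "e \<in> Wt \<alpha>" and f: "f \<in> Wt (- \<alpha>)" and t: "bracket e f = rp \<alpha>" using root_triple[OF a(1)] by metis
  note tH = rp_weight(1)[OF a(1)]
  have "\<beta> (rp \<alpha>) = 0" if b: "\<beta> \<in> \<Phi>" for \<beta>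
  proof -
    \<comment> \<open>Integers of both signs make the sum of the weight spaces of this string stable
      under both \<open>e\<close> and \<open>f\<close>.\<close>
    define J where "J = {\<gamma> \<in> \<Phi>. \<exists>n::int. \<forall>h. \<gamma> h = \<beta> h + of_int n * \<alpha> h}"
    have J: "J \<subseteq> \<Phi>" by (auto simp: J_def)
    have bJ: "\<beta> \<in> J" using b by (auto simp: J_def intro!: exI[of _ 0])
    have fJ: "finite J" using finite_subset[OF J O.finite_weights] .
    define M where "M = {\<Sum>j\<in>J. x j | x. \<forall>j\<in>J. x j \<in> Wt j}"
    interpret M: direct_sum scale Basis M J Wt
      unfolding M_def by (rule O.W.sub_direct_sum[where g = "\<lambda>x. x"]) (use J fJ O.weight_space_subspace in auto)
    have st: "bracket y v \<in> M" if y: "y \<in> Wt \<delta>" "\<And>h. \<delta> h = of_int k * \<alpha> h" and v: "v \<in> M" for y \<delta> k v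
    proof (rule M.stable[OF bracket_lin _ v])
      fix \<gamma> x assume g: "\<gamma> \<in> J" "x \<in> Wt \<gamma>"
      have yx: "bracket y x \<in> Wt (\<delta> + \<gamma>)" by (rule Wt_bracket[OF y(1) g(2)])
      show "bracket y x \<in> M"
      proof (cases "bracket y x = 0")
        case True
        then show ?thesis using subspace_0[OF M.L_subspace] by simp
      next
        case False
        obtain n :: int where n: "\<gamma> h = \<beta> h + of_int n * \<alpha> h" for h using g(1) unfolding J_def by blast
        have "\<delta> + \<gamma> \<in> \<Phi>" by (rule weightI[OF yx False]) (use weight_outside[OF a(1)] weight_outside[OF b] y(2) n in simp)
        moreover have "(\<delta> + \<gamma>) h = \<beta> h + of_int (n + k) * \<alpha> h" for h by (simp add: y(2) n distrib_right)
        ultimately have "\<delta> + \<gamma> \<in> J" unfolding J_def by blast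
        then show ?thesis using M.W_L yx by blast
      qed
    qed
    have "tr M (bracket (rp \<alpha>)) = 0"
      unfolding t[symmetric] by (rule tr_bracket_zero[OF M.L_subspace]) (use st[OF e, of 1] st[OF f, of "- 1"] in auto)
    moreover have "tr M (bracket (rp \<alpha>)) = (\<Sum>\<gamma>\<in>J. tr (Wt \<gamma>) (bracket (rp \<alpha>)))"
      by (rule M.tr_direct[OF bracket_lin]) (use O.weight_space_A[OF tH] in auto)
    moreover have "\<dots> = (\<Sum>\<gamma>\<in>J. of_nat (dim (Wt \<gamma>)) * \<beta> (rp \<alpha>))"
    proof (rule sum.cong[OF refl])
      fix \<gamma> assume "\<gamma> \<in> J"
      then obtain n :: int where n: "\<gamma> h = \<beta> h + of_int n * \<alpha> h" for h unfolding J_def by blast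
      show "tr (Wt \<gamma>) (bracket (rp \<alpha>)) = of_nat (dim (Wt \<gamma>)) * \<beta> (rp \<alpha>)"
        using O.tr_weight_space[OF tH, of \<gamma>] n[of "rp \<alpha>"] z by simp
    qed
    \<comment> \<open>Every weight of the string takes the same value as \<beta> at the
      representative, since \<alpha> is zero there; the total dimension is a positive integer, so
      this value is zero.\<close>
    ultimately have "of_nat (\<Sum>\<gamma>\<in>J. dim (Wt \<gamma>)) * \<beta> (rp \<alpha>) = 0" by (simp add: sum_distrib_right)
    moreover have "dim (Wt \<beta>) \<le> (\<Sum>\<gamma>\<in>J. dim (Wt \<gamma>))" by (rule member_le_sum[OF bJ _ fJ]) simp
    then have "(\<Sum>\<gamma>\<in>J. dim (Wt \<gamma>)) \<noteq> 0" using dim_Wt_pos[OF b] by linarith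
    ultimately show ?thesis unfolding mult_eq_0_iff of_nat_eq_0_iff by blast
  qed
  then have "rp \<alpha> \<in> center" by (rule null_central[OF tH])
  moreover have "rp \<alpha> \<in> derived" unfolding t[symmetric]
    by (rule span_base) (use e f O.weight_space_L in blast)
  ultimately show False using center_derived rp_nonzero[OF a] by blast
qed

text \<open>The trace of \<open>ad t\<close> vanishes on \<open>k f + k t\<close> plus the sum of the weight spaces of the positive
  multiples of \<open>\<alpha>\<close>.\<close>

lemma dim_root:
  assumes a: "\<alpha> \<in> \<Phi>" "\<alpha> \<noteq> 0"
  shows "dim (Wt \<alpha>) = 1"
proof -
  obtain e f where e: "e \<in> Wt \<alpha>" and f: "f \<in> Wt (- \<alpha>)" "f \<noteq> 0" "\<And>h. h \<in> H \<Longrightarrow> bracket h f = scale (- \<alpha> h) f"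
    and ef: "bracket e f = rp \<alpha>" using root_triple[OF a(1)] by metis
  define t where "t = rp \<alpha>"
  note tH = rp_weight(1)[OF a(1), folded t_def] and nz = rp_self[OF a, folded t_def] and t0 = rp_nonzero[OF a, folded t_def]
  define K where "K = {\<gamma> \<in> \<Phi>. \<exists>n. n > 0 \<and> (\<forall>h. \<gamma> h = of_nat n * \<alpha> h)}"
  define J where "J = insert (- \<alpha>) (insert 0 K)"
  \<comment> \<open>Only the line of \<open>f\<close> is kept from the weight space of - \<alpha>
    and only the line of \<open>t\<close> from \<open>H\<close>, so that their traces are
    known.\<close>
  define U where "U \<gamma> = (if \<gamma> = - \<alpha> then span {f} else if \<gamma> = 0 then span {t} else Wt \<gamma>)" for \<gamma>
  have fK: "finite K" by (rule finite_subset[OF _ O.finite_weights]) (auto simp: K_def)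
  have aK: "\<alpha> \<in> K" using a by (auto simp: K_def intro!: exI[of _ 1])
  have K0: "0 \<notin> K" using nz by (auto simp: K_def dest!: spec[of _ t])
  have Kn: "- \<alpha> \<notin> K"
  proof
    assume "- \<alpha> \<in> K"
    then obtain n where "(- \<alpha>) t = of_nat n * \<alpha> t" unfolding K_def by blast
    then have "of_nat n * \<alpha> t = - \<alpha> t" by simp
    then have "of_nat (Suc n) * \<alpha> t = 0" by (simp add: distrib_right)
    then show False using nz by (simp del: of_nat_Suc)
  qed
  have n0: "- \<alpha> \<noteq> 0" using a(2) by simp
  have U1: "U (- \<alpha>) = span {f}" and U2: "U 0 = span {t}" and U3: "\<gamma> \<in> K \<Longrightarrow> U \<gamma> = Wt \<gamma>" for \<gamma>
    using n0 K0 Kn by (auto simp: U_def)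
  have t00: "t \<in> Wt 0" using tH Wt_0 by simp
  have z\<Phi>: "0 \<in> \<Phi>" by (rule weightI[OF t00 t0]) simp
  define M where "M = {\<Sum>j\<in>J. x j | x. \<forall>j\<in>J. x j \<in> U j}"
  interpret M: direct_sum scale Basis M J U
    unfolding M_def
  proof (rule O.W.sub_direct_sum[where g = "\<lambda>x. x"])
    show "(\<lambda>x. x) ` J \<subseteq> \<Phi>" using z\<Phi> weight_neg[OF a(1)] by (auto simp: J_def K_def)
    show "subspace (U j)" for j by (simp add: U_def O.weight_space_subspace)
    show "U j \<subseteq> Wt j" for j
      using span_minimal[of "{f}" "Wt (- \<alpha>)"] span_minimal[of "{t}" "Wt 0"] f(1) t00 O.weight_space_subspace
      by (simp add: U_def)
  qed (use fK in \<open>auto simp: J_def\<close>)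
  have Msc: "scale c v \<in> M" if "v \<in> M" for c v by (rule subspace_scale[OF M.L_subspace that])
  have KM: "v \<in> M" if "v \<in> Wt \<gamma>" "\<gamma> \<in> K" for v \<gamma> using M.W_L[of \<gamma>] that U3 by (auto simp: J_def)
  have fM: "f \<in> M" using M.W_L[of "- \<alpha>"] span_base[of f "{f}"] U1 by (auto simp: J_def)
  have tM: "t \<in> M" using M.W_L[of 0] span_base[of t "{t}"] U2 by (auto simp: J_def)
  have eM: "bracket e v \<in> M" if "v \<in> M" for v
  proof (rule M.stable[OF bracket_lin _ that])
    fix \<gamma> x assume g: "\<gamma> \<in> J" "x \<in> U \<gamma>"
    then consider "\<gamma> = - \<alpha>" "x \<in> span {f}" | "\<gamma> = 0" "x \<in> span {t}" | "\<gamma> \<in> K" "x \<in> Wt \<gamma>"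
      unfolding J_def using U1 U2 U3 by blast
    then show "bracket e x \<in> M"
    proof cases
      case 1
      then obtain c where "x = scale c f" by (auto simp: span_singleton)
      then show ?thesis using ef Msc[OF tM] by (simp add: bracket_simps t_def)
    next
      case 2
      then obtain c where c: "x = scale c t" by (auto simp: span_singleton)
      have "bracket t e \<in> M" by (rule KM[OF O.weight_space_A[OF tH e] aK])
      then have "bracket e t \<in> M" using Msc[of "bracket t e" "- 1"] bracket_swap[of e t] by simp
      then show ?thesis using Msc by (simp add: bracket_simps c)
    next
      case 3
      have ex: "bracket e x \<in> Wt (\<alpha> + \<gamma>)" by (rule Wt_bracket[OF e 3(2)])
      obtain n where n: "\<gamma> h = of_nat n * \<alpha> h" for h using 3(1) unfolding K_def by blast
      show ?thesis
      proof (cases "bracket e x = 0")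
        case False
        have "\<alpha> + \<gamma> \<in> \<Phi>" by (rule weightI[OF ex False]) (use weight_outside[OF a(1)] n in simp)
        moreover have "(\<alpha> + \<gamma>) h = of_nat (Suc n) * \<alpha> h" for h by (simp add: n distrib_right)
        ultimately have "\<alpha> + \<gamma> \<in> K" unfolding K_def by blast
        then show ?thesis using KM[OF ex] by simp
      qed (simp add: subspace_0[OF M.L_subspace])
    qed
  qed
  have fM': "bracket f v \<in> M" if "v \<in> M" for v
  proof (rule M.stable[OF bracket_lin _ that])
    fix \<gamma> x assume g: "\<gamma> \<in> J" "x \<in> U \<gamma>"
    then consider "\<gamma> = - \<alpha>" "x \<in> span {f}" | "\<gamma> = 0" "x \<in> span {t}" | "\<gamma> \<in> K" "x \<in> Wt \<gamma>"
      unfolding J_def using U1 U2 U3 by blast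
    then show "bracket f x \<in> M"
    proof cases
      case 1
      then obtain c where "x = scale c f" by (auto simp: span_singleton)
      then show ?thesis using subspace_0[OF M.L_subspace] by (simp add: bracket_simps bracket_self)
    next
      case 2
      then obtain c where c: "x = scale c t" by (auto simp: span_singleton)
      have "bracket f t = scale (\<alpha> t) f" using f(3)[OF tH] bracket_swap[of f t] by simp
      then show ?thesis using Msc[OF Msc[OF fM]] by (simp only: bracket_simps c)
    next
      case 3
      have fx: "bracket f x \<in> Wt (- \<alpha> + \<gamma>)" by (rule Wt_bracket[OF f(1) 3(2)])
      obtain n where n: "n > 0" "\<gamma> h = of_nat n * \<alpha> h" for h using 3(1) unfolding K_def by blast
      show ?thesis
      \<comment> \<open>For n = 1 the bracket has to land in the line of \<open>t\<close>, not
        merely in \<open>H\<close>; \<open>bracket_pair\<close> provides this because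
        \<open>f\<close> is a genuine eigenvector.\<close>
      proof (cases "n = 1")
        case True
        then have "\<gamma> = \<alpha>" using n(2) by (simp add: fun_eq_iff)
        then have "bracket x f = scale (B x f) t" using bracket_pair[OF a(1) _ f(1,3)] 3(2) by (simp add: t_def)
        then have "bracket f x = scale (- B x f) t" using bracket_swap[of f x] by simp
        then show ?thesis using Msc[OF tM, of "- B x f"] by simp
      next
        case False
        then obtain m where m: "n = Suc m" "m > 0" using n(1) by (cases n) auto
        show ?thesis
        proof (cases "bracket f x = 0")
          case False
          have "- \<alpha> + \<gamma> \<in> \<Phi>" by (rule weightI[OF fx False]) (use weight_outside[OF a(1)] n in simp)
          moreover have "(- \<alpha> + \<gamma>) h = of_nat m * \<alpha> h" for h by (simp add: n m distrib_right)
          ultimately have "- \<alpha> + \<gamma> \<in> K" using m(2) unfolding K_def by blast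
          then show ?thesis using KM[OF fx] by simp
        qed (simp add: subspace_0[OF M.L_subspace])
      qed
    qed
  qed
  define \<nu> where "\<nu> \<gamma> = (SOME n. n > 0 \<and> (\<forall>h. \<gamma> h = of_nat n * \<alpha> h))" for \<gamma>
  have \<nu>: "\<nu> \<gamma> > 0" "\<gamma> h = of_nat (\<nu> \<gamma>) * \<alpha> h" if "\<gamma> \<in> K" for \<gamma> h
    using someI_ex[of "\<lambda>n. n > 0 \<and> (\<forall>h. \<gamma> h = of_nat n * \<alpha> h)"] that unfolding K_def \<nu>_def by blast+
  have "0 = tr M (bracket t)"
    using tr_bracket_zero[OF M.L_subspace eM fM'] by (simp add: ef t_def)
  also have "\<dots> = (\<Sum>\<gamma>\<in>J. tr (U \<gamma>) (bracket t))"
  proof (rule M.tr_direct[OF bracket_lin])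
    fix x \<gamma> assume "\<gamma> \<in> J" "x \<in> U \<gamma>"
    then consider "\<gamma> = - \<alpha>" "x \<in> span {f}" | "\<gamma> = 0" "x \<in> span {t}" | "\<gamma> \<in> K" "x \<in> Wt \<gamma>"
      unfolding J_def using U1 U2 U3 by blast
    then show "bracket t x \<in> U \<gamma>"
    proof cases
      case 1
      then obtain c where "x = scale c f" by (auto simp: span_singleton)
      then have "bracket t x = scale (c * - \<alpha> t) f" using f(3)[OF tH] by (simp add: bracket_simps)
      then show ?thesis using 1 U1 span_scale[OF span_base[of f "{f}"], of "- (c * \<alpha> t)"] by simp
    next
      case 2
      then obtain c where "x = scale c t" by (auto simp: span_singleton)
      then show ?thesis using 2 U2 by (simp add: bracket_simps bracket_self span_zero)
    next
      case 3
      then show ?thesis using U3 O.weight_space_A[OF tH] by simp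
    qed
  qed
  also have "\<dots> = tr (span {f}) (bracket t) + (tr (span {t}) (bracket t) + (\<Sum>\<gamma>\<in>K. tr (Wt \<gamma>) (bracket t)))"
    unfolding J_def using fK n0 K0 Kn U1 U2 U3 by simp
  also have "tr (span {f}) (bracket t) = tr (span {f}) (\<lambda>z. scale (- \<alpha> t) z)"
    by (rule tr_cong[OF subspace_span]) (use f(3)[OF tH] in \<open>auto simp: span_singleton bracket_simps mult.commute\<close>)
  also have "\<dots> = - \<alpha> t" unfolding tr_id[OF subspace_span] using f(2) by simp
  also have "tr (span {t}) (bracket t) = tr (span {t}) (\<lambda>z. scale 0 z)"
    by (rule tr_cong[OF subspace_span]) (auto simp: span_singleton bracket_simps bracket_self)
  also have "\<dots> = 0" unfolding tr_id[OF subspace_span] by simp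
  also have "(\<Sum>\<gamma>\<in>K. tr (Wt \<gamma>) (bracket t)) = (\<Sum>\<gamma>\<in>K. of_nat (dim (Wt \<gamma>) * \<nu> \<gamma>) * \<alpha> t)"
    by (rule sum.cong[OF refl]) (use \<nu>(2) in \<open>simp add: O.tr_weight_space[OF tH] mult.assoc\<close>)
  also have "\<dots> = of_nat (\<Sum>\<gamma>\<in>K. dim (Wt \<gamma>) * \<nu> \<gamma>) * \<alpha> t" by (simp add: sum_distrib_right)
  \<comment> \<open>After cancelling \<alpha> t the multiples n of \<alpha>, weighted by the
    dimensions of their weight spaces, add up to 1. These are natural numbers and \<alpha> itself
    contributes at least 1, so its dimension is 1.\<close>
  finally have "of_nat (\<Sum>\<gamma>\<in>K. dim (Wt \<gamma>) * \<nu> \<gamma>) * \<alpha> t = 1 * \<alpha> t" by simp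
  then have "(of_nat (\<Sum>\<gamma>\<in>K. dim (Wt \<gamma>) * \<nu> \<gamma>) :: 'k) = of_nat 1" using nz by (simp del: of_nat_sum)
  then have "(\<Sum>\<gamma>\<in>K. dim (Wt \<gamma>) * \<nu> \<gamma>) = 1" unfolding of_nat_eq_iff .
  moreover have "dim (Wt \<alpha>) * \<nu> \<alpha> \<le> (\<Sum>\<gamma>\<in>K. dim (Wt \<gamma>) * \<nu> \<gamma>)" by (rule member_le_sum[OF aK _ fK]) simp
  moreover have "dim (Wt \<alpha>) * 1 \<le> dim (Wt \<alpha>) * \<nu> \<alpha>" by (rule mult_le_mono2) (use \<nu>(1)[OF aK] in linarith)
  ultimately show ?thesis using dim_Wt_pos[OF a(1)] by linarith
qed

lemma root_space_span:
  assumes a: "\<alpha> \<in> \<Phi>" "\<alpha> \<noteq> 0" and x: "x \<in> Wt \<alpha>" "x \<noteq> 0"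
  shows "Wt \<alpha> = span {x}"
proof (rule subspace_dim_equal[symmetric, OF subspace_span O.weight_space_subspace])
  show "span {x} \<subseteq> Wt \<alpha>" by (rule span_minimal[OF _ O.weight_space_subspace]) (use x in simp)
  show "dim (Wt \<alpha>) \<le> dim (span {x})" unfolding dim_root[OF a] using x(2) by simp
qed

lemma bracket_root:
  assumes a: "\<alpha> \<in> \<Phi>" "\<alpha> \<noteq> 0" and x: "x \<in> Wt \<alpha>" and h: "h \<in> H"
  shows "bracket h x = scale (\<alpha> h) x"
proof -
  obtain v where v: "v \<in> Wt \<alpha>" "v \<noteq> 0" "\<And>h. h \<in> H \<Longrightarrow> bracket h v = scale (\<alpha> h) v"
    using common_eigenvector[OF a(1)] by blast
  have "x \<in> span {v}" using root_space_span[OF a v(1,2)] x by simp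
  then obtain c where "x = scale c v" by (auto simp: span_singleton)
  then show ?thesis using v(3)[OF h] by (simp add: bracket_simps mult.commute)
qed

text \<open>Root spaces consist of genuine eigenvectors, weight spaces of generalized ones; a common
  eigenvector in each weight space bridges the two notions.\<close>

lemma roots_eq: "roots H L = \<Phi> - {0}"
proof (rule equalityI; rule subsetI)
  fix \<alpha> assume "\<alpha> \<in> roots H L"
  then have d: "\<alpha> \<in> dual_space H" "\<alpha> \<noteq> 0" "root_space H L \<alpha> \<noteq> {0}" by (auto simp: roots_def)
  have "0 \<in> root_space H L \<alpha>" using subspace_0[OF L_sub] by (simp add: root_space_def bracket_simps)
  then obtain x where x: "x \<in> root_space H L \<alpha>" "x \<noteq> 0" using d(3) by blast
  have "x \<in> gen_eigenspace L (bracket h) (\<alpha> h)" if "h \<in> H" for h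
    using x(1) that by (auto simp: root_space_def gen_eigenspace_def shift_def intro!: exI[of _ 1])
  then have "x \<in> Wt \<alpha>" using x(1) by (auto simp: O.weight_space_def root_space_def)
  then have "\<alpha> \<in> \<Phi>" by (rule weightI[OF _ x(2)]) (use d(1) in \<open>auto simp: dual_space_def\<close>)
  then show "\<alpha> \<in> \<Phi> - {0}" using d(2) by simp
next
  fix \<alpha> assume a: "\<alpha> \<in> \<Phi> - {0}"
  obtain v where v: "v \<in> Wt \<alpha>" "v \<noteq> 0" "\<And>h. h \<in> H \<Longrightarrow> bracket h v = scale (\<alpha> h) v"
    using common_eigenvector a by blast
  have "v \<in> root_space H L \<alpha>" using v O.weight_space_L by (auto simp: root_space_def)
  moreover have "\<alpha> \<in> dual_space H"
    using weight_linear(1,2)[of \<alpha>] weight_outside[of \<alpha>] a by (simp add: dual_space_def)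
  ultimately show "\<alpha> \<in> roots H L" using v(2) a by (auto simp: roots_def)
qed

end

section \<open>Casimir traces and the strange formula\<close>

context fin_quadratic
begin

text \<open>Dual bases, encoded by the expansion that they provide. Indexed families allow the pairs
  of two summands to be joined over a disjoint sum of index types.\<close>

definition dual_pair :: "'g set \<Rightarrow> 'i set \<Rightarrow> ('i \<Rightarrow> 'g) \<Rightarrow> ('i \<Rightarrow> 'g) \<Rightarrow> bool" where
  "dual_pair L I u v \<longleftrightarrow> finite I \<and> (\<forall>i\<in>I. u i \<in> L \<and> v i \<in> L) \<and> (\<forall>x\<in>L. (\<Sum>i\<in>I. scale (B x (v i)) (u i)) = x)"

lemma dual_pairD:
  assumes "dual_pair L I u v"
  shows "finite I" "i \<in> I \<Longrightarrow> u i \<in> L" "i \<in> I \<Longrightarrow> v i \<in> L" "x \<in> L \<Longrightarrow> (\<Sum>i\<in>I. scale (B x (v i)) (u i)) = x"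
  using assms by (auto simp: dual_pair_def)

lemma dual_pair_form:
  assumes "dual_pair L I u v" "x \<in> L"
  shows "(\<Sum>i\<in>I. B x (v i) * B (u i) y) = B x y"
proof -
  have "B x y = B (\<Sum>i\<in>I. scale (B x (v i)) (u i)) y" using dual_pairD(4)[OF assms] by simp
  then show ?thesis by (simp add: B_sum B_simps)
qed

text \<open>A dual pair carries its own nondegeneracy: an element of \<open>L\<close> orthogonal to
  all \<open>v i\<close> has zero expansion. Testing the swapped expansion against \<open>L\<close>
  therefore suffices.\<close>

lemma dual_pair_swap:
  assumes d: "dual_pair L I u v" and L: "subspace L"
  shows "dual_pair L I v u"
  unfolding dual_pair_def
proof (intro conjI ballI)
  note dd = dual_pairD[OF d]
  show "finite I" "\<And>i. i \<in> I \<Longrightarrow> v i \<in> L" "\<And>i. i \<in> I \<Longrightarrow> u i \<in> L" by (rule dd; assumption?)+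
  fix x assume x: "x \<in> L"
  let ?y = "\<Sum>i\<in>I. scale (B x (u i)) (v i)"
  have yL: "?y \<in> L" by (intro subspace_sum[OF L] subspace_scale[OF L] dd(3))
  have "B ?y z = B x z" if z: "z \<in> L" for z
  proof -
    have "B ?y z = (\<Sum>i\<in>I. B z (v i) * B (u i) x)" by (simp add: B_sum B_simps B_sym[of z] B_sym[of x] mult.commute)
    also have "\<dots> = B x z" unfolding dual_pair_form[OF d z] by (rule B_sym)
    finally show ?thesis .
  qed
  then have "B (?y - x) (v i) = 0" if "i \<in> I" for i using dd(3)[OF that] by (simp add: B_simps)
  then have "(\<Sum>i\<in>I. scale (B (?y - x) (v i)) (u i)) = 0" by simp
  then have "?y - x = 0" using dd(4)[OF subspace_diff[OF L yL x]] by simp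
  then show "?y = x" by simp
qed

definition bilin :: "('g \<Rightarrow> 'g \<Rightarrow> 'k) \<Rightarrow> bool" where
  "bilin F \<longleftrightarrow> (\<forall>x y z c. F (x + y) z = F x z + F y z \<and> F (scale c x) z = c * F x z \<and>
     F z (x + y) = F z x + F z y \<and> F z (scale c x) = c * F z x)"

lemma bilin_sum:
  assumes "bilin F"
  shows "F (\<Sum>i\<in>I. scale (c i) (x i)) z = (\<Sum>i\<in>I. c i * F (x i) z)" "F z (\<Sum>i\<in>I. scale (c i) (x i)) = (\<Sum>i\<in>I. c i * F z (x i))"
proof -
  have F: "F (x + y) z = F x z + F y z" "F (scale c x) z = c * F x z" "F z (x + y) = F z x + F z y" "F z (scale c x) = c * F z x" for x y z c
    using assms unfolding bilin_def by blast+
  have 0: "F 0 z = 0" "F z 0 = 0" for z using F(2)[of 0 0 z] F(4)[of z 0 0] by simp_all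
  show "F (\<Sum>i\<in>I. scale (c i) (x i)) z = (\<Sum>i\<in>I. c i * F (x i) z)"
    by (induction I rule: infinite_finite_induct) (simp_all add: F 0)
  show "F z (\<Sum>i\<in>I. scale (c i) (x i)) = (\<Sum>i\<in>I. c i * F z (x i))"
    by (induction I rule: infinite_finite_induct) (simp_all add: F 0)
qed

text \<open>The tensor formed from a dual pair is canonical: expand the first family of one pair in
  the other pair and move the coefficients to the second factor.\<close>

lemma dual_pair_independent:
  assumes F: "bilin F" and L: "subspace L" and d: "dual_pair L I u v" and d': "dual_pair L J u' v'"
  shows "(\<Sum>i\<in>I. F (u i) (v i)) = (\<Sum>j\<in>J. F (u' j) (v' j))"
proof -
  note dd = dual_pairD[OF d] and dd' = dual_pairD[OF d'] and sw = dual_pairD[OF dual_pair_swap[OF d' L]]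
  have "(\<Sum>j\<in>J. F (u' j) (v' j)) = (\<Sum>j\<in>J. F (\<Sum>i\<in>I. scale (B (u' j) (v i)) (u i)) (v' j))"
    by (rule sum.cong[OF refl]) (simp add: dd(4) dd'(2))
  also have "\<dots> = (\<Sum>j\<in>J. \<Sum>i\<in>I. B (u' j) (v i) * F (u i) (v' j))" by (simp add: bilin_sum[OF F])
  also have "\<dots> = (\<Sum>i\<in>I. \<Sum>j\<in>J. B (v i) (u' j) * F (u i) (v' j))"
    by (subst sum.swap) (intro sum.cong refl arg_cong2[of _ _ _ _ "(*)"] B_sym)
  also have "\<dots> = (\<Sum>i\<in>I. F (u i) (\<Sum>j\<in>J. scale (B (v i) (u' j)) (v' j)))" by (simp add: bilin_sum[OF F])
  also have "\<dots> = (\<Sum>i\<in>I. F (u i) (v i))" by (rule sum.cong[OF refl]) (simp add: dd(3) sw(4))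
  finally show ?thesis by simp
qed

lemma dual_pair_join:
  assumes d: "dual_pair K I u v" and d': "dual_pair P J u' v'" and orth: "\<And>x y. x \<in> K \<Longrightarrow> y \<in> P \<Longrightarrow> B x y = 0"
    and L: "L = {x + y | x y. x \<in> K \<and> y \<in> P}" and K: "subspace K" and P: "subspace P"
  shows "dual_pair L (I <+> J) (case_sum u u') (case_sum v v')"
  unfolding dual_pair_def
proof (intro conjI ballI)
  note dd = dual_pairD[OF d] and dd' = dual_pairD[OF d']
  have KL: "x \<in> L" if "x \<in> K" for x unfolding L using that subspace_0[OF P] by force
  have PL: "x \<in> L" if "x \<in> P" for x unfolding L using that subspace_0[OF K] by force
  show "finite (I <+> J)" using dd(1) dd'(1) by simp
  show "case_sum u u' i \<in> L" "case_sum v v' i \<in> L" if "i \<in> I <+> J" for i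
    using that KL PL dd(2,3) dd'(2,3) by auto
  fix x assume "x \<in> L"
  then obtain a b where x: "x = a + b" "a \<in> K" "b \<in> P" unfolding L by blast
  have 1: "B x (v i) = B a (v i)" if "i \<in> I" for i
    using orth[OF dd(3)[OF that] x(3)] B_sym[of b] by (simp add: x(1) B_simps)
  have 2: "B x (v' i) = B b (v' i)" if "i \<in> J" for i
    using orth[OF x(2) dd'(3)[OF that]] by (simp add: x(1) B_simps)
  show "(\<Sum>i\<in>I <+> J. scale (B x (case_sum v v' i)) (case_sum u u' i)) = x"
    using 1 2 dd(4)[OF x(2)] dd'(4)[OF x(3)] by (simp add: sum.Plus dd(1) dd'(1) x(1))
qed

lemma dual_pair_exists:
  assumes L: "subspace L" and nd: "\<And>x. x \<in> L \<Longrightarrow> (\<And>y. y \<in> L \<Longrightarrow> B x y = 0) \<Longrightarrow> x = 0" and X: "is_basis_of X L"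
  shows "\<exists>v. dual_pair L X (\<lambda>x. x) v \<and> (\<forall>x\<in>L. \<forall>w\<in>X. B x (v w) = representation X x w)"
proof -
  note x = is_basis_ofD[OF X]
  have fX: "finite X" by (rule is_basis_of_finite[OF X])
  have "\<exists>t\<in>L. \<forall>y\<in>L. B t y = representation X y w" for w
    by (rule functional_representation[where F = B, OF L B_simps(1) B_simps(2) B_simps(3) B_simps(4)])
      (use nd L x in \<open>auto simp: representation_add representation_scale\<close>)
  then obtain v where v: "\<And>w. v w \<in> L" "\<And>w y. y \<in> L \<Longrightarrow> B (v w) y = representation X y w" by metis
  have v': "B y (v w) = representation X y w" if "y \<in> L" for y w using v(2)[OF that] B_sym[of y] by simp
  have "dual_pair L X (\<lambda>x. x) v"
    unfolding dual_pair_def using fX x(4) v(1) v' basis_expansion[OF X fX] by simp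
  then show ?thesis using v' by blast
qed

text \<open>The trace, on the space of the second pair, of the Casimir operator formed from the
  first pair; diagonal entries are read off by pairing with the dual vectors.\<close>

definition casimir_trace where
  "casimir_trace I u v J u' v' = (\<Sum>i\<in>I. \<Sum>j\<in>J. B (bracket (u i) (bracket (v i) (u' j))) (v' j))"

lemma casimir_trace_independent:
  assumes L: "subspace L" and d: "dual_pair L I u v" "dual_pair L J u' v'" and M: "subspace M"
    and e: "dual_pair M I2 w x" "dual_pair M J2 w' x'"
  shows "casimir_trace I u v I2 w x = casimir_trace J u' v' J2 w' x'"
proof -
  have "casimir_trace I u v I2 w x = (\<Sum>i\<in>I. \<Sum>j\<in>J2. B (bracket (u i) (bracket (v i) (w' j))) (x' j))"
    unfolding casimir_trace_def
    by (rule sum.cong[OF refl], rule dual_pair_independent[OF _ M e]) (simp add: bilin_def B_simps bracket_simps)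
  also have "\<dots> = casimir_trace J u' v' J2 w' x'"
    unfolding casimir_trace_def
    by (rule dual_pair_independent[OF _ L d])
      (simp add: bilin_def B_simps bracket_simps sum.distrib sum_distrib_left)
  finally show ?thesis .
qed

lemma B_double: "B (bracket x (bracket y z)) w = - B (bracket y z) (bracket x w)"
proof -
  have "B (bracket x (bracket y z)) w = - B (bracket (bracket y z) x) w"
    using bracket_swap[of x "bracket y z"] by (simp add: B_simps)
  then show ?thesis using B_inv by simp
qed

text \<open>By invariance ad w is skew for \<open>B\<close>, while exchanging the two families of a
  dual pair leaves the sum unchanged; so it equals its own negative.\<close>

lemma dual_pair_trace_skew:
  assumes L: "subspace L" and d: "dual_pair L I u v"
  shows "(\<Sum>i\<in>I. B (bracket w (u i)) (v i)) = 0"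
proof -
  have "(\<Sum>i\<in>I. B (bracket w (u i)) (v i)) = (\<Sum>i\<in>I. B (bracket w (v i)) (u i))"
    by (rule dual_pair_independent[OF _ L d dual_pair_swap[OF d L]]) (simp add: bilin_def B_simps bracket_simps)
  also have "\<dots> = - (\<Sum>i\<in>I. B (bracket w (u i)) (v i))"
    unfolding sum_negf[symmetric]
  proof (rule sum.cong[OF refl])
    fix i
    have "B (bracket w (v i)) (u i) = - B (bracket (v i) w) (u i)" using bracket_swap[of w "v i"] by (simp add: B_simps)
    also have "B (bracket (v i) w) (u i) = B (v i) (bracket w (u i))" by (rule B_inv)
    also have "\<dots> = B (bracket w (u i)) (v i)" by (rule B_sym)
    finally show "B (bracket w (v i)) (u i) = - B (bracket w (u i)) (v i)" .
  qed
  finally have "2 * (\<Sum>i\<in>I. B (bracket w (u i)) (v i)) = 0" unfolding eq_neg_iff_add_eq_0 mult_2 .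
  then show ?thesis by simp
qed

lemma dual_pair_trace_comp:
  assumes d: "dual_pair L I u v" and c: "\<And>z. z \<in> L \<Longrightarrow> bracket y z \<in> L"
  shows "(\<Sum>i\<in>I. \<Sum>j\<in>I. B (bracket x (u i)) (v j) * B (bracket y (u j)) (v i)) = (\<Sum>j\<in>I. B (bracket x (bracket y (u j))) (v j))"
proof -
  have "(\<Sum>i\<in>I. B (bracket y (u j)) (v i) * B (bracket x (u i)) (v j)) = B (bracket x (bracket y (u j))) (v j)" if j: "j \<in> I" for j
  proof -
    have yu: "bracket y (u j) \<in> L" using c dual_pairD(2)[OF d j] .
    have "B (bracket x (bracket y (u j))) (v j) = B (bracket x (\<Sum>i\<in>I. scale (B (bracket y (u j)) (v i)) (u i))) (v j)"
      using dual_pairD(4)[OF d yu] by simp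
    then show ?thesis by (simp add: bracket_simps B_sum B_simps)
  qed
  then show ?thesis by (subst sum.swap) (simp add: mult.commute)
qed

text \<open>Of the four blocks, that of \<open>P\<close> on \<open>K\<close> equals that of
  \<open>K\<close> on \<open>P\<close> term by term, by invariance. In the block of \<open>P\<close>
  on \<open>P\<close> the inner bracket lies in \<open>K\<close>; expanding it in the dual pair of
  \<open>K\<close> and summing over the first index yields the block of \<open>K\<close> on
  \<open>P\<close> once more.\<close>

lemma casimir_trace_gradation:
  assumes d: "dual_pair K I u v" and d': "dual_pair P J u' v'" and P: "subspace P"
    and KP: "\<And>x y. x \<in> K \<Longrightarrow> y \<in> P \<Longrightarrow> bracket x y \<in> P" and PP: "\<And>x y. x \<in> P \<Longrightarrow> y \<in> P \<Longrightarrow> bracket x y \<in> K"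
  shows "casimir_trace (I <+> J) (case_sum u u') (case_sum v v') (I <+> J) (case_sum u u') (case_sum v v') =
    casimir_trace I u v I u v + 3 * casimir_trace I u v J u' v'"
proof -
  note dd = dual_pairD[OF d] and dd' = dual_pairD[OF d']
  have 1: "B (bracket (u' i) (bracket (v' i) (u a))) (v a) = B (bracket (u a) (bracket (v a) (u' i))) (v' i)" for i a
  proof -
    have "B (bracket (u' i) (bracket (v' i) (u a))) (v a) = - B (bracket (u a) (v' i)) (bracket (v a) (u' i))"
      unfolding B_double using bracket_swap[of "v' i" "u a"] bracket_swap[of "u' i" "v a"] by (simp add: B_simps)
    also have "\<dots> = B (bracket (u a) (bracket (v a) (u' i))) (v' i)"
      unfolding B_double using B_sym by simp
    finally show ?thesis .
  qed
  have PK: "casimir_trace J u' v' I u v = casimir_trace I u v J u' v'"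
    unfolding casimir_trace_def 1 by (rule sum.swap)
  have 2: "(\<Sum>i\<in>J. B (v' i) p * B (u' i) q) = B p q" if "p \<in> P" for p q
    using dual_pair_form[OF d' that, of q] B_sym[of _ p] by simp
  have "casimir_trace J u' v' J u' v' = (\<Sum>i\<in>J. \<Sum>j\<in>J. \<Sum>a\<in>I. B (v' i) (bracket (u' j) (v a)) * B (u' i) (bracket (u a) (v' j)))"
    unfolding casimir_trace_def
  proof (intro sum.cong refl)
    fix i j assume i: "i \<in> J" and j: "j \<in> J"
    have vu: "bracket (v' i) (u' j) \<in> K" using PP dd'(2,3) i j by blast
    have "B (bracket (u' i) (bracket (v' i) (u' j))) (v' j) = - (\<Sum>a\<in>I. B (bracket (v' i) (u' j)) (v a) * B (u a) (bracket (u' i) (v' j)))"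
      unfolding B_double dual_pair_form[OF d vu] ..
    also have "\<dots> = (\<Sum>a\<in>I. B (v' i) (bracket (u' j) (v a)) * B (u' i) (bracket (u a) (v' j)))"
      unfolding sum_negf[symmetric]
    proof (rule sum.cong[OF refl])
      fix a
      have "B (u a) (bracket (u' i) (v' j)) = B (bracket (u a) (u' i)) (v' j)" by (simp add: B_inv)
      also have "\<dots> = - B (u' i) (bracket (u a) (v' j))"
        using bracket_swap[of "u a" "u' i"] by (simp add: B_simps B_inv)
      finally show "- (B (bracket (v' i) (u' j)) (v a) * B (u a) (bracket (u' i) (v' j))) =
        B (v' i) (bracket (u' j) (v a)) * B (u' i) (bracket (u a) (v' j))" by (simp add: B_inv)
    qed
    finally show "B (bracket (u' i) (bracket (v' i) (u' j))) (v' j) = \<dots>" .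
  qed
  also have "\<dots> = (\<Sum>j\<in>J. \<Sum>a\<in>I. \<Sum>i\<in>J. B (v' i) (bracket (u' j) (v a)) * B (u' i) (bracket (u a) (v' j)))"
    by (subst sum.swap, rule sum.cong[OF refl], rule sum.swap)
  also have "\<dots> = (\<Sum>j\<in>J. \<Sum>a\<in>I. B (bracket (u a) (bracket (v a) (u' j))) (v' j))"
  proof (intro sum.cong refl)
    fix j a assume j: "j \<in> J" and a: "a \<in> I"
    have "bracket (v a) (u' j) \<in> P" using KP dd(3)[OF a] dd'(2)[OF j] by blast
    then have uv: "bracket (u' j) (v a) \<in> P" using subspace_neg[OF P] bracket_swap[of "u' j" "v a"] by simp
    show "(\<Sum>i\<in>J. B (v' i) (bracket (u' j) (v a)) * B (u' i) (bracket (u a) (v' j))) = B (bracket (u a) (bracket (v a) (u' j))) (v' j)"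
      unfolding 2[OF uv] B_double using bracket_swap[of "u' j" "v a"] by (simp add: B_simps)
  qed
  also have "\<dots> = casimir_trace I u v J u' v'" unfolding casimir_trace_def by (rule sum.swap)
  finally have PP': "casimir_trace J u' v' J u' v' = casimir_trace I u v J u' v'" .
  have "casimir_trace (I <+> J) (case_sum u u') (case_sum v v') (I <+> J) (case_sum u u') (case_sum v v') =
    (casimir_trace I u v I u v + casimir_trace I u v J u' v') + (casimir_trace J u' v' I u v + casimir_trace J u' v' J u' v')"
    by (simp add: casimir_trace_def sum.Plus dd(1) dd'(1) sum.distrib)
  then show ?thesis unfolding PK PP' by simp
qed

end

section \<open>Structure constants and the strange formula\<close>

locale root_vectors = cartan_setup scale Basis bracket B L H
  for scale :: "'k::{alg_closed_field, field_char_0} \<Rightarrow> 'g::ab_group_add \<Rightarrow> 'g" and Basis and bracket and B and L and H +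
  fixes P :: "('g \<Rightarrow> 'k) set" and e :: "('g \<Rightarrow> 'k) \<Rightarrow> 'g"
  assumes P: "positive_system H L P" and e_root: "\<And>\<alpha>. \<alpha> \<in> roots H L \<Longrightarrow> e \<alpha> \<in> Wt \<alpha>"
    and e_form: "\<And>\<alpha>. \<alpha> \<in> roots H L \<Longrightarrow> B (e \<alpha>) (e (- \<alpha>)) = 1"
begin

abbreviation "R \<equiv> roots H L"

lemma R_iff: "\<alpha> \<in> R \<longleftrightarrow> \<alpha> \<in> \<Phi> \<and> \<alpha> \<noteq> 0"
  by (simp add: roots_eq)

lemma R_neg: "\<alpha> \<in> R \<Longrightarrow> - \<alpha> \<in> R"
  by (simp add: R_iff weight_neg)

lemma finite_R: "finite R" and finite_P: "finite P" and P_R: "P \<subseteq> R" and R_cases: "\<alpha> \<in> R \<Longrightarrow> (\<alpha> \<in> P) \<noteq> (- \<alpha> \<in> P)"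
  and P_add: "\<alpha> \<in> P \<Longrightarrow> \<beta> \<in> P \<Longrightarrow> \<alpha> + \<beta> \<in> R \<Longrightarrow> \<alpha> + \<beta> \<in> P"
proof -
  show f: "finite R" unfolding roots_eq by (simp add: O.finite_weights)
  show "P \<subseteq> R" and "\<alpha> \<in> R \<Longrightarrow> (\<alpha> \<in> P) \<noteq> (- \<alpha> \<in> P)" and "\<alpha> \<in> P \<Longrightarrow> \<beta> \<in> P \<Longrightarrow> \<alpha> + \<beta> \<in> R \<Longrightarrow> \<alpha> + \<beta> \<in> P"
    using P unfolding positive_system_def by blast+
  then show "finite P" using finite_subset f by blast
qed

lemma e_nonzero: "\<alpha> \<in> R \<Longrightarrow> e \<alpha> \<noteq> 0"
  using e_form[of \<alpha>] by (auto simp: B_simps)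

lemma e_expand:
  assumes a: "\<alpha> \<in> R" and x: "x \<in> Wt \<alpha>"
  shows "x = scale (B x (e (- \<alpha>))) (e \<alpha>)"
proof -
  have "x \<in> span {e \<alpha>}" using root_space_span[OF _ _ e_root[OF a] e_nonzero[OF a]] a x by (simp add: R_iff)
  then obtain c where "x = scale c (e \<alpha>)" by (auto simp: span_singleton)
  then show ?thesis using e_form[OF a] by (simp add: B_simps)
qed

lemma e_orth:
  assumes "\<alpha> \<in> R" "\<beta> \<in> R" "\<alpha> \<noteq> - \<beta>"
  shows "B (e \<alpha>) (e \<beta>) = 0"
proof -
  obtain h where h: "\<alpha> h \<noteq> - \<beta> h" using assms(3) by (auto simp: fun_eq_iff)
  then have "h \<in> H" using assms(1,2) weight_outside[of \<alpha> h] weight_outside[of \<beta> h] by (auto simp: R_iff)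
  moreover have "\<alpha> h + \<beta> h \<noteq> 0" using h by (simp add: eq_neg_iff_add_eq_0)
  ultimately show ?thesis using B_orth e_root assms(1,2) by blast
qed

lemma bracket_h_e: "\<alpha> \<in> R \<Longrightarrow> h \<in> H \<Longrightarrow> bracket h (e \<alpha>) = scale (\<alpha> h) (e \<alpha>)"
  using bracket_root[OF _ _ e_root] by (simp add: R_iff)

lemma bracket_e_neg:
  assumes a: "\<alpha> \<in> R"
  shows "bracket (e \<alpha>) (e (- \<alpha>)) = rp \<alpha>"
  using bracket_pair[OF _ e_root[OF a] e_root[OF R_neg[OF a]]] bracket_h_e[OF R_neg[OF a]] a e_form[OF a]
  by (simp add: R_iff)

lemma rpR: "\<alpha> \<in> R \<Longrightarrow> rp \<alpha> \<in> H" "\<alpha> \<in> R \<Longrightarrow> h \<in> H \<Longrightarrow> B (rp \<alpha>) h = \<alpha> h"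
  using rp_weight by (auto simp: R_iff)

lemma rp_neg: "\<alpha> \<in> R \<Longrightarrow> rp (- \<alpha>) = - rp \<alpha>"
  by (rule form_representative_eqI) (auto simp: rpR subspace_neg[OF H_sub] B_simps)

text \<open>With \<open>[e \<alpha>, e \<beta>] = N \<alpha> \<beta> e (\<alpha> + \<beta>)\<close>, the number \<open>c \<alpha> \<beta>\<close> is \<open>- N \<alpha> \<beta> N (- \<alpha>) (- \<beta>)\<close>.\<close>

definition c where "c \<alpha> \<beta> = B (bracket (e \<alpha>) (e \<beta>)) (bracket (e (- \<beta>)) (e (- \<alpha>)))"
definition ip where "ip \<alpha> \<beta> = B (rp \<alpha>) (rp \<beta>)"

lemma c_sym: "c \<alpha> \<beta> = c \<beta> \<alpha>"
  unfolding c_def bracket_swap[of "e \<alpha>" "e \<beta>"] bracket_swap[of "e (- \<beta>)" "e (- \<alpha>)"] by (simp add: B_simps)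

lemma c_neg: "c (- \<alpha>) (- \<beta>) = c \<alpha> \<beta>"
  unfolding c_def minus_minus bracket_swap[of "e \<alpha>" "e \<beta>"] bracket_swap[of "e (- \<beta>)" "e (- \<alpha>)"]
  by (simp add: B_simps) (rule B_sym)

lemma c_neg': "c \<alpha> (- \<beta>) = c (- \<alpha>) \<beta>"
  using c_neg[of "- \<alpha>" \<beta>] by simp

lemma c_same: "c \<alpha> \<alpha> = 0"
  by (simp add: c_def bracket_self B_simps)

lemma c_zero:
  assumes "\<alpha> \<in> R" "\<beta> \<in> R" "\<alpha> + \<beta> \<notin> R" "\<alpha> + \<beta> \<noteq> 0"
  shows "c \<alpha> \<beta> = 0"
proof -
  have "bracket (e \<alpha>) (e \<beta>) \<in> Wt (\<alpha> + \<beta>)" using Wt_bracket e_root assms by blast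
  moreover have "\<alpha> + \<beta> \<notin> \<Phi>" using assms(3,4) by (simp add: R_iff)
  moreover have "(\<alpha> + \<beta>) h = 0" if "h \<notin> H" for h
    using assms(1,2) weight_outside[OF _ that, of \<alpha>] weight_outside[OF _ that, of \<beta>] by (simp add: R_iff)
  ultimately have "bracket (e \<alpha>) (e \<beta>) = 0" using weightI by blast
  then show ?thesis by (simp add: c_def B_simps)
qed

text \<open>Pair [[e \<alpha>, e (- \<alpha>)], e \<beta>] with e (- \<beta>) in two ways: the inner
  bracket is the representative of \<alpha>, which yields \<open>ip \<alpha> \<beta>\<close>, and
  the Jacobi identity splits the expression into a difference of two values of
  \<open>c\<close>.\<close>

lemma c_jacobi:
  assumes a: "\<alpha> \<in> R" and b: "\<beta> \<in> R"
  shows "c (- \<alpha>) \<beta> = c \<alpha> \<beta> + ip \<alpha> \<beta>"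
proof -
  have "B (bracket (bracket (e \<alpha>) (e (- \<alpha>))) (e \<beta>)) (e (- \<beta>)) = \<beta> (rp \<alpha>) * B (e \<beta>) (e (- \<beta>))"
    unfolding bracket_e_neg[OF a] bracket_h_e[OF b rpR(1)[OF a]] by (rule B_scale)
  also have "\<dots> = ip \<alpha> \<beta>" using e_form[OF b] rpR(2)[OF b rpR(1)[OF a]] B_sym[of "rp \<alpha>" "rp \<beta>"] by (simp add: ip_def)
  finally have "ip \<alpha> \<beta> = - B (bracket (e (- \<alpha>)) (e \<beta>)) (bracket (e \<alpha>) (e (- \<beta>))) +
    B (bracket (e \<alpha>) (e \<beta>)) (bracket (e (- \<alpha>)) (e (- \<beta>)))"
    unfolding bracket_bracket by (simp add: B_simps B_double)
  moreover have "c (- \<alpha>) \<beta> = - B (bracket (e (- \<alpha>)) (e \<beta>)) (bracket (e \<alpha>) (e (- \<beta>)))"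
    unfolding c_def minus_minus using bracket_swap[of "e (- \<beta>)" "e \<alpha>"] by (simp add: B_simps)
  moreover have "c \<alpha> \<beta> = - B (bracket (e \<alpha>) (e \<beta>)) (bracket (e (- \<alpha>)) (e (- \<beta>)))"
    unfolding c_def using bracket_swap[of "e (- \<beta>)" "e (- \<alpha>)"] by (simp add: B_simps)
  ultimately show ?thesis by simp
qed

lemma c_prod:
  assumes a: "\<alpha> \<in> R" and b: "\<beta> \<in> R" and g: "\<gamma> \<in> R" and z: "\<alpha> + \<beta> + \<gamma> = 0"
  shows "c \<alpha> \<beta> = B (bracket (e \<alpha>) (e \<beta>)) (e \<gamma>) * B (bracket (e (- \<beta>)) (e (- \<alpha>))) (e (- \<gamma>))"
proof -
  have ab: "\<alpha> + \<beta> = - \<gamma>" using z by (simp add: eq_neg_iff_add_eq_0)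
  have ab': "- \<beta> + - \<alpha> = \<gamma>" using arg_cong[OF ab, of uminus] by (simp add: add.commute)
  have "bracket (e \<alpha>) (e \<beta>) \<in> Wt (- \<gamma>)" using Wt_bracket[OF e_root[OF a] e_root[OF b]] unfolding ab .
  from e_expand[OF R_neg[OF g] this]
  have 1: "bracket (e \<alpha>) (e \<beta>) = scale (B (bracket (e \<alpha>) (e \<beta>)) (e \<gamma>)) (e (- \<gamma>))" by simp
  have "bracket (e (- \<beta>)) (e (- \<alpha>)) \<in> Wt \<gamma>"
    using Wt_bracket[OF e_root[OF R_neg[OF b]] e_root[OF R_neg[OF a]]] unfolding ab' .
  from e_expand[OF g this]
  have 2: "bracket (e (- \<beta>)) (e (- \<alpha>)) = scale (B (bracket (e (- \<beta>)) (e (- \<alpha>))) (e (- \<gamma>))) (e \<gamma>)" .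
  have "B (scale p (e (- \<gamma>))) (scale q (e \<gamma>)) = p * q" for p q
    using e_form[OF R_neg[OF g]] by (simp add: B_simps)
  then show ?thesis unfolding c_def using 1 2 by metis
qed

text \<open>By \<open>c_prod\<close> the value is a product of two numbers of the form B([x, y], z),
  and invariance makes each of them stable under cyclic rotation.\<close>

lemma c_cyclic:
  assumes a: "\<alpha> \<in> R" and b: "\<beta> \<in> R" and g: "\<gamma> \<in> R" and z: "\<alpha> + \<beta> + \<gamma> = 0"
  shows "c \<alpha> \<beta> = c \<beta> \<gamma>"
proof -
  have z': "\<beta> + \<gamma> + \<alpha> = 0" using z by (simp add: add_ac)
  have "B (bracket (e \<alpha>) (e \<beta>)) (e \<gamma>) = B (bracket (e \<beta>) (e \<gamma>)) (e \<alpha>)"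
    unfolding B_inv[of "e \<alpha>"] by (rule B_sym)
  moreover have "B (bracket (e (- \<gamma>)) (e (- \<beta>))) (e (- \<alpha>)) = B (bracket (e (- \<beta>)) (e (- \<alpha>))) (e (- \<gamma>))"
    unfolding B_inv[of "e (- \<gamma>)"] by (rule B_sym)
  ultimately show ?thesis unfolding c_prod[OF a b g z] c_prod[OF b g a z'] by simp
qed

text \<open>A difference of positive roots is zero, a positive root, the negative of one, or no
  root. In the root cases cyclic symmetry rewrites the value at (- \<alpha>, \<beta>) through two
  positive roots, so that the summation stays inside \<open>P\<close>.\<close>

lemma c_difference:
  assumes a: "\<alpha> \<in> P" and b: "\<beta> \<in> P"
  shows "c (- \<alpha>) \<beta> = (if \<beta> = \<alpha> then ip \<alpha> \<alpha> else 0) + (if \<beta> - \<alpha> \<in> P then c \<alpha> (\<beta> - \<alpha>) else 0)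
    + (if \<alpha> - \<beta> \<in> P then c \<beta> (\<alpha> - \<beta>) else 0)"
proof -
  have aR: "\<alpha> \<in> R" and bR: "\<beta> \<in> R" using a b P_R by auto
  have 0: "0 \<notin> P" using P_R by (auto simp: R_iff)
  \<comment> \<open>The roots - \<alpha>, \<beta> and \<alpha> - \<beta> have sum zero; two
    rotations, a common change of sign and symmetry give the claim.\<close>
  have key: "c (- \<alpha>) \<beta> = c \<alpha> (\<beta> - \<alpha>)" if "\<alpha> \<in> P" "\<beta> \<in> P" "\<beta> - \<alpha> \<in> P" for \<alpha> \<beta>
  proof -
    have r: "- \<alpha> \<in> R" "\<beta> \<in> R" "- (\<beta> - \<alpha>) \<in> R" using that P_R R_neg by blast+
    have "c (- \<alpha>) \<beta> = c \<beta> (- (\<beta> - \<alpha>))" by (rule c_cyclic[OF r]) simp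
    also have "\<dots> = c (- (\<beta> - \<alpha>)) (- \<alpha>)" by (rule c_cyclic[OF r(2,3,1)]) simp
    also have "\<dots> = c \<alpha> (\<beta> - \<alpha>)" unfolding c_neg by (rule c_sym)
    finally show ?thesis .
  qed
  consider "\<beta> = \<alpha>" | "\<beta> \<noteq> \<alpha>" "\<beta> - \<alpha> \<in> P" | "\<beta> \<noteq> \<alpha>" "\<alpha> - \<beta> \<in> P" "\<beta> - \<alpha> \<notin> P" | "\<beta> \<noteq> \<alpha>" "\<alpha> - \<beta> \<notin> P" "\<beta> - \<alpha> \<notin> P" by blast
  then show ?thesis
  proof cases
    case 1
    then show ?thesis using c_jacobi[OF aR aR] 0 by (simp add: c_same)
  next
    case 2
    then have "\<alpha> - \<beta> \<notin> P" using R_cases[of "\<beta> - \<alpha>"] P_R by auto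
    then show ?thesis using 2 key[OF a b] by simp
  next
    case 3
    have "c (- \<alpha>) \<beta> = c (- \<beta>) \<alpha>" using c_neg'[of \<alpha> \<beta>] c_sym[of \<alpha> "- \<beta>"] by simp
    then show ?thesis using 3 key[OF b a] by simp
  next
    case 4
    then have "\<beta> - \<alpha> \<notin> R" using R_cases[of "\<beta> - \<alpha>"] by auto
    then have "c (- \<alpha>) \<beta> = 0" using 4 by (intro c_zero R_neg aR bR) auto
    then show ?thesis using 4 by simp
  qed
qed

text \<open>Put \<gamma> = \<beta> - \<alpha>. The \<gamma> in \<open>P\<close> for which \<alpha> +
  \<gamma> is not in \<open>P\<close> contribute nothing: such a sum is not zero, both roots being
  positive, and not a root, as \<open>P\<close> is closed under sums that are roots.\<close>

lemma sum_c_shift: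
  assumes a: "\<alpha> \<in> P"
  shows "(\<Sum>\<beta>\<in>P. if \<beta> - \<alpha> \<in> P then c \<alpha> (\<beta> - \<alpha>) else 0) = (\<Sum>\<gamma>\<in>P. c \<alpha> \<gamma>)"
proof -
  have "(\<Sum>\<beta>\<in>P. if \<beta> - \<alpha> \<in> P then c \<alpha> (\<beta> - \<alpha>) else 0) = (\<Sum>\<beta>\<in>{\<beta> \<in> P. \<beta> - \<alpha> \<in> P}. c \<alpha> (\<beta> - \<alpha>))"
    by (simp add: sum.inter_filter[OF finite_P])
  also have "\<dots> = (\<Sum>\<gamma>\<in>{\<gamma> \<in> P. \<alpha> + \<gamma> \<in> P}. c \<alpha> \<gamma>)"
    by (rule sum.reindex_bij_witness[of _ "\<lambda>\<gamma>. \<alpha> + \<gamma>" "\<lambda>\<beta>. \<beta> - \<alpha>"]) auto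
  also have "\<dots> = (\<Sum>\<gamma>\<in>P. c \<alpha> \<gamma>)"
  proof (rule sum.mono_neutral_left[OF finite_P])
    show "\<forall>\<gamma>\<in>P - {\<gamma> \<in> P. \<alpha> + \<gamma> \<in> P}. c \<alpha> \<gamma> = 0"
    proof
      fix \<gamma> assume g: "\<gamma> \<in> P - {\<gamma> \<in> P. \<alpha> + \<gamma> \<in> P}"
      have "\<alpha> + \<gamma> \<noteq> 0"
      proof
        assume "\<alpha> + \<gamma> = 0"
        then have "\<gamma> = - \<alpha>" by (simp add: eq_neg_iff_add_eq_0 add.commute)
        then show False using R_cases[of \<alpha>] a g P_R by auto
      qed
      then show "c \<alpha> \<gamma> = 0" using g P_add[OF a] P_R a by (intro c_zero) auto
    qed
  qed auto
  finally show ?thesis .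
qed

definition "sum_P f = (\<Sum>\<alpha>\<in>P. \<Sum>\<beta>\<in>P. (f \<alpha> \<beta> :: 'k))" for f :: "('g \<Rightarrow> 'k) \<Rightarrow> ('g \<Rightarrow> 'k) \<Rightarrow> 'k"

text \<open>Compute the sum of c (- \<alpha>) \<beta> over pairs of positive roots twice:
  \<open>c_jacobi\<close> gives \<open>sum_P c\<close> plus \<open>sum_P ip\<close>,
  \<open>c_difference\<close> gives the diagonal of \<open>ip\<close> plus twice
  \<open>sum_P c\<close>.\<close>

lemma sum_ip: "sum_P ip = (\<Sum>\<alpha>\<in>P. ip \<alpha> \<alpha>) + sum_P c"
proof -
  have "sum_P (\<lambda>\<alpha> \<beta>. c (- \<alpha>) \<beta>) = sum_P (\<lambda>\<alpha> \<beta>. if \<beta> = \<alpha> then ip \<alpha> \<alpha> else 0)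
      + sum_P (\<lambda>\<alpha> \<beta>. if \<beta> - \<alpha> \<in> P then c \<alpha> (\<beta> - \<alpha>) else 0) + sum_P (\<lambda>\<alpha> \<beta>. if \<alpha> - \<beta> \<in> P then c \<beta> (\<alpha> - \<beta>) else 0)"
    unfolding sum_P_def sum.distrib[symmetric] by (intro sum.cong refl c_difference)
  also have "sum_P (\<lambda>\<alpha> \<beta>. if \<beta> = \<alpha> then ip \<alpha> \<alpha> else 0) = (\<Sum>\<alpha>\<in>P. ip \<alpha> \<alpha>)"
    unfolding sum_P_def using finite_P by simp
  also have "sum_P (\<lambda>\<alpha> \<beta>. if \<beta> - \<alpha> \<in> P then c \<alpha> (\<beta> - \<alpha>) else 0) = sum_P c"
    unfolding sum_P_def by (rule sum.cong[OF refl sum_c_shift])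
  also have "sum_P (\<lambda>\<alpha> \<beta>. if \<alpha> - \<beta> \<in> P then c \<beta> (\<alpha> - \<beta>) else 0) = sum_P c"
    unfolding sum_P_def by (subst sum.swap) (rule sum.cong[OF refl sum_c_shift])
  finally have 1: "sum_P (\<lambda>\<alpha> \<beta>. c (- \<alpha>) \<beta>) = (\<Sum>\<alpha>\<in>P. ip \<alpha> \<alpha>) + sum_P c + sum_P c" .
  have 2: "sum_P (\<lambda>\<alpha> \<beta>. c (- \<alpha>) \<beta>) = sum_P c + sum_P ip"
    unfolding sum_P_def sum.distrib[symmetric] by (intro sum.cong refl c_jacobi) (use P_R in auto)
  have "sum_P c + sum_P ip = sum_P c + ((\<Sum>\<alpha>\<in>P. ip \<alpha> \<alpha>) + sum_P c)"
    unfolding 2[symmetric] 1 by (simp only: add_ac)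
  then show ?thesis by (simp only: add_left_cancel)
qed

lemma sum_R: "(\<Sum>\<alpha>\<in>R. f \<alpha>) = (\<Sum>\<alpha>\<in>P. f \<alpha> + f (- \<alpha>))"
proof -
  have "R = P \<union> uminus ` P"
  proof (rule equalityI; rule subsetI)
    fix \<alpha> assume "\<alpha> \<in> R"
    then have "\<alpha> \<in> P \<or> - \<alpha> \<in> P" using R_cases by blast
    then show "\<alpha> \<in> P \<union> uminus ` P" by (metis UnCI image_eqI minus_minus)
  qed (use P_R R_neg in auto)
  moreover have "P \<inter> uminus ` P = {}" using R_cases P_R by auto
  moreover have "inj_on (uminus :: ('g \<Rightarrow> 'k) \<Rightarrow> _) P" by (rule inj_onI) simp
  ultimately show ?thesis
    by (simp add: sum.union_disjoint finite_P sum.reindex sum.distrib)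
qed

lemma dual_form_weyl: "4 * dual_form B H (weyl_vector P) (weyl_vector P) = sum_P ip"
proof -
  have "rp (weyl_vector P) = scale (1 / 2) (\<Sum>\<alpha>\<in>P. rp \<alpha>)"
  proof (rule form_representative_eqI)
    show "scale (1 / 2) (\<Sum>\<alpha>\<in>P. rp \<alpha>) \<in> H"
      by (intro subspace_scale[OF H_sub] subspace_sum[OF H_sub] rpR(1)) (use P_R in blast)
    fix h assume h: "h \<in> H"
    have "(\<Sum>\<alpha>\<in>P. B (rp \<alpha>) h) = (\<Sum>\<alpha>\<in>P. \<alpha> h)" by (rule sum.cong[OF refl]) (use P_R rpR(2) h in blast)
    then show "B (scale (1 / 2) (\<Sum>\<alpha>\<in>P. rp \<alpha>)) h = weyl_vector P h" by (simp add: B_simps B_sum weyl_vector_def)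
  qed
  moreover have "4 * B (scale (1 / 2) x) (scale (1 / 2) x) = B x x" for x by (simp add: B_simps)
  ultimately have "4 * dual_form B H (weyl_vector P) (weyl_vector P) = B (\<Sum>\<alpha>\<in>P. rp \<alpha>) (\<Sum>\<alpha>\<in>P. rp \<alpha>)"
    by (simp only: dual_form_def)
  also have "\<dots> = sum_P ip" unfolding B_sum sum_P_def ip_def by (rule sum.swap)
  finally show ?thesis .
qed

definition E where "E = {\<Sum>\<alpha>\<in>R. scale (a \<alpha>) (e \<alpha>) | a. True}"

lemma E_subspace: "subspace E"
proof (rule subspaceI)
  show "0 \<in> E" unfolding E_def by (rule CollectI, rule exI[of _ "\<lambda>_. 0"]) simp
next
  fix x y assume "x \<in> E" "y \<in> E"
  then obtain a b where "x = (\<Sum>\<alpha>\<in>R. scale (a \<alpha>) (e \<alpha>))" "y = (\<Sum>\<alpha>\<in>R. scale (b \<alpha>) (e \<alpha>))" unfolding E_def by blast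
  then have "x + y = (\<Sum>\<alpha>\<in>R. scale (a \<alpha> + b \<alpha>) (e \<alpha>))" by (simp add: scale_left_distrib sum.distrib)
  then show "x + y \<in> E" unfolding E_def by (intro CollectI exI[of _ "\<lambda>\<alpha>. a \<alpha> + b \<alpha>"]) simp
next
  fix r x assume "x \<in> E"
  then obtain a where "x = (\<Sum>\<alpha>\<in>R. scale (a \<alpha>) (e \<alpha>))" unfolding E_def by blast
  then have "scale r x = (\<Sum>\<alpha>\<in>R. scale (r * a \<alpha>) (e \<alpha>))" by (simp add: scale_sum_right)
  then show "scale r x \<in> E" unfolding E_def by (intro CollectI exI[of _ "\<lambda>\<alpha>. r * a \<alpha>"]) simp
qed

lemma e_E: "\<alpha> \<in> R \<Longrightarrow> e \<alpha> \<in> E"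
  unfolding E_def
  by (rule CollectI, rule exI[of _ "\<lambda>\<beta>. if \<beta> = \<alpha> then 1 else 0"])
    (simp add: finite_R if_distrib[of "\<lambda>c. scale c _"] cong: if_cong)

lemma E_dual_pair: "dual_pair E R e (\<lambda>\<alpha>. e (- \<alpha>))"
  unfolding dual_pair_def
proof (intro conjI ballI)
  fix x assume "x \<in> E"
  then obtain a where x: "x = (\<Sum>\<alpha>\<in>R. scale (a \<alpha>) (e \<alpha>))" unfolding E_def by blast
  have "B x (e (- \<alpha>)) = a \<alpha>" if a: "\<alpha> \<in> R" for \<alpha>
  proof -
    have "B x (e (- \<alpha>)) = (\<Sum>\<beta>\<in>R. if \<beta> = \<alpha> then a \<alpha> else 0)"
      unfolding x B_sum by (rule sum.cong[OF refl]) (use e_form[OF a] e_orth[OF _ R_neg[OF a]] in \<open>auto simp: B_simps\<close>)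
    then show ?thesis using finite_R a by simp
  qed
  then show "(\<Sum>i\<in>R. scale (B x (e (- i))) (e i)) = x" unfolding x[symmetric] using x by simp
qed (use finite_R e_E R_neg in auto)

lemma L_decomposition: "L = {x + y | x y. x \<in> H \<and> y \<in> E}"
proof (rule equalityI; rule subsetI)
  fix x assume x: "x \<in> L"
  note p = O.W.proj_props[OF x]
  have rest: "(\<Sum>\<alpha>\<in>R. O.W.proj \<alpha> x) \<in> E"
  proof (rule subspace_sum[OF E_subspace])
    fix \<alpha> assume a: "\<alpha> \<in> R"
    then have "O.W.proj \<alpha> x \<in> Wt \<alpha>" using p(1) by (simp add: R_iff)
    from e_expand[OF a this] show "O.W.proj \<alpha> x \<in> E" using subspace_scale[OF E_subspace e_E[OF a]] by metis
  qed
  have "\<exists>h\<in>H. x = h + (\<Sum>\<alpha>\<in>R. O.W.proj \<alpha> x)"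
  proof (cases "0 \<in> \<Phi>")
    case True
    then have "\<Phi> = insert 0 R" "0 \<notin> R" unfolding roots_eq by auto
    then have "(\<Sum>\<alpha>\<in>\<Phi>. O.W.proj \<alpha> x) = O.W.proj 0 x + (\<Sum>\<alpha>\<in>R. O.W.proj \<alpha> x)" using finite_R by simp
    then show ?thesis using p(1)[OF True] Wt_0 unfolding p(2)[symmetric] by blast
  next
    case False
    then have "\<Phi> = R" unfolding roots_eq by auto
    then have "x = 0 + (\<Sum>\<alpha>\<in>R. O.W.proj \<alpha> x)" using p(2) by simp
    then show ?thesis using subspace_0[OF H_sub] by blast
  qed
  then show "x \<in> {x + y | x y. x \<in> H \<and> y \<in> E}" using rest by blast
next
  fix z assume "z \<in> {x + y | x y. x \<in> H \<and> y \<in> E}"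
  then obtain x a where z: "z = x + (\<Sum>\<alpha>\<in>R. scale (a \<alpha>) (e \<alpha>))" "x \<in> H" unfolding E_def by blast
  have "(\<Sum>\<alpha>\<in>R. scale (a \<alpha>) (e \<alpha>)) \<in> L"
    by (intro subspace_sum[OF L_sub] subspace_scale[OF L_sub]) (use e_root O.weight_space_L in blast)
  then show "z \<in> L" using z HL subspace_add[OF L_sub] by blast
qed

lemma H_E_orth:
  assumes x: "x \<in> H" and y: "y \<in> E"
  shows "B x y = 0"
proof -
  obtain a where y: "y = (\<Sum>\<alpha>\<in>R. scale (a \<alpha>) (e \<alpha>))" using y unfolding E_def by blast
  have "B x (e \<alpha>) = 0" if a: "\<alpha> \<in> R" for \<alpha>
  proof -
    obtain h where h: "\<alpha> h \<noteq> 0" using a by (auto simp: R_iff fun_eq_iff)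
    then have "h \<in> H" using a weight_outside by (auto simp: R_iff)
    then show ?thesis using B_orth[of x 0 "e \<alpha>" \<alpha> h] x Wt_0 e_root[OF a] h by simp
  qed
  then show ?thesis by (simp add: y B_sum B_simps)
qed

text \<open>Along \<open>H\<close> and the root vectors there are four blocks: the first is zero,
  the two mixed ones are each twice the diagonal sum of \<open>ip\<close> over \<open>P\<close>, the
  last is 4 \<open>sum_P c\<close> + 2 \<open>sum_P ip\<close>. By \<open>sum_ip\<close> the total
  is 6 \<open>sum_P ip\<close>, and \<open>sum_P ip\<close> is four times the squared length of the
  Weyl vector, whence 24.\<close>

lemma strange_formula_root_vectors:
  assumes d: "dual_pair L I u v"
  shows "casimir_trace I u v I u v = 24 * dual_form B H (weyl_vector P) (weyl_vector P)"
proof -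
  obtain Y where Y: "is_basis_of Y H" using subspace_basis[OF H_sub] by metis
  obtain h' where h': "dual_pair H Y (\<lambda>x. x) h'"
    using dual_pair_exists[OF H_sub _ Y] B_H_nondeg by blast
  note dh = dual_pairD[OF h']
  let ?u = "case_sum (\<lambda>x. x) e" and ?v = "case_sum h' (\<lambda>\<alpha>. e (- \<alpha>))"
  have full: "dual_pair L (Y <+> R) ?u ?v"
    by (rule dual_pair_join[OF h' E_dual_pair H_E_orth L_decomposition H_sub E_subspace])
  have ip: "(\<Sum>y\<in>Y. \<alpha> y * \<alpha> (h' y)) = ip \<alpha> \<alpha>" if a: "\<alpha> \<in> R" for \<alpha>
  proof -
    have "(\<Sum>y\<in>Y. \<alpha> y * \<alpha> (h' y)) = (\<Sum>y\<in>Y. B (rp \<alpha>) (h' y) * B y (rp \<alpha>))"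
      by (rule sum.cong[OF refl]) (use rpR(2)[OF a] dh(2,3) B_sym[of _ "rp \<alpha>"] in \<open>simp add: mult.commute\<close>)
    then show ?thesis unfolding ip_def using dual_pair_form[OF h' rpR(1)[OF a]] by simp
  qed
  have HH: "casimir_trace Y (\<lambda>x. x) h' Y (\<lambda>x. x) h' = 0"
    unfolding casimir_trace_def using H_abelian dh(2,3) by (simp add: bracket_simps B_simps)
  have HR: "casimir_trace Y (\<lambda>x. x) h' R e (\<lambda>\<alpha>. e (- \<alpha>)) = (\<Sum>\<alpha>\<in>R. ip \<alpha> \<alpha>)"
  proof -
    have "casimir_trace Y (\<lambda>x. x) h' R e (\<lambda>\<alpha>. e (- \<alpha>)) = (\<Sum>y\<in>Y. \<Sum>\<alpha>\<in>R. \<alpha> y * \<alpha> (h' y))"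
      unfolding casimir_trace_def
      by (intro sum.cong refl) (use dh(2,3) in \<open>simp add: bracket_h_e bracket_simps B_simps e_form mult.commute\<close>)
    then show ?thesis by (subst (asm) sum.swap) (simp add: ip)
  qed
  have RH: "casimir_trace R e (\<lambda>\<alpha>. e (- \<alpha>)) Y (\<lambda>x. x) h' = (\<Sum>\<alpha>\<in>R. ip \<alpha> \<alpha>)"
    unfolding casimir_trace_def
  proof (rule sum.cong[OF refl])
    fix \<alpha> assume a: "\<alpha> \<in> R"
    have "B (bracket (e \<alpha>) (bracket (e (- \<alpha>)) y)) (h' y) = \<alpha> y * \<alpha> (h' y)" if y: "y \<in> Y" for y
    proof -
      have "bracket (e (- \<alpha>)) y = scale (\<alpha> y) (e (- \<alpha>))"
        using bracket_h_e[OF R_neg[OF a] dh(2)[OF y]] bracket_swap[of "e (- \<alpha>)" y] by simp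
      then show ?thesis using bracket_e_neg[OF a] rpR(2)[OF a dh(3)[OF y]] by (simp add: bracket_simps B_simps)
    qed
    then show "(\<Sum>y\<in>Y. B (bracket (e \<alpha>) (bracket (e (- \<alpha>)) y)) (h' y)) = ip \<alpha> \<alpha>" using ip[OF a] by simp
  qed
  have "B (bracket (e \<alpha>) (bracket (e (- \<alpha>)) (e \<beta>))) (e (- \<beta>)) = c (- \<alpha>) \<beta>" for \<alpha> \<beta>
    unfolding B_double c_def minus_minus using bracket_swap[of "e (- \<beta>)" "e \<alpha>"] by (simp add: B_simps)
  then have "casimir_trace R e (\<lambda>\<alpha>. e (- \<alpha>)) R e (\<lambda>\<alpha>. e (- \<alpha>)) = (\<Sum>\<alpha>\<in>R. \<Sum>\<beta>\<in>R. c (- \<alpha>) \<beta>)"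
    by (simp add: casimir_trace_def)
  also have "\<dots> = sum_P (\<lambda>\<alpha> \<beta>. (c (- \<alpha>) \<beta> + c \<alpha> \<beta>) + (c (- \<alpha>) \<beta> + c \<alpha> \<beta>))"
    unfolding sum_R sum_P_def sum.distrib[symmetric] by (intro sum.cong refl) (simp add: c_neg c_neg')
  also have "\<dots> = sum_P (\<lambda>\<alpha> \<beta>. (2 * c \<alpha> \<beta> + ip \<alpha> \<beta>) + (2 * c \<alpha> \<beta> + ip \<alpha> \<beta>))"
    unfolding sum_P_def
  proof (intro sum.cong refl)
    fix \<alpha> \<beta> assume "\<alpha> \<in> P" "\<beta> \<in> P"
    then have "c (- \<alpha>) \<beta> = c \<alpha> \<beta> + ip \<alpha> \<beta>" using P_R c_jacobi by blast
    then show "(c (- \<alpha>) \<beta> + c \<alpha> \<beta>) + (c (- \<alpha>) \<beta> + c \<alpha> \<beta>) = (2 * c \<alpha> \<beta> + ip \<alpha> \<beta>) + (2 * c \<alpha> \<beta> + ip \<alpha> \<beta>)"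
      by (simp only: mult_2 add_ac)
  qed
  also have "\<dots> = 4 * sum_P c + 2 * sum_P ip"
    by (simp only: sum_P_def sum.distrib sum_distrib_left[symmetric]) (simp add: algebra_simps)
  finally have RR: "casimir_trace R e (\<lambda>\<alpha>. e (- \<alpha>)) R e (\<lambda>\<alpha>. e (- \<alpha>)) = 4 * sum_P c + 2 * sum_P ip" .
  have "(\<Sum>\<alpha>\<in>R. ip \<alpha> \<alpha>) = (\<Sum>\<alpha>\<in>P. ip \<alpha> \<alpha> + ip \<alpha> \<alpha>)"
    unfolding sum_R
  proof (rule sum.cong[OF refl])
    fix \<alpha> assume "\<alpha> \<in> P"
    then have "rp (- \<alpha>) = - rp \<alpha>" using P_R rp_neg by blast
    then show "ip \<alpha> \<alpha> + ip (- \<alpha>) (- \<alpha>) = ip \<alpha> \<alpha> + ip \<alpha> \<alpha>" by (simp add: ip_def B_simps)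
  qed
  then have D: "(\<Sum>\<alpha>\<in>R. ip \<alpha> \<alpha>) = 2 * (\<Sum>\<alpha>\<in>P. ip \<alpha> \<alpha>)" by (simp only: sum.distrib mult_2)
  have "casimir_trace I u v I u v = casimir_trace (Y <+> R) ?u ?v (Y <+> R) ?u ?v"
    by (rule casimir_trace_independent[OF L_sub d full L_sub d full])
  also have "\<dots> = (casimir_trace Y (\<lambda>x. x) h' Y (\<lambda>x. x) h' + casimir_trace Y (\<lambda>x. x) h' R e (\<lambda>\<alpha>. e (- \<alpha>))) +
     (casimir_trace R e (\<lambda>\<alpha>. e (- \<alpha>)) Y (\<lambda>x. x) h' + casimir_trace R e (\<lambda>\<alpha>. e (- \<alpha>)) R e (\<lambda>\<alpha>. e (- \<alpha>)))"
    by (simp add: casimir_trace_def sum.Plus dh(1) finite_R sum.distrib)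
  also have "\<dots> = 4 * ((\<Sum>\<alpha>\<in>P. ip \<alpha> \<alpha>) + sum_P c) + 2 * sum_P ip"
    unfolding HH HR RH RR D by (simp add: algebra_simps)
  also have "\<dots> = 6 * sum_P ip" unfolding sum_ip[symmetric] by simp
  also have "\<dots> = 24 * dual_form B H (weyl_vector P) (weyl_vector P)" unfolding dual_form_weyl[symmetric] by simp
  finally show ?thesis .
qed

end

lemma (in cartan_setup) strange_formula:
  assumes P: "positive_system H L P" and d: "dual_pair L I u v"
  shows "casimir_trace I u v I u v = 24 * dual_form B H (weyl_vector P) (weyl_vector P)"
proof -
  have PR: "P \<subseteq> roots H L" and cases: "\<And>\<alpha>. \<alpha> \<in> roots H L \<Longrightarrow> (\<alpha> \<in> P) \<noteq> (- \<alpha> \<in> P)"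
    using P unfolding positive_system_def by blast+
  have "\<exists>x y. x \<in> Wt \<alpha> \<and> y \<in> Wt (- \<alpha>) \<and> B x y = 1" if "\<alpha> \<in> P" for \<alpha>
  proof -
    have a: "\<alpha> \<in> \<Phi>" using that PR by (auto simp: roots_eq)
    obtain x where x: "x \<in> Wt \<alpha>" "x \<noteq> 0" using weight_obtain[OF a] .
    show ?thesis using weight_pairing[OF x weight_outside[OF a]] x(1) by blast
  qed
  then obtain x y where xy: "\<And>\<alpha>. \<alpha> \<in> P \<Longrightarrow> x \<alpha> \<in> Wt \<alpha>" "\<And>\<alpha>. \<alpha> \<in> P \<Longrightarrow> y \<alpha> \<in> Wt (- \<alpha>)" "\<And>\<alpha>. \<alpha> \<in> P \<Longrightarrow> B (x \<alpha>) (y \<alpha>) = 1"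
    by metis
  \<comment> \<open>A positive system contains exactly one of \<alpha> and - \<alpha>, so partners
    chosen for the positive roots normalize all opposite pairs consistently.\<close>
  define e where "e \<alpha> = (if \<alpha> \<in> P then x \<alpha> else y (- \<alpha>))" for \<alpha>
  interpret root_vectors scale Basis bracket B L H P e
  proof unfold_locales
    show "positive_system H L P" by (rule P)
    fix \<alpha> assume a: "\<alpha> \<in> roots H L"
    show "e \<alpha> \<in> Wt \<alpha>" using cases[OF a] xy(1)[of \<alpha>] xy(2)[of "- \<alpha>"] by (cases "\<alpha> \<in> P") (auto simp: e_def)
    show "B (e \<alpha>) (e (- \<alpha>)) = 1" using cases[OF a] xy(3)[of \<alpha>] xy(3)[of "- \<alpha>"] B_sym[of "y (- \<alpha>)"]
      by (cases "\<alpha> \<in> P") (auto simp: e_def)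
  qed
  show ?thesis by (rule strange_formula_root_vectors[OF d])
qed

section \<open>The constant term of the image of the Casimir element\<close>

lemma (in vector_space) dual_spaceD:
  assumes "\<alpha> \<in> dual_space U"
  shows "x \<in> U \<Longrightarrow> y \<in> U \<Longrightarrow> \<alpha> (x + y) = \<alpha> x + \<alpha> y" "x \<in> U \<Longrightarrow> \<alpha> (scale c x) = c * \<alpha> x"
    "x \<notin> U \<Longrightarrow> \<alpha> x = 0" "0 \<in> U \<Longrightarrow> \<alpha> 0 = 0"
proof -
  show 1: "x \<in> U \<Longrightarrow> \<alpha> (scale c x) = c * \<alpha> x" for x c using assms by (auto simp: dual_space_def)
  show "0 \<in> U \<Longrightarrow> \<alpha> 0 = 0" using 1[of 0 0] by simp
qed (use assms in \<open>auto simp: dual_space_def\<close>)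

section \<open>The morphism \<open>nu\<close> on the free algebra\<close>

locale lie_module = lie_algebra scale bracket
  for scale :: "'k::field_char_0 \<Rightarrow> 'g::ab_group_add \<Rightarrow> 'g" and bracket +
  fixes \<kk> \<pp> Z :: "'g set"
  assumes k_subspace: "subspace \<kk>" and p_subspace: "subspace \<pp>"
    and k_closed: "\<And>x y. x \<in> \<kk> \<Longrightarrow> y \<in> \<kk> \<Longrightarrow> bracket x y \<in> \<kk>"
    and p_closed: "\<And>x y. x \<in> \<kk> \<Longrightarrow> y \<in> \<pp> \<Longrightarrow> bracket x y \<in> \<pp>"
    and Z_basis: "is_basis_of Z \<pp>" and Z_finite: "finite Z"
begin

abbreviation "V \<equiv> double \<pp>"
abbreviation "vsc \<equiv> double_scale scale"

lemma double_generators: "free_generators vsc V"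
proof unfold_locales
  show "0 \<in> V" using subspace_0[OF p_subspace] by (simp add: double_def zero_prod_def dual_space_def)
  show "v + w \<in> V" if "v \<in> V" "w \<in> V" for v w
    using that subspace_add[OF p_subspace] by (auto simp: double_def plus_prod_def dual_space_def algebra_simps)
  show "vsc c v \<in> V" if "v \<in> V" for c v
    using that subspace_scale[OF p_subspace]
    by (auto simp: double_def double_scale_def dual_space_def algebra_simps)
qed

sublocale weyl_system vsc V double_form
proof (intro weyl_system.intro double_generators weyl_system_axioms.intro)
  fix u v w c assume "u \<in> V" "v \<in> V"
  then show "double_form u (vsc c v) = c * double_form u v" "double_form u v = - double_form v u"
    by (auto simp: double_def double_form_def double_scale_def dual_spaceD algebra_simps)
  assume "w \<in> V"
  then show "double_form u (v + w) = double_form u v + double_form u w"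
    using \<open>u \<in> V\<close> \<open>v \<in> V\<close> by (auto simp: double_def double_form_def dual_spaceD algebra_simps)
qed

definition coord :: "'g \<Rightarrow> 'g \<Rightarrow> 'k" where
  "coord z = (\<lambda>y. representation Z y z)"

lemma Z_indep: "independent Z" and Z_span: "span Z = \<pp>"
  using Z_basis by (auto simp: is_basis_of_def)

lemma coord_dual: "coord z \<in> dual_space \<pp>"
  using Z_indep Z_span
  by (auto simp: dual_space_def coord_def representation_add representation_scale)
     (simp add: representation_def)

lemma coord_sum: "u \<in> \<pp> \<Longrightarrow> (\<Sum>z\<in>Z. scale (coord z u) z) = u"
  using sum_representation_eq[OF Z_indep, of u Z] Z_finite Z_span by (simp add: coord_def)

definition gp :: "'g \<Rightarrow> ('k, 'g \<times> ('g \<Rightarrow> 'k)) free" where "gp v = free_gen (v, 0)"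
definition gd :: "('g \<Rightarrow> 'k) \<Rightarrow> ('k, 'g \<times> ('g \<Rightarrow> 'k)) free" where "gd \<alpha> = free_gen (0, \<alpha>)"

lemma Z_p: "z \<in> Z \<Longrightarrow> z \<in> \<pp>" using Z_span span_base by blast
lemma bracket_Z: "x \<in> \<kk> \<Longrightarrow> z \<in> Z \<Longrightarrow> bracket x z \<in> \<pp>"
  by (intro p_closed Z_p)
lemma pV: "v \<in> \<pp> \<Longrightarrow> (v, 0) \<in> V"
  using subspace_0[OF p_subspace] by (simp add: double_def dual_space_def)
lemma dV: "\<alpha> \<in> dual_space \<pp> \<Longrightarrow> (0, \<alpha>) \<in> V"
  using subspace_0[OF p_subspace] by (simp add: double_def)

lemma gp_carrier: "v \<in> \<pp> \<Longrightarrow> gp v \<in> free_carrier V" by (simp add: gp_def free_carrier_gen pV)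
lemma gd_carrier: "\<alpha> \<in> dual_space \<pp> \<Longrightarrow> gd \<alpha> \<in> free_carrier V" by (simp add: gd_def free_carrier_gen dV)

lemmas IW = free_subspaceD[OF W.I_subspace]

lemma gp_add: "v \<in> \<pp> \<Longrightarrow> w \<in> \<pp> \<Longrightarrow> gp (v + w) - gp v - gp w \<in> W.I"
  using gen_add_I(4)[OF pV pV, of v w] by (simp add: gp_def)

lemma gp_scale: "v \<in> \<pp> \<Longrightarrow> gp (scale c v) - free_scale c (gp v) \<in> W.I"
  using gen_add_I(5)[OF pV, of v c] by (simp add: gp_def double_scale_def zero_fun_def)

lemma gp_sum:
  assumes "finite X" "\<And>x. x \<in> X \<Longrightarrow> h x \<in> \<pp>"
  shows "gp (\<Sum>x\<in>X. scale (c x) (h x)) - (\<Sum>x\<in>X. free_scale (c x) (gp (h x))) \<in> W.I"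
  using assms
proof (induction X)
  case empty
  have "gp (scale 0 0) - free_scale 0 (gp 0) \<in> W.I" by (rule gp_scale) (rule subspace_0[OF p_subspace])
  then show ?case by simp
next
  case (insert x X)
  have 1: "scale (c x) (h x) \<in> \<pp>" "(\<Sum>x\<in>X. scale (c x) (h x)) \<in> \<pp>"
    using insert.prems by (auto intro!: subspace_sum[OF p_subspace] subspace_scale[OF p_subspace])
  have "(gp (scale (c x) (h x) + (\<Sum>x\<in>X. scale (c x) (h x))) - gp (scale (c x) (h x)) - gp (\<Sum>x\<in>X. scale (c x) (h x))) +
     (gp (scale (c x) (h x)) - free_scale (c x) (gp (h x))) +
     (gp (\<Sum>x\<in>X. scale (c x) (h x)) - (\<Sum>x\<in>X. free_scale (c x) (gp (h x)))) \<in> W.I"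
    by (intro IW(2)) (use gp_add[OF 1] gp_scale[of "h x" "c x"] insert in auto)
  then show ?case using insert.hyps by (simp add: algebra_simps)
qed

definition nu_free :: "'g \<Rightarrow> ('k, 'g \<times> ('g \<Rightarrow> 'k)) free" where
  "nu_free x = (\<Sum>z\<in>Z. gp (bracket x z) * gd (coord z))"

lemma nu_free_carrier: "x \<in> \<kk> \<Longrightarrow> nu_free x \<in> free_carrier V"
  unfolding nu_free_def by (intro free_carrier_sum free_carrier_mult gp_carrier gd_carrier coord_dual bracket_Z)

lemma nu_eq: "x \<in> \<kk> \<Longrightarrow> nu \<pp> Z x = W.\<pi> (nu_free x)"
proof -
  assume x: "x \<in> \<kk>"
  have "W.\<pi> (nu_free x) = (\<Oplus>\<^bsub>W.A\<^esub>z\<in>Z. W.\<pi> (gp (bracket x z) * gd (coord z)))"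
    unfolding nu_free_def
    by (rule W.pi_finsum) (auto intro!: free_carrier_mult gp_carrier gd_carrier coord_dual bracket_Z x Z_finite)
  also have "\<dots> = (\<Oplus>\<^bsub>W.A\<^esub>z\<in>Z. W.\<pi> (gp (bracket x z)) \<otimes>\<^bsub>W.A\<^esub> W.\<pi> (gd (coord z)))"
    by (intro abelian_monoid.finsum_cong' [OF abelian_group.axioms(1)[OF ring.axioms(1)[OF W.ring_A]]])
      (auto intro!: W.pi_closed W.pi_simps(2) monoid.m_closed[OF ring.is_monoid[OF W.ring_A]]
         gp_carrier gd_carrier coord_dual bracket_Z x)
  finally show ?thesis by (simp add: nu_def Let_def quot_gen_eq gp_def gd_def coord_def)
qed

lemma nu_free_add:
  assumes "x \<in> \<kk>" "y \<in> \<kk>"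
  shows "nu_free (x + y) - nu_free x - nu_free y \<in> W.I"
proof -
  have "nu_free (x + y) - nu_free x - nu_free y =
      (\<Sum>z\<in>Z. (gp (bracket x z + bracket y z) - gp (bracket x z) - gp (bracket y z)) * gd (coord z))"
    by (simp add: nu_free_def bracket_simps left_diff_distrib sum_subtractf)
  then show ?thesis
    using assms by (auto intro!: IW(6) W.I_mult(2) gp_add bracket_Z gd_carrier coord_dual)
qed

lemma nu_free_scale:
  assumes "x \<in> \<kk>"
  shows "nu_free (scale c x) - free_scale c (nu_free x) \<in> W.I"
proof -
  have "nu_free (scale c x) - free_scale c (nu_free x) =
      (\<Sum>z\<in>Z. (gp (scale c (bracket x z)) - free_scale c (gp (bracket x z))) * gd (coord z))"
    by (simp add: nu_free_def bracket_simps left_diff_distrib sum_subtractf sum_distrib_left mult.assoc)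
  then show ?thesis
    using assms by (auto intro!: IW(6) W.I_mult(2) gp_scale bracket_Z gd_carrier coord_dual)
qed

text \<open>Four commutators of generators, multiplied by the remaining factors, telescope to the
  commutator of the two quadratic terms; those within \<pp> and within its dual vanish because both
  are isotropic.\<close>

lemma gp_gd_commutator:
  assumes "v \<in> \<pp>" "w \<in> \<pp>" "\<alpha> \<in> dual_space \<pp>" "\<beta> \<in> dual_space \<pp>"
  shows "(gp v * gd \<alpha>) * (gp w * gd \<beta>) - (gp w * gd \<beta>) * (gp v * gd \<alpha>)
     - (free_scale (\<alpha> w) (gp v) * gd \<beta> - free_scale (\<beta> v) (gp w) * gd \<alpha>) \<in> W.I"
proof -
  let ?a = "gp v" and ?b = "gd \<alpha>" and ?c = "gp w" and ?d = "gd \<beta>"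
  have z: "\<alpha> 0 = 0" "\<beta> 0 = 0" using assms dual_spaceD(4) subspace_0[OF p_subspace] by auto
  have 1: "?b * ?c - ?c * ?b - free_scalar (\<alpha> w) \<in> W.I" "?d * ?a - ?a * ?d - free_scalar (\<beta> v) \<in> W.I"
    "?a * ?c - ?c * ?a \<in> W.I" "?b * ?d - ?d * ?b \<in> W.I"
    using gen_add_I(6)[OF dV[OF assms(3)] pV[OF assms(2)]] gen_add_I(6)[OF dV[OF assms(4)] pV[OF assms(1)]]
      gen_add_I(6)[OF pV[OF assms(1)] pV[OF assms(2)]] gen_add_I(6)[OF dV[OF assms(3)] dV[OF assms(4)]]
    by (simp_all add: gp_def gd_def double_form_def z)
  have "?a * (?b * ?c - ?c * ?b - free_scalar (\<alpha> w)) * ?d - ?c * (?d * ?a - ?a * ?d - free_scalar (\<beta> v)) * ?b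
     + (?a * ?c - ?c * ?a) * (?b * ?d) + ?c * ?a * (?b * ?d - ?d * ?b) \<in> W.I"
    by (rule IW(2)[OF IW(2)[OF IW(5)[OF W.I_mult(2)[OF W.I_mult(1)[OF 1(1)]] W.I_mult(2)[OF W.I_mult(1)[OF 1(2)]]]
        W.I_mult(2)[OF 1(3)]] W.I_mult(1)[OF 1(4)]])
      (intro free_carrier_mult gp_carrier gd_carrier assms)+
  moreover have "?a * (?b * ?c - ?c * ?b - free_scalar (\<alpha> w)) * ?d - ?c * (?d * ?a - ?a * ?d - free_scalar (\<beta> v)) * ?b
     + (?a * ?c - ?c * ?a) * (?b * ?d) + ?c * ?a * (?b * ?d - ?d * ?b) =
     (?a * ?b) * (?c * ?d) - (?c * ?d) * (?a * ?b) - (?a * free_scalar (\<alpha> w) * ?d - ?c * free_scalar (\<beta> v) * ?b)"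
    by (simp add: algebra_simps)
  ultimately show ?thesis by (simp only: free_scalar_commute)
qed

lemma nu_free_contract:
  assumes x: "x \<in> \<kk>" and u: "u \<in> \<pp>"
  shows "(\<Sum>z\<in>Z. free_scale (coord z u) (gp (bracket x z))) - gp (bracket x u) \<in> W.I"
proof -
  have "bracket x u = (\<Sum>z\<in>Z. scale (coord z u) (bracket x z))"
    by (subst coord_sum[OF u, symmetric]) (simp only: bracket_simps(4,5))
  then show ?thesis
    using IW(4)[OF gp_sum[OF Z_finite, of "bracket x" "\<lambda>z. coord z u"]] x by (simp add: p_closed Z_p)
qed

text \<open>The quadratic element of \<open>x\<close> stands for the operator ad x on \<pp>. By
  \<open>nu_free_contract\<close> the contracted sums recombine to the elements of ad x ad y and ad
  y ad x, whose difference is ad [x, y].\<close>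

lemma nu_free_bracket:
  assumes x: "x \<in> \<kk>" and y: "y \<in> \<kk>"
  shows "nu_free x * nu_free y - nu_free y * nu_free x - nu_free (bracket x y) \<in> W.I"
proof -
  let ?t = "\<lambda>x z. gp (bracket x z) * gd (coord z)"
  have 1: "nu_free x * nu_free y - nu_free y * nu_free x =
     (\<Sum>z\<in>Z. \<Sum>z'\<in>Z. ?t x z * ?t y z' - ?t y z' * ?t x z)"
    unfolding nu_free_def sum_product sum_subtractf by (subst (2) sum.swap) simp
  let ?u = "\<lambda>z z'. free_scale (coord z (bracket y z')) (gp (bracket x z)) * gd (coord z')
     - free_scale (coord z' (bracket x z)) (gp (bracket y z')) * gd (coord z)"
  have c: "bracket x z \<in> \<pp>" "bracket y z \<in> \<pp>" if "z \<in> Z" for z using that x y by (simp_all add: p_closed Z_p)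
  have 2: "(\<Sum>z\<in>Z. \<Sum>z'\<in>Z. ?t x z * ?t y z' - ?t y z' * ?t x z - ?u z z') \<in> W.I"
    by (intro IW(6) gp_gd_commutator c coord_dual)
  have 3: "(\<Sum>z\<in>Z. \<Sum>z'\<in>Z. ?u z z') =
     (\<Sum>z\<in>Z. (\<Sum>z'\<in>Z. free_scale (coord z' (bracket y z)) (gp (bracket x z'))) * gd (coord z)) -
     (\<Sum>z\<in>Z. (\<Sum>z'\<in>Z. free_scale (coord z' (bracket x z)) (gp (bracket y z'))) * gd (coord z))"
    unfolding sum_subtractf sum_distrib_right by (subst (1) sum.swap) simp
  have 4: "(\<Sum>z\<in>Z. ((\<Sum>z'\<in>Z. free_scale (coord z' (bracket y z)) (gp (bracket x z'))) - gp (bracket x (bracket y z))) * gd (coord z)) \<in> W.I"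
    "(\<Sum>z\<in>Z. ((\<Sum>z'\<in>Z. free_scale (coord z' (bracket x z)) (gp (bracket y z'))) - gp (bracket y (bracket x z))) * gd (coord z)) \<in> W.I"
    by (intro IW(6) W.I_mult(2) nu_free_contract gd_carrier coord_dual c x y; assumption)+
  have 5: "(\<Sum>z\<in>Z. (gp (bracket x (bracket y z)) - gp (bracket y (bracket x z)) - gp (bracket (bracket x y) z)) * gd (coord z)) \<in> W.I"
  proof (intro IW(6) W.I_mult(2) gd_carrier coord_dual)
    fix z assume z: "z \<in> Z"
    have "gp (bracket (bracket x y) z + bracket y (bracket x z)) - gp (bracket (bracket x y) z) - gp (bracket y (bracket x z)) \<in> W.I"
      using z x y by (intro gp_add) (auto intro: p_closed k_closed c bracket_Z)
    then show "gp (bracket x (bracket y z)) - gp (bracket y (bracket x z)) - gp (bracket (bracket x y) z) \<in> W.I"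
      by (simp add: bracket_bracket algebra_simps)
  qed
  show ?thesis
    using IW(2)[OF 2 IW(2)[OF IW(5)[OF 4] 5]] 3 unfolding 1
    by (simp add: sum_subtractf left_diff_distrib nu_free_def)
qed

lemma k_generators: "free_generators scale \<kk>"
  by unfold_locales (auto intro: subspace_0 subspace_add subspace_scale k_subspace)

definition "env_free = {free_gen x * free_gen y - free_gen y * free_gen x - free_gen (bracket x y) :: ('k, 'g) free | x y. x \<in> \<kk> \<and> y \<in> \<kk>}"

sublocale U: free_quotient scale \<kk> env_free "enveloping_relations \<kk>"
proof unfold_locales
  interpret t: free_quotient scale \<kk> "{}" "{}" by (rule free_generators.trivial_quotient[OF k_generators])
  note c = free_carrier_diff free_carrier_mult free_carrier_gen free_carrier_scalar
  show "env_free \<subseteq> free_carrier \<kk>" unfolding env_free_def by (auto intro!: c k_closed)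
  have "t.\<tau> (free_gen v * free_gen w - free_gen w * free_gen v - free_gen (bracket v w)) =
     tensor_gen scale \<kk> v \<otimes>\<^bsub>tensor_algebra scale \<kk>\<^esub> tensor_gen scale \<kk> w
       \<ominus>\<^bsub>tensor_algebra scale \<kk>\<^esub> tensor_gen scale \<kk> w \<otimes>\<^bsub>tensor_algebra scale \<kk>\<^esub> tensor_gen scale \<kk> v
       \<ominus>\<^bsub>tensor_algebra scale \<kk>\<^esub> tensor_gen scale \<kk> (bracket v w)" if "v \<in> \<kk>" "w \<in> \<kk>" for v w
    using that by (simp add: t.tau_simps c k_closed tensor_gen_def)
  then show "enveloping_relations \<kk> = t.\<tau> ` env_free"
    unfolding enveloping_relations_def env_free_def Let_def by (intro image_setcompr2) auto
qed (auto intro: subspace_0 subspace_add subspace_scale k_subspace)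

primrec nu_word :: "'g list \<Rightarrow> ('k, 'g \<times> ('g \<Rightarrow> 'k)) free" where
  "nu_word [] = 1"
| "nu_word (x # xs) = nu_free x * nu_word xs"

definition nu_ext :: "('k, 'g) free \<Rightarrow> ('k, 'g \<times> ('g \<Rightarrow> 'k)) free" where
  "nu_ext = free_lift nu_word"

lemma nu_ext_linear:
  "nu_ext (f + g) = nu_ext f + nu_ext g" "nu_ext (f - g) = nu_ext f - nu_ext g"
  "nu_ext (free_scale c f) = free_scale c (nu_ext f)" "nu_ext 0 = 0" "nu_ext (word ws) = nu_word ws"
  "nu_ext (sum h X) = (\<Sum>x\<in>X. nu_ext (h x))"
  by (simp_all add: nu_ext_def free_lift_add free_lift_diff free_lift_scale free_lift_word free_lift_sum)

lemma nu_word_append: "nu_word (xs @ ys) = nu_word xs * nu_word ys"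
  by (induction xs) (simp_all add: mult.assoc)

lemma nu_ext_mult: "nu_ext (f * g) = nu_ext f * nu_ext g"
proof -
  have 1: "nu_ext (word us * g) = nu_word us * nu_ext g" for us
  proof -
    have "g \<in> {g. nu_ext (word us * g) = nu_word us * nu_ext g}"
      by (rule free_subspace_induct[of g UNIV])
        (auto simp: free_subspace_def nu_ext_linear distrib_left free_carrier_def nu_word_append
          free_scale_left_commute[of "word us"] free_scale_left_commute[of "nu_word us"] simp flip: word_append)
    then show ?thesis by simp
  qed
  have "f \<in> {f. nu_ext (f * g) = nu_ext f * nu_ext g}"
    by (rule free_subspace_induct[of f UNIV])
      (auto simp: free_subspace_def nu_ext_linear 1 distrib_right free_carrier_def mult.assoc)
  then show ?thesis by simp
qed

lemma nu_ext_gen: "nu_ext (free_gen x) = nu_free x"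
  using nu_ext_linear(5)[of "[x]"] by (simp add: free_gen_def)

lemma nu_ext_scalar: "nu_ext (free_scalar c) = free_scalar c"
  using nu_ext_linear(3)[of c 1] nu_ext_linear(5)[of "[]"] by (simp add: word_Nil)

lemma nu_word_carrier: "set xs \<subseteq> \<kk> \<Longrightarrow> nu_word xs \<in> free_carrier V"
  by (induction xs) (auto intro!: free_carrier_mult nu_free_carrier)

lemma nu_ext_carrier: "f \<in> free_carrier \<kk> \<Longrightarrow> nu_ext f \<in> free_carrier V"
  unfolding nu_ext_def by (erule free_lift_carrier) (rule nu_word_carrier)

lemma nu_ext_I:
  assumes f: "f \<in> U.I"
  shows "nu_ext f \<in> W.I"
proof -
  have mid: "nu_word u * (r * nu_word u') \<in> W.I" if "r \<in> W.I" "set u \<subseteq> \<kk>" "set u' \<subseteq> \<kk>" for r u u'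
    by (intro W.I_mult(1)[OF W.I_mult(2)] nu_word_carrier that)
  have "f \<in> {f. nu_ext f \<in> W.I}"
  proof (rule U.I_induct[OF _ _ _ _ f])
    show "free_subspace {f. nu_ext f \<in> W.I}"
      using IW(1-3) by (auto simp: free_subspace_def nu_ext_linear)
  next
    fix a b and u u' :: "'g list" assume ab: "a \<in> \<kk>" "b \<in> \<kk>" and u: "set u \<subseteq> \<kk>" "set u' \<subseteq> \<kk>"
    show "word (u @ [a + b] @ u') - word (u @ [a] @ u') - word (u @ [b] @ u') \<in> {f. nu_ext f \<in> W.I}"
      using mid[OF nu_free_add[OF ab] u] by (simp add: nu_ext_linear(1,2,5) nu_word_append algebra_simps)
  next
    fix a c and u u' :: "'g list" assume a: "a \<in> \<kk>" and u: "set u \<subseteq> \<kk>" "set u' \<subseteq> \<kk>"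
    show "word (u @ [scale c a] @ u') - free_scale c (word (u @ [a] @ u')) \<in> {f. nu_ext f \<in> W.I}"
      using mid[OF nu_free_scale[OF a, of c] u]
      by (simp add: nu_ext_linear(2,3,5) nu_word_append left_diff_distrib right_diff_distrib mult.assoc
        free_scale_left_commute[of "nu_word u"])
  next
    fix r and u u' :: "'g list" assume r: "r \<in> env_free" and u: "set u \<subseteq> \<kk>" "set u' \<subseteq> \<kk>"
    then obtain a b where ab: "a \<in> \<kk>" "b \<in> \<kk>" "r = free_gen a * free_gen b - free_gen b * free_gen a - free_gen (bracket a b)"
      by (auto simp: env_free_def)
    then have "nu_ext r \<in> W.I" using nu_free_bracket by (simp add: nu_ext_linear(2) nu_ext_mult nu_ext_gen)
    from mid[OF this u]
    show "word u * r * word u' \<in> {f. nu_ext f \<in> W.I}" by (simp add: nu_ext_mult nu_ext_linear(5) mult.assoc)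
  qed
  then show ?thesis by simp
qed

text \<open>As for symmetrization, a map on representatives resolves the definite description.
  Existence rests on \<open>nu_ext_I\<close>; uniqueness holds because scalars and generators
  generate the enveloping algebra.\<close>

lemma nu_hom_eq:
  assumes f: "f \<in> free_carrier \<kk>"
  shows "nu_hom \<kk> \<pp> Z (U.\<pi> f) = W.\<pi> (nu_ext f)"
proof -
  note c = free_carrier_add free_carrier_mult free_carrier_scalar free_carrier_gen nu_ext_carrier
  define rep where "rep a = (SOME f. f \<in> free_carrier \<kk> \<and> U.\<pi> f = a)" for a
  define N where "N = restrict (\<lambda>a. W.\<pi> (nu_ext (rep a))) (carrier U.A)"
  have rep: "rep (U.\<pi> f) \<in> free_carrier \<kk>" "U.\<pi> (rep (U.\<pi> f)) = U.\<pi> f" if "f \<in> free_carrier \<kk>" for f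
    using someI[of "\<lambda>g. g \<in> free_carrier \<kk> \<and> U.\<pi> g = U.\<pi> f" f] that by (auto simp: rep_def)
  have N: "N (U.\<pi> f) = W.\<pi> (nu_ext f)" if f: "f \<in> free_carrier \<kk>" for f
  proof -
    have "rep (U.\<pi> f) - f \<in> U.I" using rep[OF f] f U.pi_eq_iff by metis
    then have "nu_ext (rep (U.\<pi> f)) - nu_ext f \<in> W.I" using nu_ext_I by (metis nu_ext_linear(2))
    then show ?thesis using rep[OF f] f by (simp add: N_def U.pi_closed W.pi_eq_iff nu_ext_carrier)
  qed
  let ?P = "\<lambda>N. N \<in> ring_hom U.A W.A \<and> N \<in> extensional (carrier U.A) \<and>
        (\<forall>c. N (quot_scalar scale \<kk> (enveloping_relations \<kk>) c) = quot_scalar vsc V (weyl_relations vsc V double_form) c) \<and>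
        (\<forall>x\<in>\<kk>. N (quot_gen scale \<kk> (enveloping_relations \<kk>) x) = nu \<pp> Z x)"
  have PN: "?P N"
  proof (intro conjI ballI allI)
    show "N \<in> ring_hom U.A W.A"
    proof (rule ring_hom_memI)
      fix a assume "a \<in> carrier U.A"
      then show "N a \<in> carrier W.A" using N W.pi_closed nu_ext_carrier by (auto simp: U.carrier_A)
    next
      fix a b assume "a \<in> carrier U.A" "b \<in> carrier U.A"
      then obtain f g where "f \<in> free_carrier \<kk>" "g \<in> free_carrier \<kk>" "a = U.\<pi> f" "b = U.\<pi> g" by (auto simp: U.carrier_A)
      then show "N (a \<otimes>\<^bsub>U.A\<^esub> b) = N a \<otimes>\<^bsub>W.A\<^esub> N b" "N (a \<oplus>\<^bsub>U.A\<^esub> b) = N a \<oplus>\<^bsub>W.A\<^esub> N b"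
        by (simp_all add: N c nu_ext_linear(1) nu_ext_mult flip: U.pi_simps W.pi_simps)
    next
      have "nu_ext 1 = 1" using nu_ext_linear(5)[of "[]"] by (simp add: word_Nil)
      then show "N \<one>\<^bsub>U.A\<^esub> = \<one>\<^bsub>W.A\<^esub>" using N[of 1] by (simp add: U.pi_simps(3) W.pi_simps(3))
    qed
    show "N \<in> extensional (carrier U.A)" by (simp add: N_def)
    show "N (quot_scalar scale \<kk> (enveloping_relations \<kk>) c) = quot_scalar vsc V (weyl_relations vsc V double_form) c" for c
      by (simp add: quot_scalar_eq N free_carrier_scalar nu_ext_scalar)
    show "N (quot_gen scale \<kk> (enveloping_relations \<kk>) x) = nu \<pp> Z x" if "x \<in> \<kk>" for x
      using that by (simp add: quot_gen_eq N free_carrier_gen nu_ext_gen nu_eq)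
  qed
  have unique: "N' = N" if P: "?P N'" for N'
  proof (rule extensionalityI[of _ "carrier U.A"])
    note P1 = P[THEN conjunct1] and P3 = P[THEN conjunct2, THEN conjunct2, THEN conjunct1]
      and P4 = P[THEN conjunct2, THEN conjunct2, THEN conjunct2]
    note hm = ring_hom_memE[OF P1]
    have scal: "N' (U.\<pi> (free_scalar c)) = W.\<pi> (free_scalar c)" for c using P3 by (simp add: quot_scalar_eq)
    have gen: "N' (U.\<pi> (free_gen x)) = W.\<pi> (nu_free x)" if "x \<in> \<kk>" for x
      using P4 that by (simp add: quot_gen_eq nu_eq)
    fix a assume "a \<in> carrier U.A"
    then obtain f where f: "f \<in> free_carrier \<kk>" "a = U.\<pi> f" by (auto simp: U.carrier_A)
    have mlt: "N' (U.\<pi> (f * g)) = N' (U.\<pi> f) \<otimes>\<^bsub>W.A\<^esub> N' (U.\<pi> g)" if "f \<in> free_carrier \<kk>" "g \<in> free_carrier \<kk>" for f g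
      using hm(2)[OF U.pi_closed[OF that(1)] U.pi_closed[OF that(2)]] U.pi_simps(2)[OF that] by simp
    have "f \<in> {f \<in> free_carrier \<kk>. N' (U.\<pi> f) = W.\<pi> (nu_ext f)}"
    proof (rule free_subspace_induct[OF f(1)])
      show "free_subspace {f \<in> free_carrier \<kk>. N' (U.\<pi> f) = W.\<pi> (nu_ext f)}"
        unfolding free_subspace_def
      proof (intro conjI ballI allI)
        show "0 \<in> {f \<in> free_carrier \<kk>. N' (U.\<pi> f) = W.\<pi> (nu_ext f)}"
          using scal[of 0] by (simp add: nu_ext_linear(4))
      next
        fix f g assume fg: "f \<in> {f \<in> free_carrier \<kk>. N' (U.\<pi> f) = W.\<pi> (nu_ext f)}" "g \<in> {f \<in> free_carrier \<kk>. N' (U.\<pi> f) = W.\<pi> (nu_ext f)}"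
        then have fg': "f \<in> free_carrier \<kk>" "g \<in> free_carrier \<kk>" by auto
        show "f + g \<in> {f \<in> free_carrier \<kk>. N' (U.\<pi> f) = W.\<pi> (nu_ext f)}"
          using fg hm(3)[OF U.pi_closed[OF fg'(1)] U.pi_closed[OF fg'(2)]]
          by (simp add: c U.pi_simps(1) nu_ext_linear(1) W.pi_simps(1))
      next
        fix d f assume "f \<in> {f \<in> free_carrier \<kk>. N' (U.\<pi> f) = W.\<pi> (nu_ext f)}"
        then show "free_scale d f \<in> {f \<in> free_carrier \<kk>. N' (U.\<pi> f) = W.\<pi> (nu_ext f)}"
          using mlt[of "free_scalar d" f] by (simp add: c scal nu_ext_linear(3) W.pi_simps(2))
      qed
    next
      fix vs :: "'g list" assume vs: "set vs \<subseteq> \<kk>"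
      have "N' (U.\<pi> (word vs)) = W.\<pi> (nu_word vs)"
        using vs
      proof (induction vs)
        case Nil
        then show ?case using hm(4) by (simp add: word_Nil U.pi_simps(3) W.pi_simps(3))
      next
        case (Cons x xs)
        then show ?case
          using mlt[of "free_gen x" "word xs"]
          by (simp add: word_Cons gen c free_carrier_word W.pi_simps(2) nu_free_carrier nu_word_carrier)
      qed
      then show "word vs \<in> {f \<in> free_carrier \<kk>. N' (U.\<pi> f) = W.\<pi> (nu_ext f)}"
        using vs by (simp add: free_carrier_word nu_ext_linear(5))
    qed
    then show "N' a = N a" using f N by simp
  qed (use P PN in blast)+
  have "nu_hom \<kk> \<pp> Z = (THE N. ?P N)" by (simp add: nu_hom_def Let_def)
  also have "\<dots> = N" by (rule the_equality[of ?P N]) (rule PN, rule unique)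
  finally show ?thesis using N[OF f] by simp
qed

section \<open>Constant terms and the trace on \<pp>\<close>

lemma lookup_gen_mult: "Poly_Mapping.lookup (free_gen v * f) 0 = 0"
proof -
  have "f \<in> {f. Poly_Mapping.lookup (free_gen v * f) 0 = 0}"
    by (rule free_subspace_induct[of f UNIV])
      (auto simp: free_subspace_def distrib_left lookup_add free_carrier_def lookup_free_scale
        free_scale_left_commute[of "free_gen v"] lookup_single zero_free_monoid_def simp flip: word_Cons)
  then show ?thesis by simp
qed

lemma lookup_act: "Poly_Mapping.lookup (act v f) 0 = Poly_Mapping.lookup (deriv v f) 0 / 2"
  by (simp add: act_def lookup_add lookup_gen_mult lookup_free_scale)

text \<open>Wick's formula: only complete contractions reach the constant term, that is, the three
  pairings of four vectors. Each pairing uses two half contractions, whence the denominator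
  4.\<close>

lemma lookup_normal_4:
  "Poly_Mapping.lookup (normal (free_gen a * free_gen b * (free_gen c * free_gen d))) 0 =
    (double_form a b * double_form c d + double_form a c * double_form b d + double_form a d * double_form b c) / 4"
proof -
  have 1: "deriv v 1 = 0" for v using deriv_linear(5)[of v "[]"] by (simp add: word_Nil)
  have n1: "normal 1 = 1" using normal_linear(5)[of "[]"] by (simp add: word_Nil)
  have s: "deriv v (free_scalar k) = 0" for v k
    using deriv_linear(3)[of v k 1] 1 by simp
  have g: "deriv v (free_gen w) = free_scalar (double_form v w)" for v w
    using deriv_gen_mult[of v w 1] 1 by simp
  have l: "Poly_Mapping.lookup (free_scalar k :: ('k, _) free) 0 = k" for k by (simp add: free_scalar_def)
  have "free_gen a * free_gen b * (free_gen c * free_gen d) = free_gen a * (free_gen b * (free_gen c * (free_gen d * (1 :: ('k, _) free))))"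
    by (simp add: mult.assoc)
  then have "normal (free_gen a * free_gen b * (free_gen c * free_gen d)) = act a (act b (act c (free_gen d)))"
    by (simp only: normal_gen_mult n1) (simp add: act_def[of d] 1)
  moreover have ab: "deriv v (act w f) = free_scale (double_form v w) f + free_gen w * deriv v f + free_scale (1/2) (deriv v (deriv w f))" for v w f
    by (simp add: act_def deriv_linear deriv_gen_mult)
  have "deriv b (act c (free_gen d)) = free_scale (double_form b c) (free_gen d) + free_gen c * free_scalar (double_form b d)"
    by (simp add: ab g s)
  then have "deriv a (deriv b (act c (free_gen d))) = free_scalar (double_form b c * double_form a d) + free_scalar (double_form a c * double_form b d)"
    by (simp add: deriv_linear deriv_gen_mult g s free_scalar_mult)
  ultimately show ?thesis
    by (simp add: lookup_act ab g lookup_add lookup_gen_mult lookup_free_scale l)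
qed

end

text \<open>A complementary ideal \<open>J\<close> commutes with \<open>I\<close>, since their
  brackets lie in both. As \<open>I\<close> is abelian, all brackets of \<open>L\<close> lie in
  \<open>J\<close>; so an \<open>I\<close> inside the derived algebra is contained in
  \<open>J\<close>, which it meets only in 0.\<close>

lemma (in lie_algebra) reductive_abelian_ideal:
  assumes r: "reductive L" and I: "lie_ideal I L" and ab: "\<And>x y. x \<in> I \<Longrightarrow> y \<in> I \<Longrightarrow> bracket x y = 0"
    and d: "I \<subseteq> span {bracket x y | x y. x \<in> L \<and> y \<in> L}"
  shows "I = {0}"
proof -
  obtain J where J: "lie_ideal J L" "I \<inter> J = {0}" "{x + y | x y. x \<in> I \<and> y \<in> J} = L"
    using r I unfolding reductive_def by blast
  have Is: "subspace I" and Js: "subspace J" and IL: "I \<subseteq> L" and JL: "J \<subseteq> L"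
    and Ii: "\<And>x y. x \<in> L \<Longrightarrow> y \<in> I \<Longrightarrow> bracket x y \<in> I" and Ji: "\<And>x y. x \<in> L \<Longrightarrow> y \<in> J \<Longrightarrow> bracket x y \<in> J"
    using I J(1) by (auto simp: lie_ideal_def)
  have IJ: "bracket a b = 0" if "a \<in> I" "b \<in> J" for a b
  proof -
    have "bracket b a \<in> I" using Ii that JL by blast
    then have "bracket a b \<in> I" using subspace_neg[OF Is] bracket_swap[of a b] by simp
    moreover have "bracket a b \<in> J" using Ji that IL by blast
    ultimately show ?thesis using J(2) by blast
  qed
  have "bracket x y \<in> J" if xy: "x \<in> L" "y \<in> L" for x y
  proof -
    obtain a b where x: "x = a + b" "a \<in> I" "b \<in> J" using xy(1) J(3) by blast
    obtain a' b' where y: "y = a' + b'" "a' \<in> I" "b' \<in> J" using xy(2) J(3) by blast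
    have "bracket b a' = 0" using IJ[OF y(2) x(3)] bracket_swap[of b a'] by simp
    then have "bracket x y = bracket b b'" using ab[OF x(2) y(2)] IJ[OF x(2) y(3)] by (simp add: x(1) y(1) bracket_simps)
    then show ?thesis using Ji[of b b'] x(3) y(3) JL by auto
  qed
  then have "span {bracket x y | x y. x \<in> L \<and> y \<in> L} \<subseteq> J" by (intro span_minimal[OF _ Js]) blast
  then show ?thesis using d J(2) subspace_0[OF Is] by blast
qed

text \<open>Of the three pairings, the one that joins the two vectors of \<pp> vanishes by isotropy.
  With a vector of \<pp> in first place \<open>double_form\<close> is negative evaluation: this
  happens twice in the product of diagonal entries and once in the mixed term.\<close>

lemma (in lie_module) constant_term:
  assumes X: "finite X" "X \<subseteq> \<kk>" and d: "\<And>w. w \<in> X \<Longrightarrow> form_dual_vector B \<kk> X w \<in> \<kk>"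
  shows "symmetric_component vsc V (eta vsc V double_form (nu_hom \<kk> \<pp> Z (casimir B \<kk> X))) 0 =
    quot_scalar vsc V (symmetric_relations vsc V)
      (\<Sum>w\<in>X. \<Sum>z\<in>Z. \<Sum>z'\<in>Z. (coord z (bracket w z) * coord z' (bracket (form_dual_vector B \<kk> X w) z')
         - coord z' (bracket w z) * coord z (bracket (form_dual_vector B \<kk> X w) z')) / 4)"
proof -
  let ?d = "form_dual_vector B \<kk> X"
  define f :: "('k, 'g) free" where "f = (\<Sum>w\<in>X. free_gen w * free_gen (?d w))"
  have cf: "free_gen w * free_gen (?d w) \<in> free_carrier \<kk>" if "w \<in> X" for w
    using that X(2) d by (intro free_carrier_mult free_carrier_gen) auto
  have f: "f \<in> free_carrier \<kk>" unfolding f_def by (rule free_carrier_sum[OF cf])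
  have "U.\<pi> f = (\<Oplus>\<^bsub>U.A\<^esub>w\<in>X. U.\<pi> (free_gen w * free_gen (?d w)))"
    unfolding f_def by (rule U.pi_finsum[OF cf X(1)])
  also have "\<dots> = casimir B \<kk> X"
    unfolding casimir_def Let_def quot_gen_eq
  proof (rule abelian_monoid.finsum_cong'[OF abelian_group.axioms(1)[OF ring.is_abelian_group[OF U.ring_A]] refl])
    show "(\<lambda>w. U.\<pi> (free_gen w) \<otimes>\<^bsub>U.A\<^esub> U.\<pi> (free_gen (?d w))) \<in> X \<rightarrow> carrier U.A"
      using X(2) d by (auto intro!: monoid.m_closed[OF ring.is_monoid[OF U.ring_A]] U.pi_closed free_carrier_gen)
    show "U.\<pi> (free_gen w * free_gen (?d w)) = U.\<pi> (free_gen w) \<otimes>\<^bsub>U.A\<^esub> U.\<pi> (free_gen (?d w))" if "w \<in> X" for w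
      using that X(2) d by (intro U.pi_simps(2) free_carrier_gen) auto
  qed
  finally have "casimir B \<kk> X = U.\<pi> f" by simp
  then have "symmetric_component vsc V (eta vsc V double_form (nu_hom \<kk> \<pp> Z (casimir B \<kk> X))) 0 =
    quot_scalar vsc V (symmetric_relations vsc V) (Poly_Mapping.lookup (normal (nu_ext f)) 0)"
    using f by (simp add: nu_hom_eq eta_eq symmetric_component_0 nu_ext_carrier normal_carrier)
  also have "nu_ext f = (\<Sum>w\<in>X. nu_free w * nu_free (?d w))"
    by (simp add: f_def nu_ext_linear(6) nu_ext_mult nu_ext_gen)
  also have "\<dots> = (\<Sum>w\<in>X. \<Sum>z\<in>Z. \<Sum>z'\<in>Z. gp (bracket w z) * gd (coord z) * (gp (bracket (?d w) z') * gd (coord z')))"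
    by (simp only: nu_free_def sum_product)
  also have "Poly_Mapping.lookup (normal \<dots>) 0 = (\<Sum>w\<in>X. \<Sum>z\<in>Z. \<Sum>z'\<in>Z. (coord z (bracket w z) * coord z' (bracket (?d w) z')
         - coord z' (bracket w z) * coord z (bracket (?d w) z')) / 4)"
  proof -
    have c0: "coord z 0 = 0" for z using dual_spaceD(4)[OF coord_dual subspace_0[OF p_subspace]] .
    have "Poly_Mapping.lookup (normal (gp (bracket w z) * gd (coord z) * (gp (bracket y z') * gd (coord z')))) 0 =
      (coord z (bracket w z) * coord z' (bracket y z') - coord z' (bracket w z) * coord z (bracket y z')) / 4" for w y z z'
      unfolding gp_def gd_def lookup_normal_4 by (simp add: double_form_def c0)
    then show ?thesis by (simp only: normal_linear(6) lookup_sum)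
  qed
  finally show ?thesis .
qed

theorem corollary3p5:
  fixes scale :: "'k::{alg_closed_field, field_char_0} \<Rightarrow> 'g::ab_group_add \<Rightarrow> 'g"
    and bracket :: "'g \<Rightarrow> 'g \<Rightarrow> 'g"
    and B :: "'g \<Rightarrow> 'g \<Rightarrow> 'k"
    and \<kk> \<pp> \<hh>\<^sub>\<gg> \<hh>\<^sub>\<kk> X Z :: "'g set"
    and P\<^sub>\<gg> P\<^sub>\<kk> :: "('g \<Rightarrow> 'k) set"
  assumes "quadratic_lie_algebra scale bracket B"
    and "\<exists>F. finite F \<and> module.span scale F = (UNIV :: 'g set)"
    and "lie_algebra.z2_gradation scale bracket \<kk> \<pp>"
    and "\<forall>x\<in>\<kk>. \<forall>y\<in>\<pp>. B x y = 0"
    and "lie_algebra.reductive scale bracket \<kk>"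
    and "lie_algebra.reductive scale bracket (UNIV :: 'g set)"
    and "lie_algebra.cartan_subalgebra scale bracket \<hh>\<^sub>\<gg> UNIV"
    and "lie_algebra.positive_system scale bracket \<hh>\<^sub>\<gg> UNIV P\<^sub>\<gg>"
    and "lie_algebra.cartan_subalgebra scale bracket \<hh>\<^sub>\<kk> \<kk>"
    and "lie_algebra.positive_system scale bracket \<hh>\<^sub>\<kk> \<kk> P\<^sub>\<kk>"
    and "vector_space.is_basis_of scale X \<kk>"
    and "vector_space.is_basis_of scale Z \<pp>"
  shows "let V = vector_space.double scale \<pp>; sc = double_scale scale in
           symmetric_component sc V
             (eta sc V double_form
               (lie_algebra.nu_hom scale bracket \<kk> \<pp> Z
                 (lie_algebra.casimir scale bracket B \<kk> X))) 0
           = quot_scalar sc V (symmetric_relations sc V)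
               (2 * (dual_form B \<hh>\<^sub>\<kk> (weyl_vector P\<^sub>\<kk>) (weyl_vector P\<^sub>\<kk>)
                     - dual_form B \<hh>\<^sub>\<gg> (weyl_vector P\<^sub>\<gg>) (weyl_vector P\<^sub>\<gg>)))"
proof -
  interpret q: quadratic_lie_algebra scale bracket B by (rule assms(1))
  obtain F where F: "finite F" "q.span F = UNIV" using assms(2) by blast
  obtain Basis where Basis: "Basis \<subseteq> F" "q.independent Basis" "F \<subseteq> q.span Basis"
    using q.maximal_independent_subset by metis
  have fd: "finite_dimensional_vector_space scale Basis"
  proof unfold_locales
    show "finite Basis" using Basis(1) F(1) by (rule finite_subset)
    show "q.independent Basis" by (rule Basis(2))
    have "q.span F \<subseteq> q.span Basis" by (rule q.span_minimal[OF Basis(3) q.subspace_span])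
    then show "q.span Basis = UNIV" using F(2) by blast
  qed
  have lin: "B (x + y) z = B x z + B y z" "B (scale c x) z = c * B x z" for x y z c
    using module_hom.add[OF Vector_Spaces.linear.axioms(3)[OF q.form_linear_left[of z]]]
      module_hom.scale[OF Vector_Spaces.linear.axioms(3)[OF q.form_linear_left[of z]]] by auto
  interpret fq: fin_quadratic scale Basis bracket B
    by (intro fin_quadratic.intro fin_lie.intro closed_fin_space.intro fin_space.intro fd q.lie_algebra_axioms fin_quadratic_axioms.intro lin q.form_symmetric q.form_invariant)
  have k: "q.subspace \<kk>" and p: "q.subspace \<pp>" and sum: "UNIV = {x + y | x y. x \<in> \<kk> \<and> y \<in> \<pp>}"
    and kk: "\<And>x y. x \<in> \<kk> \<Longrightarrow> y \<in> \<kk> \<Longrightarrow> bracket x y \<in> \<kk>"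
    and kp: "\<And>x y. x \<in> \<kk> \<Longrightarrow> y \<in> \<pp> \<Longrightarrow> bracket x y \<in> \<pp>"
    and pp: "\<And>x y. x \<in> \<pp> \<Longrightarrow> y \<in> \<pp> \<Longrightarrow> bracket x y \<in> \<kk>"
    using assms(3) unfolding q.z2_gradation_def by auto
  have orth: "B x y = 0" if "x \<in> \<kk>" "y \<in> \<pp>" for x y using assms(4) that by blast
  \<comment> \<open>As \<kk> and \<pp> are orthogonal and span, \<open>B\<close> stays nondegenerate
    on each of them.\<close>
  have nd_k: "x = 0" if x: "x \<in> \<kk>" and z: "\<And>y. y \<in> \<kk> \<Longrightarrow> B x y = 0" for x
  proof (rule q.form_nondegenerate)
    fix y obtain a b where "y = a + b" "a \<in> \<kk>" "b \<in> \<pp>" using sum by blast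
    then show "B x y = 0" using z orth[OF x] by (simp add: fq.B_simps)
  qed
  have nd_p: "x = 0" if x: "x \<in> \<pp>" and z: "\<And>y. y \<in> \<pp> \<Longrightarrow> B x y = 0" for x
  proof (rule q.form_nondegenerate)
    fix y obtain a b where y: "y = a + b" "a \<in> \<kk>" "b \<in> \<pp>" using sum by blast
    then show "B x y = 0" using z[OF y(3)] orth[OF y(2) x] q.form_symmetric[of x a] by (simp add: fq.B_simps)
  qed
  interpret g: cartan_setup scale Basis bracket B UNIV "\<hh>\<^sub>\<gg>"
    by unfold_locales (use q.form_nondegenerate q.reductive_abelian_ideal[OF assms(6)] assms(7) in auto)
  interpret k: cartan_setup scale Basis bracket B \<kk> "\<hh>\<^sub>\<kk>"
    by unfold_locales (use nd_k k kk q.reductive_abelian_ideal[OF assms(5)] assms(9) in auto)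
  have fX: "finite X" and fZ: "finite Z" using fq.is_basis_of_finite assms(11,12) by blast+
  interpret m: lie_module scale bracket \<kk> \<pp> Z
    by unfold_locales (use k p kk kp assms(12) fZ in auto)
  obtain v where v: "fq.dual_pair \<kk> X (\<lambda>x. x) v" "\<And>x w. x \<in> \<kk> \<Longrightarrow> w \<in> X \<Longrightarrow> B x (v w) = q.representation X x w"
    using fq.dual_pair_exists[OF k nd_k assms(11)] by blast
  obtain v' where v': "fq.dual_pair \<pp> Z (\<lambda>x. x) v'" "\<And>x z. x \<in> \<pp> \<Longrightarrow> z \<in> Z \<Longrightarrow> B x (v' z) = q.representation Z x z"
    using fq.dual_pair_exists[OF p nd_p assms(12)] by blast
  note dX = fq.dual_pairD[OF v(1)] and dZ = fq.dual_pairD[OF v'(1)]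
  have X: "q.independent X" "q.span X = \<kk>" using assms(11) by (auto simp: q.is_basis_of_def)
  \<comment> \<open>The described dual vector is the one from the expansion identity; uniqueness is
    nondegeneracy on \<kk>.\<close>
  have dual: "q.form_dual_vector B \<kk> X w = v w" if w: "w \<in> X" for w
    unfolding q.form_dual_vector_def
  proof (rule the_equality)
    show 1: "v w \<in> \<kk> \<and> (\<forall>u\<in>X. B u (v w) = (if u = w then 1 else 0))"
      using dX(2,3) w v(2) q.representation_basis[OF X(1)] by auto
    fix y assume y: "y \<in> \<kk> \<and> (\<forall>u\<in>X. B u y = (if u = w then 1 else 0))"
    have ym: "y - v w \<in> \<kk>" using q.subspace_diff[OF k] y dX(3)[OF w] by blast
    have "B (y - v w) x = 0" if x: "x \<in> \<kk>" for x
    proof -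
      have "B x (y - v w) = (\<Sum>u\<in>X. B x (v u) * B u (y - v w))" using fq.dual_pair_form[OF v(1) x] by simp
      also have "\<dots> = 0" using y 1 by (intro sum.neutral) (auto simp: fq.B_simps)
      finally show ?thesis using q.form_symmetric by simp
    qed
    from nd_k[OF ym this] show "y = v w" by simp
  qed
  have full: "fq.dual_pair UNIV (X <+> Z) (case_sum (\<lambda>x. x) (\<lambda>x. x)) (case_sum v v')"
    by (rule fq.dual_pair_join[OF v(1) v'(1) orth sum k p])
  let ?T = "fq.casimir_trace X (\<lambda>x. x) v Z (\<lambda>x. x) v'"
  let ?g = "dual_form B \<hh>\<^sub>\<gg> (weyl_vector P\<^sub>\<gg>) (weyl_vector P\<^sub>\<gg>)" and ?k = "dual_form B \<hh>\<^sub>\<kk> (weyl_vector P\<^sub>\<kk>) (weyl_vector P\<^sub>\<kk>)"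
  \<comment> \<open>The strange formula for both algebras, with the trace for \<gg> taken in the
    joined dual pair and split by the gradation.\<close>
  have "24 * ?g = 24 * ?k + 3 * ?T"
    using g.strange_formula[OF assms(8) full] k.strange_formula[OF assms(10) v(1)]
      fq.casimir_trace_gradation[OF v(1) v'(1) p kp pp] by simp
  then have "3 * ?T = 3 * (8 * (?g - ?k))" by (simp add: right_diff_distrib)
  then have T: "?T = 8 * (?g - ?k)" unfolding mult_cancel_left by auto
  have "(\<Sum>z\<in>Z. \<Sum>z'\<in>Z. (m.coord z (bracket w z) * m.coord z' (bracket (v w) z')
         - m.coord z' (bracket w z) * m.coord z (bracket (v w) z')) / 4) = - (\<Sum>j\<in>Z. B (bracket w (bracket (v w) j)) (v' j)) / 4"
    if w: "w \<in> X" for w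
  proof -
    have co: "m.coord z (bracket y z') = B (bracket y z') (v' z)" if "y \<in> \<kk>" "z \<in> Z" "z' \<in> Z" for y z z'
      using v'(2)[OF kp[OF that(1) dZ(2)[OF that(3)]] that(2)] by (simp add: m.coord_def)
    have wk: "w \<in> \<kk>" "v w \<in> \<kk>" using dX(2,3) w by auto
    have "(\<Sum>z\<in>Z. \<Sum>z'\<in>Z. (m.coord z (bracket w z) * m.coord z' (bracket (v w) z')
         - m.coord z' (bracket w z) * m.coord z (bracket (v w) z')) / 4) =
      (\<Sum>z\<in>Z. \<Sum>z'\<in>Z. (B (bracket w z) (v' z) * B (bracket (v w) z') (v' z')
         - B (bracket w z) (v' z') * B (bracket (v w) z') (v' z)) / 4)"
      by (intro sum.cong refl) (simp add: co wk)
    \<comment> \<open>The double sum is the product of the traces of ad w and ad (v w), which vanish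
      by skewness, minus the trace of the product of these operators.\<close>
    also have "\<dots> = ((\<Sum>z\<in>Z. B (bracket w z) (v' z)) * (\<Sum>z\<in>Z. B (bracket (v w) z) (v' z))
         - (\<Sum>z\<in>Z. \<Sum>z'\<in>Z. B (bracket w z) (v' z') * B (bracket (v w) z') (v' z))) / 4"
      by (simp only: sum_divide_distrib[symmetric] sum_subtractf sum_product)
    also have "\<dots> = - (\<Sum>j\<in>Z. B (bracket w (bracket (v w) j)) (v' j)) / 4"
      using fq.dual_pair_trace_skew[OF p v'(1), of w] fq.dual_pair_trace_comp[OF v'(1) kp[OF wk(2)], of w] by simp
    finally show ?thesis .
  qed
  then have "(\<Sum>w\<in>X. \<Sum>z\<in>Z. \<Sum>z'\<in>Z. (m.coord z (bracket w z) * m.coord z' (bracket (q.form_dual_vector B \<kk> X w) z')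
         - m.coord z' (bracket w z) * m.coord z (bracket (q.form_dual_vector B \<kk> X w) z')) / 4) = - ?T / 4"
    by (simp add: dual fq.casimir_trace_def sum_negf sum_divide_distrib)
  also have "\<dots> = 2 * (?k - ?g)" unfolding T by (simp add: field_simps)
  finally show ?thesis
    unfolding Let_def
    using m.constant_term[OF fX, of B] dX(2,3) dual by (simp add: subset_iff)
qed

end
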